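(* Let $p\in[1,\infty)$, $\mu\in\mathcal P_p(\mathcal X)$, $\nu\in\mathcal P_p(\mathcal Y)$, and assume $c:\mathcal X\times\mathcal Y\to\mathbb R$ is continuous and has growth of order at most $p$. Denote by $\pi^*$ the optimizer of $E_c(\mu,\nu,c)$ and let $\pi^{(k)},\pi^{(k+\frac12)}$, $k\in\mathbb N$, be the iterates of the causal version of Sinkhorn's algorithm. If $\nu$ has finite exponential moments of order $p$, then $\pi^{(k+\frac12)}$ converges in $W_p$ to $\pi^*$ as $k\to\infty$, $k\in\mathbb N$. If further $\mu$ has finite exponential moments of order $p$ as well, then $\pi^{(k)}$ also converges in $W_p$ to $\pi^*$ as $k\to\infty$.
   Context: $N\in\mathbb N$; $\mathcal X=\mathcal X_1\times\dots\times\mathcal X_N$ and $\mathcal Y=\mathcal Y_1\times\dots\times\mathcal Y_N$ are products of Polish spaces, with metrics $d_{\mathcal X},d_{\mathcal Y}$ inducing their topologies. $\mathcal P_p(\mathcal X)$ is the set of Borel probability measures with finite $p$-th moment $\int d_{\mathcal X}(\hat x,x)^p\,\mu(dx)$. The function $c$ has growth of order at most $p$ if $c/(1+d_{\mathcal X}(\hat x,\cdot)^p+d_{\mathcal Y}(\hat y,\cdot)^p)$ is bounded for some $(\hat x,\hat y)$. A measure $\mu\in\mathcal P(\mathcal X)$ has finite exponential moments of order $p$ if $\int\exp(\alpha\,d_{\mathcal X}(\hat x,x)^p)\,\mu(dx)<\infty$ for some $\alpha>0$, $\hat x\in\mathcal X$ (analogously for $\nu$ on $\mathcal Y$ with $d_{\mathcal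 Y}$). With $X_t,Y_t$ the coordinate projections and $X_{1:t}=(X_1,\dots,X_t)$ etc., a measure $\pi\in\mathcal P(\mathcal X\times\mathcal Y)$ is causal if under $\pi$, for all $t=1,\dots,N-1$, $X_{t+1}$ is conditionally independent of $Y_{1:t}$ given $X_{1:t}$. $\Pi(\mu,\nu)$ is the set of couplings, $\Pi_c(\mu,\nu)$ the set of causal couplings; $\Pi_c(\mu,* )=\bigcup_{\tilde\nu\in\mathcal P(\mathcal Y)}\Pi_c(\mu,\tilde\nu)$, $\Pi( *,\nu)=\bigcup_{\tilde\mu\in\mathcal P(\mathcal X)}\Pi(\tilde\mu,\nu)$. $D_{\rm KL}(\pi,\tilde\pi)=\int\log\frac{d\pi}{d\tilde\pi}\,d\pi$ if $\pi\ll\tilde\pi$, $+\infty$ otherwise. $P=\mu\otimes\nu$ and $E_c(\mu,\nu,c)=\inf_{\pi\in\Pi_c(\mu,\nu)}\int c\,d\pi+D_{\rm KL}(\pi,P)$. Causal Sinkhorn iterates: $\pi^{(0)}=P_c$ with $\frac{dP_c}{dP}=\frac{\exp(-c)}{\int\exp(-c)\,dP}$ (it is presupposed that $\int\exp(-c)\,dP<\infty$, so that $P_c$ is a probability measure), and for $k\ge0$, $\pi^{(k+\frac12)}=\arg\min_{\pi\in\Pi_c(\mu,* )}D_{\rm KL}(\pi,\pi^{(k)})$, $\pi^{(k+1)}=\arg\min_{\pi\in\Pi( *,\nu)}D_{\rm KL}(\pi,\pi^{(k+\frac12)})$. $W_p(\pi,\tilde\pi)^p=\inf_{\theta\in\Pi(\pi,\tilde\pi)}\int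 d_{\mathcal X}(x,\tilde x)^p+d_{\mathcal Y}(y,\tilde y)^p\,\theta(dx,dy,d\tilde x,d\tilde y)$ for $\pi,\tilde\pi\in\mathcal P(\mathcal X\times\mathcal Y)$. *)

theory Defs
  imports "HOL-Probability.Probability"
begin

section \<open>Polish spaces and Borel probability measures\<close>

text \<open>
  The factors of a path space may be different Polish spaces, so they are given as a family
  of abstract topologies over one type \<open>'a\<close>. As \<open>'a\<close> is arbitrary (it may for instance be taken
  to be a disjoint union of the factors), this is no restriction.
  The definition of Polish follows the type class \<^class>\<open>polish_space\<close>.
\<close>

definition polish_topology :: "'a topology \<Rightarrow> bool" where
  "polish_topology X \<longleftrightarrow> completely_metrizable_space X \<and> second_countable X"

definition borel_of :: "'a topology \<Rightarrow> 'a measure" where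
  "borel_of X = sigma (topspace X) {U. openin X U}"

definition borel_probs :: "'a topology \<Rightarrow> 'a measure set" where
  "borel_probs X = {\<mu>. prob_space \<mu> \<and> sets \<mu> = sets (borel_of X)}"

definition path_space :: "nat \<Rightarrow> (nat \<Rightarrow> 'a topology) \<Rightarrow> (nat \<Rightarrow> 'a) topology" where
  "path_space N X = product_topology X {1..N}"

text \<open>The metric is not required to be complete.\<close>

definition metric_for :: "'a topology \<Rightarrow> ('a \<Rightarrow> 'a \<Rightarrow> real) \<Rightarrow> bool" where
  "metric_for X d \<longleftrightarrow>
     Metric_space (topspace X) d \<and> Metric_space.mtopology (topspace X) d = X"


section \<open>Moments and growth\<close>

definition borel_probs_p :: "real \<Rightarrow> 'a topology \<Rightarrow> ('a \<Rightarrow> 'a \<Rightarrow> real) \<Rightarrow> 'a measure set" where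
  "borel_probs_p p X d =
     {\<mu> \<in> borel_probs X. \<exists>x0\<in>topspace X. (\<integral>\<^sup>+x. ennreal (d x0 x powr p) \<partial>\<mu>) < \<infinity>}"

definition finite_exp_moments ::
  "real \<Rightarrow> 'a topology \<Rightarrow> ('a \<Rightarrow> 'a \<Rightarrow> real) \<Rightarrow> 'a measure \<Rightarrow> bool" where
  "finite_exp_moments p X d \<mu> \<longleftrightarrow>
     (\<exists>\<alpha>>0. \<exists>x0\<in>topspace X. (\<integral>\<^sup>+x. ennreal (exp (\<alpha> * d x0 x powr p)) \<partial>\<mu>) < \<infinity>)"

definition growth_at_most ::
  "real \<Rightarrow> 'a topology \<Rightarrow> ('a \<Rightarrow> 'a \<Rightarrow> real) \<Rightarrow> 'b topology \<Rightarrow> ('b \<Rightarrow> 'b \<Rightarrow> real)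
     \<Rightarrow> ('a \<times> 'b \<Rightarrow> real) \<Rightarrow> bool" where
  "growth_at_most p X dX Y dY c \<longleftrightarrow>
     (\<exists>x0\<in>topspace X. \<exists>y0\<in>topspace Y. \<exists>C. \<forall>x\<in>topspace X. \<forall>y\<in>topspace Y.
        \<bar>c (x, y) / (1 + dX x0 x powr p + dY y0 y powr p)\<bar> \<le> C)"


section \<open>Couplings and causality\<close>

definition couplings ::
  "'a topology \<Rightarrow> 'b topology \<Rightarrow> 'a measure \<Rightarrow> 'b measure \<Rightarrow> ('a \<times> 'b) measure set" where
  "couplings X Y \<mu> \<nu> =
     {\<pi> \<in> borel_probs (prod_topology X Y).
        distr \<pi> (borel_of X) fst = \<mu> \<and> distr \<pi> (borel_of Y) snd = \<nu>}"

text \<open>The sigma-algebras \<open>G\<close> and \<open>H\<close> are conditionally independent given \<open>F\<close> under \<open>M\<close>.\<close>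

definition cond_indep ::
  "'a measure \<Rightarrow> 'a measure \<Rightarrow> 'a measure \<Rightarrow> 'a measure \<Rightarrow> bool" where
  "cond_indep M F G H \<longleftrightarrow>
     (\<forall>A\<in>sets G. \<forall>B\<in>sets H. AE z in M.
        real_cond_exp M F (indicator (A \<inter> B)) z =
        real_cond_exp M F (indicator A) z * real_cond_exp M F (indicator B) z)"

definition causal ::
  "nat \<Rightarrow> (nat \<Rightarrow> 'a topology) \<Rightarrow> (nat \<Rightarrow> 'b topology)
     \<Rightarrow> ((nat \<Rightarrow> 'a) \<times> (nat \<Rightarrow> 'b)) measure \<Rightarrow> bool" where
  "causal N X Y \<pi> \<longleftrightarrow>
     (\<forall>t\<in>{1..<N}. cond_indep \<pi>
        (vimage_algebra (space \<pi>) (\<lambda>z. restrict (fst z) {1..t}) (borel_of (path_space t X)))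
        (vimage_algebra (space \<pi>) (\<lambda>z. fst z (t + 1)) (borel_of (X (t + 1))))
        (vimage_algebra (space \<pi>) (\<lambda>z. restrict (snd z) {1..t}) (borel_of (path_space t Y))))"

definition causal_couplings ::
  "nat \<Rightarrow> (nat \<Rightarrow> 'a topology) \<Rightarrow> (nat \<Rightarrow> 'b topology)
     \<Rightarrow> (nat \<Rightarrow> 'a) measure \<Rightarrow> (nat \<Rightarrow> 'b) measure
     \<Rightarrow> ((nat \<Rightarrow> 'a) \<times> (nat \<Rightarrow> 'b)) measure set" where
  "causal_couplings N X Y \<mu> \<nu> =
     {\<pi> \<in> couplings (path_space N X) (path_space N Y) \<mu> \<nu>. causal N X Y \<pi>}"

text \<open>The sets \<open>\<Pi>\<^sub>c(\<mu>, *)\<close> and \<open>\<Pi>(*, \<nu>)\<close>.\<close>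

definition causal_couplings_fst ::
  "nat \<Rightarrow> (nat \<Rightarrow> 'a topology) \<Rightarrow> (nat \<Rightarrow> 'b topology) \<Rightarrow> (nat \<Rightarrow> 'a) measure
     \<Rightarrow> ((nat \<Rightarrow> 'a) \<times> (nat \<Rightarrow> 'b)) measure set" where
  "causal_couplings_fst N X Y \<mu> =
     (\<Union>\<nu>\<in>borel_probs (path_space N Y). causal_couplings N X Y \<mu> \<nu>)"

definition couplings_snd ::
  "'a topology \<Rightarrow> 'b topology \<Rightarrow> 'b measure \<Rightarrow> ('a \<times> 'b) measure set" where
  "couplings_snd X Y \<nu> = (\<Union>\<mu>\<in>borel_probs X. couplings X Y \<mu> \<nu>)"


section \<open>Relative entropy and causal entropic transport\<close>

text \<open>
  The Bochner integral, and hence \<^const>\<open>KL_divergence\<close>, is 0 for non-integrable functions;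
  infinite values matter here.
\<close>

definition ext_integral :: "'a measure \<Rightarrow> ('a \<Rightarrow> real) \<Rightarrow> ereal" where
  "ext_integral M f =
     enn2ereal (\<integral>\<^sup>+x. ennreal (f x) \<partial>M) - enn2ereal (\<integral>\<^sup>+x. ennreal (- f x) \<partial>M)"

text \<open>\<open>absolutely_continuous M N\<close> means that \<open>N\<close> is absolutely continuous with respect to \<open>M\<close>,
  and \<open>RN_deriv M N\<close> is the density of \<open>N\<close> with respect to \<open>M\<close>.\<close>

definition D_KL :: "'a measure \<Rightarrow> 'a measure \<Rightarrow> ereal" where
  "D_KL \<pi> \<rho> =
     (if absolutely_continuous \<rho> \<pi>
      then ext_integral \<pi> (\<lambda>z. ln (enn2real (RN_deriv \<rho> \<pi> z)))
      else \<infinity>)"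

definition entropic_cost ::
  "'a measure \<Rightarrow> 'b measure \<Rightarrow> ('a \<times> 'b \<Rightarrow> real) \<Rightarrow> ('a \<times> 'b) measure \<Rightarrow> ereal" where
  "entropic_cost \<mu> \<nu> c \<pi> = ext_integral \<pi> c + D_KL \<pi> (\<mu> \<Otimes>\<^sub>M \<nu>)"

definition E_c ::
  "nat \<Rightarrow> (nat \<Rightarrow> 'a topology) \<Rightarrow> (nat \<Rightarrow> 'b topology)
     \<Rightarrow> (nat \<Rightarrow> 'a) measure \<Rightarrow> (nat \<Rightarrow> 'b) measure
     \<Rightarrow> ((nat \<Rightarrow> 'a) \<times> (nat \<Rightarrow> 'b) \<Rightarrow> real) \<Rightarrow> ereal" where
  "E_c N X Y \<mu> \<nu> c = (INF \<pi>\<in>causal_couplings N X Y \<mu> \<nu>. entropic_cost \<mu> \<nu> c \<pi>)"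

definition E_c_optimizer ::
  "nat \<Rightarrow> (nat \<Rightarrow> 'a topology) \<Rightarrow> (nat \<Rightarrow> 'b topology)
     \<Rightarrow> (nat \<Rightarrow> 'a) measure \<Rightarrow> (nat \<Rightarrow> 'b) measure
     \<Rightarrow> ((nat \<Rightarrow> 'a) \<times> (nat \<Rightarrow> 'b) \<Rightarrow> real)
     \<Rightarrow> ((nat \<Rightarrow> 'a) \<times> (nat \<Rightarrow> 'b)) measure \<Rightarrow> bool" where
  "E_c_optimizer N X Y \<mu> \<nu> c \<pi> \<longleftrightarrow>
     \<pi> \<in> causal_couplings N X Y \<mu> \<nu> \<and> entropic_cost \<mu> \<nu> c \<pi> = E_c N X Y \<mu> \<nu> c"


section \<open>The causal version of Sinkhorn's algorithm\<close>

definition gibbs :: "'a measure \<Rightarrow> ('a \<Rightarrow> real) \<Rightarrow> 'a measure" where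
  "gibbs P c = density P (\<lambda>z. ennreal (exp (- c z) / (\<integral>w. exp (- c w) \<partial>P)))"

text \<open>\<open>\<pi> k\<close> and \<open>\<pi>h k\<close> are the iterates with index \<open>k\<close> and \<open>k + 1/2\<close>, respectively.\<close>

definition causal_sinkhorn ::
  "nat \<Rightarrow> (nat \<Rightarrow> 'a topology) \<Rightarrow> (nat \<Rightarrow> 'b topology)
     \<Rightarrow> (nat \<Rightarrow> 'a) measure \<Rightarrow> (nat \<Rightarrow> 'b) measure
     \<Rightarrow> ((nat \<Rightarrow> 'a) \<times> (nat \<Rightarrow> 'b) \<Rightarrow> real)
     \<Rightarrow> (nat \<Rightarrow> ((nat \<Rightarrow> 'a) \<times> (nat \<Rightarrow> 'b)) measure)
     \<Rightarrow> (nat \<Rightarrow> ((nat \<Rightarrow> 'a) \<times> (nat \<Rightarrow> 'b)) measure) \<Rightarrow> bool" where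
  "causal_sinkhorn N X Y \<mu> \<nu> c \<pi> \<pi>h \<longleftrightarrow>
     \<pi> 0 = gibbs (\<mu> \<Otimes>\<^sub>M \<nu>) c \<and>
     (\<forall>k. is_arg_min (\<lambda>\<rho>. D_KL \<rho> (\<pi> k))
            (\<lambda>\<rho>. \<rho> \<in> causal_couplings_fst N X Y \<mu>) (\<pi>h k)) \<and>
     (\<forall>k. is_arg_min (\<lambda>\<rho>. D_KL \<rho> (\<pi>h k))
            (\<lambda>\<rho>. \<rho> \<in> couplings_snd (path_space N X) (path_space N Y) \<nu>) (\<pi> (Suc k)))"


section \<open>Wasserstein distance on the product space\<close>

definition wasserstein_pow ::
  "real \<Rightarrow> 'a topology \<Rightarrow> ('a \<Rightarrow> 'a \<Rightarrow> real) \<Rightarrow> 'b topology \<Rightarrow> ('b \<Rightarrow> 'b \<Rightarrow> real)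
     \<Rightarrow> ('a \<times> 'b) measure \<Rightarrow> ('a \<times> 'b) measure \<Rightarrow> ennreal" where
  "wasserstein_pow p X dX Y dY \<pi> \<rho> =
     (INF \<theta>\<in>couplings (prod_topology X Y) (prod_topology X Y) \<pi> \<rho>.
        \<integral>\<^sup>+((x, y), (x', y')). ennreal (dX x x' powr p + dY y y' powr p) \<partial>\<theta>)"

definition wasserstein ::
  "real \<Rightarrow> 'a topology \<Rightarrow> ('a \<Rightarrow> 'a \<Rightarrow> real) \<Rightarrow> 'b topology \<Rightarrow> ('b \<Rightarrow> 'b \<Rightarrow> real)
     \<Rightarrow> ('a \<times> 'b) measure \<Rightarrow> ('a \<times> 'b) measure \<Rightarrow> ennreal" where
  "wasserstein p X dX Y dY \<pi> \<rho> =
     (let w = wasserstein_pow p X dX Y dY \<pi> \<rho>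
      in if w = \<infinity> then \<infinity> else ennreal (enn2real w powr (1 / p)))"


section \<open>Compatibility of product sigma-algebras\<close>

text \<open>
  Measures on a product of path spaces live on its Borel sets, whereas \<open>\<mu> \<Otimes>\<^sub>M \<nu>\<close> lives on the
  product sigma-algebra. For Polish factors the two agree.
\<close>

lemma space_borel_of [simp]: "space (borel_of X) = topspace X"
  unfolding borel_of_def by (rule space_measure_of) (auto dest: openin_subset)

lemma sets_borel_of: "sets (borel_of X) = sigma_sets (topspace X) {U. openin X U}"
  unfolding borel_of_def by (rule sets_measure_of) (auto dest: openin_subset)

lemma openin_sets_borel_of: "openin X U \<Longrightarrow> U \<in> sets (borel_of X)"
  by (auto simp: sets_borel_of)

lemma continuous_map_measurable_borel_of:
  assumes "continuous_map X Y f"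
  shows "f \<in> borel_of X \<rightarrow>\<^sub>M borel_of Y"
  unfolding borel_of_def[of Y]
proof (rule measurable_measure_of)
  show "{U. openin Y U} \<subseteq> Pow (topspace Y)" by (auto dest: openin_subset)
  show "f \<in> space (borel_of X) \<rightarrow> topspace Y"
    using assms by (auto simp: continuous_map_def)
  fix U assume "U \<in> {U. openin Y U}"
  then have "openin X {x \<in> topspace X. f x \<in> U}"
    using assms by (auto simp: continuous_map_def)
  moreover have "f -` U \<inter> space (borel_of X) = {x \<in> topspace X. f x \<in> U}" by auto
  ultimately show "f -` U \<inter> space (borel_of X) \<in> sets (borel_of X)"
    by (simp add: openin_sets_borel_of)
qed

lemma second_countable_path_space:
  assumes "\<And>t. t \<in> {1..N} \<Longrightarrow> second_countable (X t)"
  shows "second_countable (path_space N X)"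
proof -
  have "\<forall>t. \<exists>B. t \<in> {1..N} \<longrightarrow> countable B \<and> (\<forall>V\<in>B. openin (X t) V) \<and>
      (\<forall>U x. openin (X t) U \<and> x \<in> U \<longrightarrow> (\<exists>V\<in>B. x \<in> V \<and> V \<subseteq> U))"
    using assms unfolding second_countable_def by meson
  then obtain B where "\<forall>t. t \<in> {1..N} \<longrightarrow> countable (B t) \<and> (\<forall>V\<in>B t. openin (X t) V) \<and>
      (\<forall>U x. openin (X t) U \<and> x \<in> U \<longrightarrow> (\<exists>V\<in>B t. x \<in> V \<and> V \<subseteq> U))"
    by (rule choice[THEN exE])
  then have cB: "countable (B t)" and oB: "V \<in> B t \<Longrightarrow> openin (X t) V"
    and bB: "openin (X t) U \<Longrightarrow> x \<in> U \<Longrightarrow> \<exists>V\<in>B t. x \<in> V \<and> V \<subseteq> U"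
    if "t \<in> {1..N}" for t V U x
    using that by blast+
  let ?B = "Pi\<^sub>E {1..N} ` Pi\<^sub>E {1..N} B"
  show ?thesis
    unfolding second_countable_def path_space_def
  proof (intro exI[of _ ?B] conjI ballI allI impI)
    show "countable ?B"
      by (intro countable_image countable_PiE) (auto intro: cB)
  next
    fix W assume "W \<in> ?B"
    then obtain V where V: "V \<in> Pi\<^sub>E {1..N} B" "W = Pi\<^sub>E {1..N} V" by blast
    show "openin (product_topology X {1..N}) W"
      unfolding V(2) openin_PiE_gen using V(1) oB by (auto dest: PiE_mem)
  next
    fix U x assume Ux: "openin (product_topology X {1..N}) U \<and> x \<in> U"
    then have "\<exists>W. (\<forall>t\<in>{1..N}. openin (X t) (W t)) \<and> x \<in> Pi\<^sub>E {1..N} W \<and> Pi\<^sub>E {1..N} W \<subseteq> U"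
      unfolding openin_product_topology_alt by blast
    then obtain W where W: "\<And>t. t \<in> {1..N} \<Longrightarrow> openin (X t) (W t)"
      "x \<in> Pi\<^sub>E {1..N} W" "Pi\<^sub>E {1..N} W \<subseteq> U"
      by blast
    then have "\<forall>t\<in>{1..N}. \<exists>V\<in>B t. x t \<in> V \<and> V \<subseteq> W t"
      using bB by (auto dest: PiE_mem)
    then obtain V where V: "\<And>t. t \<in> {1..N} \<Longrightarrow> V t \<in> B t \<and> x t \<in> V t \<and> V t \<subseteq> W t"
      by (metis (full_types))
    let ?V = "restrict V {1..N}"
    have "Pi\<^sub>E {1..N} ?V \<in> ?B" using V by (intro imageI) auto
    moreover have "x \<in> Pi\<^sub>E {1..N} ?V"
      using V W(2) by (auto simp: PiE_iff)
    moreover have "Pi\<^sub>E {1..N} ?V \<subseteq> Pi\<^sub>E {1..N} W"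
      using V by (intro PiE_mono) auto
    ultimately show "\<exists>V\<in>?B. x \<in> V \<and> V \<subseteq> U"
      using W(3) by (intro bexI[of _ "Pi\<^sub>E {1..N} ?V"] conjI order_trans[OF _ W(3)])
  qed
qed

lemma sets_borel_of_prod_topology:
  assumes "second_countable X" "second_countable Y"
  shows "sets (borel_of (prod_topology X Y)) = sets (borel_of X \<Otimes>\<^sub>M borel_of Y)"
proof
  have "(\<lambda>z. (fst z, snd z)) \<in> borel_of (prod_topology X Y) \<rightarrow>\<^sub>M borel_of X \<Otimes>\<^sub>M borel_of Y"
    by (intro measurable_Pair continuous_map_measurable_borel_of continuous_map_fst continuous_map_snd)
  then have m: "(\<lambda>z. z) \<in> borel_of (prod_topology X Y) \<rightarrow>\<^sub>M borel_of X \<Otimes>\<^sub>M borel_of Y"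
    by simp
  show "sets (borel_of X \<Otimes>\<^sub>M borel_of Y) \<subseteq> sets (borel_of (prod_topology X Y))"
  proof
    fix A assume A: "A \<in> sets (borel_of X \<Otimes>\<^sub>M borel_of Y)"
    then have "A \<subseteq> space (borel_of (prod_topology X Y))"
      using sets.sets_into_space[OF A] by (simp add: space_pair_measure)
    then have "(\<lambda>z. z) -` A \<inter> space (borel_of (prod_topology X Y)) = A" by auto
    with measurable_sets[OF m A] show "A \<in> sets (borel_of (prod_topology X Y))" by simp
  qed
next
  obtain A where A: "countable A" "\<And>V. V \<in> A \<Longrightarrow> openin X V"
    "\<And>U x. openin X U \<Longrightarrow> x \<in> U \<Longrightarrow> \<exists>V\<in>A. x \<in> V \<and> V \<subseteq> U"
    using assms(1) unfolding second_countable_def by auto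
  obtain B where B: "countable B" "\<And>V. V \<in> B \<Longrightarrow> openin Y V"
    "\<And>U x. openin Y U \<Longrightarrow> x \<in> U \<Longrightarrow> \<exists>V\<in>B. x \<in> V \<and> V \<subseteq> U"
    using assms(2) unfolding second_countable_def by auto
  have "U \<in> sets (borel_of X \<Otimes>\<^sub>M borel_of Y)" if U: "openin (prod_topology X Y) U" for U
  proof -
    let ?I = "{(V, W). V \<in> A \<and> W \<in> B \<and> V \<times> W \<subseteq> U}"
    have "countable ?I"
      by (rule countable_subset[of _ "A \<times> B"]) (use A(1) B(1) in auto)
    moreover have "U = (\<Union>(V, W)\<in>?I. V \<times> W)"
    proof
      show "U \<subseteq> (\<Union>(V, W)\<in>?I. V \<times> W)"
      proof
        fix z assume z: "z \<in> U"
        obtain x y where xy: "z = (x, y)" by force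
        obtain V W where VW: "openin X V" "openin Y W" "x \<in> V" "y \<in> W" "V \<times> W \<subseteq> U"
          using U[unfolded openin_prod_topology_alt, rule_format, of x y] z xy by auto
        obtain V' where V': "V' \<in> A" "x \<in> V'" "V' \<subseteq> V" using A(3) VW by blast
        obtain W' where W': "W' \<in> B" "y \<in> W'" "W' \<subseteq> W" using B(3) VW by blast
        have "V' \<times> W' \<subseteq> U" using V' W' VW by blast
        then show "z \<in> (\<Union>(V, W)\<in>?I. V \<times> W)" using V' W' xy by blast
      qed
    qed auto
    moreover have "(\<Union>(V, W)\<in>?I. V \<times> W) \<in> sets (borel_of X \<Otimes>\<^sub>M borel_of Y)"
      by (rule sets.countable_UN'')
         (use \<open>countable ?I\<close> A(2) B(2) in \<open>auto intro!: pair_measureI openin_sets_borel_of\<close>)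
    ultimately show ?thesis by simp
  qed
  then show "sets (borel_of (prod_topology X Y)) \<subseteq> sets (borel_of X \<Otimes>\<^sub>M borel_of Y)"
    unfolding sets_borel_of[of "prod_topology X Y"]
    using sets.sigma_sets_subset[of "{U. openin (prod_topology X Y) U}" "borel_of X \<Otimes>\<^sub>M borel_of Y"]
    by (auto simp: space_pair_measure)
qed

lemma pair_measure_borel_probs:
  assumes "\<And>t. t \<in> {1..N} \<Longrightarrow> polish_topology (X t)" "\<And>t. t \<in> {1..N} \<Longrightarrow> polish_topology (Y t)"
    and "\<mu> \<in> borel_probs (path_space N X)" "\<nu> \<in> borel_probs (path_space N Y)"
  shows "\<mu> \<Otimes>\<^sub>M \<nu> \<in> borel_probs (prod_topology (path_space N X) (path_space N Y))"
proof -
  interpret \<mu>: prob_space \<mu> using assms(3) by (simp add: borel_probs_def)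
  interpret \<nu>: prob_space \<nu> using assms(4) by (simp add: borel_probs_def)
  interpret pair_prob_space \<mu> \<nu> ..
  have "sets (\<mu> \<Otimes>\<^sub>M \<nu>) = sets (borel_of (path_space N X) \<Otimes>\<^sub>M borel_of (path_space N Y))"
    by (rule sets_pair_measure_cong) (use assms(3,4) in \<open>auto simp: borel_probs_def\<close>)
  also have "\<dots> = sets (borel_of (prod_topology (path_space N X) (path_space N Y)))"
    using assms(1,2) unfolding polish_topology_def
    by (intro sets_borel_of_prod_topology[symmetric] second_countable_path_space) blast+
  finally show ?thesis
    using prob_space_axioms by (simp add: borel_probs_def)
qed

end

theory Submission
  imports Defs
begin

text \<open>
  All measures in play are described by their densities with respect to \<open>P = \<mu> \<otimes> \<nu>\<close>. Write \<open>R n\<close> and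
  \<open>Rh n\<close> for the densities of \<open>\<pi> n\<close> and \<open>\<pi>h n\<close>, and \<open>f n\<close> for the density of the second marginal of
  \<open>\<pi>h n\<close>, so that \<open>R (n + 1) = Rh n / f n\<close>. The set of causal densities is convex and stable under
  multiplicative perturbations of the conditional law of a coordinate \<open>Y\<^sub>t\<close>. Hence the causal half step satisfies the
  Pythagorean identity \<open>KL(r | R n) = KL(r | Rh n) + A n\<close> for causal \<open>r\<close>, not only an inequality,
  and \<open>\<Sum> A n\<close> is finite.
  Testing the telescoped identity with \<open>\<mu>\<close> times a density in \<open>y\<close> bounds the potentials
  \<open>- \<Sum>k<n. ln (f k)\<close> from above in terms of the cost; together with the exponential moments of \<open>\<nu>\<close>
  this shows that the limsup of the entropies \<open>KL(Rh n | R 0)\<close> is at most the entropy of the optimizer.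
  As the second marginals of \<open>Rh n\<close> tend to \<open>\<nu>\<close>, uniform convexity of the entropy makes \<open>Rh n\<close>, and
  then \<open>R n\<close>, converge in \<open>L\<^sup>1\<close> to the density of the optimizer. Exponential moments and the vanishing of
  the entropies of consecutive iterates give uniform integrability of the \<open>p\<close>-th moments, and the
  weighted total variation distance dominates the Wasserstein distance.
\<close>

section \<open>Relative entropy of densities\<close>

text \<open>The delicate term is the integral of \<open>\<psi> n * (f n - 1)\<close>, where
  \<open>\<psi> n\<close> is minus the sum of \<open>ln (f k)\<close> over \<open>k < n\<close>: the
  telescoped identity for \<open>Rh n\<close> integrates this potential against \<open>f n\<close>,
  the one for the optimizer against 1, and no uniform bound from below is at hand. So the sign of
  \<open>f n - 1\<close> decides. Where \<open>f n > 1\<close>, an upper bound on the potential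
  suffices. Where \<open>f n < 1\<close>, the potential is bounded below only by minus the positive
  parts of the \<open>ln (f k)\<close>, but their product with \<open>1 - f n\<close> is of second
  order in the defects \<open>sqrt (f k) - 1\<close>, whose squares are controlled by the summable
  entropies \<open>A k\<close>. An inequality in the causal half step would be enough to bound the
  potentials and the increments; equality is what bounds the entropy of \<open>Rh n\<close> from
  above. A first order condition alone does not give it: \<open>ln (Rh n / R n)\<close> is known to
  be integrable under \<open>Rh n\<close>, and carrying its mean over to another causal density
  takes a martingale argument.\<close>

definition kl_fun :: "real \<Rightarrow> real \<Rightarrow> real" where
  "kl_fun r q = r * ln (r / q) - r + q"

text \<open>The summand \<open>- r + q\<close> of \<open>kl_fun\<close> integrates to 0 between
  densities and makes the integrand nonnegative, so that relative entropy becomes an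
  \<open>ennreal\<close> integral that always exists. At \<open>r = 0\<close> the integrand is
  \<open>q\<close>, whatever \<open>ln 0\<close> is.\<close>

definition kl :: "'a measure \<Rightarrow> ('a \<Rightarrow> real) \<Rightarrow> ('a \<Rightarrow> real) \<Rightarrow> ennreal" where
  "kl M r q = (\<integral>\<^sup>+x. ennreal (kl_fun (r x) (q x)) \<partial>M)"

text \<open>Apply \<open>ln t \<le> t - 1\<close> at \<open>t = sqrt (q / r)\<close>; the square
  root halves the logarithm. Integrated, this bounds the squared Hellinger distance by the relative
  entropy.\<close>

lemma kl_fun_hellinger:
  assumes "r \<ge> 0" "q > 0"
  shows "(sqrt r - sqrt q)\<^sup>2 \<le> kl_fun r q"
proof (cases "r = 0")
  case True
  then show ?thesis using assms by (simp add: kl_fun_def)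
next
  case False
  then have r: "r > 0" using assms by simp
  have "ln (sqrt q / sqrt r) \<le> sqrt q / sqrt r - 1"
    by (rule ln_le_minus_one) (use r assms in simp)
  moreover have "ln (sqrt q / sqrt r) = - ln (r / q) / 2"
    using r assms by (simp add: ln_div ln_sqrt field_simps)
  ultimately have "ln (r / q) \<ge> 2 - 2 * (sqrt q / sqrt r)" by simp
  then have "r * ln (r / q) \<ge> r * (2 - 2 * (sqrt q / sqrt r))"
    using r by (intro mult_left_mono) auto
  also have "r * (2 - 2 * (sqrt q / sqrt r)) = 2 * r - 2 * (sqrt r * sqrt q)"
    using r by (simp add: field_simps)
  finally show ?thesis
    using r assms by (simp add: kl_fun_def power2_eq_square algebra_simps)
qed

text \<open>The alternative \<open>q = r\<close> admits the points where a mixture vanishes together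
  with both of its parts.\<close>

lemma kl_fun_nonneg:
  assumes "r \<ge> 0" "q > 0 \<or> q = r"
  shows "kl_fun r q \<ge> 0"
proof (cases "q > 0")
  case True
  then show ?thesis using kl_fun_hellinger[of r q] assms by (meson order_trans zero_le_power2)
next
  case False
  then show ?thesis using assms by (auto simp: kl_fun_def)
qed

text \<open>Fenchel-Young inequality: \<open>q * (exp h - 1)\<close> is the convex conjugate of the
  entropy integrand in \<open>r\<close>. It transfers exponential integrability from
  \<open>q\<close> to \<open>r\<close>, with \<open>h\<close> a weight or the logarithm of a
  marginal density.\<close>

lemma kl_fun_young:
  assumes "r \<ge> 0" "q > 0"
  shows "r * h \<le> kl_fun r q + q * (exp h - 1)"
proof (cases "r = 0")
  case True
  then show ?thesis using assms by (simp add: kl_fun_def algebra_simps)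
next
  case False
  then have r: "r > 0" using assms by simp
  have "ln (q * exp h / r) \<le> q * exp h / r - 1"
    by (rule ln_le_minus_one) (use r assms in simp)
  moreover have "ln (q * exp h / r) = h - ln (r / q)"
    using r assms by (simp add: ln_div ln_mult)
  ultimately have "r * (h - ln (r / q)) \<le> r * (q * exp h / r - 1)"
    using r by (intro mult_left_mono) auto
  also have "\<dots> = q * exp h - r" using r by (simp add: field_simps)
  finally show ?thesis by (simp add: kl_fun_def algebra_simps)
qed

text \<open>\<open>ln (x / q) = ln (x / m) + ln (m / q)\<close>, and the weighted mean of the
  factors \<open>x\<close> in front of \<open>ln (m / q)\<close> is \<open>m\<close>. The last two
  terms measure the gap in the convexity inequality exactly.\<close>

lemma kl_fun_compensation:
  assumes "a \<ge> 0" "r \<ge> 0" "q > 0" "0 < s" "s < 1" and m: "m = (1 - s) * a + s * r"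
  shows "(1 - s) * kl_fun a q + s * kl_fun r q =
     kl_fun m q + (1 - s) * kl_fun a m + s * kl_fun r m"
proof (cases "a = 0 \<and> r = 0")
  case True
  then show ?thesis using m by (simp add: kl_fun_def algebra_simps)
next
  case False
  have m0: "m > 0"
  proof (cases "a = 0")
    case True then show ?thesis using False assms by simp
  next
    case f: False
    then have "(1 - s) * a > 0" "s * r \<ge> 0" using assms by auto
    then show ?thesis using m by linarith
  qed
  have *: "x * ln (x / q) = x * ln (x / m) + x * ln (m / q)" if "x \<ge> 0" for x
    using that m0 assms(3) by (cases "x = 0") (auto simp: ln_div algebra_simps)
  have "(1 - s) * (a * ln (a / q)) + s * (r * ln (r / q))
     = (1 - s) * (a * ln (a / m)) + s * (r * ln (r / m)) + ((1-s) * a + s * r) * ln (m / q)"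
    unfolding *[OF assms(1)] *[OF assms(2)] by (simp add: algebra_simps)
  then show ?thesis unfolding kl_fun_def m[symmetric] by (simp add: algebra_simps m)
qed

lemma kl_fun_measurable [measurable]:
  assumes [measurable]: "r \<in> borel_measurable M" "q \<in> borel_measurable M"
  shows "(\<lambda>x. kl_fun (r x) (q x)) \<in> borel_measurable M"
  unfolding kl_fun_def by measurable

definition kl_integrable :: "'a measure \<Rightarrow> ('a \<Rightarrow> real) \<Rightarrow> ('a \<Rightarrow> real) \<Rightarrow> bool" where
  "kl_integrable M r q \<longleftrightarrow> integrable M (\<lambda>x. r x * ln (r x / q x))"

text \<open>A Bochner integral, hence 0 without integrability; statements about it are therefore
  paired with \<open>kl_integrable\<close>.\<close>

definition KL :: "'a measure \<Rightarrow> ('a \<Rightarrow> real) \<Rightarrow> ('a \<Rightarrow> real) \<Rightarrow> real" where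
  "KL M r q = (\<integral>x. r x * ln (r x / q x) \<partial>M)"

text \<open>Nonnegativity is demanded at every point, not only almost everywhere, so that the
  pointwise inequalities apply directly.\<close>

definition dens :: "'a measure \<Rightarrow> ('a \<Rightarrow> real) \<Rightarrow> bool" where
  "dens M r \<longleftrightarrow> (\<forall>x. 0 \<le> r x) \<and> integrable M r \<and> (\<integral>x. r x \<partial>M) = 1"

lemma densD:
  assumes "dens M r"
  shows "0 \<le> r x" "integrable M r" "(\<integral>x. r x \<partial>M) = 1" "r \<in> borel_measurable M"
  using assms unfolding dens_def by auto

lemma kl_less_top_iff:
  assumes r: "dens M r" and q: "dens M q" and pos: "\<And>x. q x > 0"
  shows "kl M r q < \<infinity> \<longleftrightarrow> kl_integrable M r q"
proof -
  note [measurable] = densD(4)[OF r] densD(4)[OF q]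
  have nn: "kl_fun (r x) (q x) \<ge> 0" for x
    using densD(1)[OF r] pos by (intro kl_fun_nonneg) auto
  have "kl M r q < \<infinity> \<longleftrightarrow> integrable M (\<lambda>x. kl_fun (r x) (q x))"
    unfolding kl_def using nn by (auto simp: integrable_iff_bounded)
  also have "\<dots> \<longleftrightarrow> kl_integrable M r q"
  proof
    assume "integrable M (\<lambda>x. kl_fun (r x) (q x))"
    then have "integrable M (\<lambda>x. kl_fun (r x) (q x) + r x - q x)"
      using densD(2)[OF r] densD(2)[OF q] by auto
    then show "kl_integrable M r q" by (simp add: kl_fun_def kl_integrable_def)
  next
    assume "kl_integrable M r q"
    then have "integrable M (\<lambda>x. r x * ln (r x / q x) - r x + q x)"
      using densD(2)[OF r] densD(2)[OF q] unfolding kl_integrable_def by auto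
    then show "integrable M (\<lambda>x. kl_fun (r x) (q x))" by (simp add: kl_fun_def)
  qed
  finally show ?thesis .
qed

lemma kl_fun_integral:
  assumes r: "dens M r" and q: "dens M q" and pos: "\<And>x. q x > 0" and I: "kl_integrable M r q"
  shows "integrable M (\<lambda>x. kl_fun (r x) (q x))" "(\<integral>x. kl_fun (r x) (q x) \<partial>M) = KL M r q"
    "kl M r q = ennreal (KL M r q)" "KL M r q \<ge> 0"
proof -
  have nn: "kl_fun (r x) (q x) \<ge> 0" for x
    using densD(1)[OF r] pos by (intro kl_fun_nonneg) auto
  show i: "integrable M (\<lambda>x. kl_fun (r x) (q x))"
    using I densD(2)[OF r] densD(2)[OF q] unfolding kl_fun_def kl_integrable_def by auto
  show e: "(\<integral>x. kl_fun (r x) (q x) \<partial>M) = KL M r q"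
    using I densD[OF r] densD[OF q] unfolding kl_fun_def kl_integrable_def KL_def by simp
  show "kl M r q = ennreal (KL M r q)"
    unfolding kl_def e[symmetric] using nn by (intro nn_integral_eq_integral[OF i]) auto
  show "KL M r q \<ge> 0" unfolding e[symmetric] using nn by simp
qed

section \<open>Entropy and Hellinger distance control the L1 distance\<close>

lemma L1_le_hellinger:
  assumes r: "dens M r" and q: "dens M q" and "(\<integral>\<^sup>+x. ennreal ((sqrt (r x) - sqrt (q x))\<^sup>2) \<partial>M) \<le> ennreal K" "K \<ge> 0"
  shows "(\<integral>x. \<bar>r x - q x\<bar> \<partial>M) \<le> 2 * sqrt K"
proof -
  note [measurable] = densD(4)[OF r] densD(4)[OF q]
  note i = densD(2)[OF r] densD(2)[OF q]
  let ?h = "\<lambda>x. (sqrt (r x) - sqrt (q x))\<^sup>2"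
  have ih: "integrable M ?h"
    using assms(3) by (intro integrableI_nonneg) (auto simp: le_less_trans)
  have hK: "(\<integral>x. ?h x \<partial>M) \<le> K"
    using assms(3,4) nn_integral_eq_integral[OF ih] by simp
  \<comment> \<open>Factor \<open>r - q\<close> into difference and sum of the square roots and
    split the product by Young's inequality with a free weight \<open>t\<close>, using
    \<open>(sqrt r + sqrt q)^2 \<le> 2 * (r + q)\<close>.\<close>
  have *: "\<bar>r x - q x\<bar> \<le> t * (r x + q x) + ?h x / (2 * t)" if "t > 0" for t x
  proof -
    have "\<bar>r x - q x\<bar> = \<bar>sqrt (r x) - sqrt (q x)\<bar> * (sqrt (r x) + sqrt (q x))"
    proof -
      have "r x - q x = (sqrt (r x) - sqrt (q x)) * (sqrt (r x) + sqrt (q x))"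
        using densD(1)[OF r, of x] densD(1)[OF q, of x] by (simp add: algebra_simps)
      then show ?thesis using densD(1)[OF r, of x] densD(1)[OF q, of x] by (simp add: abs_mult)
    qed
    also have "\<dots> \<le> t * (r x + q x) + ?h x / (2 * t)"
    proof -
      let ?a = "\<bar>sqrt (r x) - sqrt (q x)\<bar>" and ?b = "sqrt (r x) + sqrt (q x)"
      have "0 \<le> (?a - t * ?b)\<^sup>2" by simp
      then have "2 * t * (?a * ?b) \<le> ?a\<^sup>2 + t\<^sup>2 * ?b\<^sup>2" by (simp add: power2_eq_square algebra_simps)
      then have "?a * ?b \<le> (?a\<^sup>2 + t\<^sup>2 * ?b\<^sup>2) / (2 * t)" using that by (simp add: field_simps)
      also have "\<dots> = ?a\<^sup>2 / (2 * t) + t / 2 * ?b\<^sup>2" using that by (simp add: field_simps power2_eq_square)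
      finally have 1: "?a * ?b \<le> ?h x / (2 * t) + t / 2 * ?b\<^sup>2" by simp
      have "?b\<^sup>2 \<le> 2 * (r x + q x)"
      proof -
        have "0 \<le> (sqrt (r x) - sqrt (q x))\<^sup>2" by simp
        then show ?thesis using densD(1)[OF r, of x] densD(1)[OF q, of x]
          by (simp add: power2_eq_square algebra_simps)
      qed
      then have "t / 2 * ?b\<^sup>2 \<le> t / 2 * (2 * (r x + q x))" using that by (intro mult_left_mono) auto
      also have "\<dots> = t * (r x + q x)" by (simp add: algebra_simps)
      finally have "?h x / (2 * t) + t / 2 * ?b\<^sup>2 \<le> ?h x / (2 * t) + t * (r x + q x)"
        by (rule add_left_mono)
      from order_trans[OF 1 this] show ?thesis by (simp only: add.commute)
    qed
    finally show ?thesis .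
  qed
  have b: "(\<integral>x. \<bar>r x - q x\<bar> \<partial>M) \<le> 2 * t + K / (2 * t)" if "t > 0" for t
  proof -
    have "(\<integral>x. \<bar>r x - q x\<bar> \<partial>M) \<le> (\<integral>x. t * (r x + q x) + ?h x / (2 * t) \<partial>M)"
      using i ih *[OF that] by (intro integral_mono) auto
    also have "\<dots> = 2 * t + (\<integral>x. ?h x \<partial>M) / (2 * t)"
      using i ih densD(3)[OF r] densD(3)[OF q] by simp
    also have "\<dots> \<le> 2 * t + K / (2 * t)" using hK that by (intro add_left_mono divide_right_mono) auto
    finally show ?thesis .
  qed
  show ?thesis
  proof (cases "K = 0")
    case True
    \<comment> \<open>The weight chosen below would be 0 here; let \<open>t\<close> tend to 0
      instead.\<close>
    have "(\<integral>x. \<bar>r x - q x\<bar> \<partial>M) \<le> 0 + e" if "e > 0" for e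
      using b[of "e/2"] that True by simp
    then have "(\<integral>x. \<bar>r x - q x\<bar> \<partial>M) \<le> 0" by (rule field_le_epsilon)
    then show ?thesis using True by simp
  next
    case False
    then have "sqrt K > 0" using assms by simp
    \<comment> \<open>\<open>t = sqrt K / 2\<close> minimises
      \<open>2 * t + K / (2 * t)\<close>.\<close>
    then have "(\<integral>x. \<bar>r x - q x\<bar> \<partial>M) \<le> 2 * (sqrt K / 2) + K / (2 * (sqrt K / 2))" by (intro b) auto
    also have "\<dots> = 2 * sqrt K" using assms(4) by (simp add: real_div_sqrt)
    finally show ?thesis .
  qed
qed

text \<open>An inequality of Pinsker type, with constant 2 instead of the sharp
  \<open>sqrt 2\<close>; the route through the Hellinger distance needs only pointwise
  estimates.\<close>

lemma L1_le_kl: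
  assumes r: "dens M r" and q: "dens M q" and pos: "\<And>x. q x > 0 \<or> r x = 0"
    and "kl M r q \<le> ennreal K" "K \<ge> 0"
  shows "(\<integral>x. \<bar>r x - q x\<bar> \<partial>M) \<le> 2 * sqrt K"
proof (rule L1_le_hellinger[OF r q _ assms(5)])
  have "(sqrt (r x) - sqrt (q x))\<^sup>2 \<le> kl_fun (r x) (q x)" for x
  proof (cases "q x > 0")
    case True then show ?thesis using kl_fun_hellinger densD(1)[OF r] by blast
  next
    case False
    then have "r x = 0" "q x = 0" using pos[of x] densD(1)[OF q, of x] by auto
    then show ?thesis by (simp add: kl_fun_def)
  qed
  then have "(\<integral>\<^sup>+x. ennreal ((sqrt (r x) - sqrt (q x))\<^sup>2) \<partial>M) \<le> kl M r q"
    unfolding kl_def by (intro nn_integral_mono ennreal_leI) auto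
  then show "(\<integral>\<^sup>+x. ennreal ((sqrt (r x) - sqrt (q x))\<^sup>2) \<partial>M) \<le> ennreal K"
    using assms(4) by (rule order_trans)
qed

section \<open>Entropy along segments and lower semicontinuity\<close>

lemma kl_compensation:
  assumes a: "dens M a" and r: "dens M r" and q: "q \<in> borel_measurable M" "\<And>x. q x > 0" and s: "0 < s" "s < 1"
  defines "m \<equiv> \<lambda>x. (1 - s) * a x + s * r x"
  shows "ennreal (1 - s) * kl M a q + ennreal s * kl M r q =
     kl M m q + ennreal (1 - s) * kl M a m + ennreal s * kl M r m"
proof -
  note [measurable] = densD(4)[OF r] densD(4)[OF a] q(1)
  have mM[measurable]: "m \<in> borel_measurable M" unfolding m_def by measurable
  note ra = densD(1)[OF a] densD(1)[OF r]
  have m0: "m x > 0 \<or> a x = 0 \<and> r x = 0 \<and> m x = 0" for x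
  proof -
    have "0 \<le> (1-s) * a x" "0 \<le> s * r x" "a x \<noteq> 0 \<Longrightarrow> 0 < (1-s) * a x" "r x \<noteq> 0 \<Longrightarrow> 0 < s * r x"
      using ra s by (auto simp: less_le)
    then show ?thesis unfolding m_def by (cases "a x = 0"; cases "r x = 0") (auto simp: add_pos_nonneg add_nonneg_pos)
  qed
  have nn: "kl_fun (a x) (q x) \<ge> 0" "kl_fun (r x) (q x) \<ge> 0" "kl_fun (m x) (q x) \<ge> 0"
    "kl_fun (a x) (m x) \<ge> 0" "kl_fun (r x) (m x) \<ge> 0" for x
    using m0[of x] q(2)[of x] ra[of x] by (auto intro!: kl_fun_nonneg)
  have "ennreal (1 - s) * kl M a q + ennreal s * kl M r q =
     (\<integral>\<^sup>+x. ennreal ((1 - s) * kl_fun (a x) (q x) + s * kl_fun (r x) (q x)) \<partial>M)"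
    unfolding kl_def using nn s
    by (simp add: nn_integral_add nn_integral_cmult ennreal_plus ennreal_mult)
  also have "\<dots> = (\<integral>\<^sup>+x. ennreal (kl_fun (m x) (q x) + (1 - s) * kl_fun (a x) (m x) + s * kl_fun (r x) (m x)) \<partial>M)"
    using kl_fun_compensation[OF ra q(2) s] unfolding m_def by simp
  also have "\<dots> = kl M m q + ennreal (1 - s) * kl M a m + ennreal s * kl M r m"
    unfolding kl_def using nn s
    by (simp add: nn_integral_add nn_integral_cmult ennreal_plus ennreal_mult)
  finally show ?thesis .
qed

lemma dens_convex:
  assumes "dens M a" "dens M r" "0 \<le> s" "s \<le> 1"
  shows "dens M (\<lambda>x. (1 - s) * a x + s * r x)"
  using assms unfolding dens_def by auto

text \<open>The entropies relative to the convex combinations stay bounded as \<open>s \<longlonglongrightarrow> 0\<close>; both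
  Pythagorean facts follow by letting \<open>s\<close> tend to 0.\<close>

lemma kl_minimal_segment:
  assumes a: "dens M a" and r: "dens M r" and q: "q \<in> borel_measurable M" "\<And>x. q x > 0"
    and s: "0 < s" "s < 1" and fin: "kl M a q < \<infinity>"
    and min: "kl M a q \<le> kl M (\<lambda>x. (1 - s) * a x + s * r x) q"
  shows "kl M r (\<lambda>x. (1 - s) * a x + s * r x) + kl M a q \<le> kl M r q"
proof (cases "kl M r q = \<infinity>")
  case False
  let ?m = "\<lambda>x. (1 - s) * a x + s * r x"
  have eq: "ennreal (1 - s) * kl M a q + ennreal s * kl M r q =
     kl M ?m q + ennreal (1 - s) * kl M a ?m + ennreal s * kl M r ?m"
    by (rule kl_compensation[OF a r q s])
  obtain A where A: "kl M a q = ennreal A" "A \<ge> 0" using fin by (cases "kl M a q") auto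
  obtain B where B: "kl M r q = ennreal B" "B \<ge> 0" using False by (cases "kl M r q") auto
  have "ennreal s * kl M r ?m \<le> ennreal (1 - s) * kl M a q + ennreal s * kl M r q"
    unfolding eq by simp
  also have "\<dots> < \<infinity>" using A B s by (simp add: ennreal_mult_less_top)
  finally have "kl M r ?m < \<infinity>" using s by (auto simp: ennreal_mult_less_top)
  then obtain D where D: "kl M r ?m = ennreal D" "D \<ge> 0" by (cases "kl M r ?m") auto
  \<comment> \<open>Drop the term \<open>kl M a ?m\<close> of the compensation identity and divide
    by \<open>s\<close>; what is left depends on \<open>s\<close> only through the mixture.\<close>
  have "ennreal (A + s * D) = kl M a q + ennreal s * kl M r ?m"
    using A D s by (simp add: ennreal_mult)
  also have "\<dots> \<le> kl M ?m q + ennreal s * kl M r ?m"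
    using min by (intro add_right_mono)
  also have "\<dots> \<le> kl M ?m q + ennreal (1 - s) * kl M a ?m + ennreal s * kl M r ?m" by (simp add: add_right_mono)
  also have "\<dots> = ennreal ((1 - s) * A + s * B)"
    unfolding eq[symmetric] using A B s by (simp add: ennreal_mult)
  finally have "ennreal (A + s * D) \<le> ennreal ((1 - s) * A + s * B)" .
  then have "A + s * D \<le> (1 - s) * A + s * B"
  proof -
    have "0 \<le> (1 - s) * A + s * B" using A B s by simp
    then show ?thesis using \<open>ennreal (A + s * D) \<le> ennreal ((1 - s) * A + s * B)\<close>
      by (simp only: ennreal_le_iff)
  qed
  then have "s * (D + A) \<le> s * B" by (simp add: algebra_simps)
  then have "D + A \<le> B" using s by simp
  then show ?thesis using A B D by (simp flip: ennreal_plus)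
qed simp

text \<open>On the set where \<open>a = 0 < r\<close> the mixture is \<open>s * r\<close>, so the
  entropy of \<open>r\<close> relative to it grows like \<open>ln (1 / s)\<close> times the mass of
  that set under \<open>r\<close>. The bound of \<open>kl_minimal_segment\<close> is uniform in
  \<open>s\<close> and forces this mass to be 0.\<close>

lemma kl_minimal_pos:
  assumes a: "dens M a" and r: "dens M r" and q: "q \<in> borel_measurable M" "\<And>x. q x > 0"
    and fin: "kl M a q < \<infinity>" "kl M r q < \<infinity>"
    and min: "\<And>s. 0 < s \<Longrightarrow> s < 1 \<Longrightarrow> kl M a q \<le> kl M (\<lambda>x. (1 - s) * a x + s * r x) q"
  shows "AE x in M. r x > 0 \<longrightarrow> a x > 0"
proof -
  note [measurable] = densD(4)[OF r] densD(4)[OF a] q(1)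
  note ra = densD(1)[OF a] densD(1)[OF r]
  obtain B where B: "kl M r q = ennreal B" "B \<ge> 0" using fin by (cases "kl M r q") auto
  define S where "S = {x \<in> space M. a x = 0 \<and> r x > 0}"
  have [measurable]: "S \<in> sets M" unfolding S_def by measurable
  have "integrable M (\<lambda>x. indicator S x * r x)"
    using densD(2)[OF r] by (simp add: integrable_real_mult_indicator mult.commute)
  define \<rho> where "\<rho> = (\<integral>x. indicator S x * r x \<partial>M)"
  have \<rho>0: "\<rho> \<ge> 0" unfolding \<rho>_def by (intro integral_nonneg_AE) (use ra in auto)
  have bound: "\<rho> * L \<le> B + 1" if "L > 0" for L
  proof -
    \<comment> \<open>This value makes \<open>ln (r / (s * r)) = L + 1\<close>; the extra 1 pays for
      the summand \<open>- r\<close> of \<open>kl_fun\<close>.\<close>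
    define s where "s = exp (- L - 1)"
    have s: "0 < s" "s < 1" using that by (auto simp: s_def)
    let ?m = "\<lambda>x. (1 - s) * a x + s * r x"
    have m0: "?m x > 0 \<or> ?m x = r x" for x
    proof -
      have "0 \<le> (1-s) * a x" "0 \<le> s * r x" "a x \<noteq> 0 \<Longrightarrow> 0 < (1-s) * a x" "r x \<noteq> 0 \<Longrightarrow> 0 < s * r x"
        using ra s by (auto simp: less_le)
      then show ?thesis by (cases "a x = 0"; cases "r x = 0") (auto simp: add_pos_nonneg add_nonneg_pos)
    qed
    have le: "indicator S x * r x * L \<le> kl_fun (r x) (?m x)" for x
    proof (cases "x \<in> S")
      case True
      then have x: "a x = 0" "r x > 0" by (auto simp: S_def)
      have "kl_fun (r x) (?m x) = r x * (L + 1) - r x + s * r x"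
        using x s by (simp add: kl_fun_def s_def ln_div ln_mult)
      then show ?thesis using True x s by (simp add: algebra_simps)
    next
      case False
      then show ?thesis using kl_fun_nonneg[of "r x" "?m x"] m0[of x] ra by auto
    qed
    have "ennreal (\<rho> * L) = (\<integral>\<^sup>+x. ennreal (indicator S x * r x * L) \<partial>M)"
    proof -
      have "integrable M (\<lambda>x. indicator S x * r x * L)"
        using \<open>integrable M (\<lambda>x. indicator S x * r x)\<close> by simp
      then show ?thesis
        unfolding \<rho>_def using ra that
        by (subst nn_integral_eq_integral) auto
    qed
    also have "\<dots> \<le> kl M r ?m" unfolding kl_def by (intro nn_integral_mono ennreal_leI le)
    also have "\<dots> \<le> kl M r ?m + kl M a q" by simp
    also have "\<dots> \<le> ennreal B"
      using kl_minimal_segment[OF a r q s fin(1) min[OF s]] B by simp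
    finally show ?thesis using B by simp
  qed
  have "\<rho> = 0"
  proof (rule ccontr)
    assume "\<rho> \<noteq> 0"
    then have "\<rho> > 0" using \<rho>0 by simp
    \<comment> \<open>Any \<open>L\<close> above \<open>(B + 1) / \<rho>\<close> contradicts the
      bound.\<close>
    then have "\<rho> * ((B + 2) / \<rho>) \<le> B + 1" using B by (intro bound) auto
    then show False using \<open>\<rho> > 0\<close> by simp
  qed
  then have "AE x in M. indicator S x * r x = 0"
    unfolding \<rho>_def using \<open>integrable M (\<lambda>x. indicator S x * r x)\<close> ra
    by (subst (asm) integral_nonneg_eq_0_iff_AE) auto
  then show ?thesis
    using AE_space by eventually_elim (use ra in \<open>auto simp: S_def less_le\<close>)
qed

text \<open>Fatou's lemma. Mixtures vary in the second argument, minimising sequences in the first,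
  hence two sequences.\<close>

lemma kl_liminf:
  assumes [measurable]: "r \<in> borel_measurable M" "h \<in> borel_measurable M"
    "\<And>n. u n \<in> borel_measurable M" "\<And>n. v n \<in> borel_measurable M"
    and "AE x in M. (\<lambda>n. kl_fun (u n x) (v n x)) \<longlonglongrightarrow> kl_fun (r x) (h x)"
    and "\<And>n. kl M (u n) (v n) \<le> K"
  shows "kl M r h \<le> K"
proof -
  have "kl M r h = (\<integral>\<^sup>+x. liminf (\<lambda>n. ennreal (kl_fun (u n x) (v n x))) \<partial>M)"
    unfolding kl_def
  proof (rule nn_integral_cong_AE)
    show "AE x in M. ennreal (kl_fun (r x) (h x)) = liminf (\<lambda>n. ennreal (kl_fun (u n x) (v n x)))"
      using assms(5)
      by eventually_elim (metis tendsto_ennrealI lim_imp_Liminf trivial_limit_sequentially)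
  qed
  also have "\<dots> \<le> liminf (\<lambda>n. kl M (u n) (v n))"
    unfolding kl_def by (intro nn_integral_liminf) auto
  also have "\<dots> \<le> K"
    using assms(6) by (intro Liminf_le) (auto intro: always_eventually)
  finally show ?thesis .
qed

lemma kl_pythagoras:
  assumes a: "dens M a" "\<And>x. a x > 0" and r: "dens M r" and q: "q \<in> borel_measurable M" "\<And>x. q x > 0"
    and fin: "kl M a q < \<infinity>"
    and min: "\<And>s. 0 < s \<Longrightarrow> s < 1 \<Longrightarrow> kl M a q \<le> kl M (\<lambda>x. (1 - s) * a x + s * r x) q"
  shows "kl M r a + kl M a q \<le> kl M r q"
proof (cases "kl M r q = \<infinity>")
  case False
  note [measurable] = densD(4)[OF r] densD(4)[OF a(1)] q(1)
  obtain A where A: "kl M a q = ennreal A" "A \<ge> 0" using fin by (cases "kl M a q") auto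
  obtain B where B: "kl M r q = ennreal B" "B \<ge> 0" using False by (cases "kl M r q") auto
  \<comment> \<open>The shift by 2 gives \<open>s n < 1\<close> already at
    \<open>n = 0\<close>.\<close>
  define s where "s = (\<lambda>n::nat. 1 / real (n + 2))"
  have s: "0 < s n" "s n < 1" for n by (auto simp: s_def)
  have s0: "s \<longlonglongrightarrow> 0"
    unfolding s_def by (rule LIMSEQ_ignore_initial_segment[where k=2]) (rule lim_1_over_n)
  let ?m = "\<lambda>n x. (1 - s n) * a x + s n * r x"
  have "kl M r a \<le> ennreal (B - A)"
  proof (rule kl_liminf[where u="\<lambda>n. r" and v="?m"])
    show "AE x in M. (\<lambda>n. kl_fun (r x) (?m n x)) \<longlonglongrightarrow> kl_fun (r x) (a x)"
    proof (intro AE_I2)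
      fix x
      have m: "(\<lambda>n. ?m n x) \<longlonglongrightarrow> (1 - 0) * a x + 0 * r x" using s0 by (intro tendsto_intros)
      show "(\<lambda>n. kl_fun (r x) (?m n x)) \<longlonglongrightarrow> kl_fun (r x) (a x)"
      proof (cases "r x = 0")
        case True then show ?thesis using m by (simp add: kl_fun_def)
      next
        case False
        have "(\<lambda>n. r x * ln (r x / ?m n x) - r x + ?m n x) \<longlonglongrightarrow> r x * ln (r x / a x) - r x + a x"
          using m a(2)[of x] False by (intro tendsto_intros) auto
        then show ?thesis by (simp add: kl_fun_def)
      qed
    qed
    show "kl M r (?m n) \<le> ennreal (B - A)" for n
    proof -
      have *: "kl M r (?m n) + ennreal A \<le> ennreal B"
        using kl_minimal_segment[OF a(1) r q s fin min[OF s]] A B by simp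
      have "kl M r (?m n) \<le> kl M r (?m n) + ennreal A" by simp
      also note *
      also have "ennreal B < \<infinity>" by simp
      finally have "kl M r (?m n) < \<infinity>" .
      then obtain D where D: "kl M r (?m n) = ennreal D" "D \<ge> 0" by (cases "kl M r (?m n)") auto
      have "ennreal (D + A) \<le> ennreal B" using * D A(2) by simp
      then have "D + A \<le> B" by (simp only: ennreal_le_iff[OF B(2)])
      then show ?thesis using D by (simp add: ennreal_leI)
    qed
  qed measurable
  moreover have "A \<le> B"
  proof -
    have "ennreal A \<le> kl M r (?m 0) + ennreal A" by simp
    also have "\<dots> \<le> ennreal B"
      using kl_minimal_segment[OF a(1) r q s fin min[OF s]] A B by simp
    finally have "ennreal A \<le> ennreal B" .
    then show ?thesis using B by simp
  qed
  ultimately have "kl M r a + ennreal A \<le> ennreal (B - A) + ennreal A" by (intro add_right_mono)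
  also have "\<dots> = ennreal B" using A \<open>A \<le> B\<close> by (subst ennreal_plus[symmetric]) auto
  finally show ?thesis unfolding A(1) B(1) .
qed simp

section \<open>Conditional expectations on probability spaces\<close>

lemma (in prob_space) sigma_finite_subalgebraI:
  assumes "subalgebra M G"
  shows "sigma_finite_subalgebra M G"
proof -
  interpret finite_measure_subalgebra M G using assms by unfold_locales
  show ?thesis by (rule finite_measure_subalgebra_is_sigma_finite) (rule finite_measure_subalgebra_axioms)
qed

lemma integrable_bounded_mult:
  fixes h k :: "'a \<Rightarrow> real"
  assumes "integrable M k" "h \<in> borel_measurable M" "AE x in M. \<bar>h x\<bar> \<le> c"
  shows "integrable M (\<lambda>x. h x * k x)"
proof (rule Bochner_Integration.integrable_bound[of M "\<lambda>x. c * k x"])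
  show "AE x in M. norm (h x * k x) \<le> norm (c * k x)"
    using assms(3)
  proof eventually_elim
    case (elim x)
    then have "\<bar>h x\<bar> * \<bar>k x\<bar> \<le> c * \<bar>k x\<bar>" by (intro mult_right_mono) auto
    also have "\<dots> \<le> \<bar>c\<bar> * \<bar>k x\<bar>" by (intro mult_right_mono) auto
    finally show ?case by (simp add: abs_mult)
  qed
qed (use assms in auto)

lemma (in prob_space) cond_exp_indicator_bounds:
  assumes G: "subalgebra M G" and A: "A \<in> sets M"
  shows "AE x in M. 0 \<le> real_cond_exp M G (indicator A) x"
    "AE x in M. real_cond_exp M G (indicator A) x \<le> 1"
    "AE x in M. \<bar>real_cond_exp M G (indicator A) x\<bar> \<le> 1"
proof -
  interpret sigma_finite_subalgebra M G using sigma_finite_subalgebraI[OF G] .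
  have i: "integrable M (indicator A :: _ \<Rightarrow> real)" using A by (simp add: integrable_real_indicator emeasure_eq_measure)
  show 1: "AE x in M. 0 \<le> real_cond_exp M G (indicator A) x"
    by (rule real_cond_exp_ge_c[OF i]) auto
  show 2: "AE x in M. real_cond_exp M G (indicator A) x \<le> 1"
    by (rule real_cond_exp_le_c[OF i]) (auto simp: indicator_def)
  show "AE x in M. \<bar>real_cond_exp M G (indicator A) x\<bar> \<le> 1"
    using 1 2 by eventually_elim auto
qed

text \<open>Conditional expectation is self-adjoint: both sides are the integral of the product of
  the two conditional expectations. One factor is an indicator because its bounded conditional
  expectation makes all products integrable.\<close>

lemma (in prob_space) cond_exp_swap:
  assumes G: "subalgebra M G" and A: "A \<in> sets M" and k: "integrable M k"
  shows "(\<integral>x. real_cond_exp M G (indicator A) x * k x \<partial>M) = (\<integral>x. indicator A x * real_cond_exp M G k x \<partial>M)"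
    "integrable M (\<lambda>x. real_cond_exp M G (indicator A) x * k x)"
proof -
  interpret sigma_finite_subalgebra M G using sigma_finite_subalgebraI[OF G] .
  note b = cond_exp_indicator_bounds(3)[OF G A]
  show i: "integrable M (\<lambda>x. real_cond_exp M G (indicator A) x * k x)"
    by (rule integrable_bounded_mult[OF k _ b]) simp
  have "(\<integral>x. real_cond_exp M G (indicator A) x * k x \<partial>M)
      = (\<integral>x. real_cond_exp M G (indicator A) x * real_cond_exp M G k x \<partial>M)"
    using k by (intro real_cond_exp_intg(2)[symmetric] i) auto
  also have "\<dots> = (\<integral>x. real_cond_exp M G k x * real_cond_exp M G (indicator A) x \<partial>M)"
    by (simp add: mult.commute)
  also have "\<dots> = (\<integral>x. real_cond_exp M G k x * indicator A x \<partial>M)"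
    using A real_cond_exp_int(1)[OF k]
    by (intro real_cond_exp_intg(2)) (auto intro!: integrable_real_mult_indicator)
  finally show "(\<integral>x. real_cond_exp M G (indicator A) x * k x \<partial>M) = (\<integral>x. indicator A x * real_cond_exp M G k x \<partial>M)"
    by (simp add: mult.commute)
qed

lemma (in prob_space) cond_exp_zero_subalg:
  assumes G: "subalgebra M G" "subalgebra G G'" and k: "integrable M k"
    and z: "AE x in M. real_cond_exp M G k x = 0"
  shows "AE x in M. real_cond_exp M G' k x = 0"
proof -
  have G': "subalgebra M G'" using G by (auto simp: subalgebra_def)
  interpret G: sigma_finite_subalgebra M G using sigma_finite_subalgebraI[OF G(1)] .
  interpret G': sigma_finite_subalgebra M G' using sigma_finite_subalgebraI[OF G'] .
  have "AE x in M. real_cond_exp M G' (real_cond_exp M G k) x = real_cond_exp M G' k x"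
    by (rule G'.real_cond_exp_nested_subalg[OF G k])
  moreover have "AE x in M. real_cond_exp M G' (real_cond_exp M G k) x = real_cond_exp M G' (\<lambda>_. 0) x"
    by (rule G'.real_cond_exp_cong[OF z]) auto
  moreover have "AE x in M. real_cond_exp M G' (\<lambda>_. 0) x = 0"
    by (rule G'.real_cond_exp_F_meas) auto
  ultimately show ?thesis by eventually_elim simp
qed

lemma (in prob_space) nn_cond_exp_eq_real:
  assumes G: "subalgebra M G" and Z: "integrable M Z" "\<And>x. 0 \<le> Z x"
  shows "AE x in M. nn_cond_exp M G (\<lambda>x. ennreal (Z x)) x = ennreal (real_cond_exp M G Z x)"
proof -
  interpret sigma_finite_subalgebra M G using sigma_finite_subalgebraI[OF G] .
  have [measurable]: "Z \<in> borel_measurable M" using Z by auto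
  have nn: "AE x in M. real_cond_exp M G Z x \<ge> 0"
    by (rule real_cond_exp_pos) (use Z in auto)
  have "AE x in M. ennreal (real_cond_exp M G Z x) = nn_cond_exp M G (\<lambda>x. ennreal (Z x)) x"
  proof (rule nn_cond_exp_charact)
    fix A assume A: "A \<in> sets G"
    then have A'[measurable]: "A \<in> sets M" using G by (auto simp: subalgebra_def)
    have "(\<integral>\<^sup>+x\<in>A. ennreal (Z x) \<partial>M) = (\<integral>\<^sup>+x. ennreal (Z x * indicator A x) \<partial>M)"
      by (intro nn_integral_cong) (auto simp: indicator_def)
    also have "\<dots> = ennreal (\<integral>x. Z x * indicator A x \<partial>M)"
      using Z A' by (intro nn_integral_eq_integral integrable_real_mult_indicator) auto
    also have "(\<integral>x. Z x * indicator A x \<partial>M) = (\<integral>x. real_cond_exp M G Z x * indicator A x \<partial>M)"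
      using real_cond_exp_intA[OF Z(1) A] by (simp add: set_lebesgue_integral_def mult.commute)
    also have "ennreal \<dots> = (\<integral>\<^sup>+x. ennreal (real_cond_exp M G Z x * indicator A x) \<partial>M)"
      using nn Z A' by (intro nn_integral_eq_integral[symmetric] integrable_real_mult_indicator) auto
    also have "\<dots> = (\<integral>\<^sup>+x\<in>A. ennreal (real_cond_exp M G Z x) \<partial>M)"
      by (intro nn_integral_cong) (auto simp: indicator_def)
    finally show "(\<integral>\<^sup>+x\<in>A. ennreal (Z x) \<partial>M) = (\<integral>\<^sup>+x\<in>A. ennreal (real_cond_exp M G Z x) \<partial>M)" .
  qed auto
  then show ?thesis by eventually_elim simp
qed

section \<open>Changes of measure that preserve conditional laws\<close>

text \<open>Equal projections of \<open>Z\<close> say that under the measure with density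
  \<open>Z\<close> the events of \<open>H\<close> have the same conditional law given
  \<open>G\<close> as under \<open>M\<close>. Project \<open>Z\<close> to \<open>H\<close>, replace
  this by its projection to \<open>G\<close>, and move that projection over to \<open>g\<close>; for
  nonnegative \<open>g\<close> no integrability is involved.\<close>

lemma (in prob_space) conditional_law_nn:
  assumes H: "subalgebra M H" "subalgebra H G"
    and Z: "integrable M Z" "\<And>x. 0 \<le> Z x"
    and c: "AE x in M. real_cond_exp M H Z x = real_cond_exp M G Z x"
    and g: "g \<in> borel_measurable H"
  shows "(\<integral>\<^sup>+x. g x * ennreal (Z x) \<partial>M) = (\<integral>\<^sup>+x. nn_cond_exp M G g x * ennreal (Z x) \<partial>M)"
proof -
  have G: "subalgebra M G" using H by (auto simp: subalgebra_def)
  interpret H: sigma_finite_subalgebra M H using sigma_finite_subalgebraI[OF H(1)] .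
  interpret G: sigma_finite_subalgebra M G using sigma_finite_subalgebraI[OF G] .
  have [measurable]: "Z \<in> borel_measurable M" using Z by auto
  have [measurable]: "g \<in> borel_measurable M" using g H(1) by (metis measurable_from_subalg)
  let ?Z = "\<lambda>x. ennreal (Z x)"
  have e: "AE x in M. nn_cond_exp M H ?Z x = nn_cond_exp M G ?Z x"
    using nn_cond_exp_eq_real[OF H(1) Z] nn_cond_exp_eq_real[OF G Z] c by eventually_elim simp
  have "(\<integral>\<^sup>+x. g x * ?Z x \<partial>M) = (\<integral>\<^sup>+x. g x * nn_cond_exp M H ?Z x \<partial>M)"
    using g by (intro H.nn_cond_exp_intg[symmetric]) auto
  also have "\<dots> = (\<integral>\<^sup>+x. nn_cond_exp M G ?Z x * g x \<partial>M)"
    using e by (intro nn_integral_cong_AE) (auto simp: mult.commute)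
  also have "\<dots> = (\<integral>\<^sup>+x. nn_cond_exp M G ?Z x * nn_cond_exp M G g x \<partial>M)"
    by (intro G.nn_cond_exp_intg[symmetric]) auto
  also have "\<dots> = (\<integral>\<^sup>+x. nn_cond_exp M G g x * nn_cond_exp M G ?Z x \<partial>M)" by (simp add: mult.commute)
  also have "\<dots> = (\<integral>\<^sup>+x. nn_cond_exp M G g x * ?Z x \<partial>M)"
    by (intro G.nn_cond_exp_intg) auto
  finally show ?thesis .
qed

text \<open>The first claim is Jensen's inequality for the negative part. For the second,
  \<open>\<alpha>\<close> plus the projected negative part of \<open>\<eta>\<close> is the projected
  positive part, so integrability of \<open>\<alpha>\<close> and of the negative part of
  \<open>\<eta>\<close> under \<open>Z\<close> yields that of \<open>\<eta>\<close>.\<close>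

lemma (in prob_space) conditional_law_step:
  assumes H: "subalgebra M H" "subalgebra H G"
    and Z: "integrable M Z" "\<And>x. 0 \<le> Z x"
    and c: "AE x in M. real_cond_exp M H Z x = real_cond_exp M G Z x"
    and \<eta>: "\<eta> \<in> borel_measurable H" "integrable M \<eta>"
    and \<alpha>: "AE x in M. \<alpha> x = real_cond_exp M G \<eta> x"
  shows "(\<integral>\<^sup>+x. ennreal (- \<alpha> x) * ennreal (Z x) \<partial>M) \<le> (\<integral>\<^sup>+x. ennreal (- \<eta> x) * ennreal (Z x) \<partial>M)"
    and "(\<integral>\<^sup>+x. ennreal (- \<eta> x) * ennreal (Z x) \<partial>M) < \<infinity> \<Longrightarrow> integrable M (\<lambda>x. \<alpha> x * Z x) \<Longrightarrow>
      integrable M (\<lambda>x. \<eta> x * Z x) \<and> (\<integral>x. \<eta> x * Z x \<partial>M) = (\<integral>x. \<alpha> x * Z x \<partial>M)"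
proof -
  have G: "subalgebra M G" using H by (auto simp: subalgebra_def)
  interpret H: sigma_finite_subalgebra M H using sigma_finite_subalgebraI[OF H(1)] .
  interpret G: sigma_finite_subalgebra M G using sigma_finite_subalgebraI[OF G] .
  have [measurable]: "Z \<in> borel_measurable M" "\<eta> \<in> borel_measurable M" using Z \<eta> by auto
  let ?p = "nn_cond_exp M G (\<lambda>x. ennreal (\<eta> x))" and ?m = "nn_cond_exp M G (\<lambda>x. ennreal (- \<eta> x))"
  have pZ: "(\<integral>\<^sup>+x. ennreal (\<eta> x) * ennreal (Z x) \<partial>M) = (\<integral>\<^sup>+x. ?p x * ennreal (Z x) \<partial>M)"
    by (rule conditional_law_nn[OF H Z c]) (use \<eta>(1) in measurable)
  have mZ: "(\<integral>\<^sup>+x. ennreal (- \<eta> x) * ennreal (Z x) \<partial>M) = (\<integral>\<^sup>+x. ?m x * ennreal (Z x) \<partial>M)"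
    by (rule conditional_law_nn[OF H Z c]) (use \<eta>(1) in measurable)
  have \<alpha>eq: "AE x in M. \<alpha> x = enn2real (?p x) - enn2real (?m x)"
    using \<alpha> by eventually_elim (simp add: real_cond_exp_def)
  have "(\<integral>\<^sup>+x. ennreal (- \<alpha> x) * ennreal (Z x) \<partial>M) \<le> (\<integral>\<^sup>+x. ?m x * ennreal (Z x) \<partial>M)"
  proof (rule nn_integral_mono_AE)
    show "AE x in M. ennreal (- \<alpha> x) * ennreal (Z x) \<le> ?m x * ennreal (Z x)"
      using \<alpha>eq
    proof eventually_elim
      case (elim x)
      have "ennreal (- \<alpha> x) \<le> ennreal (enn2real (?m x))"
        using elim by (intro ennreal_leI) simp
      also have "\<dots> \<le> ?m x" by (cases "?m x") auto
      finally show ?case by (rule mult_right_mono) simp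
    qed
  qed
  then show "(\<integral>\<^sup>+x. ennreal (- \<alpha> x) * ennreal (Z x) \<partial>M) \<le> (\<integral>\<^sup>+x. ennreal (- \<eta> x) * ennreal (Z x) \<partial>M)"
    unfolding mZ .
  assume fin: "(\<integral>\<^sup>+x. ennreal (- \<eta> x) * ennreal (Z x) \<partial>M) < \<infinity>" and i\<alpha>: "integrable M (\<lambda>x. \<alpha> x * Z x)"
  \<comment> \<open>The projected positive part is finite almost everywhere, so
    \<open>enn2real\<close> in the formula for \<open>\<alpha>\<close> loses nothing there.\<close>
  have "(\<integral>\<^sup>+x. ?p x \<partial>M) = (\<integral>\<^sup>+x. 1 * ?p x \<partial>M)" by simp
  also have "\<dots> = (\<integral>\<^sup>+x. 1 * ennreal (\<eta> x) \<partial>M)" by (rule G.nn_cond_exp_intg) auto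
  also have "\<dots> \<le> (\<integral>\<^sup>+x. ennreal (norm (\<eta> x)) \<partial>M)" by (auto intro!: nn_integral_mono ennreal_leI)
  also have "\<dots> < \<infinity>" using \<eta>(2) by (simp add: integrable_iff_bounded)
  finally have pfin: "AE x in M. ?p x \<noteq> \<infinity>" by (intro nn_integral_PInf_AE) auto
  have "(\<integral>\<^sup>+x. ?p x * ennreal (Z x) \<partial>M) \<le> (\<integral>\<^sup>+x. ennreal (norm (\<alpha> x * Z x)) + ?m x * ennreal (Z x) \<partial>M)"
  proof (rule nn_integral_mono_AE)
    show "AE x in M. ?p x * ennreal (Z x) \<le> ennreal (norm (\<alpha> x * Z x)) + ?m x * ennreal (Z x)"
      using \<alpha>eq pfin
    proof eventually_elim
      case (elim x)
      have "?p x = ennreal (enn2real (?p x))" using elim(2) by (cases "?p x") auto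
      also have "\<dots> \<le> ennreal (\<bar>\<alpha> x\<bar> + enn2real (?m x))"
        using elim(1) by (intro ennreal_leI) simp
      also have "\<dots> = ennreal \<bar>\<alpha> x\<bar> + ennreal (enn2real (?m x))" by simp
      also have "\<dots> \<le> ennreal \<bar>\<alpha> x\<bar> + ?m x"
        by (rule add_left_mono) (cases "?m x", auto)
      finally have "?p x * ennreal (Z x) \<le> (ennreal \<bar>\<alpha> x\<bar> + ?m x) * ennreal (Z x)"
        by (rule mult_right_mono) simp
      also have "\<dots> = ennreal (norm (\<alpha> x * Z x)) + ?m x * ennreal (Z x)"
        using Z(2)[of x] by (simp add: distrib_right abs_mult ennreal_mult)
      finally show ?case .
    qed
  qed
  also have "\<dots> = (\<integral>\<^sup>+x. ennreal (norm (\<alpha> x * Z x)) \<partial>M) + (\<integral>\<^sup>+x. ?m x * ennreal (Z x) \<partial>M)"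
    using i\<alpha> by (intro nn_integral_add) auto
  also have "\<dots> < \<infinity>" using i\<alpha> fin unfolding mZ by (simp add: integrable_iff_bounded)
  finally have pos: "(\<integral>\<^sup>+x. ennreal (\<eta> x) * ennreal (Z x) \<partial>M) < \<infinity>" unfolding pZ .
  have i: "integrable M (\<lambda>x. \<eta> x * Z x)"
  proof (rule integrableI_bounded)
    have "(\<integral>\<^sup>+x. ennreal (norm (\<eta> x * Z x)) \<partial>M) = (\<integral>\<^sup>+x. ennreal (\<eta> x) * ennreal (Z x) + ennreal (- \<eta> x) * ennreal (Z x) \<partial>M)"
    proof (intro nn_integral_cong)
      fix x
      show "ennreal (norm (\<eta> x * Z x)) = ennreal (\<eta> x) * ennreal (Z x) + ennreal (- \<eta> x) * ennreal (Z x)"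
      proof (cases "\<eta> x \<ge> 0")
        case True
        then show ?thesis using Z(2)[of x] by (simp add: abs_mult ennreal_mult ennreal_neg)
      next
        case False
        then have "norm (\<eta> x * Z x) = (- \<eta> x) * Z x" using Z(2)[of x] by (simp add: abs_mult)
        then show ?thesis using False Z(2)[of x] by (simp only: ennreal_mult'') (simp add: ennreal_neg)
      qed
    qed
    also have "\<dots> = (\<integral>\<^sup>+x. ennreal (\<eta> x) * ennreal (Z x) \<partial>M) + (\<integral>\<^sup>+x. ennreal (- \<eta> x) * ennreal (Z x) \<partial>M)"
      by (intro nn_integral_add) auto
    also have "\<dots> < \<infinity>" using pos fin by simp
    finally show "(\<integral>\<^sup>+x. ennreal (norm (\<eta> x * Z x)) \<partial>M) < \<infinity>" .
  qed measurable
  have iH: "integrable M (\<lambda>x. \<eta> x * real_cond_exp M H Z x)"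
    "(\<integral>x. \<eta> x * real_cond_exp M H Z x \<partial>M) = (\<integral>x. \<eta> x * Z x \<partial>M)"
    by (rule H.real_cond_exp_intg[OF i \<eta>(1)]; simp)+
  have iG: "integrable M (\<lambda>x. real_cond_exp M G Z x * \<eta> x)"
    using iH(1) by (rule Bochner_Integration.integrable_cong_AE_imp) (use c in \<open>auto simp: mult.commute\<close>)
  have i\<alpha>': "integrable M (\<lambda>x. real_cond_exp M G \<eta> x * Z x)"
    using i\<alpha> by (rule Bochner_Integration.integrable_cong_AE_imp) (use \<alpha> in auto)
  have "(\<integral>x. \<eta> x * Z x \<partial>M) = (\<integral>x. \<eta> x * real_cond_exp M H Z x \<partial>M)" using iH(2) by simp
  also have "\<dots> = (\<integral>x. real_cond_exp M G Z x * \<eta> x \<partial>M)"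
    using c by (intro integral_cong_AE) (auto simp: mult.commute)
  also have "\<dots> = (\<integral>x. real_cond_exp M G Z x * real_cond_exp M G \<eta> x \<partial>M)"
    by (rule G.real_cond_exp_intg(2)[symmetric, OF iG]) auto
  also have "\<dots> = (\<integral>x. real_cond_exp M G \<eta> x * real_cond_exp M G Z x \<partial>M)" by (simp add: mult.commute)
  also have "\<dots> = (\<integral>x. real_cond_exp M G \<eta> x * Z x \<partial>M)"
    by (rule G.real_cond_exp_intg(2)[OF i\<alpha>']) auto
  also have "\<dots> = (\<integral>x. \<alpha> x * Z x \<partial>M)"
  proof (rule integral_cong_AE)
    show "(\<lambda>x. \<alpha> x * Z x) \<in> borel_measurable M" using i\<alpha> by auto
  qed (use \<alpha> in auto)
  finally show "integrable M (\<lambda>x. \<eta> x * Z x) \<and> (\<integral>x. \<eta> x * Z x \<partial>M) = (\<integral>x. \<alpha> x * Z x \<partial>M)" using i by simp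
qed

text \<open>In discrete time a local martingale whose terminal value has an integrable negative part is a
  martingale; hence only the negative part of \<open>a\<close> needs to be controlled.\<close>

lemma (in prob_space) conditional_law_chain:
  fixes G H :: "nat \<Rightarrow> 'a measure"
  assumes sub: "\<And>t. t < n \<Longrightarrow> subalgebra M (H t)" "\<And>t. t < n \<Longrightarrow> subalgebra (H t) (G t)"
    and Gn: "subalgebra M (G n)" "sets (G n) = sets M"
    and Z: "integrable M Z" "\<And>x. 0 \<le> Z x" "(\<integral>x. Z x \<partial>M) = 1"
    and c: "\<And>t. t < n \<Longrightarrow> AE x in M. real_cond_exp M (H t) Z x = real_cond_exp M (G t) Z x"
    and a: "integrable M a"
    and d: "\<And>t. t < n \<Longrightarrow> AE x in M. real_cond_exp M (G (Suc t)) a x = real_cond_exp M (H t) a x"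
    and triv: "\<And>A. A \<in> sets (G 0) \<Longrightarrow> A = {} \<or> A = space M"
    and fin: "(\<integral>\<^sup>+x. ennreal (- a x) * ennreal (Z x) \<partial>M) < \<infinity>"
  shows "integrable M (\<lambda>x. a x * Z x)" "(\<integral>x. a x * Z x \<partial>M) = (\<integral>x. a x \<partial>M)"
proof -
  define \<alpha> where "\<alpha> t = real_cond_exp M (G t) a" for t
  define \<eta> where "\<eta> t = real_cond_exp M (H t) a" for t
  have sG: "subalgebra M (G t)" if "t \<le> n" for t
    using that Gn sub[of t] by (cases "t = n") (auto simp: subalgebra_def)
  have \<alpha>n: "AE x in M. \<alpha> n x = a x"
  proof -
    interpret sigma_finite_subalgebra M "G n" using sigma_finite_subalgebraI[OF Gn(1)] .
    have "a \<in> borel_measurable (G n)" using borel_measurable_integrable[OF a] measurable_cong_sets[OF Gn(2) refl] by blast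
    then show ?thesis unfolding \<alpha>_def using a by (intro real_cond_exp_F_meas)
  qed
  have step: "\<eta> t \<in> borel_measurable (H t)" "integrable M (\<eta> t)"
    "AE x in M. \<alpha> t x = real_cond_exp M (G t) (\<eta> t) x" "AE x in M. \<alpha> (Suc t) x = \<eta> t x" if "t < n" for t
  proof -
    interpret H: sigma_finite_subalgebra M "H t" using sigma_finite_subalgebraI[OF sub(1)[OF that]] .
    interpret G: sigma_finite_subalgebra M "G t" using sigma_finite_subalgebraI[OF sG] that by simp
    show "\<eta> t \<in> borel_measurable (H t)" "integrable M (\<eta> t)" unfolding \<eta>_def using a by auto
    have "AE x in M. real_cond_exp M (G t) (\<eta> t) x = \<alpha> t x"
      unfolding \<eta>_def \<alpha>_def by (rule G.real_cond_exp_nested_subalg[OF sub[OF that] a])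
    then show "AE x in M. \<alpha> t x = real_cond_exp M (G t) (\<eta> t) x" by eventually_elim simp
    show "AE x in M. \<alpha> (Suc t) x = \<eta> t x" unfolding \<alpha>_def \<eta>_def using d[OF that] .
  qed
  have cong: "(\<integral>\<^sup>+x. ennreal (- u x) * ennreal (Z x) \<partial>M) = (\<integral>\<^sup>+x. ennreal (- v x) * ennreal (Z x) \<partial>M)"
    if "AE x in M. u x = v x" for u v :: "'a \<Rightarrow> real"
    by (rule nn_integral_cong_AE) (use that in auto)
  \<comment> \<open>Backwards in time: projecting decreases the negative part, so at every time its
    integral under \<open>Z\<close> is at most that of \<open>a\<close>.\<close>
  have neg: "(\<integral>\<^sup>+x. ennreal (- \<alpha> (n - t) x) * ennreal (Z x) \<partial>M) < \<infinity>" if "t \<le> n" for t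
    using that
  proof (induction t)
    case 0
    then show ?case using fin cong[OF \<alpha>n] by simp
  next
    case (Suc t)
    let ?t = "n - Suc t"
    have t: "?t < n" "Suc ?t = n - t" using Suc by auto
    have "(\<integral>\<^sup>+x. ennreal (- \<alpha> ?t x) * ennreal (Z x) \<partial>M) \<le> (\<integral>\<^sup>+x. ennreal (- \<eta> ?t x) * ennreal (Z x) \<partial>M)"
      by (rule conditional_law_step(1)[OF sub[OF t(1)] Z(1,2) c[OF t(1)] step(1-3)[OF t(1)]])
    also have "\<dots> = (\<integral>\<^sup>+x. ennreal (- \<alpha> (n - t) x) * ennreal (Z x) \<partial>M)"
      using cong[OF step(4)[OF t(1)]] t(2) by simp
    also have "\<dots> < \<infinity>" using Suc by simp
    finally show ?case .
  qed
  \<comment> \<open>Forwards in time: over the trivial \<open>G 0\<close> the projection of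
    \<open>a\<close> is its mean, and each step preserves integrability and the mean under
    \<open>Z\<close>.\<close>
  have J: "integrable M (\<lambda>x. \<alpha> t x * Z x) \<and> (\<integral>x. \<alpha> t x * Z x \<partial>M) = (\<integral>x. a x \<partial>M)" if "t \<le> n" for t
    using that
  proof (induction t)
    case 0
    interpret G: sigma_finite_subalgebra M "G 0" using sigma_finite_subalgebraI[OF sG] by simp
    have "AE x in M. real_cond_exp M (G 0) a x = (\<integral>x. a x \<partial>M)"
    proof (rule G.real_cond_exp_charact)
      fix A assume "A \<in> sets (G 0)"
      then have "A = {} \<or> A = space M" by (rule triv)
      then show "(\<integral>x\<in>A. a x \<partial>M) = (\<integral>x\<in>A. (\<integral>x. a x \<partial>M) \<partial>M)"
      proof
        assume A: "A = space M"
        have "(\<integral>x\<in>A. a x \<partial>M) = (\<integral>x. a x \<partial>M)" unfolding A using a by (rule set_integral_space)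
        moreover have "(\<integral>x\<in>A. (\<integral>x. a x \<partial>M) \<partial>M) = (\<integral>x. (\<integral>x. a x \<partial>M) \<partial>M)" unfolding A by (rule set_integral_space) simp
        ultimately show ?thesis by (simp add: prob_space)
      qed (simp add: set_lebesgue_integral_def)
    qed (use a in auto)
    then have e: "AE x in M. \<alpha> 0 x * Z x = (\<integral>x. a x \<partial>M) * Z x" unfolding \<alpha>_def by eventually_elim simp
    have i: "integrable M (\<lambda>x. (\<integral>x. a x \<partial>M) * Z x)" using Z by simp
    have m: "(\<lambda>x. \<alpha> 0 x * Z x) \<in> borel_measurable M" unfolding \<alpha>_def using Z(1) by measurable
    have "integrable M (\<lambda>x. \<alpha> 0 x * Z x)"
      using i by (rule Bochner_Integration.integrable_cong_AE_imp) (use e m in auto)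
    moreover have "(\<integral>x. \<alpha> 0 x * Z x \<partial>M) = (\<integral>x. (\<integral>x. a x \<partial>M) * Z x \<partial>M)"
      using m i e by (intro integral_cong_AE) auto
    ultimately show ?case using Z(3) by simp
  next
    case (Suc t)
    then have t: "t < n" by simp
    have "(\<integral>\<^sup>+x. ennreal (- \<eta> t x) * ennreal (Z x) \<partial>M) < \<infinity>"
      using cong[OF step(4)[OF t]] neg[of "n - Suc t"] t by simp
    then have *: "integrable M (\<lambda>x. \<eta> t x * Z x)" "(\<integral>x. \<eta> t x * Z x \<partial>M) = (\<integral>x. \<alpha> t x * Z x \<partial>M)"
      using conditional_law_step(2)[OF sub[OF t] Z(1,2) c[OF t] step(1-3)[OF t]] Suc by auto
    have e: "AE x in M. \<eta> t x * Z x = \<alpha> (Suc t) x * Z x" using step(4)[OF t] by eventually_elim simp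
    have m: "(\<lambda>x. \<alpha> (Suc t) x * Z x) \<in> borel_measurable M" unfolding \<alpha>_def using Z(1) by measurable
    have "integrable M (\<lambda>x. \<alpha> (Suc t) x * Z x)"
      using *(1) by (rule Bochner_Integration.integrable_cong_AE_imp) (use e m in auto)
    moreover have "(\<integral>x. \<alpha> (Suc t) x * Z x \<partial>M) = (\<integral>x. \<eta> t x * Z x \<partial>M)"
    proof (rule integral_cong_AE)
      show "AE x in M. \<alpha> (Suc t) x * Z x = \<eta> t x * Z x" using e by eventually_elim (rule sym)
    qed (use m * in auto)
    ultimately show ?case using *(2) Suc by simp
  qed
  have e: "AE x in M. \<alpha> n x * Z x = a x * Z x" using \<alpha>n by eventually_elim simp
  have m: "(\<lambda>x. a x * Z x) \<in> borel_measurable M" using a Z(1) by measurable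
  show "integrable M (\<lambda>x. a x * Z x)"
    using J[of n] e m by (intro Bochner_Integration.integrable_cong_AE_imp[where f="\<lambda>x. a x * Z x" and g="\<lambda>x. \<alpha> n x * Z x"]) auto
  have "(\<integral>x. a x * Z x \<partial>M) = (\<integral>x. \<alpha> n x * Z x \<partial>M)"
  proof (rule integral_cong_AE)
    show "AE x in M. a x * Z x = \<alpha> n x * Z x" using e by eventually_elim (rule sym)
  qed (use m J[of n] in auto)
  then show "(\<integral>x. a x * Z x \<partial>M) = (\<integral>x. a x \<partial>M)" using J[of n] by simp
qed

section \<open>Causal densities\<close>

text \<open>\<open>F s t\<close> plays the role of the sigma-algebra generated by \<open>X\<^sub>1, \<dots>, X\<^sub>s, Y\<^sub>1, \<dots>, Y\<^sub>t\<close>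
  under the independent coupling \<open>P\<close>.\<close>

locale causal_filtration = prob_space P for P :: "'a measure" +
  fixes N :: nat and F :: "nat \<Rightarrow> nat \<Rightarrow> 'a measure"
  assumes F_subalg: "s \<le> N \<Longrightarrow> t \<le> N \<Longrightarrow> subalgebra P (F s t)"
    and F_mono: "s \<le> s' \<Longrightarrow> s' \<le> N \<Longrightarrow> t \<le> t' \<Longrightarrow> t' \<le> N \<Longrightarrow> subalgebra (F s' t') (F s t)"
    and F_full: "sets (F N N) = sets P"
    and F_trivial: "A \<in> sets (F 0 0) \<Longrightarrow> A = {} \<or> A = space P"
    and commute: "s \<le> s' \<Longrightarrow> s' \<le> N \<Longrightarrow> t' \<le> t \<Longrightarrow> t \<le> N \<Longrightarrow> A \<in> sets (F s' t') \<Longrightarrow>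
      AE x in P. real_cond_exp P (F s t) (indicator A) x = real_cond_exp P (F s t') (indicator A) x"
begin

lemma sf: "s \<le> N \<Longrightarrow> t \<le> N \<Longrightarrow> sigma_finite_subalgebra P (F s t)"
  by (rule sigma_finite_subalgebraI) (rule F_subalg)

lemma sets_F: "s \<le> N \<Longrightarrow> t \<le> N \<Longrightarrow> A \<in> sets (F s t) \<Longrightarrow> A \<in> sets P"
  using F_subalg by (auto simp: subalgebra_def)

lemma sets_F_mono: "s \<le> s' \<Longrightarrow> s' \<le> N \<Longrightarrow> t \<le> t' \<Longrightarrow> t' \<le> N \<Longrightarrow> A \<in> sets (F s t) \<Longrightarrow> A \<in> sets (F s' t')"
  using F_mono[of s s' t t'] by (auto simp: subalgebra_def)

lemma meas_F: "s \<le> N \<Longrightarrow> t \<le> N \<Longrightarrow> f \<in> measurable (F s t) K \<Longrightarrow> f \<in> measurable P K"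
  using measurable_from_subalg[OF F_subalg] by blast

lemma meas_F_mono: "s \<le> s' \<Longrightarrow> s' \<le> N \<Longrightarrow> t \<le> t' \<Longrightarrow> t' \<le> N \<Longrightarrow> f \<in> measurable (F s t) K \<Longrightarrow> f \<in> measurable (F s' t') K"
  using measurable_from_subalg[OF F_mono] by blast

lemma commute_indicator_integral:
  assumes st: "s \<le> s'" "s' \<le> N" "t' \<le> t" "t \<le> N" and A: "A \<in> sets (F s' t')"
    and k: "k \<in> borel_measurable (F s t)" "integrable P k"
  shows "(\<integral>x. k x * indicator A x \<partial>P) = (\<integral>x. indicator A x * real_cond_exp P (F s t') k x \<partial>P)"
proof -
  have [simp]: "s \<le> N" "t' \<le> N" using st by auto
  interpret sigma_finite_subalgebra P "F s t" using sf st by auto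
  have A': "A \<in> sets P" by (rule sets_F[OF _ _ A]) (use st in auto)
  have "(\<integral>x. k x * indicator A x \<partial>P) = (\<integral>x. k x * real_cond_exp P (F s t) (indicator A) x \<partial>P)"
    using A' k by (intro real_cond_exp_intg(2)[symmetric] integrable_real_mult_indicator) auto
  also have "\<dots> = (\<integral>x. real_cond_exp P (F s t') (indicator A) x * k x \<partial>P)"
    using commute[OF st A] k by (intro integral_cong_AE) (auto simp: mult.commute)
  also have "\<dots> = (\<integral>x. indicator A x * real_cond_exp P (F s t') k x \<partial>P)"
    by (rule cond_exp_swap(1)) (use F_subalg A' k in auto)
  finally show ?thesis .
qed

text \<open>The dual of \<open>commute\<close>, obtained by self-adjointness: once \<open>t'\<close>
  coordinates of \<open>Y\<close> and \<open>s\<close> coordinates of \<open>X\<close> are known,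
  further coordinates of \<open>X\<close> say nothing new about a function of \<open>s\<close>
  coordinates of \<open>X\<close> and \<open>t\<close> of \<open>Y\<close>.\<close>

lemma cond_exp_commute1:
  assumes st: "s \<le> s'" "s' \<le> N" "t' \<le> t" "t \<le> N"
    and k: "k \<in> borel_measurable (F s t)" "integrable P k"
  shows "AE x in P. real_cond_exp P (F s' t') k x = real_cond_exp P (F s t') k x"
proof -
  have [simp]: "s \<le> N" "t' \<le> N" using st by auto
  interpret A: sigma_finite_subalgebra P "F s' t'" using sf st by auto
  interpret B: sigma_finite_subalgebra P "F s t'" using sf st by auto
  show ?thesis
  proof (rule A.real_cond_exp_charact)
    show "real_cond_exp P (F s t') k \<in> borel_measurable (F s' t')"
      by (rule meas_F_mono[of s _ t']) (use st in auto)
  next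
    fix A assume "A \<in> sets (F s' t')"
    from commute_indicator_integral[OF st this k]
    show "(\<integral>x\<in>A. k x \<partial>P) = (\<integral>x\<in>A. real_cond_exp P (F s t') k x \<partial>P)"
      by (simp add: set_lebesgue_integral_def mult.commute)
  qed (use k in auto)
qed

text \<open>For \<open>t = 0\<close> the condition says that the first marginal is that of \<open>P\<close>; for \<open>t > 0\<close> it says
  that the path \<open>X\<close> and \<open>Y\<^sub>1, \<dots>, Y\<^sub>t\<close> are conditionally independent given \<open>X\<^sub>1, \<dots>, X\<^sub>t\<close>.\<close>

definition causal_dens :: "('a \<Rightarrow> real) \<Rightarrow> bool" where
  "causal_dens r \<longleftrightarrow> dens P r \<and>
     (\<forall>t<N. AE x in P. real_cond_exp P (F N t) r x = real_cond_exp P (F t t) r x)"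

lemma causal_dens_dens: "causal_dens r \<Longrightarrow> dens P r"
  by (simp add: causal_dens_def)

lemma causal_densD: "causal_dens r \<Longrightarrow> t < N \<Longrightarrow> AE x in P. real_cond_exp P (F N t) r x = real_cond_exp P (F t t) r x"
  by (simp add: causal_dens_def)

lemma causal_cond_linear:
  assumes a: "integrable P a" "AE x in P. real_cond_exp P (F N t) a x = real_cond_exp P (F t t) a x"
    and b: "integrable P b" "AE x in P. real_cond_exp P (F N t) b x = real_cond_exp P (F t t) b x"
    and t: "t \<le> N"
  shows "AE x in P. real_cond_exp P (F N t) (\<lambda>x. c * a x + d * b x) x = real_cond_exp P (F t t) (\<lambda>x. c * a x + d * b x) x"
proof -
  interpret A: sigma_finite_subalgebra P "F N t" using sf t by auto
  interpret B: sigma_finite_subalgebra P "F t t" using sf t by auto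
  have i: "integrable P (\<lambda>x. c * a x)" "integrable P (\<lambda>x. d * b x)" using a b by auto
  show ?thesis
    using a(2) b(2) A.real_cond_exp_add[OF i] B.real_cond_exp_add[OF i]
      A.real_cond_exp_cmult[OF a(1), of c] B.real_cond_exp_cmult[OF a(1), of c]
      A.real_cond_exp_cmult[OF b(1), of d] B.real_cond_exp_cmult[OF b(1), of d]
    by eventually_elim simp
qed

lemma causal_dens_convex:
  assumes "causal_dens a" "causal_dens b" "0 \<le> s" "s \<le> 1"
  shows "causal_dens (\<lambda>x. (1 - s) * a x + s * b x)"
  unfolding causal_dens_def
proof (intro conjI allI impI)
  show "dens P (\<lambda>x. (1 - s) * a x + s * b x)"
    using assms by (intro dens_convex causal_dens_dens)
  fix t assume "t < N"
  then show "AE x in P. real_cond_exp P (F N t) (\<lambda>x. (1 - s) * a x + s * b x) x =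
      real_cond_exp P (F t t) (\<lambda>x. (1 - s) * a x + s * b x) x"
    using assms by (intro causal_cond_linear causal_densD densD(2)[OF causal_dens_dens]) auto
qed

lemma causal_dens_cong:
  assumes "causal_dens a" "AE x in P. a x = b x" "\<And>x. 0 \<le> b x" and b: "b \<in> borel_measurable P"
  shows "causal_dens b"
  unfolding causal_dens_def dens_def
proof (intro conjI allI impI)
  note ia = densD(2)[OF causal_dens_dens[OF assms(1)]]
  show "integrable P b" using ia by (rule Bochner_Integration.integrable_cong_AE_imp) (use assms in auto)
  have "(\<integral>x. b x \<partial>P) = (\<integral>x. a x \<partial>P)" by (rule integral_cong_AE) (use assms ia in auto)
  then show "(\<integral>x. b x \<partial>P) = 1" using densD(3)[OF causal_dens_dens[OF assms(1)]] by simp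
  fix t assume t: "t < N"
  interpret A: sigma_finite_subalgebra P "F N t" using sf t by auto
  interpret B: sigma_finite_subalgebra P "F t t" using sf t by auto
  have am: "a \<in> borel_measurable P" using ia by auto
  show "AE x in P. real_cond_exp P (F N t) b x = real_cond_exp P (F t t) b x"
    using causal_densD[OF assms(1) t] A.real_cond_exp_cong[OF assms(2) am b] B.real_cond_exp_cong[OF assms(2) am b]
    by eventually_elim simp
qed (use assms in auto)

text \<open>Reweighting by a function of \<open>Y\<close> alone keeps the two paths independent:
  projecting to \<open>F N t\<close> leaves a function of \<open>Y\<close> up to \<open>t\<close>,
  which \<open>F t t\<close> already sees. These densities serve as test functions for the
  potentials.\<close>

lemma causal_dens_snd:
  assumes g: "dens P g" "g \<in> borel_measurable (F 0 N)"
  shows "causal_dens g"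
  unfolding causal_dens_def
proof (intro conjI allI impI g(1))
  fix t assume t: "t < N"
  interpret A: sigma_finite_subalgebra P "F N t" using sf t by auto
  interpret B: sigma_finite_subalgebra P "F t t" using sf t by auto
  note ig = densD(2)[OF g(1)]
  let ?e = "real_cond_exp P (F 0 t) g"
  have 1: "AE x in P. real_cond_exp P (F N t) g x = ?e x"
    by (rule cond_exp_commute1) (use t g ig in auto)
  have 2: "AE x in P. real_cond_exp P (F t t) (real_cond_exp P (F N t) g) x = real_cond_exp P (F t t) g x"
    by (rule B.real_cond_exp_nested_subalg) (use t ig F_subalg F_mono in auto)
  have 3: "AE x in P. real_cond_exp P (F t t) (real_cond_exp P (F N t) g) x = real_cond_exp P (F t t) ?e x"
    by (rule B.real_cond_exp_cong[OF 1]) auto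
  interpret C: sigma_finite_subalgebra P "F 0 t" using sf t by auto
  have 4: "AE x in P. real_cond_exp P (F t t) ?e x = ?e x"
    by (rule B.real_cond_exp_F_meas) (use t ig in \<open>auto intro: meas_F_mono[of 0 t t t]\<close>)
  show "AE x in P. real_cond_exp P (F N t) g x = real_cond_exp P (F t t) g x"
    using 1 2 3 4 by eventually_elim simp
qed

lemma causal_dens_one: "causal_dens (\<lambda>_. 1)"
  by (rule causal_dens_snd) (auto simp: dens_def prob_space)

section \<open>The causal projection\<close>

text \<open>Multiplying by \<open>1 + s * w\<close> alters only the conditional law of coordinate
  \<open>t + 1\<close> of \<open>Y\<close> given \<open>F (Suc t) t\<close>, on which causality
  imposes no condition. For \<open>u \<le> t\<close> both projections of \<open>w * a\<close> are 0;
  for \<open>u > t\<close> the factor \<open>w\<close> is known and comes out.\<close>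

lemma causal_perturbation:
  assumes a: "causal_dens a" and t: "t < N"
    and w: "w \<in> borel_measurable (F (Suc t) (Suc t))" "\<And>x. \<bar>w x\<bar> \<le> 1"
    and z: "\<And>A. A \<in> sets (F (Suc t) t) \<Longrightarrow> (\<integral>x. indicator A x * (w x * a x) \<partial>P) = 0"
    and s: "\<bar>s\<bar> \<le> 1"
  shows "causal_dens (\<lambda>x. a x * (1 + s * w x))"
proof -
  note ia = densD(2)[OF causal_dens_dens[OF a]]
  have wP: "w \<in> borel_measurable P" using w(1) meas_F[of "Suc t" "Suc t"] t by auto
  have iw: "integrable P (\<lambda>x. w x * a x)"
    by (rule integrable_bounded_mult[OF ia wP]) (use w in auto)
  have 0: "AE x in P. real_cond_exp P (F (Suc t) t) (\<lambda>x. w x * a x) x = 0"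
  proof -
    interpret sigma_finite_subalgebra P "F (Suc t) t" using sf t by auto
    show ?thesis
      by (rule real_cond_exp_charact) (use iw z in \<open>auto simp: set_lebesgue_integral_def\<close>)
  qed
  \<comment> \<open>The projection stays 0 when the whole path \<open>X\<close> is known: given
    \<open>F N (Suc t)\<close>, causality of \<open>a\<close> leaves a function \<open>k\<close> of
    \<open>t + 1\<close> coordinates, and \<open>cond_exp_commute1\<close> removes the later
    \<open>X\<close>. For \<open>Suc t = N\<close> there is no later \<open>X\<close>.\<close>
  have N0: "AE x in P. real_cond_exp P (F N t) (\<lambda>x. w x * a x) x = 0"
  proof (cases "Suc t = N")
    case True
    then show ?thesis using 0 by simp
  next
    case False
    then have t': "Suc t < N" using t by simp
    interpret A: sigma_finite_subalgebra P "F N t" using sf t by auto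
    interpret B: sigma_finite_subalgebra P "F N (Suc t)" using sf t by auto
    interpret C: sigma_finite_subalgebra P "F (Suc t) (Suc t)" using sf t by auto
    interpret D: sigma_finite_subalgebra P "F (Suc t) t" using sf t by auto
    define k where "k x = w x * real_cond_exp P (F (Suc t) (Suc t)) a x" for x
    have ik: "integrable P k" unfolding k_def
      by (rule integrable_bounded_mult[of P _ w 1]) (use w wP ia in auto)
    have km: "k \<in> borel_measurable (F (Suc t) (Suc t))" unfolding k_def using w(1) by auto
    have wN: "w \<in> borel_measurable (F N (Suc t))"
      using w(1) meas_F_mono[of "Suc t" N "Suc t" "Suc t"] t by auto
    have 1: "AE x in P. real_cond_exp P (F N (Suc t)) (\<lambda>x. w x * a x) x = k x"
      unfolding k_def using B.real_cond_exp_mult[OF wN borel_measurable_integrable[OF ia] iw] causal_densD[OF a t']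
      by eventually_elim simp
    have 2: "AE x in P. real_cond_exp P (F N t) (real_cond_exp P (F N (Suc t)) (\<lambda>x. w x * a x)) x
        = real_cond_exp P (F N t) (\<lambda>x. w x * a x) x"
      by (rule A.real_cond_exp_nested_subalg) (use t iw F_subalg F_mono in auto)
    have 3: "AE x in P. real_cond_exp P (F N t) (real_cond_exp P (F N (Suc t)) (\<lambda>x. w x * a x)) x
        = real_cond_exp P (F N t) k x"
      by (rule A.real_cond_exp_cong[OF 1]) (use ik in auto)
    have 4: "AE x in P. real_cond_exp P (F N t) k x = real_cond_exp P (F (Suc t) t) k x"
      by (rule cond_exp_commute1[of _ _ _ "Suc t"]) (use t ik km in auto)
    have 5: "AE x in P. real_cond_exp P (F (Suc t) t) (real_cond_exp P (F N (Suc t)) (\<lambda>x. w x * a x)) x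
        = real_cond_exp P (F (Suc t) t) (\<lambda>x. w x * a x) x"
      by (rule D.real_cond_exp_nested_subalg) (use t iw F_subalg F_mono in auto)
    have 6: "AE x in P. real_cond_exp P (F (Suc t) t) (real_cond_exp P (F N (Suc t)) (\<lambda>x. w x * a x)) x
        = real_cond_exp P (F (Suc t) t) k x"
      by (rule D.real_cond_exp_cong[OF 1]) (use ik in auto)
    show ?thesis using 0 2 3 4 5 6 by eventually_elim simp
  qed
  have c: "AE x in P. real_cond_exp P (F N u) (\<lambda>x. w x * a x) x = real_cond_exp P (F u u) (\<lambda>x. w x * a x) x"
    if u: "u < N" for u
  proof (cases "u \<le> t")
    case True
    have "AE x in P. real_cond_exp P (F N u) (\<lambda>x. w x * a x) x = 0"
      by (rule cond_exp_zero_subalg[OF _ _ iw N0]) (use True t F_subalg F_mono in auto)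
    moreover have "AE x in P. real_cond_exp P (F u u) (\<lambda>x. w x * a x) x = 0"
      by (rule cond_exp_zero_subalg[OF _ _ iw N0]) (use True t F_subalg F_mono in auto)
    ultimately show ?thesis by eventually_elim simp
  next
    case False
    interpret A: sigma_finite_subalgebra P "F N u" using sf u by auto
    interpret B: sigma_finite_subalgebra P "F u u" using sf u by auto
    have m: "w \<in> borel_measurable (F N u)" "w \<in> borel_measurable (F u u)"
      by (rule meas_F_mono[OF _ _ _ _ w(1)]; use False u in simp)+
    show ?thesis
      using A.real_cond_exp_mult[OF m(1) borel_measurable_integrable[OF ia] iw]
        B.real_cond_exp_mult[OF m(2) borel_measurable_integrable[OF ia] iw] causal_densD[OF a u]
      by eventually_elim simp
  qed
  have e: "(\<lambda>x. a x * (1 + s * w x)) = (\<lambda>x. 1 * a x + s * (w x * a x))"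
    by (auto simp: algebra_simps)
  have "(\<integral>x. w x * a x \<partial>P) = 0"
  proof -
    have sp: "space P \<in> sets (F (Suc t) t)" using F_subalg[of "Suc t" t] t by (metis Suc_leI less_imp_le subalgebra_def sets.top)
    have "(\<integral>x. w x * a x \<partial>P) = (\<integral>x. indicator (space P) x * (w x * a x) \<partial>P)"
      by (intro Bochner_Integration.integral_cong) auto
    then show ?thesis using z[OF sp] by simp
  qed
  then have i1: "(\<integral>x. 1 * a x + s * (w x * a x) \<partial>P) = 1"
    using ia iw densD(3)[OF causal_dens_dens[OF a]] by simp
  have nn: "0 \<le> a x * (1 + s * w x)" for x
  proof -
    have "\<bar>s * w x\<bar> \<le> 1 * 1" unfolding abs_mult using s w(2)[of x] by (intro mult_mono) auto
    then show ?thesis using densD(1)[OF causal_dens_dens[OF a], of x] by (intro mult_nonneg_nonneg) auto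
  qed
  have "dens P (\<lambda>x. 1 * a x + s * (w x * a x))"
    unfolding dens_def using nn[unfolded fun_cong[OF e]] ia iw i1 by auto
  then show ?thesis
    unfolding causal_dens_def e using causal_cond_linear[OF ia causal_densD[OF a] iw c, of _ 1 s] by auto
qed


text \<open>First variation of the entropy in the directions of \<open>causal_perturbation\<close>.
  Both signs of \<open>s\<close> are admissible, which turns the variational inequality into an
  equation.\<close>

lemma causal_projection_orthogonal:
  assumes q: "dens P q" "\<And>x. q x > 0"
    and a: "causal_dens a" "\<And>x. a x > 0" and fin: "kl_integrable P a q"
    and min: "\<And>r. causal_dens r \<Longrightarrow> kl P a q \<le> kl P r q"
    and t: "t < N"
    and w: "w \<in> borel_measurable (F (Suc t) (Suc t))" "\<And>x. \<bar>w x\<bar> \<le> 1"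
    and z: "\<And>A. A \<in> sets (F (Suc t) t) \<Longrightarrow> (\<integral>x. indicator A x * (w x * a x) \<partial>P) = 0"
  shows "(\<integral>x. a x * (w x * ln (a x / q x)) \<partial>P) = 0"
proof -
  have [measurable]: "w \<in> borel_measurable P" "a \<in> borel_measurable P" "q \<in> borel_measurable P"
    using w(1) meas_F[of "Suc t" "Suc t"] t densD(4)[OF causal_dens_dens[OF a(1)]] densD(4)[OF q(1)] by auto
  note da = causal_dens_dens[OF a(1)]
  have iw: "integrable P (\<lambda>x. a x * (w x * ln (a x / q x)))"
    using integrable_bounded_mult[of P "\<lambda>x. a x * ln (a x / q x)" w 1] fin w(2)
    unfolding kl_integrable_def by (simp add: mult_ac)
  have iww: "integrable P (\<lambda>x. a x * (w x)\<^sup>2)"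
    using integrable_bounded_mult[OF densD(2)[OF da], of "\<lambda>x. (w x)\<^sup>2" 1] w(2)
    by (simp add: mult_ac abs_square_le_1)
  have iw1: "integrable P (\<lambda>x. a x * w x)"
    using integrable_bounded_mult[OF densD(2)[OF da], of w 1] w(2) by (simp add: mult_ac)
  have w0: "(\<integral>x. a x * w x \<partial>P) = 0"
  proof -
    have sp: "space P \<in> sets (F (Suc t) t)"
      using F_subalg[of "Suc t" t] t by (metis Suc_leI less_imp_le subalgebra_def sets.top)
    have "(\<integral>x. a x * w x \<partial>P) = (\<integral>x. indicator (space P) x * (w x * a x) \<partial>P)"
      by (intro Bochner_Integration.integral_cong) auto
    then show ?thesis using z[OF sp] by simp
  qed
  let ?I = "\<integral>x. a x * (w x * ln (a x / q x)) \<partial>P"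
  \<comment> \<open>\<open>\<bar>s\<bar> \<le> 1/2\<close> keeps \<open>1 + s * w\<close> at least
    1/2, so its logarithm is bounded. The linear term of the remainder vanishes because
    \<open>w\<close> has mean 0 under \<open>a\<close>, leaving at most \<open>s^2\<close>.\<close>
  have b: "0 \<le> s * ?I + s\<^sup>2" if s: "\<bar>s\<bar> \<le> 1/2" for s
  proof -
    let ?b = "\<lambda>x. a x * (1 + s * w x)"
    have s1: "\<bar>s\<bar> \<le> 1" using s by simp
    have cb: "causal_dens ?b" by (rule causal_perturbation[OF a(1) t w z s1])
    have sw: "1 + s * w x > 0" for x
    proof -
      have "\<bar>s * w x\<bar> \<le> 1/2 * 1" unfolding abs_mult using s w(2)[of x] by (intro mult_mono) auto
      then show ?thesis by linarith
    qed
    have eq: "?b x * ln (?b x / q x) = a x * ln (a x / q x) + s * (a x * (w x * ln (a x / q x))) + ?b x * ln (1 + s * w x)" for x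
    proof -
      have "ln (?b x / q x) = ln (a x / q x) + ln (1 + s * w x)"
        using a(2)[of x] q(2)[of x] sw[of x] by (simp add: ln_div ln_mult)
      then show ?thesis by (simp add: algebra_simps)
    qed
    have le: "?b x * ln (1 + s * w x) \<le> s * (a x * w x) + s\<^sup>2 * (a x * (w x)\<^sup>2)" for x
    proof -
      have "ln (1 + s * w x) \<le> s * w x" using ln_le_minus_one[OF sw[of x]] by simp
      then have "?b x * ln (1 + s * w x) \<le> ?b x * (s * w x)"
        using a(2)[of x] sw[of x] by (intro mult_left_mono) (auto intro: less_imp_le)
      then show ?thesis by (simp add: algebra_simps power2_eq_square)
    qed
    have ib: "integrable P (\<lambda>x. ?b x * ln (1 + s * w x))"
    proof -
      have "integrable P (\<lambda>x. ((1 + s * w x) * ln (1 + s * w x)) * a x)"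
      proof (rule integrable_bounded_mult[OF densD(2)[OF da]])
        show "AE x in P. \<bar>(1 + s * w x) * ln (1 + s * w x)\<bar> \<le> 3"
        proof (intro AE_I2)
          fix x
          have h: "\<bar>s * w x\<bar> \<le> 1/2 * 1" unfolding abs_mult using s w(2)[of x] by (intro mult_mono) auto
          have "ln (1 + s * w x) \<le> s * w x" using ln_le_minus_one[OF sw[of x]] by simp
          moreover have "- ln (1 + s * w x) \<le> 1 / (1 + s * w x) - 1"
            using ln_le_minus_one[of "1 / (1 + s * w x)"] sw[of x] by (simp add: ln_div)
          moreover have "1 / (1 + s * w x) \<le> 2"
          proof -
            have "1/2 \<le> 1 + s * w x" using h by linarith
            then have "1 / (1 + s * w x) \<le> 1 / (1/2)" by (intro divide_left_mono) auto
            then show ?thesis by simp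
          qed
          ultimately have "\<bar>ln (1 + s * w x)\<bar> \<le> 1" using h by linarith
          then have "\<bar>1 + s * w x\<bar> * \<bar>ln (1 + s * w x)\<bar> \<le> 3 * 1" using h by (intro mult_mono) auto
          then show "\<bar>(1 + s * w x) * ln (1 + s * w x)\<bar> \<le> 3" by (simp add: abs_mult)
        qed
      qed measurable
      then show ?thesis by (simp add: mult_ac)
    qed
    have kb: "kl_integrable P ?b q"
      unfolding kl_integrable_def eq using fin iw ib unfolding kl_integrable_def by simp
    have "ennreal (KL P a q) \<le> ennreal (KL P ?b q)"
      using min[OF cb] kl_fun_integral(3)[OF da q fin] kl_fun_integral(3)[OF causal_dens_dens[OF cb] q kb] by simp
    then have "KL P a q \<le> KL P ?b q"
      using kl_fun_integral(4)[OF causal_dens_dens[OF cb] q kb] by (simp add: ennreal_le_iff)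
    also have "KL P ?b q = KL P a q + s * ?I + (\<integral>x. ?b x * ln (1 + s * w x) \<partial>P)"
      unfolding KL_def eq using fin iw ib unfolding kl_integrable_def by simp
    also have "(\<integral>x. ?b x * ln (1 + s * w x) \<partial>P) \<le> (\<integral>x. s * (a x * w x) + s\<^sup>2 * (a x * (w x)\<^sup>2) \<partial>P)"
      using ib iw1 iww le by (intro integral_mono) auto
    also have "\<dots> = s\<^sup>2 * (\<integral>x. a x * (w x)\<^sup>2 \<partial>P)" using iw1 iww w0 by simp
    also have "\<dots> \<le> s\<^sup>2 * (\<integral>x. a x \<partial>P)"
      using iww densD[OF da] w(2)
      by (intro mult_left_mono integral_mono) (auto simp: abs_square_le_1 mult_left_le)
    finally show ?thesis using densD(3)[OF da] by simp
  qed
  show ?thesis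
  proof (rule ccontr)
    assume n: "?I \<noteq> 0"
    \<comment> \<open>Sign opposite to the integral and size at most half of it, so that the linear
      term beats the square.\<close>
    define s where "s = - sgn ?I * min (1/2) (\<bar>?I\<bar> / 2)"
    have m: "0 < min (1/2) (\<bar>?I\<bar> / 2)" using n by simp
    have "\<bar>s\<bar> = min (1/2) (\<bar>?I\<bar> / 2)" unfolding s_def using n by (simp add: abs_mult abs_sgn_eq)
    then have 1: "\<bar>s\<bar> \<le> 1/2" "\<bar>s\<bar> \<le> \<bar>?I\<bar> / 2" "\<bar>s\<bar> > 0" using m by auto
    have "s * ?I = - (\<bar>s\<bar> * \<bar>?I\<bar>)"
      unfolding s_def using m n by (auto simp: abs_mult sgn_if)
    then have "0 \<le> - (\<bar>s\<bar> * \<bar>?I\<bar>) + \<bar>s\<bar> * \<bar>s\<bar>" using b[OF 1(1)] by (simp add: power2_eq_square)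
    then have "\<bar>s\<bar> * \<bar>?I\<bar> \<le> \<bar>s\<bar> * \<bar>s\<bar>" by simp
    then have "\<bar>?I\<bar> \<le> \<bar>s\<bar>" by (rule mult_left_le_imp_le[OF _ 1(3)])
    then show False using 1 n by simp
  qed
qed

text \<open>Under the measure with density \<open>a\<close>, revealing a coordinate of
  \<open>Y\<close> does not change the projection of \<open>ln (a / q)\<close>, by the orthogonality
  just shown, and revealing a coordinate of \<open>X\<close> does not change that of
  \<open>r / a\<close>, by causality of both densities. The two kinds of steps alternate, which is
  what \<open>conditional_law_chain\<close> needs to equate the means under \<open>a\<close> and
  \<open>r\<close>.\<close>

lemma causal_projection_equality:
  assumes q: "dens P q" "\<And>x. q x > 0"
    and a: "causal_dens a" "\<And>x. a x > 0" and fin: "kl_integrable P a q"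
    and min: "\<And>r. causal_dens r \<Longrightarrow> kl P a q \<le> kl P r q"
    and r: "causal_dens r" "kl_integrable P r a"
  shows "integrable P (\<lambda>x. r x * ln (a x / q x))" "(\<integral>x. r x * ln (a x / q x) \<partial>P) = KL P a q"
proof -
  note da = causal_dens_dens[OF a(1)] and dr = causal_dens_dens[OF r(1)]
  have [measurable]: "a \<in> borel_measurable P" "q \<in> borel_measurable P" "r \<in> borel_measurable P"
    using densD(4)[OF da] densD(4)[OF q(1)] densD(4)[OF dr] by auto
  have r0: "0 \<le> r x" for x using densD(1)[OF dr] .
  have a0[simp]: "a x \<noteq> 0" for x using a(2)[of x] by simp
  define M where "M = density P (\<lambda>x. ennreal (a x))"
  have sM[simp]: "sets M = sets P" "space M = space P" by (auto simp: M_def)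
  have M_int: "integrable M f \<longleftrightarrow> integrable P (\<lambda>x. a x * f x)" "(\<integral>x. f x \<partial>M) = (\<integral>x. a x * f x \<partial>P)"
    if "f \<in> borel_measurable P" for f :: "'a \<Rightarrow> real"
    unfolding M_def using that a(2)
    by (subst integrable_density integral_density; auto intro: less_imp_le)+
  have M_nn: "(\<integral>\<^sup>+x. f x \<partial>M) = (\<integral>\<^sup>+x. ennreal (a x) * f x \<partial>P)" if "f \<in> borel_measurable P" for f
    unfolding M_def using that by (intro nn_integral_density) auto
  have pM: "prob_space M"
  proof (rule prob_spaceI)
    have "emeasure M (space M) = (\<integral>\<^sup>+x. ennreal (a x) \<partial>P)"
      unfolding M_def by (subst emeasure_density) (auto intro!: nn_integral_cong simp: indicator_def)
    also have "\<dots> = ennreal (\<integral>x. a x \<partial>P)"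
      using densD[OF da] by (intro nn_integral_eq_integral) auto
    finally show "emeasure M (space M) = 1" using densD(3)[OF da] by simp
  qed
  interpret M: prob_space M by (rule pM)
  have Msub: "subalgebra M (F s t)" if "s \<le> N" "t \<le> N" for s t
    using F_subalg[OF that] by (auto simp: subalgebra_def)
  have AE_M: "(AE x in M. Q x) \<longleftrightarrow> (AE x in P. Q x)" for Q
    unfolding M_def by (subst AE_density) (auto simp: a(2))
  let ?Z = "\<lambda>x. r x / a x" and ?a = "\<lambda>x. ln (a x / q x)"
  have aZ: "a x * (r x / a x) = r x" "a x * (f * (r x / a x)) = f * r x" for x f using a(2)[of x] by auto
  have iZ: "integrable M ?Z" and Z1: "(\<integral>x. ?Z x \<partial>M) = 1"
    using densD[OF dr] by (auto simp: M_int aZ)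
  have Z0: "0 \<le> ?Z x" for x using r0 a(2)[of x] by simp
  have ia: "integrable M ?a" and ia_eq: "(\<integral>x. ?a x \<partial>M) = KL P a q"
    using fin by (auto simp: M_int kl_integrable_def KL_def)
  \<comment> \<open>Bayes' formula: projections under \<open>M\<close> are quotients of projections
    of \<open>r\<close> and \<open>a\<close> under \<open>P\<close>, and neither of these changes
    between \<open>F N t\<close> and \<open>F t t\<close>.\<close>
  have cZ: "AE x in M. real_cond_exp M (F N t) ?Z x = real_cond_exp M (F t t) ?Z x" if t: "t < N" for t
  proof -
    interpret MN: sigma_finite_subalgebra M "F N t" using M.sigma_finite_subalgebraI[OF Msub] t by auto
    interpret Mt: sigma_finite_subalgebra M "F t t" using M.sigma_finite_subalgebraI[OF Msub] t by auto
    interpret PN: sigma_finite_subalgebra P "F N t" using sf t by auto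
    interpret Pt: sigma_finite_subalgebra P "F t t" using sf t by auto
    define \<zeta> where "\<zeta> = real_cond_exp M (F t t) ?Z"
    have \<zeta>m: "\<zeta> \<in> borel_measurable (F t t)" and \<zeta>M[measurable]: "\<zeta> \<in> borel_measurable P" and i\<zeta>: "integrable M \<zeta>"
      unfolding \<zeta>_def using iZ t by (auto intro: meas_F[of t t])
    have \<zeta>N: "\<zeta> \<in> borel_measurable (F N t)" using \<zeta>m meas_F_mono[of t N t t] t by auto
    have i\<zeta>a: "integrable P (\<lambda>x. \<zeta> x * a x)" using i\<zeta> by (simp add: M_int mult.commute)
    have i1: "integrable P (\<lambda>x. indicator A x * (\<zeta> x * a x))" if "A \<in> sets P" for A
      using i\<zeta>a that by (simp add: integrable_mult_indicator[where 'b=real, simplified])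
    have e1: "AE x in P. real_cond_exp P (F t t) (\<lambda>x. \<zeta> x * a x) x = real_cond_exp P (F t t) r x"
    proof (rule Pt.real_cond_exp_charact)
      fix B assume B: "B \<in> sets (F t t)"
      then have BP[measurable]: "B \<in> sets P" using sets_F[of t t] t by auto
      have "(\<integral>x\<in>B. \<zeta> x * a x \<partial>P) = (\<integral>x. indicator B x * \<zeta> x \<partial>M)"
        by (subst M_int) (auto simp: set_lebesgue_integral_def mult_ac)
      also have "\<dots> = (\<integral>x\<in>B. real_cond_exp M (F t t) ?Z x \<partial>M)" by (simp add: set_lebesgue_integral_def \<zeta>_def)
      also have "\<dots> = (\<integral>x\<in>B. ?Z x \<partial>M)" by (rule Mt.real_cond_exp_intA[OF iZ B, symmetric])
      also have "\<dots> = (\<integral>x\<in>B. r x \<partial>P)" by (simp add: set_lebesgue_integral_def M_int aZ)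
      also have "\<dots> = (\<integral>x\<in>B. real_cond_exp P (F t t) r x \<partial>P)"
        by (rule Pt.real_cond_exp_intA[OF densD(2)[OF dr] B])
      finally show "(\<integral>x\<in>B. \<zeta> x * a x \<partial>P) = (\<integral>x\<in>B. real_cond_exp P (F t t) r x \<partial>P)" .
    qed (use i\<zeta>a densD(2)[OF dr] in auto)
    have e2: "AE x in P. \<zeta> x * real_cond_exp P (F N t) a x = real_cond_exp P (F N t) r x"
      using e1 Pt.real_cond_exp_mult[OF \<zeta>m \<open>a \<in> borel_measurable P\<close> i\<zeta>a] causal_densD[OF a(1) t] causal_densD[OF r(1) t]
      by eventually_elim simp
    show ?thesis
      unfolding \<zeta>_def[symmetric]
    proof (rule MN.real_cond_exp_charact[OF _ iZ i\<zeta> \<zeta>N])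
      fix A assume A: "A \<in> sets (F N t)"
      then have AP[measurable]: "A \<in> sets P" using sets_F[of N t] t by auto
      have "(\<integral>x\<in>A. \<zeta> x \<partial>M) = (\<integral>x. (indicator A x * \<zeta> x) * a x \<partial>P)"
        by (simp add: set_lebesgue_integral_def M_int mult_ac)
      also have "\<dots> = (\<integral>x. (indicator A x * \<zeta> x) * real_cond_exp P (F N t) a x \<partial>P)"
        using A \<zeta>N i1[OF AP] by (intro PN.real_cond_exp_intg(2)[symmetric]) (auto simp: mult_ac)
      also have "\<dots> = (\<integral>x. indicator A x * real_cond_exp P (F N t) r x \<partial>P)"
        using e2 by (intro integral_cong_AE) (auto simp: mult_ac)
      also have "\<dots> = (\<integral>x\<in>A. r x \<partial>P)"
        using PN.real_cond_exp_intA[OF densD(2)[OF dr] A] by (simp add: set_lebesgue_integral_def)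
      also have "\<dots> = (\<integral>x\<in>A. ?Z x \<partial>M)" by (simp add: set_lebesgue_integral_def M_int aZ)
      finally show "(\<integral>x\<in>A. ?Z x \<partial>M) = (\<integral>x\<in>A. \<zeta> x \<partial>M)" by simp
    qed
  qed
  have cZ': "AE x in M. real_cond_exp M (F (Suc t) t) ?Z x = real_cond_exp M (F t t) ?Z x" if t: "t < N" for t
  proof -
    interpret MH: sigma_finite_subalgebra M "F (Suc t) t" using M.sigma_finite_subalgebraI[OF Msub] t by auto
    interpret Mt: sigma_finite_subalgebra M "F t t" using M.sigma_finite_subalgebraI[OF Msub] t by auto
    let ?e = "real_cond_exp M (F t t) ?Z"
    have 1: "AE x in M. real_cond_exp M (F (Suc t) t) (real_cond_exp M (F N t) ?Z) x = real_cond_exp M (F (Suc t) t) ?Z x"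
      by (rule MH.real_cond_exp_nested_subalg) (use t Msub F_mono iZ in auto)
    have 2: "AE x in M. real_cond_exp M (F (Suc t) t) (real_cond_exp M (F N t) ?Z) x = real_cond_exp M (F (Suc t) t) ?e x"
      by (rule MH.real_cond_exp_cong[OF cZ[OF t]]) auto
    have 3: "AE x in M. real_cond_exp M (F (Suc t) t) ?e x = ?e x"
      by (rule MH.real_cond_exp_F_meas) (use t iZ in \<open>auto intro: meas_F_mono[of t "Suc t" t t]\<close>)
    show ?thesis using 1 2 3 by eventually_elim simp
  qed
  have d: "AE x in M. real_cond_exp M (F (Suc t) (Suc t)) ?a x = real_cond_exp M (F (Suc t) t) ?a x" if t: "t < N" for t
  proof -
    interpret MS: sigma_finite_subalgebra M "F (Suc t) (Suc t)" using M.sigma_finite_subalgebraI[OF Msub] t by auto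
    interpret MH: sigma_finite_subalgebra M "F (Suc t) t" using M.sigma_finite_subalgebraI[OF Msub] t by auto
    have sH: "subalgebra M (F (Suc t) t)" using Msub t by auto
    show ?thesis
    proof (rule MS.real_cond_exp_charact)
      show "real_cond_exp M (F (Suc t) t) ?a \<in> borel_measurable (F (Suc t) (Suc t))"
        by (rule meas_F_mono[of "Suc t" "Suc t" t]) (use t in auto)
      fix B assume B: "B \<in> sets (F (Suc t) (Suc t))"
      then have BP[measurable]: "B \<in> sets P" and BM: "B \<in> sets M" using sets_F[of "Suc t" "Suc t"] t by auto
      have iB: "integrable M (indicator B :: _ \<Rightarrow> real)" using BM by (simp add: integrable_real_indicator M.emeasure_eq_measure)
      let ?e = "real_cond_exp M (F (Suc t) t) (indicator B)"
      \<comment> \<open>Clamped to [0,1] at every point: \<open>causal_projection_orthogonal\<close>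
        asks for \<open>\<bar>w\<bar> \<le> 1\<close> everywhere, and a version of the conditional
        probability obeys its bounds only almost everywhere.\<close>
      define h where "h x = max 0 (min 1 (?e x))" for x
      have hm: "h \<in> borel_measurable (F (Suc t) t)" unfolding h_def by measurable
      have hP[measurable]: "h \<in> borel_measurable P" using hm meas_F[of "Suc t" t] t by auto
      have hS: "h \<in> borel_measurable (F (Suc t) (Suc t))"
        using hm meas_F_mono[of "Suc t" "Suc t" t "Suc t"] t by auto
      have h01: "0 \<le> h x" "h x \<le> 1" for x by (auto simp: h_def)
      have he: "AE x in M. h x = ?e x"
        using M.cond_exp_indicator_bounds(1,2)[OF sH BM] by eventually_elim (simp add: h_def)
      let ?w = "\<lambda>x. indicator B x - h x"
      have wb: "\<bar>?w x\<bar> \<le> 1" for x using h01[of x] by (auto simp: indicator_def)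
      have hM[measurable]: "h \<in> borel_measurable M" unfolding h_def by measurable
      have ih: "integrable M h" by (rule M.integrable_const_bound[of _ 1]) (use h01 in auto)
      have "(\<integral>x. a x * (?w x * ?a x) \<partial>P) = 0"
      proof (rule causal_projection_orthogonal[OF q a fin min t _ wb])
        show "?w \<in> borel_measurable (F (Suc t) (Suc t))" using B hS by auto
        fix A assume A: "A \<in> sets (F (Suc t) t)"
        then have AP[measurable]: "A \<in> sets P" and AM[measurable]: "A \<in> sets M" using sets_F[of "Suc t" t] t by auto
        have "(\<integral>x. indicator A x * (?w x * a x) \<partial>P) = (\<integral>x. indicator A x * indicator B x - indicator A x * h x \<partial>M)"
          by (subst M_int) (auto simp: algebra_simps)
        also have "\<dots> = (\<integral>x. indicator A x * indicator B x \<partial>M) - (\<integral>x. indicator A x * h x \<partial>M)"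
          using iB ih by (intro Bochner_Integration.integral_diff integrable_mult_indicator[where 'b=real, simplified]) auto
        also have "(\<integral>x. indicator A x * h x \<partial>M) = (\<integral>x. indicator A x * ?e x \<partial>M)"
          using he by (intro integral_cong_AE) auto
        also have "\<dots> = (\<integral>x. indicator A x * indicator B x \<partial>M)"
          using MH.real_cond_exp_intA[OF iB A] by (simp add: set_lebesgue_integral_def)
        finally show "(\<integral>x. indicator A x * (?w x * a x) \<partial>P) = 0" by simp
      qed auto
      then have "(\<integral>x. indicator B x * ?a x - h x * ?a x \<partial>M) = 0"
        by (subst M_int) (auto simp: algebra_simps)
      moreover have "integrable M (\<lambda>x. h x * ?a x)"
        by (rule integrable_bounded_mult[OF ia, where c=1]) (use h01 in \<open>auto simp: abs_of_nonneg\<close>)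
      ultimately have "(\<integral>x. indicator B x * ?a x \<partial>M) = (\<integral>x. h x * ?a x \<partial>M)"
        using ia BM by (subst (asm) Bochner_Integration.integral_diff) (auto intro!: integrable_mult_indicator[where 'b=real, simplified])
      also have "\<dots> = (\<integral>x. ?e x * ?a x \<partial>M)"
        using he borel_measurable_integrable[OF ia] by (intro integral_cong_AE) auto
      also have "\<dots> = (\<integral>x. indicator B x * real_cond_exp M (F (Suc t) t) ?a x \<partial>M)"
        by (rule M.cond_exp_swap(1)[OF sH BM ia])
      finally show "(\<integral>x\<in>B. ?a x \<partial>M) = (\<integral>x\<in>B. real_cond_exp M (F (Suc t) t) ?a x \<partial>M)"
        by (simp add: set_lebesgue_integral_def)
    qed (use ia in auto)
  qed
  \<comment> \<open>Young's inequality with \<open>h\<close> the negative part of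
    \<open>ln (a / q)\<close>: where \<open>h > 0\<close>, \<open>a * exp h = q\<close>, whose
    integral is 1.\<close>
  have neg: "(\<integral>\<^sup>+x. ennreal (- ?a x) * ennreal (?Z x) \<partial>M) < \<infinity>"
  proof -
    have "(\<integral>\<^sup>+x. ennreal (- ?a x) * ennreal (?Z x) \<partial>M) = (\<integral>\<^sup>+x. ennreal (a x) * (ennreal (- ?a x) * ennreal (?Z x)) \<partial>P)"
      by (rule M_nn) measurable
    also have "\<dots> \<le> (\<integral>\<^sup>+x. ennreal (kl_fun (r x) (a x)) + ennreal (q x) \<partial>P)"
    proof (rule nn_integral_mono)
      fix x
      let ?h = "max 0 (- ?a x)"
      have k0: "0 \<le> kl_fun (r x) (a x)" using kl_fun_nonneg r0 a(2) by blast
      have "ennreal (a x) * (ennreal (- ?a x) * ennreal (?Z x)) = ennreal (a x) * (ennreal ?h * ennreal (?Z x))"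
        by (auto simp: max_def ennreal_neg)
      also have "\<dots> = ennreal (r x * ?h)"
      proof -
        have h0: "0 \<le> ?h" by simp
        have "ennreal (a x) * (ennreal ?h * ennreal (?Z x)) = ennreal (a x * (?h * ?Z x))"
          unfolding ennreal_mult[OF h0 Z0[of x], symmetric]
          by (rule ennreal_mult[symmetric, OF less_imp_le[OF a(2)] mult_nonneg_nonneg[OF h0 Z0[of x]]])
        then show ?thesis by (simp add: aZ mult.commute)
      qed
      also have "\<dots> \<le> ennreal (kl_fun (r x) (a x) + q x)"
      proof (rule ennreal_leI)
        have "r x * ?h \<le> kl_fun (r x) (a x) + a x * (exp ?h - 1)" using r0 a(2) by (rule kl_fun_young)
        also have "a x * (exp ?h - 1) \<le> q x"
        proof (cases "- ?a x \<ge> 0")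
          case True
          then have "exp ?h = q x / a x"
            using a(2)[of x] q(2)[of x] by (simp add: exp_minus max_def)
          then show ?thesis using a(2)[of x] q(2)[of x] by (simp add: field_simps)
        next
          case False
          then show ?thesis using q(2)[of x] by simp
        qed
        finally show "r x * ?h \<le> kl_fun (r x) (a x) + q x" by simp
      qed
      also have "\<dots> = ennreal (kl_fun (r x) (a x)) + ennreal (q x)"
        using k0 q(2)[of x] by (simp add: less_imp_le)
      finally show "ennreal (a x) * (ennreal (- ?a x) * ennreal (?Z x)) \<le> ennreal (kl_fun (r x) (a x)) + ennreal (q x)" .
    qed
    also have "\<dots> = kl P r a + (\<integral>\<^sup>+x. ennreal (q x) \<partial>P)" unfolding kl_def by (rule nn_integral_add) auto
    also have "(\<integral>\<^sup>+x. ennreal (q x) \<partial>P) = ennreal 1"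
      using densD[OF q(1)] by (subst nn_integral_eq_integral) auto
    also have "kl P r a + ennreal 1 < \<infinity>"
      using r(2) kl_less_top_iff[OF dr da a(2)] by simp
    finally show ?thesis .
  qed
  have chain: "integrable M (\<lambda>x. ?a x * ?Z x)" "(\<integral>x. ?a x * ?Z x \<partial>M) = (\<integral>x. ?a x \<partial>M)"
    by (rule M.conditional_law_chain[where n=N and G="\<lambda>t. F t t" and H="\<lambda>t. F (Suc t) t", OF _ _ _ _ iZ Z0 Z1 cZ' ia d _ neg];
        use Msub F_mono F_full F_trivial in auto)+
  show "integrable P (\<lambda>x. r x * ln (a x / q x))"
    using chain(1) by (subst (asm) M_int) (auto simp: aZ mult.commute)
  show "(\<integral>x. r x * ln (a x / q x) \<partial>P) = KL P a q"
    using chain(2) unfolding ia_eq by (subst (asm) M_int) (auto simp: aZ mult.commute)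
qed

end

section \<open>Sinkhorn iterates as densities\<close>

context causal_filtration
begin

text \<open>\<open>\<phi>\<close> is the density of the second marginal of \<open>r\<close>. When an integral does not exist, both sides
  are 0.\<close>

definition marginal :: "('a \<Rightarrow> real) \<Rightarrow> ('a \<Rightarrow> real) \<Rightarrow> bool" where
  "marginal r \<phi> \<longleftrightarrow> (\<forall>h\<in>borel_measurable (F 0 N).
     (integrable P (\<lambda>x. h x * r x) \<longleftrightarrow> integrable P (\<lambda>x. h x * \<phi> x)) \<and>
     (\<integral>x. h x * r x \<partial>P) = (\<integral>x. h x * \<phi> x \<partial>P))"

lemma marginalD:
  assumes "marginal r \<phi>" "h \<in> borel_measurable (F 0 N)"
  shows "integrable P (\<lambda>x. h x * r x) \<longleftrightarrow> integrable P (\<lambda>x. h x * \<phi> x)"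
    "(\<integral>x. h x * r x \<partial>P) = (\<integral>x. h x * \<phi> x \<partial>P)"
  using assms unfolding marginal_def by auto

lemma cond_density_integral:
  fixes h :: "'a \<Rightarrow> real"
  assumes st: "s \<le> N" "t \<le> N" and r: "dens P r"
    and \<phi>: "\<phi> \<in> borel_measurable (F s t)" "\<And>x. 0 \<le> \<phi> x"
    and e: "AE x in P. real_cond_exp P (F s t) r x = \<phi> x"
    and h: "h \<in> borel_measurable (F s t)"
  shows "integrable P (\<lambda>x. h x * r x) \<longleftrightarrow> integrable P (\<lambda>x. h x * \<phi> x)"
    "(\<integral>x. h x * r x \<partial>P) = (\<integral>x. h x * \<phi> x \<partial>P)"
proof -
  interpret Y: sigma_finite_subalgebra P "F s t" using sf st by auto
  have [measurable]: "h \<in> borel_measurable P" "\<phi> \<in> borel_measurable P" "r \<in> borel_measurable P"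
    using h \<phi> meas_F[OF st] densD(4)[OF r] by auto
  have r0: "0 \<le> r x" for x using densD(1)[OF r] .
  have "(\<integral>\<^sup>+x. ennreal (norm (h x * r x)) \<partial>P) = (\<integral>\<^sup>+x. ennreal \<bar>h x\<bar> * ennreal (r x) \<partial>P)"
    using r0 by (intro nn_integral_cong) (simp add: abs_mult ennreal_mult)
  also have "\<dots> = (\<integral>\<^sup>+x. ennreal \<bar>h x\<bar> * nn_cond_exp P (F s t) (\<lambda>x. ennreal (r x)) x \<partial>P)"
    using h by (intro Y.nn_cond_exp_intg[symmetric]) auto
  also have "\<dots> = (\<integral>\<^sup>+x. ennreal (norm (h x * \<phi> x)) \<partial>P)"
  proof (rule nn_integral_cong_AE)
    show "AE x in P. ennreal \<bar>h x\<bar> * nn_cond_exp P (F s t) (\<lambda>x. ennreal (r x)) x = ennreal (norm (h x * \<phi> x))"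
      using nn_cond_exp_eq_real[OF F_subalg[OF st] densD(2)[OF r] r0] e
      by eventually_elim (simp add: abs_mult ennreal_mult \<phi>)
  qed
  finally have n: "(\<integral>\<^sup>+x. ennreal (norm (h x * r x)) \<partial>P) = (\<integral>\<^sup>+x. ennreal (norm (h x * \<phi> x)) \<partial>P)" .
  show i: "integrable P (\<lambda>x. h x * r x) \<longleftrightarrow> integrable P (\<lambda>x. h x * \<phi> x)"
    unfolding integrable_iff_bounded n by simp
  show "(\<integral>x. h x * r x \<partial>P) = (\<integral>x. h x * \<phi> x \<partial>P)"
  proof (cases "integrable P (\<lambda>x. h x * r x)")
    case True
    have "(\<integral>x. h x * r x \<partial>P) = (\<integral>x. h x * real_cond_exp P (F s t) r x \<partial>P)"
      using h by (intro Y.real_cond_exp_intg(2)[symmetric] True) auto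
    also have "\<dots> = (\<integral>x. h x * \<phi> x \<partial>P)" using e by (intro integral_cong_AE) auto
    finally show ?thesis .
  next
    case False
    then show ?thesis using i by (simp add: not_integrable_integral_eq)
  qed
qed

lemma marginalI:
  assumes r: "dens P r" and \<phi>: "\<phi> \<in> borel_measurable (F 0 N)" "\<And>x. 0 \<le> \<phi> x"
    and e: "AE x in P. real_cond_exp P (F 0 N) r x = \<phi> x"
  shows "marginal r \<phi>"
  unfolding marginal_def using cond_density_integral[OF _ _ r \<phi> e] by simp

end

text \<open>The facts about the iterates that convergence uses, with versions of the densities that
  are positive everywhere. \<open>U\<close> dominates the cost after averaging over
  \<open>x\<close>; through its exponential moment those of \<nu> enter the entropy estimates.
  \<open>one0\<close> says that the product coupling is a competitor of finite entropy.\<close>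

locale causal_sinkhorn_dens = causal_filtration P N F for P :: "'a measure" and N F +
  fixes R Rh f :: "nat \<Rightarrow> 'a \<Rightarrow> real" and rs U :: "'a \<Rightarrow> real" and \<alpha> :: real
  assumes R_dens: "dens P (R n)" and R_pos: "R n x > 0"
    and Rh_causal: "causal_dens (Rh n)" and Rh_pos: "Rh n x > 0"
    and f_meas: "f n \<in> borel_measurable (F 0 N)" and f_pos: "f n x > 0"
    and f_cond: "AE x in P. real_cond_exp P (F 0 N) (Rh n) x = f n x"
    and Rh_min: "causal_dens r \<Longrightarrow> kl P (Rh n) (R n) \<le> kl P r (R n)"
    and R_Suc: "AE x in P. R (Suc n) x = Rh n x / f n x"
    and one0: "kl_integrable P (\<lambda>_. 1) (R 0)"
    and rs: "causal_dens rs" "AE x in P. real_cond_exp P (F 0 N) rs x = 1" "kl_integrable P rs (R 0)"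
    and rs_min: "causal_dens r \<Longrightarrow> AE x in P. real_cond_exp P (F 0 N) r x = 1 \<Longrightarrow> kl P rs (R 0) \<le> kl P r (R 0)"
    and U: "U \<in> borel_measurable (F 0 N)" "0 \<le> U x" "0 < \<alpha>" "integrable P (\<lambda>x. exp (\<alpha> * U x))"
    and U_bound: "g \<in> borel_measurable (F 0 N) \<Longrightarrow> (\<And>x. 0 \<le> g x) \<Longrightarrow> (\<And>x. g x \<le> K) \<Longrightarrow>
      integrable P (\<lambda>x. g x * ln (R 0 x))"
      "g \<in> borel_measurable (F 0 N) \<Longrightarrow> (\<And>x. 0 \<le> g x) \<Longrightarrow> (\<And>x. g x \<le> K) \<Longrightarrow>
      - (\<integral>x. g x * ln (R 0 x) \<partial>P) \<le> (\<integral>x. U x * g x \<partial>P)"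
begin

lemma Rh_dens: "dens P (Rh n)" using causal_dens_dens[OF Rh_causal] .

lemma R_meas[measurable]: "R n \<in> borel_measurable P" using densD(4)[OF R_dens] .
lemma Rh_meas[measurable]: "Rh n \<in> borel_measurable P" using densD(4)[OF Rh_dens] .
lemma f_measP[measurable]: "f n \<in> borel_measurable P" using f_meas meas_F[of 0 N] by auto
lemma U_measP[measurable]: "U \<in> borel_measurable P" using U meas_F[of 0 N] by auto

lemma f_nz[simp]: "f n x \<noteq> 0" "0 \<le> f n x" "0 < f n x" using f_pos[of n x] by auto

lemma marginal_Rh: "marginal (Rh n) (f n)"
  by (rule marginalI[OF Rh_dens f_meas _ f_cond]) simp

lemma marginal_rs: "marginal rs (\<lambda>_. 1)"
  by (rule marginalI[OF causal_dens_dens[OF rs(1)] _ _ rs(2)]) auto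

lemma marginal_R: "marginal (R (Suc n)) (\<lambda>_. 1)"
  unfolding marginal_def
proof
  fix h :: "'a \<Rightarrow> real" assume h: "h \<in> borel_measurable (F 0 N)"
  then have [measurable]: "h \<in> borel_measurable P" using meas_F[of 0 N] by auto
  have "(\<lambda>x. h x / f n x) \<in> borel_measurable (F 0 N)" using h f_meas by measurable
  note m = marginalD[OF marginal_Rh this]
  have e: "AE x in P. h x * R (Suc n) x = h x / f n x * Rh n x"
    using R_Suc[of n] by eventually_elim simp
  have "integrable P (\<lambda>x. h x * R (Suc n) x) \<longleftrightarrow> integrable P (\<lambda>x. h x / f n x * Rh n x)"
    using e by (intro integrable_cong_AE) auto
  moreover have "(\<integral>x. h x * R (Suc n) x \<partial>P) = (\<integral>x. h x / f n x * Rh n x \<partial>P)"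
    using e by (intro integral_cong_AE) auto
  ultimately show "(integrable P (\<lambda>x. h x * R (Suc n) x) \<longleftrightarrow> integrable P (\<lambda>x. h x * 1)) \<and>
     (\<integral>x. h x * R (Suc n) x \<partial>P) = (\<integral>x. h x * 1 \<partial>P)" using m by simp
qed

lemma f_dens: "dens P (f n)"
  using marginalD[OF marginal_Rh, of "\<lambda>_. 1" n] densD[OF Rh_dens, of n]
  by (auto simp: dens_def)

lemma f_int: "integrable P (f n)" "(\<integral>x. f n x \<partial>P) = 1"
  using densD[OF f_dens] by auto

lemma kl_split:
  fixes r a b :: "'c \<Rightarrow> real"
  assumes "\<And>x. 0 < a x" "\<And>x. 0 < b x" "\<And>x. 0 \<le> r x"
  shows "r x * ln (r x / b x) = r x * ln (r x / a x) + r x * ln (a x / b x)"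
proof (cases "r x = 0")
  case False
  then have "0 < r x" using assms(3)[of x] by simp
  then have "ln (r x / b x) = ln (r x / a x) + ln (a x / b x)"
    using assms(1)[of x] assms(2)[of x] by (simp add: ln_div)
  then show ?thesis by (simp add: distrib_left)
qed simp

section \<open>Finite entropies and the telescoped Pythagorean identity\<close>

definition A :: "nat \<Rightarrow> real" where "A n = KL P (Rh n) (R n)"

lemma kl_integrable_Rh_of_one:
  assumes "kl_integrable P (\<lambda>_. 1) (R n)"
  shows "kl_integrable P (Rh n) (R n)"
proof -
  have "kl P (Rh n) (R n) \<le> kl P (\<lambda>_. 1) (R n)" by (rule Rh_min[OF causal_dens_one])
  also have "\<dots> < \<infinity>"
    using assms kl_less_top_iff[OF causal_dens_dens[OF causal_dens_one] R_dens R_pos] by simp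
  finally show ?thesis using kl_less_top_iff[OF Rh_dens R_dens R_pos] by simp
qed

lemma pythagoras_Rh:
  assumes "kl_integrable P (Rh n) (R n)" "causal_dens r" "kl_integrable P r (R n)"
  shows "kl_integrable P r (Rh n)"
proof -
  note dr = causal_dens_dens[OF assms(2)]
  have "kl P r (Rh n) \<le> kl P r (Rh n) + kl P (Rh n) (R n)" by simp
  also have "\<dots> \<le> kl P r (R n)"
  proof (rule kl_pythagoras[OF Rh_dens Rh_pos dr densD(4)[OF R_dens] R_pos])
    show "kl P (Rh n) (R n) < \<infinity>" using assms(1) kl_less_top_iff[OF Rh_dens R_dens R_pos] by simp
    show "kl P (Rh n) (R n) \<le> kl P (\<lambda>x. (1 - s) * Rh n x + s * r x) (R n)" if "0 < s" "s < 1" for s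
      using that by (intro Rh_min causal_dens_convex Rh_causal assms(2)) auto
  qed
  also have "\<dots> < \<infinity>" using assms(3) kl_less_top_iff[OF dr R_dens R_pos] by simp
  finally show ?thesis using kl_less_top_iff[OF dr Rh_dens Rh_pos] by simp
qed

text \<open>Above, \<open>ln f \<le> f - 1\<close>. Below,
  \<open>ln (R (Suc n)) = ln (Rh n) - ln (f n)\<close> is at most \<open>R (Suc n) - 1\<close>,
  which is integrable.\<close>

lemma ln_f_integrable_of_one:
  assumes "kl_integrable P (\<lambda>_. 1) (Rh n)"
  shows "integrable P (\<lambda>x. ln (f n x))"
proof -
  have i: "integrable P (\<lambda>x. ln (Rh n x))"
  proof -
    have "ln (1 / Rh n x) = - ln (Rh n x)" for x using Rh_pos[of n x] by (simp add: ln_div)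
    then show ?thesis using assms unfolding kl_integrable_def by simp
  qed
  show ?thesis
  proof (rule Bochner_Integration.integrable_bound)
    show "integrable P (\<lambda>x. \<bar>ln (Rh n x)\<bar> + 1 + R (Suc n) x + f n x)"
      using i densD(2)[OF R_dens, of "Suc n"] f_int(1)[of n] by auto
    show "AE x in P. norm (ln (f n x)) \<le> norm (\<bar>ln (Rh n x)\<bar> + 1 + R (Suc n) x + f n x)"
      using R_Suc[of n]
    proof eventually_elim
      case (elim x)
      have "ln (f n x) \<le> f n x - 1" by (rule ln_le_minus_one) simp
      moreover have "ln (R (Suc n) x) \<le> R (Suc n) x - 1" by (rule ln_le_minus_one[OF R_pos])
      moreover have "ln (R (Suc n) x) = ln (Rh n x) - ln (f n x)"
        using Rh_pos[of n x] by (simp add: elim ln_div)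
      moreover note R_pos[of "Suc n" x] f_pos[of n x]
      ultimately have "\<bar>ln (f n x)\<bar> \<le> \<bar>ln (Rh n x)\<bar> + 1 + R (Suc n) x + f n x" by linarith
      also have "\<dots> \<le> \<bar>\<bar>ln (Rh n x)\<bar> + 1 + R (Suc n) x + f n x\<bar>" by (rule abs_ge_self)
      finally show ?case by simp
    qed
  qed measurable
qed

lemma kl_integrable_R_Suc:
  assumes r: "dens P r" and i: "integrable P (\<lambda>x. r x * ln (f n x))"
  shows "kl_integrable P r (R (Suc n)) \<longleftrightarrow> kl_integrable P r (Rh n)"
    "kl_integrable P r (Rh n) \<Longrightarrow> KL P r (R (Suc n)) = KL P r (Rh n) + (\<integral>x. r x * ln (f n x) \<partial>P)"
proof -
  have [measurable]: "r \<in> borel_measurable P" using densD(4)[OF r] .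
  have e: "AE x in P. r x * ln (r x / R (Suc n) x) = r x * ln (r x / Rh n x) + r x * ln (f n x)"
    using R_Suc[of n]
  proof eventually_elim
    case (elim x)
    show ?case using densD(1)[OF r, of x] Rh_pos[of n x] unfolding elim
      by (cases "r x = 0") (auto simp: ln_div ln_mult algebra_simps)
  qed
  have "kl_integrable P r (R (Suc n)) \<longleftrightarrow> integrable P (\<lambda>x. r x * ln (r x / Rh n x) + r x * ln (f n x))"
    unfolding kl_integrable_def using e by (intro integrable_cong_AE) auto
  also have "\<dots> \<longleftrightarrow> kl_integrable P r (Rh n)"
    unfolding kl_integrable_def
  proof
    assume "integrable P (\<lambda>x. r x * ln (r x / Rh n x) + r x * ln (f n x))"
    from Bochner_Integration.integrable_diff[OF this i]
    show "integrable P (\<lambda>x. r x * ln (r x / Rh n x))" by simp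
  qed (use i in auto)
  finally show "kl_integrable P r (R (Suc n)) \<longleftrightarrow> kl_integrable P r (Rh n)" .
  assume I: "kl_integrable P r (Rh n)"
  have "KL P r (R (Suc n)) = (\<integral>x. r x * ln (r x / Rh n x) + r x * ln (f n x) \<partial>P)"
    unfolding KL_def using e by (intro integral_cong_AE) auto
  then show "KL P r (R (Suc n)) = KL P r (Rh n) + (\<integral>x. r x * ln (f n x) \<partial>P)"
    using I i unfolding KL_def kl_integrable_def by simp
qed

text \<open>Keeps all minimisations finite: the density 1 of the product coupling is causal, and its
  finite entropy passes through the causal half step by the Pythagorean inequality and through the
  marginal half step by integrability of \<open>ln (f n)\<close>.\<close>

lemma kl_one: "kl_integrable P (\<lambda>_. 1) (R n)"
proof (induction n)
  case 0
  show ?case by (rule one0)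
next
  case (Suc n)
  have 1: "kl_integrable P (\<lambda>_. 1) (Rh n)"
    by (rule pythagoras_Rh[OF kl_integrable_Rh_of_one[OF Suc] causal_dens_one Suc])
  show ?case
    using kl_integrable_R_Suc(1)[OF causal_dens_dens[OF causal_dens_one], of n] ln_f_integrable_of_one[OF 1] 1 by simp
qed

lemma A_integrable: "kl_integrable P (Rh n) (R n)"
  by (rule kl_integrable_Rh_of_one[OF kl_one])

lemma A_nonneg: "0 \<le> A n"
  unfolding A_def by (rule kl_fun_integral(4)[OF Rh_dens R_dens R_pos A_integrable])

lemma ln_f_integrable: "integrable P (\<lambda>x. ln (f n x))"
  by (rule ln_f_integrable_of_one[OF pythagoras_Rh[OF A_integrable causal_dens_one kl_one]])

text \<open>This is the entropy of \<open>R (Suc n)\<close> relative to \<open>Rh n\<close>, as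
  \<open>KL_R_Rh\<close> shows; since the second marginal of \<open>R (Suc n)\<close> is \<nu>, only
  the mean of \<open>ln (f n)\<close> under \<open>P\<close> remains.\<close>

definition B :: "nat \<Rightarrow> real" where "B n = - (\<integral>x. ln (f n x) \<partial>P)"

lemma B_nonneg: "0 \<le> B n"
proof -
  have "(\<integral>x. ln (f n x) \<partial>P) \<le> (\<integral>x. f n x - 1 \<partial>P)"
    using ln_f_integrable f_int(1) by (intro integral_mono) (auto intro: ln_le_minus_one)
  then show ?thesis unfolding B_def using f_int[of n] by (simp add: prob_space)
qed

text \<open>The equality starts from finite entropy relative to \<open>Rh n\<close>; the Pythagorean
  inequality supplies this from finiteness relative to \<open>R n\<close>.\<close>

lemma causal_step:
  assumes r: "causal_dens r"
  shows "kl_integrable P r (R n) \<longleftrightarrow> kl_integrable P r (Rh n)"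
    "kl_integrable P r (Rh n) \<Longrightarrow> KL P r (R n) = KL P r (Rh n) + A n"
proof -
  note dr = causal_dens_dens[OF r]
  have s: "r x * ln (r x / R n x) = r x * ln (r x / Rh n x) + r x * ln (Rh n x / R n x)" for x
    by (rule kl_split) (use Rh_pos R_pos densD(1)[OF dr] in auto)
  have *: "kl_integrable P r (R n) \<and> KL P r (R n) = KL P r (Rh n) + A n" if I: "kl_integrable P r (Rh n)"
  proof -
    note e = causal_projection_equality[OF R_dens R_pos Rh_causal Rh_pos A_integrable Rh_min r I]
    show ?thesis using I e unfolding KL_def A_def kl_integrable_def s by simp
  qed
  show "kl_integrable P r (R n) \<longleftrightarrow> kl_integrable P r (Rh n)"
    using * pythagoras_Rh[OF A_integrable r] by blast
  show "kl_integrable P r (Rh n) \<Longrightarrow> KL P r (R n) = KL P r (Rh n) + A n" using * by blast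
qed

text \<open>Holds for every causal \<open>r\<close>, whatever its second marginal. The price is
  integrability of \<open>r * ln (f k)\<close>, which has to be secured for each test density: the
  optimizer, a bounded density in \<open>y\<close>, and \<open>Rh n\<close> itself.\<close>

lemma causal_telescope:
  assumes r: "causal_dens r" and i: "\<And>k. k < n \<Longrightarrow> integrable P (\<lambda>x. r x * ln (f k x))"
  shows "kl_integrable P r (R 0) \<longleftrightarrow> kl_integrable P r (R n)"
    "kl_integrable P r (R n) \<Longrightarrow> KL P r (R 0) = (\<Sum>k<n. A k - (\<integral>x. r x * ln (f k x) \<partial>P)) + KL P r (R n)"
proof -
  note dr = causal_dens_dens[OF r]
  have "(kl_integrable P r (R 0) \<longleftrightarrow> kl_integrable P r (R n)) \<and>
    (kl_integrable P r (R n) \<longrightarrow> KL P r (R 0) = (\<Sum>k<n. A k - (\<integral>x. r x * ln (f k x) \<partial>P)) + KL P r (R n))"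
    using i
  proof (induction n)
    case (Suc n)
    have i: "integrable P (\<lambda>x. r x * ln (f n x))" using Suc.prems by simp
    have IH: "(kl_integrable P r (R 0) \<longleftrightarrow> kl_integrable P r (R n)) \<and>
    (kl_integrable P r (R n) \<longrightarrow> KL P r (R 0) = (\<Sum>k<n. A k - (\<integral>x. r x * ln (f k x) \<partial>P)) + KL P r (R n))"
      by (rule Suc.IH) (use Suc.prems in auto)
    show ?case using IH kl_integrable_R_Suc[OF dr i] causal_step[OF r, of n] by auto
  qed simp
  then show "kl_integrable P r (R 0) \<longleftrightarrow> kl_integrable P r (R n)"
    "kl_integrable P r (R n) \<Longrightarrow> KL P r (R 0) = (\<Sum>k<n. A k - (\<integral>x. r x * ln (f k x) \<partial>P)) + KL P r (R n)"
    by auto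
qed

lemma rs_ln_f: "integrable P (\<lambda>x. rs x * ln (f k x))" "(\<integral>x. rs x * ln (f k x) \<partial>P) = - B k"
proof -
  have "(\<lambda>x. ln (f k x)) \<in> borel_measurable (F 0 N)" using f_meas by measurable
  note m = marginalD[OF marginal_rs this]
  show "integrable P (\<lambda>x. rs x * ln (f k x))" using m(1) ln_f_integrable[of k] by (simp add: mult.commute)
  show "(\<integral>x. rs x * ln (f k x) \<partial>P) = - B k" using m(2) by (simp add: mult.commute B_def)
qed

definition K :: real where "K = KL P rs (R 0)"

lemma K_telescope:
  shows "kl_integrable P rs (Rh n)" "K = (\<Sum>k<n. A k + B k) + A n + KL P rs (Rh n)" "KL P rs (Rh n) \<ge> 0"
proof -
  have 1: "kl_integrable P rs (R n)"
    using causal_telescope(1)[OF rs(1) rs_ln_f(1)] rs(3) by simp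
  then show 2: "kl_integrable P rs (Rh n)" using causal_step(1)[OF rs(1)] by simp
  show "K = (\<Sum>k<n. A k + B k) + A n + KL P rs (Rh n)"
    unfolding K_def causal_telescope(2)[OF rs(1) rs_ln_f(1) 1] rs_ln_f(2) causal_step(2)[OF rs(1) 2] by simp
  show "KL P rs (Rh n) \<ge> 0"
    by (rule kl_fun_integral(4)[OF causal_dens_dens[OF rs(1)] Rh_dens Rh_pos 2])
qed

text \<open>The entropy of the optimizer relative to \<open>Rh n\<close> that remains is
  nonnegative, so all increments together cost at most the optimal entropy \<open>K\<close>; hence
  both series converge.\<close>

lemma AB_bound: "(\<Sum>k<n. A k + B k) + A n \<le> K"
  using K_telescope(2,3)[of n] by simp

lemma summable_A: "summable A"
proof (rule bounded_imp_summable[OF A_nonneg])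
  fix n
  have "sum A {..n} = sum A {..<n} + A n" by (simp add: lessThan_Suc_atMost[symmetric])
  moreover have "sum A {..<n} \<le> (\<Sum>k<n. A k + B k)" by (rule sum_mono) (use B_nonneg in auto)
  ultimately show "sum A {..n} \<le> K" using AB_bound[of n] by simp
qed

lemma summable_B: "summable B"
proof (rule bounded_imp_summable[OF B_nonneg])
  fix n
  have "sum B {..n} = sum B {..<Suc n}" by (simp add: lessThan_Suc_atMost[symmetric])
  also have "\<dots> \<le> (\<Sum>k<Suc n. A k + B k)" by (rule sum_mono) (use A_nonneg in auto)
  finally show "sum B {..n} \<le> K" using AB_bound[of "Suc n"] A_nonneg[of "Suc n"] by linarith
qed

section \<open>Entropies of the second marginals\<close>

definition e :: "nat \<Rightarrow> real" where "e n = (\<integral>x. f n x * ln (f n x) \<partial>P)"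

lemma xlnx_le: "x * ln x \<ge> x - 1" if "x > 0" for x :: real
proof -
  have "ln (1 / x) \<le> 1 / x - 1" by (rule ln_le_minus_one) (use that in simp)
  then have "ln x \<ge> 1 - 1 / x" using that by (simp add: ln_div)
  then have "x * ln x \<ge> x * (1 - 1 / x)" using that by (intro mult_left_mono) auto
  moreover have "x * (1 - 1 / x) = x - 1" using that by (simp add: right_diff_distrib)
  ultimately show ?thesis by simp
qed

text \<open>Young's inequality with the positive part of \<open>ln f\<close>; the exponential term
  is at most \<open>f * R (Suc n)\<close>, of integral 1 because \<open>R (Suc n)\<close> has second
  marginal \<nu>. \<open>R 0\<close> is not known to have it, hence the index \<open>Suc n\<close>
  here and below.\<close>

lemma flnf_integrable: "integrable P (\<lambda>x. f (Suc n) x * ln (f (Suc n) x))"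
proof -
  let ?f = "f (Suc n)" and ?r = "Rh (Suc n)" and ?q = "R (Suc n)"
  let ?h = "\<lambda>x. max 0 (ln (?f x))"
  have hm: "?h \<in> borel_measurable (F 0 N)" using f_meas by measurable
  have iq: "integrable P (\<lambda>x. ?f x * ?q x)"
    using marginalD(1)[OF marginal_R f_meas] f_int(1) by simp
  have "integrable P (\<lambda>x. ?h x * ?r x)"
  proof (rule Bochner_Integration.integrable_bound)
    show "integrable P (\<lambda>x. kl_fun (?r x) (?q x) + ?f x * ?q x)"
      using kl_fun_integral(1)[OF Rh_dens R_dens R_pos A_integrable] iq by auto
    show "AE x in P. norm (?h x * ?r x) \<le> norm (kl_fun (?r x) (?q x) + ?f x * ?q x)"
    proof (intro AE_I2)
      fix x
      have r0: "0 \<le> ?r x" "0 \<le> ?q x" using Rh_pos R_pos by (auto intro: less_imp_le)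
      have "?r x * ?h x \<le> kl_fun (?r x) (?q x) + ?q x * (exp (?h x) - 1)"
        by (rule kl_fun_young[OF r0(1) R_pos])
      also have "?q x * (exp (?h x) - 1) \<le> ?q x * ?f x"
        using r0 by (intro mult_left_mono) (auto simp: max_def)
      finally have "?h x * ?r x \<le> kl_fun (?r x) (?q x) + ?f x * ?q x" by (simp add: mult.commute)
      moreover have "0 \<le> ?h x * ?r x" using r0 by simp
      ultimately show "norm (?h x * ?r x) \<le> norm (kl_fun (?r x) (?q x) + ?f x * ?q x)" by simp
    qed
  qed measurable
  then have ih: "integrable P (\<lambda>x. ?h x * ?f x)" using marginalD(1)[OF marginal_Rh hm] by simp
  show ?thesis
  proof (rule Bochner_Integration.integrable_bound)
    show "integrable P (\<lambda>x. ?h x * ?f x + 1)" using ih by simp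
    show "AE x in P. norm (?f x * ln (?f x)) \<le> norm (?h x * ?f x + 1)"
    proof (intro AE_I2)
      fix x
      have *: "?f x * ln (?f x) \<ge> ?f x - 1" by (rule xlnx_le) simp
      show "norm (?f x * ln (?f x)) \<le> norm (?h x * ?f x + 1)"
      proof (cases "ln (?f x) \<ge> 0")
        case True
        then show ?thesis by (simp add: max_def mult.commute)
      next
        case False
        then have "?f x * ln (?f x) \<le> 0" using mult_nonneg_nonpos[of "?f x" "ln (?f x)"] by simp
        moreover have "?f x * ln (?f x) \<ge> - 1" using * f_nz(2)[of "Suc n" x] by linarith
        ultimately show ?thesis using False by (simp add: max_def)
      qed
    qed
  qed measurable
qed

text \<open>Entropy decreases under passage to a marginal: Young's inequality with
  \<open>h = ln f\<close>, where the exponential term integrates to 0 because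
  \<open>f * R (Suc n)\<close> has integral 1.\<close>

lemma e_le_A: "e (Suc n) \<le> A (Suc n)"
proof -
  let ?f = "f (Suc n)" and ?r = "Rh (Suc n)" and ?q = "R (Suc n)"
  have lm: "(\<lambda>x. ln (?f x)) \<in> borel_measurable (F 0 N)" using f_meas by measurable
  have ir: "integrable P (\<lambda>x. ln (?f x) * ?r x)"
    using marginalD(1)[OF marginal_Rh lm] flnf_integrable by (simp add: mult.commute)
  have er: "e (Suc n) = (\<integral>x. ln (?f x) * ?r x \<partial>P)"
    using marginalD(2)[OF marginal_Rh lm] by (simp add: e_def mult.commute)
  have iq: "integrable P (\<lambda>x. ?f x * ?q x)" "(\<integral>x. ?f x * ?q x \<partial>P) = 1"
    using marginalD[OF marginal_R f_meas] f_int by simp_all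
  note k = kl_fun_integral[OF Rh_dens R_dens R_pos A_integrable]
  have "(\<integral>x. ln (?f x) * ?r x \<partial>P) \<le> (\<integral>x. kl_fun (?r x) (?q x) + (?f x * ?q x - ?q x) \<partial>P)"
  proof (rule integral_mono[OF ir])
    show "integrable P (\<lambda>x. kl_fun (?r x) (?q x) + (?f x * ?q x - ?q x))"
      using k(1) iq(1) densD(2)[OF R_dens] by auto
    fix x
    have "?r x * ln (?f x) \<le> kl_fun (?r x) (?q x) + ?q x * (exp (ln (?f x)) - 1)"
      by (rule kl_fun_young[OF less_imp_le[OF Rh_pos] R_pos])
    then show "ln (?f x) * ?r x \<le> kl_fun (?r x) (?q x) + (?f x * ?q x - ?q x)"
      by (simp add: algebra_simps)
  qed
  also have "\<dots> = A (Suc n)"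
    using k(1,2) iq densD(2,3)[OF R_dens, of "Suc n"] by (simp add: A_def)
  finally show ?thesis using er by simp
qed

text \<open>\<open>Rh (Suc n)\<close> competes in the next causal minimisation, and its entropy
  relative to \<open>R (Suc (Suc n))\<close> is exactly the marginal entropy, since the two
  densities differ by the factor \<open>f (Suc n)\<close>. Together with \<open>e_le_A\<close> this
  makes \<open>e\<close> decrease.\<close>

lemma A_le_e: "A (Suc (Suc n)) \<le> e (Suc n)"
proof -
  let ?f = "f (Suc n)" and ?r = "Rh (Suc n)" and ?q = "R (Suc (Suc n))"
  have lm: "(\<lambda>x. ln (?f x)) \<in> borel_measurable (F 0 N)" using f_meas by measurable
  have ir: "integrable P (\<lambda>x. ?r x * ln (?f x))" "e (Suc n) = (\<integral>x. ?r x * ln (?f x) \<partial>P)"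
    using marginalD[OF marginal_Rh lm, of "Suc n"] flnf_integrable by (simp_all add: mult.commute e_def)
  have s: "kl_integrable P ?r ?r" "KL P ?r ?r = 0"
    using Rh_pos[of "Suc n"] by (simp_all add: kl_integrable_def KL_def less_imp_neq[symmetric])
  have k: "kl_integrable P ?r ?q" "KL P ?r ?q = e (Suc n)"
    using kl_integrable_R_Suc[OF Rh_dens ir(1)] s ir(2) by simp_all
  have "ennreal (A (Suc (Suc n))) \<le> ennreal (e (Suc n))"
    using Rh_min[OF Rh_causal[of "Suc n"], of "Suc (Suc n)"]
      kl_fun_integral(3)[OF Rh_dens R_dens R_pos A_integrable, of "Suc (Suc n)"]
      kl_fun_integral(3)[OF Rh_dens R_dens R_pos k(1)] k(2)
    by (simp add: A_def)
  moreover have "e (Suc n) \<ge> 0" using kl_fun_integral(4)[OF Rh_dens R_dens R_pos k(1)] k(2) by simp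
  ultimately show ?thesis by simp
qed

lemma e_decreasing: "Suc m \<le> n \<Longrightarrow> e n \<le> e (Suc m)"
proof (induction n)
  case (Suc n)
  show ?case
  proof (cases "n = m")
    case False
    then have "Suc m \<le> n" using Suc by simp
    then obtain k where "n = Suc k" by (cases n) auto
    then show ?thesis using Suc.IH \<open>Suc m \<le> n\<close> e_le_A[of n] A_le_e[of k] by simp
  qed simp
qed simp

lemma flnf_kl: "kl_integrable P (f (Suc n)) (\<lambda>_. 1)" "KL P (f (Suc n)) (\<lambda>_. 1) = e (Suc n)"
  using flnf_integrable by (simp_all add: kl_integrable_def KL_def e_def)

lemma one_dens: "dens P (\<lambda>_. 1)" using causal_dens_dens[OF causal_dens_one] .

lemma e_nonneg: "0 \<le> e (Suc n)"
  using kl_fun_integral(4)[OF f_dens one_dens _ flnf_kl(1)] flnf_kl(2) by simp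

lemma e_tendsto: "e \<longlonglongrightarrow> 0"
proof (rule LIMSEQ_imp_Suc)
  have "A \<longlonglongrightarrow> 0" by (rule summable_LIMSEQ_zero[OF summable_A])
  then have "(\<lambda>n. A (Suc n)) \<longlonglongrightarrow> 0" by (rule LIMSEQ_Suc)
  then show "(\<lambda>n. e (Suc n)) \<longlonglongrightarrow> 0"
    by (rule tendsto_sandwich[OF _ _ tendsto_const, rotated 2]) (auto intro!: always_eventually simp: e_nonneg e_le_A)
qed

section \<open>The potentials in the second variable\<close>

definition \<psi> :: "nat \<Rightarrow> 'a \<Rightarrow> real" where "\<psi> n x = - (\<Sum>k<n. ln (f k x))"

lemma \<psi>_meas: "\<psi> n \<in> borel_measurable (F 0 N)"
  unfolding \<psi>_def using f_meas by measurable

lemma \<psi>_measP[measurable]: "\<psi> n \<in> borel_measurable P" using \<psi>_meas meas_F[of 0 N] by auto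

lemma \<psi>_integrable: "integrable P (\<psi> n)"
  unfolding \<psi>_def using ln_f_integrable by auto

lemma bounded_xlnx: "\<bar>x * ln x\<bar> \<le> 1 + C * C" if "0 \<le> x" "x \<le> C" for x C :: real
proof (cases "x = 0")
  case False
  then have x: "x > 0" using that by simp
  have 1: "x * ln x \<ge> x - 1" by (rule xlnx_le[OF x])
  have "ln x \<le> x" using ln_le_minus_one[OF x] by simp
  then have "x * ln x \<le> x * x" using x by (intro mult_left_mono) auto
  also have "\<dots> \<le> C * C" using that by (intro mult_mono) auto
  finally show ?thesis using 1 x by (auto simp: abs_if intro: order_trans[of _ 1])
qed simp

text \<open>Testing the telescoped identity with the product of \<open>\<mu>\<close> and the normalisation of \<open>g\<close>.\<close>

lemma \<psi>_upper:
  assumes g: "g \<in> borel_measurable (F 0 N)" "\<And>x. 0 \<le> g x" "\<And>x. g x \<le> C"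
  defines "m \<equiv> (\<integral>x. g x \<partial>P)"
  shows "(\<integral>x. g x * \<psi> n x \<partial>P) \<le> (\<integral>x. g x * ln (g x) \<partial>P) - m * ln m + (\<integral>x. U x * g x \<partial>P)"
proof -
  have gP[measurable]: "g \<in> borel_measurable P" using g(1) meas_F[of 0 N] by auto
  have ig: "integrable P g" by (rule integrable_const_bound[of _ C]) (use g in auto)
  have m0: "m \<ge> 0" unfolding m_def using g by simp
  have iglng: "integrable P (\<lambda>x. g x * ln (g x))"
    by (rule integrable_const_bound[of _ "1 + C * C"]) (use bounded_xlnx[OF g(2,3)] in auto)
  show ?thesis
  proof (cases "m = 0")
    case True
    then have z: "AE x in P. g x = 0"
      unfolding m_def using integral_nonneg_eq_0_iff_AE[OF ig] g by simp
    have "(\<integral>x. g x * \<psi> n x \<partial>P) = 0" "(\<integral>x. g x * ln (g x) \<partial>P) = 0" "(\<integral>x. U x * g x \<partial>P) = 0"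
      by (rule integral_eq_zero_AE; use z in \<open>eventually_elim, simp\<close>)+
    then show ?thesis using True by simp
  next
    case False
    then have m: "m > 0" using m0 by simp
    \<comment> \<open>Normalised to a probability density; undoing the normalisation at the end
      produces \<open>- m * ln m\<close>.\<close>
    define r where "r x = g x / m" for x
    have rm: "r \<in> borel_measurable (F 0 N)" unfolding r_def using g(1) by measurable
    have rP[measurable]: "r \<in> borel_measurable P" unfolding r_def by measurable
    have r0: "0 \<le> r x" "r x \<le> C / m" for x unfolding r_def using g m by (auto simp: divide_right_mono)
    have re: "r = (\<lambda>x. g x / m)" by (simp add: r_def fun_eq_iff)
    have "(\<integral>x. g x / m \<partial>P) = m / m" by (simp add: m_def)
    then have dr: "dens P r" unfolding dens_def re using g(2) ig m by auto
    have cr: "causal_dens r" by (rule causal_dens_snd[OF dr rm])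
    have irlnr: "integrable P (\<lambda>x. r x * ln (r x))"
      by (rule integrable_const_bound[of _ "1 + (C / m) * (C / m)"]) (use bounded_xlnx[OF r0] in auto)
    have irR: "integrable P (\<lambda>x. r x * ln (R 0 x))" by (rule U_bound(1)[OF rm r0])
    have irf: "integrable P (\<lambda>x. r x * ln (f k x))" for k
      by (rule integrable_bounded_mult[OF ln_f_integrable rP, of "C / m"]) (use r0 in auto)
    have s: "r x * ln (r x / R 0 x) = r x * ln (r x) - r x * ln (R 0 x)" for x
      using r0(1)[of x] R_pos[of 0 x] by (cases "r x = 0") (auto simp: ln_div algebra_simps)
    have k0: "kl_integrable P r (R 0)" unfolding kl_integrable_def s using irlnr irR by auto
    then have kn: "kl_integrable P r (R n)" using causal_telescope(1)[OF cr irf] by simp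
    have "(\<integral>x. r x * \<psi> n x \<partial>P) = (\<integral>x. - (\<Sum>k<n. r x * ln (f k x)) \<partial>P)"
      unfolding \<psi>_def by (simp add: sum_distrib_left)
    also have "\<dots> = - (\<Sum>k<n. \<integral>x. r x * ln (f k x) \<partial>P)"
      using irf by (simp add: Bochner_Integration.integral_sum)
    \<comment> \<open>Adds the nonnegative \<open>A k\<close> and the entropy relative to
      \<open>R n\<close>; the result is the entropy relative to \<open>R 0\<close>, so the bound is
      uniform in \<open>n\<close>.\<close>
    also have "\<dots> \<le> (\<Sum>k<n. A k - (\<integral>x. r x * ln (f k x) \<partial>P)) + KL P r (R n)"
      using kl_fun_integral(4)[OF dr R_dens R_pos kn] sum_nonneg[of "{..<n}" A] A_nonneg
      by (simp add: sum_subtractf)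
    also have "\<dots> = KL P r (R 0)" by (rule causal_telescope(2)[OF cr irf kn, symmetric])
    also have "\<dots> = (\<integral>x. r x * ln (r x) \<partial>P) - (\<integral>x. r x * ln (R 0 x) \<partial>P)"
      unfolding KL_def s using irlnr irR by simp
    also have "\<dots> \<le> (\<integral>x. r x * ln (r x) \<partial>P) + (\<integral>x. U x * r x \<partial>P)"
      using U_bound(2)[OF rm r0] by simp
    finally have "m * (\<integral>x. r x * \<psi> n x \<partial>P) \<le> m * ((\<integral>x. r x * ln (r x) \<partial>P) + (\<integral>x. U x * r x \<partial>P))"
      using m by (intro mult_left_mono) auto
    moreover have "m * (\<integral>x. r x * \<psi> n x \<partial>P) = (\<integral>x. g x * \<psi> n x \<partial>P)"
      unfolding r_def using m by simp
    moreover have "m * (\<integral>x. U x * r x \<partial>P) = (\<integral>x. U x * g x \<partial>P)"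
      unfolding r_def using m by simp
    moreover have "m * (\<integral>x. r x * ln (r x) \<partial>P) = (\<integral>x. g x * ln (g x) \<partial>P) - m * ln m"
    proof -
      have "m * (r x * ln (r x)) = g x * ln (g x) - ln m * g x" for x
        unfolding r_def using m g(2)[of x] by (cases "g x = 0") (auto simp: ln_div algebra_simps)
      then have "m * (\<integral>x. r x * ln (r x) \<partial>P) = (\<integral>x. g x * ln (g x) - ln m * g x \<partial>P)"
        by (subst integral_mult_right_zero[symmetric]) simp
      then show ?thesis using iglng ig by (simp add: m_def mult.commute)
    qed
    ultimately show ?thesis by (simp add: distrib_left)
  qed
qed

end

section \<open>Uniform integrability from exponential moments\<close>

text \<open>Uniform integrability of \<open>w\<close> under the measures with densities
  \<open>r n\<close>, for large \<open>n\<close> only. Integrability is demanded explicitly, since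
  the tail integral of a function that is not integrable would be 0 by default.\<close>

definition unif_integrable :: "'a measure \<Rightarrow> ('a \<Rightarrow> real) \<Rightarrow> (nat \<Rightarrow> 'a \<Rightarrow> real) \<Rightarrow> bool" where
  "unif_integrable M w r \<longleftrightarrow> (\<forall>\<epsilon>>0. \<exists>K0. \<forall>K\<ge>K0. \<forall>\<^sub>F n in sequentially.
     integrable M (\<lambda>x. w x * r n x) \<and> (\<integral>x. indicator {x. K < w x} x * (w x * r n x) \<partial>M) \<le> \<epsilon>)"

lemma tail_integral_tendsto:
  fixes k w :: "'a \<Rightarrow> real"
  assumes k: "integrable M k" and [measurable]: "w \<in> borel_measurable M"
  shows "(\<lambda>n::nat. \<integral>x. indicator {x. real n < w x} x * k x \<partial>M) \<longlonglongrightarrow> 0"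
proof -
  have "(\<lambda>n::nat. \<integral>x. indicator {x. real n < w x} x * k x \<partial>M) \<longlonglongrightarrow> (\<integral>x. 0 \<partial>M)"
  proof (rule integral_dominated_convergence[where w="\<lambda>x. \<bar>k x\<bar>"])
    show "AE x in M. (\<lambda>n. indicator {x. real n < w x} x * k x) \<longlonglongrightarrow> 0"
    proof (intro AE_I2 tendsto_eventually)
      fix x
      have "\<forall>\<^sub>F n in sequentially. w x \<le> real n"
        by (metis eventually_sequentiallyI nat_ceiling_le_eq)
      then show "\<forall>\<^sub>F n in sequentially. indicator {x. real n < w x} x * k x = 0"
        by eventually_elim (auto simp: indicator_def)
    qed
  qed (use k in \<open>auto simp: indicator_def\<close>)
  then show ?thesis by simp
qed

text \<open>On the tail \<open>K < w\<close>, Young's inequality with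
  \<open>h = \<alpha> * w\<close> trades the tail of \<open>w\<close> under \<open>r n\<close> for
  the entropy, which tends to 0, plus the tail of \<open>exp (\<alpha> * w)\<close> under
  \<open>q n\<close>. By \<open>law\<close> the latter is the tail under \<open>M\<close>, the same
  for all \<open>n\<close>.\<close>

lemma (in prob_space) unif_integrable_exp_moment:
  fixes w :: "'a \<Rightarrow> real" and r q :: "nat \<Rightarrow> 'a \<Rightarrow> real"
  assumes w[measurable]: "w \<in> borel_measurable M" "\<And>x. 0 \<le> w x"
    and \<alpha>: "0 < \<alpha>" "integrable M (\<lambda>x. exp (\<alpha> * w x))"
    and r: "\<And>n. dens M (r n)" and q: "\<And>n. dens M (q n)" "\<And>n x. 0 < q n x"
    and I: "\<And>n. kl_integrable M (r n) (q n)" and KL0: "(\<lambda>n. KL M (r n) (q n)) \<longlonglongrightarrow> 0"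
    and law: "\<And>n (h :: real \<Rightarrow> real). h \<in> borel_measurable borel \<Longrightarrow> integrable M (\<lambda>x. h (w x)) \<Longrightarrow>
      integrable M (\<lambda>x. h (w x) * q n x) \<and> (\<integral>x. h (w x) * q n x \<partial>M) = (\<integral>x. h (w x) \<partial>M)"
  shows "unif_integrable M w r"
  unfolding unif_integrable_def
proof (intro allI impI)
  fix \<epsilon> :: real assume \<epsilon>: "\<epsilon> > 0"
  have [measurable]: "r n \<in> borel_measurable M" for n using densD(4)[OF r] .
  let ?k = "\<lambda>x. exp (\<alpha> * w x) - 1"
  have ik: "integrable M ?k" using \<alpha> by auto
  have k0: "0 \<le> ?k x" for x using \<alpha>(1) w(2) by simp
  have "\<forall>\<^sub>F n in sequentially. (\<integral>x. indicator {x. real n < w x} x * ?k x \<partial>M) < \<alpha> * \<epsilon> / 2"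
    using tail_integral_tendsto[OF ik w(1)] \<alpha>(1) \<epsilon> by (intro order_tendstoD) auto
  then obtain n0 :: nat where n0: "(\<integral>x. indicator {x. real n0 < w x} x * ?k x \<partial>M) < \<alpha> * \<epsilon> / 2"
    by (auto simp: eventually_sequentially)
  show "\<exists>K0. \<forall>K\<ge>K0. \<forall>\<^sub>F n in sequentially.
     integrable M (\<lambda>x. w x * r n x) \<and> (\<integral>x. indicator {x. K < w x} x * (w x * r n x) \<partial>M) \<le> \<epsilon>"
  proof (intro exI allI impI)
    fix K assume K: "K \<ge> real n0"
    have iK: "integrable M (\<lambda>x. indicator {x. K < w x} x * ?k x)" for K
      by (rule integrable_bounded_mult[OF ik, of _ 1]) (auto simp: indicator_def)
    have "(\<integral>x. indicator {x. K < w x} x * ?k x \<partial>M) \<le> (\<integral>x. indicator {x. real n0 < w x} x * ?k x \<partial>M)"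
      using iK K k0 by (intro integral_mono) (auto simp: indicator_def)
    then have TK: "(\<integral>x. indicator {x. K < w x} x * ?k x \<partial>M) \<le> \<alpha> * \<epsilon> / 2" using n0 by simp
    have lK: "integrable M (\<lambda>x. (indicator {x. K < w x} x * ?k x) * q n x)"
       "(\<integral>x. (indicator {x. K < w x} x * ?k x) * q n x \<partial>M) = (\<integral>x. indicator {x. K < w x} x * ?k x \<partial>M)" for K n
    proof -
      have e: "(\<lambda>x. indicator {x. K < w x} x * ?k x) = (\<lambda>x. (\<lambda>t. indicator {t. K < t} t * (exp (\<alpha> * t) - 1)) (w x))"
        by (auto simp: indicator_def)
      have "integrable M (\<lambda>x. (\<lambda>t. indicator {t. K < t} t * (exp (\<alpha> * t) - 1)) (w x))" using iK[of K] e by simp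
      from law[OF _ this, of n]
      show "integrable M (\<lambda>x. (indicator {x. K < w x} x * ?k x) * q n x)"
       "(\<integral>x. (indicator {x. K < w x} x * ?k x) * q n x \<partial>M) = (\<integral>x. indicator {x. K < w x} x * ?k x \<partial>M)"
        by (auto simp: indicator_def)
    qed
    have y: "0 \<le> indicator {x. K < w x} x * (\<alpha> * w x * r n x)"
      "indicator {x. K < w x} x * (\<alpha> * w x * r n x) \<le> kl_fun (r n x) (q n x) + (indicator {x. K < w x} x * ?k x) * q n x" for x K n
    proof -
      have r0: "0 \<le> r n x" using densD(1)[OF r] .
      show "0 \<le> indicator {x. K < w x} x * (\<alpha> * w x * r n x)" using r0 \<alpha> w(2)[of x] by simp
      show "indicator {x. K < w x} x * (\<alpha> * w x * r n x) \<le> kl_fun (r n x) (q n x) + (indicator {x. K < w x} x * ?k x) * q n x"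
      proof (cases "K < w x")
        case True
        then show ?thesis using kl_fun_young[OF r0 q(2), of "\<alpha> * w x" n x] by (simp add: mult_ac)
      next
        case False
        then show ?thesis using kl_fun_nonneg[OF r0, of "q n x"] q(2)[of n x] by simp
      qed
    qed
    have kf: "integrable M (\<lambda>x. kl_fun (r n x) (q n x))" "(\<integral>x. kl_fun (r n x) (q n x) \<partial>M) = KL M (r n) (q n)" for n
      using kl_fun_integral[OF r q I] by auto
    have iwK: "integrable M (\<lambda>x. indicator {x. K < w x} x * (\<alpha> * w x * r n x))" for K n
    proof (rule Bochner_Integration.integrable_bound)
      show "integrable M (\<lambda>x. kl_fun (r n x) (q n x) + (indicator {x. K < w x} x * ?k x) * q n x)"
        using kf(1) lK(1) by (rule Bochner_Integration.integrable_add)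
      show "AE x in M. norm (indicator {x. K < w x} x * (\<alpha> * w x * r n x)) \<le> norm (kl_fun (r n x) (q n x) + (indicator {x. K < w x} x * ?k x) * q n x)"
      proof (intro AE_I2)
        fix x
        have "norm (indicator {x. K < w x} x * (\<alpha> * w x * r n x)) = indicator {x. K < w x} x * (\<alpha> * w x * r n x)"
          unfolding real_norm_def by (rule abs_of_nonneg[OF y(1)])
        also have "\<dots> \<le> norm (kl_fun (r n x) (q n x) + (indicator {x. K < w x} x * ?k x) * q n x)"
          using y(2) abs_ge_self unfolding real_norm_def by (rule order_trans)
        finally show "norm (indicator {x. K < w x} x * (\<alpha> * w x * r n x)) \<le> norm (kl_fun (r n x) (q n x) + (indicator {x. K < w x} x * ?k x) * q n x)" .
      qed
    qed measurable
    \<comment> \<open>At level -1 nothing is cut off because \<open>w \<ge> 0\<close>, so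
      \<open>iwK\<close> gives integrability of the whole function.\<close>
    have iw: "integrable M (\<lambda>x. w x * r n x)" for n
    proof -
      have "indicator {x. - 1 < w x} x * (\<alpha> * w x * r n x) / \<alpha> = w x * r n x" for x
        using \<alpha>(1) w(2)[of x] by (auto simp: indicator_def)
      with integrable_divide[OF iwK[of "- 1" n], of \<alpha>] \<alpha>(1) show ?thesis by simp
    qed
    have "\<forall>\<^sub>F n in sequentially. KL M (r n) (q n) < \<alpha> * \<epsilon> / 2"
      using KL0 \<alpha>(1) \<epsilon> by (intro order_tendstoD) auto
    then show "\<forall>\<^sub>F n in sequentially.
     integrable M (\<lambda>x. w x * r n x) \<and> (\<integral>x. indicator {x. K < w x} x * (w x * r n x) \<partial>M) \<le> \<epsilon>"
    proof eventually_elim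
      case (elim n)
      have "\<alpha> * (\<integral>x. indicator {x. K < w x} x * (w x * r n x) \<partial>M) = (\<integral>x. indicator {x. K < w x} x * (\<alpha> * w x * r n x) \<partial>M)"
        by (subst integral_mult_right_zero[symmetric]) (simp add: mult_ac)
      also have "\<dots> \<le> (\<integral>x. kl_fun (r n x) (q n x) + (indicator {x. K < w x} x * ?k x) * q n x \<partial>M)"
        by (rule integral_mono[OF iwK Bochner_Integration.integrable_add[OF kf(1) lK(1)] y(2)])
      also have "\<dots> = KL M (r n) (q n) + (\<integral>x. indicator {x. K < w x} x * ?k x \<partial>M)"
        using Bochner_Integration.integral_add[OF kf(1) lK(1)] kf(2) lK(2) by simp
      also have "\<dots> \<le> \<alpha> * \<epsilon>" using elim TK by simp
      finally have "(\<integral>x. indicator {x. K < w x} x * (w x * r n x) \<partial>M) \<le> \<epsilon>" using \<alpha>(1) by simp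
      then show ?case using iw by simp
    qed
  qed
qed

text \<open>Cut at a level \<open>K\<close>: below it the weight is at most \<open>K\<close> and L1
  convergence suffices; above it \<open>w * r n\<close> and \<open>w * h\<close> are small
  separately.\<close>

lemma L1_weighted_tendsto:
  fixes w h :: "'a \<Rightarrow> real" and r :: "nat \<Rightarrow> 'a \<Rightarrow> real"
  assumes w[measurable]: "w \<in> borel_measurable M" "\<And>x. 0 \<le> w x"
    and r: "\<And>n. integrable M (r n)" "\<And>n x. 0 \<le> r n x" and h: "integrable M h" "\<And>x. 0 \<le> h x" "integrable M (\<lambda>x. w x * h x)"
    and L1: "(\<lambda>n. \<integral>x. \<bar>r n x - h x\<bar> \<partial>M) \<longlonglongrightarrow> 0" and ui: "unif_integrable M w r"
  shows "\<forall>\<^sub>F n in sequentially. integrable M (\<lambda>x. w x * \<bar>r n x - h x\<bar>)"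
    "(\<lambda>n. \<integral>x. w x * \<bar>r n x - h x\<bar> \<partial>M) \<longlonglongrightarrow> 0"
proof -
  have [measurable]: "r n \<in> borel_measurable M" "h \<in> borel_measurable M" for n using r h by auto
  have iwd: "integrable M (\<lambda>x. w x * \<bar>r n x - h x\<bar>)" if "integrable M (\<lambda>x. w x * r n x)" for n
  proof (rule Bochner_Integration.integrable_bound)
    show "integrable M (\<lambda>x. w x * r n x + w x * h x)" using that h by auto
    show "AE x in M. norm (w x * \<bar>r n x - h x\<bar>) \<le> norm (w x * r n x + w x * h x)"
    proof (intro AE_I2)
      fix x
      have "\<bar>r n x - h x\<bar> \<le> r n x + h x" using r(2)[of n x] h(2)[of x] by simp
      then have "w x * \<bar>r n x - h x\<bar> \<le> w x * (r n x + h x)" using w(2) by (rule mult_left_mono)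
      moreover have "0 \<le> w x * (r n x + h x)" "0 \<le> w x * \<bar>r n x - h x\<bar>" using w(2)[of x] r(2)[of n x] h(2)[of x] by auto
      ultimately show "norm (w x * \<bar>r n x - h x\<bar>) \<le> norm (w x * r n x + w x * h x)"
        by (simp add: distrib_left)
    qed
  qed measurable
  obtain K0 where "\<forall>K\<ge>K0. \<forall>\<^sub>F n in sequentially.
     integrable M (\<lambda>x. w x * r n x) \<and> (\<integral>x. indicator {x. K < w x} x * (w x * r n x) \<partial>M) \<le> 1"
    using ui[unfolded unif_integrable_def, rule_format, of 1] by auto
  then have "\<forall>\<^sub>F n in sequentially. integrable M (\<lambda>x. w x * r n x)"
    by (auto elim: eventually_mono)
  then show "\<forall>\<^sub>F n in sequentially. integrable M (\<lambda>x. w x * \<bar>r n x - h x\<bar>)"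
    by eventually_elim (rule iwd)
  show "(\<lambda>n. \<integral>x. w x * \<bar>r n x - h x\<bar> \<partial>M) \<longlonglongrightarrow> 0"
  proof (rule tendstoI)
    fix \<epsilon> :: real assume \<epsilon>: "\<epsilon> > 0"
    obtain K0 where K0: "\<And>K. K \<ge> K0 \<Longrightarrow> \<forall>\<^sub>F n in sequentially.
     integrable M (\<lambda>x. w x * r n x) \<and> (\<integral>x. indicator {x. K < w x} x * (w x * r n x) \<partial>M) \<le> \<epsilon> / 4"
      using ui[unfolded unif_integrable_def, rule_format, of "\<epsilon>/4"] \<epsilon> by auto
    have "\<forall>\<^sub>F n in sequentially. (\<integral>x. indicator {x. real n < w x} x * (w x * h x) \<partial>M) < \<epsilon> / 4"
      using tail_integral_tendsto[OF h(3) w(1)] \<epsilon> by (intro order_tendstoD) auto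
    moreover have "\<forall>\<^sub>F n in sequentially. max 1 K0 \<le> real n"
      by (metis eventually_sequentiallyI nat_ceiling_le_eq)
    ultimately have "\<forall>\<^sub>F n in sequentially. (\<integral>x. indicator {x. real n < w x} x * (w x * h x) \<partial>M) < \<epsilon> / 4 \<and> max 1 K0 \<le> real n"
      by eventually_elim simp
    then obtain m :: nat where m: "(\<integral>x. indicator {x. real m < w x} x * (w x * h x) \<partial>M) < \<epsilon> / 4" "max 1 K0 \<le> real m"
      by (auto simp: eventually_sequentially)
    define K where "K = real m"
    have K: "K \<ge> 1" "K \<ge> K0" "(\<integral>x. indicator {x. K < w x} x * (w x * h x) \<partial>M) < \<epsilon> / 4"
      using m by (auto simp: K_def)
    have "\<forall>\<^sub>F n in sequentially. (\<integral>x. \<bar>r n x - h x\<bar> \<partial>M) < \<epsilon> / 4 / K"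
      using L1 \<epsilon> K(1) by (intro order_tendstoD) auto
    with K0[OF K(2)] show "\<forall>\<^sub>F n in sequentially. dist (\<integral>x. w x * \<bar>r n x - h x\<bar> \<partial>M) 0 < \<epsilon>"
    proof eventually_elim
      case (elim n)
      let ?i = "\<lambda>x. indicator {x. K < w x} x :: real"
      have ii: "integrable M (\<lambda>x. ?i x * (w x * r n x))" "integrable M (\<lambda>x. ?i x * (w x * h x))"
        using elim h(3) by (auto intro!: integrable_bounded_mult[where c=1] simp: indicator_def)
      have ir: "integrable M (\<lambda>x. \<bar>r n x - h x\<bar>)" using r h by auto
      have "(\<integral>x. w x * \<bar>r n x - h x\<bar> \<partial>M) \<le> (\<integral>x. K * \<bar>r n x - h x\<bar> + (?i x * (w x * r n x) + ?i x * (w x * h x)) \<partial>M)"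
      proof (rule integral_mono)
        show "integrable M (\<lambda>x. w x * \<bar>r n x - h x\<bar>)" using iwd elim by blast
        show "integrable M (\<lambda>x. K * \<bar>r n x - h x\<bar> + (?i x * (w x * r n x) + ?i x * (w x * h x)))"
          using ii ir by auto
        fix x
        show "w x * \<bar>r n x - h x\<bar> \<le> K * \<bar>r n x - h x\<bar> + (?i x * (w x * r n x) + ?i x * (w x * h x))"
        proof (cases "K < w x")
          case True
          have "\<bar>r n x - h x\<bar> \<le> r n x + h x" using r(2)[of n x] h(2)[of x] by simp
          then have "w x * \<bar>r n x - h x\<bar> \<le> w x * (r n x + h x)" using w(2) by (rule mult_left_mono)
          moreover have "0 \<le> K * \<bar>r n x - h x\<bar>" using K(1) by simp
          ultimately show ?thesis using True by (simp add: distrib_left)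
        next
          case False
          then show ?thesis by (simp add: mult_right_mono)
        qed
      qed
      also have "\<dots> = K * (\<integral>x. \<bar>r n x - h x\<bar> \<partial>M) + ((\<integral>x. ?i x * (w x * r n x) \<partial>M) + (\<integral>x. ?i x * (w x * h x) \<partial>M))"
        using ii ir by simp
      also have "\<dots> < \<epsilon>"
      proof -
        have "K * (\<integral>x. \<bar>r n x - h x\<bar> \<partial>M) \<le> K * (\<epsilon> / 4 / K)" using elim K(1) by (intro mult_left_mono) auto
        also have "\<dots> = \<epsilon> / 4" using K(1) by simp
        finally show ?thesis using elim K(3) \<epsilon> by linarith
      qed
      finally have "(\<integral>x. w x * \<bar>r n x - h x\<bar> \<partial>M) < \<epsilon>" .
      moreover have "0 \<le> (\<integral>x. w x * \<bar>r n x - h x\<bar> \<partial>M)" using w(2) by simp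
      ultimately show ?case by simp
    qed
  qed
qed

section \<open>Convergence of the entropies\<close>

context causal_sinkhorn_dens
begin

lemma f_one_L1: "(\<integral>x. \<bar>f (Suc n) x - 1\<bar> \<partial>P) \<le> 2 * sqrt (e (Suc n))"
  using L1_le_kl[OF f_dens one_dens _ _ e_nonneg, of "Suc n" n]
    kl_fun_integral(3)[OF f_dens one_dens _ flnf_kl(1), of n] flnf_kl(2)[of n] by simp

lemma f_one_L1_tendsto: "(\<lambda>n. \<integral>x. \<bar>f (Suc n) x - 1\<bar> \<partial>P) \<longlonglongrightarrow> 0"
proof (rule tendsto_sandwich[OF _ _ tendsto_const])
  have "(\<lambda>n. 2 * sqrt (e (Suc n))) \<longlonglongrightarrow> 2 * sqrt 0"
    by (intro tendsto_intros LIMSEQ_Suc[OF e_tendsto])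
  then show "(\<lambda>n. 2 * sqrt (e (Suc n))) \<longlonglongrightarrow> 0" by simp
qed (auto intro!: always_eventually f_one_L1)

lemma U_integrable: "integrable P U"
proof (rule Bochner_Integration.integrable_bound)
  show "integrable P (\<lambda>x. exp (\<alpha> * U x) / \<alpha>)" using U by auto
  show "AE x in P. norm (U x) \<le> norm (exp (\<alpha> * U x) / \<alpha>)"
  proof (intro AE_I2)
    fix x
    have "\<alpha> * U x \<le> exp (\<alpha> * U x)" using exp_ge_add_one_self[of "\<alpha> * U x"] by linarith
    then have "U x \<le> exp (\<alpha> * U x) / \<alpha>" using U(3) by (simp add: field_simps)
    then show "norm (U x) \<le> norm (exp (\<alpha> * U x) / \<alpha>)" using U(2)[of x] U(3) by simp
  qed
qed measurable

lemma Uf_ui: "unif_integrable P U (\<lambda>n. f (Suc n))"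
proof (rule unif_integrable_exp_moment[where q="\<lambda>n x. 1" and \<alpha>=\<alpha>])
  show "(\<lambda>n. KL P (f (Suc n)) (\<lambda>x. 1)) \<longlonglongrightarrow> 0"
    unfolding flnf_kl(2) by (rule LIMSEQ_Suc[OF e_tendsto])
qed (use U f_dens one_dens flnf_kl in auto)

lemma Uf_integrable: "integrable P (\<lambda>x. U x * \<bar>f (Suc n) x - 1\<bar>)"
proof (rule Bochner_Integration.integrable_bound)
  show "integrable P (\<lambda>x. (kl_fun (f (Suc n) x) 1 + exp (\<alpha> * U x)) / \<alpha> + U x)"
    using U kl_fun_integral(1)[OF f_dens one_dens _ flnf_kl(1)] U_integrable by auto
  show "AE x in P. norm (U x * \<bar>f (Suc n) x - 1\<bar>) \<le> norm ((kl_fun (f (Suc n) x) 1 + exp (\<alpha> * U x)) / \<alpha> + U x)"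
  proof (intro AE_I2)
    fix x
    have "f (Suc n) x * (\<alpha> * U x) \<le> kl_fun (f (Suc n) x) 1 + 1 * (exp (\<alpha> * U x) - 1)"
      by (rule kl_fun_young) auto
    then have "f (Suc n) x * U x \<le> (kl_fun (f (Suc n) x) 1 + exp (\<alpha> * U x)) / \<alpha>"
      using U(3) by (simp add: field_simps)
    moreover have "\<bar>f (Suc n) x - 1\<bar> \<le> f (Suc n) x + 1" using f_nz(2)[of "Suc n" x] by linarith
    then have "U x * \<bar>f (Suc n) x - 1\<bar> \<le> U x * (f (Suc n) x + 1)" using U(2) by (rule mult_left_mono)
    ultimately have "U x * \<bar>f (Suc n) x - 1\<bar> \<le> (kl_fun (f (Suc n) x) 1 + exp (\<alpha> * U x)) / \<alpha> + U x"
      by (simp add: algebra_simps)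
    then show "norm (U x * \<bar>f (Suc n) x - 1\<bar>) \<le> norm ((kl_fun (f (Suc n) x) 1 + exp (\<alpha> * U x)) / \<alpha> + U x)"
      using U(2)[of x] by simp
  qed
qed measurable

lemma Uf_tendsto: "(\<lambda>n. \<integral>x. U x * \<bar>f (Suc n) x - 1\<bar> \<partial>P) \<longlonglongrightarrow> 0"
  by (rule L1_weighted_tendsto(2)[OF U_measP U(2) f_int(1) _ _ _ _ f_one_L1_tendsto Uf_ui])
    (auto simp: U_integrable)

text \<open>Sum of the errors that \<open>\<psi>_upper\<close> produces for a test function
  \<open>g\<close> of mass \<open>m\<close> below \<open>\<bar>f n - 1\<bar>\<close>: the first two
  terms bound the integral of \<open>g * ln g\<close>, the square root bounds
  \<open>- m * ln m\<close>, and the last term bounds the integral of \<open>U * g\<close>.\<close>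

definition \<eta> :: "nat \<Rightarrow> real" where
  "\<eta> n = e n + (\<integral>x. \<bar>f n x - 1\<bar> \<partial>P) + sqrt (\<integral>x. \<bar>f n x - 1\<bar> \<partial>P) + (\<integral>x. U x * \<bar>f n x - 1\<bar> \<partial>P)"

lemma \<eta>_tendsto: "(\<lambda>n. \<eta> (Suc n)) \<longlonglongrightarrow> 0"
proof -
  have "(\<lambda>n. \<eta> (Suc n)) \<longlonglongrightarrow> 0 + 0 + sqrt 0 + 0"
    unfolding \<eta>_def by (intro tendsto_intros f_one_L1_tendsto Uf_tendsto LIMSEQ_Suc[OF e_tendsto])
  then show ?thesis by simp
qed

lemma neg_xlnx_le_sqrt: "- (x * ln x) \<le> sqrt x" if "0 \<le> x" for x :: real
proof (cases "x = 0")
  case False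
  then have x: "0 < sqrt x" using that by simp
  have "ln (1 / sqrt x) \<le> 1 / sqrt x - 1" by (rule ln_le_minus_one) (use x in simp)
  then have 1: "- ln (sqrt x) \<le> 1 / sqrt x - 1" using x by (simp add: ln_div)
  \<comment> \<open>The argument \<open>1 / (2 * sqrt x)\<close> rather than
    \<open>1 / sqrt x\<close> gives the constant 1 in the end; its price \<open>ln 2\<close> is
    absorbed by the 1 in \<open>ln t \<le> t - 1\<close>.\<close>
  have "ln (1 / (2 * sqrt x)) \<le> 1 / (2 * sqrt x) - 1" by (rule ln_le_minus_one) (use x in simp)
  then have "- ln (sqrt x) \<le> 1 / (2 * sqrt x) - 1 + ln 2" using x by (simp add: ln_div ln_mult)
  moreover have "ln 2 \<le> (1::real)" using ln_le_minus_one[of "2::real"] by simp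
  ultimately have "- ln (sqrt x) \<le> 1 / (2 * sqrt x)" by linarith
  then have "(sqrt x)\<^sup>2 * (- ln (sqrt x)) \<le> (sqrt x)\<^sup>2 * (1 / (2 * sqrt x))" by (intro mult_left_mono) auto
  also have "\<dots> = sqrt x / 2" using x by (simp add: real_div_sqrt)
  finally have "- (x * ln (sqrt x)) \<le> sqrt x / 2" using that by simp
  then show ?thesis using False that by (simp add: ln_sqrt)
qed simp

text \<open>Where \<open>f n > 1\<close>, the upper bound on the potential compensates the excess mass.\<close>

lemma \<psi>_excess:
  shows "integrable P (\<lambda>x. max 0 (\<psi> m x) * max 0 (f (Suc n) x - 1))"
    "(\<integral>x. max 0 (\<psi> m x) * max 0 (f (Suc n) x - 1) \<partial>P) \<le> \<eta> (Suc n)"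
proof -
  let ?f = "f (Suc n)"
  let ?q = "\<lambda>x. max 0 (?f x - 1)"
  \<comment> \<open>\<open>\<psi>_upper\<close> accepts only bounded test functions in
    \<open>y\<close>: cut at \<open>j\<close>, restrict to where the potential is positive, and let
    \<open>j\<close> tend to infinity by Fatou's lemma.\<close>
  define g where "g j x = (if \<psi> m x > 0 then min (?q x) (real j) else 0)" for j x
  have gm: "g j \<in> borel_measurable (F 0 N)" for j
    unfolding g_def using f_meas \<psi>_meas by measurable
  have gP[measurable]: "g j \<in> borel_measurable P" for j using gm meas_F[of 0 N] by auto
  have g0: "0 \<le> g j x" "g j x \<le> real j" "g j x \<le> ?q x" for j x unfolding g_def by auto
  let ?\<epsilon> = "\<integral>x. \<bar>?f x - 1\<bar> \<partial>P"
  have if1: "integrable P (\<lambda>x. \<bar>?f x - 1\<bar>)" using f_int(1) by auto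
  have ig: "integrable P (g j)" for j by (rule integrable_const_bound[of _ "real j"]) (use g0 in auto)
  have iglng: "integrable P (\<lambda>x. g j x * ln (g j x))" for j
    by (rule integrable_const_bound[of _ "1 + real j * real j"]) (use bounded_xlnx[OF g0(1,2)] in auto)
  have iUg: "integrable P (\<lambda>x. U x * g j x)" for j
    using integrable_bounded_mult[OF U_integrable gP, of j "real j"] g0 by (simp add: mult.commute)
  have i\<psi>g: "integrable P (\<lambda>x. g j x * \<psi> m x)" for j
    by (rule integrable_bounded_mult[OF \<psi>_integrable gP, of j "real j"]) (use g0 in auto)
  note k = kl_fun_integral[OF f_dens one_dens _ flnf_kl(1), of n]
  have b: "(\<integral>x. g j x * \<psi> m x \<partial>P) \<le> \<eta> (Suc n)" for j
  proof -
    let ?m = "\<integral>x. g j x \<partial>P"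
    have "(\<integral>x. g j x * \<psi> m x \<partial>P) \<le> (\<integral>x. g j x * ln (g j x) \<partial>P) - ?m * ln ?m + (\<integral>x. U x * g j x \<partial>P)"
      by (rule \<psi>_upper[OF gm g0(1,2)])
    moreover have "(\<integral>x. g j x * ln (g j x) \<partial>P) \<le> (\<integral>x. kl_fun (?f x) 1 + \<bar>?f x - 1\<bar> \<partial>P)"
    proof (rule integral_mono[OF iglng])
      show "integrable P (\<lambda>x. kl_fun (?f x) 1 + \<bar>?f x - 1\<bar>)" using k(1) if1 by auto
      fix x
      have k0: "0 \<le> kl_fun (?f x) 1" by (rule kl_fun_nonneg) auto
      \<comment> \<open>Where \<open>g > 1\<close>, also \<open>g \<le> f\<close>, and
        \<open>f * ln f\<close> is \<open>kl_fun f 1 + f - 1\<close>; where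
        \<open>g \<le> 1\<close>, the left side is nonpositive.\<close>
      show "g j x * ln (g j x) \<le> kl_fun (?f x) 1 + \<bar>?f x - 1\<bar>"
      proof (cases "g j x \<le> 1")
        case True
        have "ln (g j x) \<le> 0 \<or> g j x = 0" using True g0(1)[of j x] by (cases "g j x = 0") auto
        then have "g j x * ln (g j x) \<le> 0" using g0(1)[of j x] by (auto intro: mult_nonneg_nonpos)
        then show ?thesis using k0 by linarith
      next
        case False
        then have 1: "1 < g j x" "g j x \<le> ?f x" using g0(3)[of j x] by (auto simp: max_def split: if_splits)
        then have "ln (g j x) \<le> ln (?f x)" "0 \<le> ln (g j x)" by auto
        then have "g j x * ln (g j x) \<le> ?f x * ln (?f x)" using 1 by (intro mult_mono) auto
        then show ?thesis by (simp add: kl_fun_def)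
      qed
    qed
    moreover have "(\<integral>x. kl_fun (?f x) 1 + \<bar>?f x - 1\<bar> \<partial>P) = e (Suc n) + ?\<epsilon>" using k(1,2) if1 flnf_kl(2) by simp
    moreover have "- (?m * ln ?m) \<le> sqrt ?\<epsilon>"
    proof -
      have m0: "0 \<le> ?m" using g0(1) by simp
      have "?m \<le> ?\<epsilon>"
      proof (rule integral_mono[OF ig if1])
        fix x show "g j x \<le> \<bar>?f x - 1\<bar>" using g0(3)[of j x] by (auto simp: max_def split: if_splits)
      qed
      then have "sqrt ?m \<le> sqrt ?\<epsilon>" by simp
      with neg_xlnx_le_sqrt[OF m0] show ?thesis by (rule order_trans)
    qed
    moreover have "(\<integral>x. U x * g j x \<partial>P) \<le> (\<integral>x. U x * \<bar>?f x - 1\<bar> \<partial>P)"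
    proof (rule integral_mono[OF iUg Uf_integrable])
      fix x
      have "g j x \<le> \<bar>?f x - 1\<bar>" using g0(3)[of j x] by (auto simp: max_def split: if_splits)
      then show "U x * g j x \<le> U x * \<bar>?f x - 1\<bar>" using U(2) by (rule mult_left_mono)
    qed
    ultimately show ?thesis unfolding \<eta>_def by linarith
  qed
  have \<eta>0: "0 \<le> \<eta> (Suc n)" unfolding \<eta>_def using e_nonneg U(2) by simp
  let ?w = "\<lambda>x. max 0 (\<psi> m x) * ?q x"
  have w0: "0 \<le> ?w x" for x by simp
  have gw: "g j x * \<psi> m x = max 0 (\<psi> m x) * min (?q x) (real j)" for j x
    by (auto simp: g_def max_def)
  have lim: "(\<lambda>j. ennreal (g j x * \<psi> m x)) \<longlonglongrightarrow> ennreal (?w x)" for x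
  proof (rule tendsto_eventually)
    have "\<forall>\<^sub>F j in sequentially. ?q x \<le> real j" by (metis eventually_sequentiallyI nat_ceiling_le_eq)
    then show "\<forall>\<^sub>F j in sequentially. ennreal (g j x * \<psi> m x) = ennreal (?w x)"
      by eventually_elim (simp add: gw min_absorb1)
  qed
  have "(\<integral>\<^sup>+x. ennreal (?w x) \<partial>P) = (\<integral>\<^sup>+x. liminf (\<lambda>j. ennreal (g j x * \<psi> m x)) \<partial>P)"
    by (intro nn_integral_cong) (metis lim lim_imp_Liminf trivial_limit_sequentially)
  also have "\<dots> \<le> liminf (\<lambda>j. \<integral>\<^sup>+x. ennreal (g j x * \<psi> m x) \<partial>P)"
    by (intro nn_integral_liminf) auto
  also have "\<dots> \<le> ennreal (\<eta> (Suc n))"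
  proof (intro Liminf_le always_eventually allI)
    fix j
    have "(\<integral>\<^sup>+x. ennreal (g j x * \<psi> m x) \<partial>P) = ennreal (\<integral>x. g j x * \<psi> m x \<partial>P)"
      by (rule nn_integral_eq_integral[OF i\<psi>g]) (auto simp: gw)
    then show "(\<integral>\<^sup>+x. ennreal (g j x * \<psi> m x) \<partial>P) \<le> ennreal (\<eta> (Suc n))" using b by (simp add: ennreal_leI)
  qed simp
  finally have n: "(\<integral>\<^sup>+x. ennreal (?w x) \<partial>P) \<le> ennreal (\<eta> (Suc n))" .
  show i: "integrable P ?w"
    using n by (intro integrableI_nonneg) (auto simp: le_less_trans)
  show "(\<integral>x. ?w x \<partial>P) \<le> \<eta> (Suc n)"
    using n nn_integral_eq_integral[OF i] \<eta>0 by simp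
qed

text \<open>A mixed second order term: up to the factor 4 it dominates the integral of the positive
  part of \<open>ln (f k)\<close> times that of \<open>1 - f n\<close>.\<close>

definition hell :: "nat \<Rightarrow> nat \<Rightarrow> real" where
  "hell k n = (\<integral>x. \<bar>sqrt (f k x) - 1\<bar> * \<bar>sqrt (f n x) - 1\<bar> \<partial>P)"

lemma hell_sq: "integrable P (\<lambda>x. (sqrt (f n x) - 1)\<^sup>2)" "(\<integral>x. (sqrt (f n x) - 1)\<^sup>2 \<partial>P) \<le> 2"
  "(\<integral>x. (sqrt (f (Suc n) x) - 1)\<^sup>2 \<partial>P) \<le> e (Suc n)"
proof -
  have le: "(sqrt (f n x) - 1)\<^sup>2 \<le> f n x + 1" for n x
    by (simp add: power2_eq_square algebra_simps)
  show i: "integrable P (\<lambda>x. (sqrt (f n x) - 1)\<^sup>2)" for n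
  proof (rule Bochner_Integration.integrable_bound)
    show "integrable P (\<lambda>x. f n x + 1)" using f_int(1) by auto
    show "AE x in P. norm ((sqrt (f n x) - 1)\<^sup>2) \<le> norm (f n x + 1)"
      using le[of n] by (intro AE_I2) (simp add: add_nonneg_nonneg)
  qed measurable
  have "(\<integral>x. (sqrt (f n x) - 1)\<^sup>2 \<partial>P) \<le> (\<integral>x. f n x + 1 \<partial>P)"
    using f_int(1) le by (intro integral_mono i) auto
  then show "(\<integral>x. (sqrt (f n x) - 1)\<^sup>2 \<partial>P) \<le> 2" using f_int by (simp add: prob_space)
  note k = kl_fun_integral[OF f_dens one_dens _ flnf_kl(1), of n]
  have "(\<integral>x. (sqrt (f (Suc n) x) - 1)\<^sup>2 \<partial>P) \<le> (\<integral>x. kl_fun (f (Suc n) x) 1 \<partial>P)"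
    using k(1) kl_fun_hellinger[of _ 1] by (intro integral_mono i) auto
  then show "(\<integral>x. (sqrt (f (Suc n) x) - 1)\<^sup>2 \<partial>P) \<le> e (Suc n)" using k(2) flnf_kl(2) by simp
qed

text \<open>The free weight \<open>t\<close> is for small \<open>k\<close>, where the first integral
  is merely bounded while the second tends to 0 with \<open>n\<close>; for large \<open>k\<close>
  the choice \<open>t = 1\<close> suffices.\<close>

lemma hell_bound:
  assumes "t > 0"
  shows "integrable P (\<lambda>x. \<bar>sqrt (f k x) - 1\<bar> * \<bar>sqrt (f n x) - 1\<bar>)"
    "hell k n \<le> t / 2 * (\<integral>x. (sqrt (f k x) - 1)\<^sup>2 \<partial>P) + (\<integral>x. (sqrt (f n x) - 1)\<^sup>2 \<partial>P) / (2 * t)"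
proof -
  have le: "\<bar>sqrt (f k x) - 1\<bar> * \<bar>sqrt (f n x) - 1\<bar> \<le> t / 2 * (sqrt (f k x) - 1)\<^sup>2 + (sqrt (f n x) - 1)\<^sup>2 / (2 * t)" if "t > 0" for x t
  proof -
    let ?a = "\<bar>sqrt (f k x) - 1\<bar>" and ?b = "\<bar>sqrt (f n x) - 1\<bar>"
    have "0 \<le> (t * ?a - ?b)\<^sup>2" by simp
    then have "2 * t * (?a * ?b) \<le> t\<^sup>2 * ?a\<^sup>2 + ?b\<^sup>2" by (simp add: power2_eq_square algebra_simps)
    then have "?a * ?b \<le> (t\<^sup>2 * ?a\<^sup>2 + ?b\<^sup>2) / (2 * t)" using that by (simp add: field_simps)
    also have "\<dots> = t / 2 * ?a\<^sup>2 + ?b\<^sup>2 / (2 * t)" using that by (simp add: field_simps power2_eq_square)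
    finally show ?thesis by simp
  qed
  show i: "integrable P (\<lambda>x. \<bar>sqrt (f k x) - 1\<bar> * \<bar>sqrt (f n x) - 1\<bar>)"
  proof (rule Bochner_Integration.integrable_bound)
    show "integrable P (\<lambda>x. t / 2 * (sqrt (f k x) - 1)\<^sup>2 + (sqrt (f n x) - 1)\<^sup>2 / (2 * t))" using hell_sq(1) by auto
    show "AE x in P. norm (\<bar>sqrt (f k x) - 1\<bar> * \<bar>sqrt (f n x) - 1\<bar>) \<le> norm (t / 2 * (sqrt (f k x) - 1)\<^sup>2 + (sqrt (f n x) - 1)\<^sup>2 / (2 * t))"
    proof (intro AE_I2)
      fix x
      have "norm (\<bar>sqrt (f k x) - 1\<bar> * \<bar>sqrt (f n x) - 1\<bar>) = \<bar>sqrt (f k x) - 1\<bar> * \<bar>sqrt (f n x) - 1\<bar>" by simp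
      also note le[OF assms, of x]
      finally show "norm (\<bar>sqrt (f k x) - 1\<bar> * \<bar>sqrt (f n x) - 1\<bar>) \<le> norm (t / 2 * (sqrt (f k x) - 1)\<^sup>2 + (sqrt (f n x) - 1)\<^sup>2 / (2 * t))"
        unfolding real_norm_def by (rule order_trans[OF _ abs_ge_self])
    qed
  qed measurable
  have "hell k n \<le> (\<integral>x. t / 2 * (sqrt (f k x) - 1)\<^sup>2 + (sqrt (f n x) - 1)\<^sup>2 / (2 * t) \<partial>P)"
    unfolding hell_def using hell_sq(1) le[OF assms] by (intro integral_mono i) auto
  then show "hell k n \<le> t / 2 * (\<integral>x. (sqrt (f k x) - 1)\<^sup>2 \<partial>P) + (\<integral>x. (sqrt (f n x) - 1)\<^sup>2 \<partial>P) / (2 * t)"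
    using hell_sq(1) by simp
qed

text \<open>The marginal entropies \<open>e k\<close> decrease and are summable, so the double products are dominated
  by a tail of the series.\<close>

lemma hell_sum_tendsto: "(\<lambda>n. \<Sum>k<n. hell k n) \<longlonglongrightarrow> 0"
proof (rule tendstoI)
  fix \<epsilon> :: real assume \<epsilon>: "\<epsilon> > 0"
  obtain J0 where J0: "\<And>m n. J0 \<le> m \<Longrightarrow> norm (sum A {m..<n}) < \<epsilon> / 2"
    using summable_A \<epsilon> unfolding summable_Cauchy by (meson half_gt_zero)
  \<comment> \<open>The successor makes \<open>J\<close> positive, so that every
    \<open>k \<ge> J\<close> has the form \<open>Suc k'\<close>, for which the bounds by
    \<open>e\<close> hold.\<close>
  define J where "J = Suc J0"
  \<comment> \<open>\<open>J\<close> terms of size \<open>t\<close> sum to \<epsilon> / 8; the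
    smallness of \<open>e n\<close> required next gives another \<epsilon> / 8.\<close>
  define t where "t = \<epsilon> / (8 * real J)"
  have J: "J > 0" and t: "t > 0" using \<epsilon> by (auto simp: J_def t_def)
  have "\<forall>\<^sub>F n in sequentially. e n < t * \<epsilon> / (4 * real J)"
    using e_tendsto \<epsilon> J t by (intro order_tendstoD) auto
  moreover have "\<forall>\<^sub>F n in sequentially. J \<le> n" by (rule eventually_ge_at_top)
  ultimately show "\<forall>\<^sub>F n in sequentially. dist (\<Sum>k<n. hell k n) 0 < \<epsilon>"
  proof eventually_elim
    case (elim n)
    then obtain n' where n': "n = Suc n'" using J by (cases n) auto
    have "(\<Sum>k<n. hell k n) = (\<Sum>k<J. hell k n) + (\<Sum>k=J..<n. hell k n)"
      using elim(2) by (metis sum.atLeastLessThan_concat lessThan_atLeast0 zero_le)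
    also have "(\<Sum>k<J. hell k n) \<le> (\<Sum>k<J. t + e n / (2 * t))"
    proof (rule sum_mono)
      fix k
      have "hell k n \<le> t / 2 * (\<integral>x. (sqrt (f k x) - 1)\<^sup>2 \<partial>P) + (\<integral>x. (sqrt (f n x) - 1)\<^sup>2 \<partial>P) / (2 * t)"
        by (rule hell_bound(2)[OF t])
      also have "\<dots> \<le> t / 2 * 2 + e n / (2 * t)"
        using hell_sq(2)[of k] hell_sq(3)[of n'] t n' by (intro add_mono mult_left_mono divide_right_mono) auto
      finally show "hell k n \<le> t + e n / (2 * t)" by simp
    qed
    also have "\<dots> = real J * t + real J * e n / (2 * t)" by (simp add: distrib_left)
    also have "\<dots> \<le> \<epsilon> / 8 + \<epsilon> / 8"
    proof (rule add_mono)
      show "real J * t \<le> \<epsilon> / 8" using J by (simp add: t_def)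
      have "real J * e n \<le> real J * (t * \<epsilon> / (4 * real J))" using elim(1) by (intro mult_left_mono) auto
      also have "\<dots> = t * \<epsilon> / 4" using J by simp
      finally show "real J * e n / (2 * t) \<le> \<epsilon> / 8" using t by (simp add: field_simps)
    qed
    also have "(\<Sum>k=J..<n. hell k n) \<le> (\<Sum>k=J..<n. A k)"
    proof (rule sum_mono)
      fix k assume k: "k \<in> {J..<n}"
      then obtain k' where k': "k = Suc k'" using J by (cases k) auto
      have "hell k n \<le> 1 / 2 * (\<integral>x. (sqrt (f k x) - 1)\<^sup>2 \<partial>P) + (\<integral>x. (sqrt (f n x) - 1)\<^sup>2 \<partial>P) / (2 * 1)"
        by (rule hell_bound(2)) simp
      also have "\<dots> \<le> 1 / 2 * e k + e n / (2 * 1)"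
        using hell_sq(3)[of k'] hell_sq(3)[of n'] k' n' by (intro add_mono mult_left_mono divide_right_mono) auto
      \<comment> \<open>\<open>e n \<le> e k\<close> because \<open>k < n\<close>: the later
        marginal is absorbed by the earlier one.\<close>
      also have "\<dots> \<le> e k" using e_decreasing[of k' n] k k' by simp
      also have "\<dots> \<le> A k" using e_le_A[of k'] k' by simp
      finally show "hell k n \<le> A k" .
    qed
    also have "sum A {J..<n} < \<epsilon> / 2" using J0[of J n] by (simp add: J_def)
    finally have "(\<Sum>k<n. hell k n) < \<epsilon>" using \<epsilon> by simp
    moreover have "0 \<le> (\<Sum>k<n. hell k n)" unfolding hell_def by (intro sum_nonneg) simp
    ultimately show ?case by simp
  qed
qed

lemma ln_pos_le_sqrt: "max 0 (ln x) \<le> 2 * \<bar>sqrt x - 1\<bar>" if "0 < x" for x :: real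
proof (cases "x \<ge> 1")
  case True
  have "ln (sqrt x) \<le> sqrt x - 1" by (rule ln_le_minus_one) (use that in simp)
  then show ?thesis using that True by (simp add: ln_sqrt max_def)
next
  case False
  then have "ln x \<le> 0" using that by simp
  then show ?thesis by (simp add: max_def)
qed

lemma one_minus_le_sqrt: "max 0 (1 - x) \<le> 2 * \<bar>sqrt x - 1\<bar>" if "0 < x" for x :: real
proof (cases "x \<ge> 1")
  case False
  have s: "sqrt x \<le> 1" "0 \<le> sqrt x" using False that by auto
  have "1 - x = (1 - sqrt x) * (1 + sqrt x)" using that by (simp add: algebra_simps)
  also have "\<dots> \<le> (1 - sqrt x) * 2" using s by (intro mult_left_mono) auto
  finally show ?thesis using s False by simp
qed simp

text \<open>The difference is the integral of \<open>\<psi> * (f - 1)\<close>. Where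
  \<open>f \<ge> 1\<close>, \<open>\<psi>_excess\<close> applies. Elsewhere \<open>- \<psi>\<close>
  is at most the sum of the positive parts of the \<open>ln (f k)\<close>; each of these and
  \<open>1 - f\<close> are at most twice a defect of square roots, whence the 4.\<close>

lemma \<psi>_f:
  shows "k < Suc n \<Longrightarrow> integrable P (\<lambda>x. f (Suc n) x * ln (f k x))"
    "integrable P (\<lambda>x. \<psi> (Suc n) x * f (Suc n) x)"
    "(\<integral>x. \<psi> (Suc n) x * f (Suc n) x \<partial>P) - (\<integral>x. \<psi> (Suc n) x \<partial>P) \<le> \<eta> (Suc n) + 4 * (\<Sum>k<Suc n. hell k (Suc n))"
proof -
  note sum.lessThan_Suc [simp del]
  let ?n = "Suc n" and ?f = "f (Suc n)"
  have lp: "integrable P (\<lambda>x. max 0 (ln (f k x)) * ?f x)" for k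
  proof (rule Bochner_Integration.integrable_bound)
    show "integrable P (\<lambda>x. kl_fun (?f x) 1 + f k x)"
      using kl_fun_integral(1)[OF f_dens one_dens _ flnf_kl(1)] f_int(1) by auto
    show "AE x in P. norm (max 0 (ln (f k x)) * ?f x) \<le> norm (kl_fun (?f x) 1 + f k x)"
    proof (intro AE_I2)
      fix x
      have "?f x * max 0 (ln (f k x)) \<le> kl_fun (?f x) 1 + 1 * (exp (max 0 (ln (f k x))) - 1)"
        by (rule kl_fun_young) auto
      also have "exp (max 0 (ln (f k x))) - 1 \<le> f k x" by (simp add: max_def)
      finally have "max 0 (ln (f k x)) * ?f x \<le> kl_fun (?f x) 1 + f k x" by (simp add: mult.commute)
      then show "norm (max 0 (ln (f k x)) * ?f x) \<le> norm (kl_fun (?f x) 1 + f k x)" by simp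
    qed
  qed measurable
  have \<psi>p: "integrable P (\<lambda>x. max 0 (\<psi> ?n x) * ?f x)"
  proof (rule Bochner_Integration.integrable_bound)
    show "integrable P (\<lambda>x. \<bar>\<psi> ?n x\<bar> + max 0 (\<psi> ?n x) * max 0 (?f x - 1))"
      using \<psi>_integrable \<psi>_excess(1) by auto
    show "AE x in P. norm (max 0 (\<psi> ?n x) * ?f x) \<le> norm (\<bar>\<psi> ?n x\<bar> + max 0 (\<psi> ?n x) * max 0 (?f x - 1))"
    proof (intro AE_I2)
      fix x
      have "max 0 (\<psi> ?n x) * ?f x \<le> max 0 (\<psi> ?n x) * (1 + max 0 (?f x - 1))" by (intro mult_left_mono) auto
      also have "\<dots> \<le> \<bar>\<psi> ?n x\<bar> + max 0 (\<psi> ?n x) * max 0 (?f x - 1)" by (simp add: distrib_left)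
      finally show "norm (max 0 (\<psi> ?n x) * ?f x) \<le> norm (\<bar>\<psi> ?n x\<bar> + max 0 (\<psi> ?n x) * max 0 (?f x - 1))" by simp
    qed
  qed measurable
  \<comment> \<open>Young's inequality gives only the positive parts of the logarithms. The negative
    part of a single one is at most \<open>\<psi>\<close> plus the positive parts of the others, so
    the bound on the potential controls it.\<close>
  have il: "integrable P (\<lambda>x. ?f x * ln (f k x))" if k: "k < ?n" for k
  proof (rule Bochner_Integration.integrable_bound)
    let ?s = "\<lambda>x. \<Sum>j<?n. max 0 (ln (f j x)) * ?f x"
    show "integrable P (\<lambda>x. max 0 (\<psi> ?n x) * ?f x + ?s x)"
      using \<psi>p lp by (intro Bochner_Integration.integrable_add Bochner_Integration.integrable_sum) auto
    show "AE x in P. norm (?f x * ln (f k x)) \<le> norm (max 0 (\<psi> ?n x) * ?f x + ?s x)"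
    proof (intro AE_I2)
      fix x
      let ?t = "\<Sum>j<?n. max 0 (ln (f j x))"
      have t: "max 0 (ln (f k x)) \<le> ?t" by (rule member_le_sum) (use k in auto)
      have t0: "0 \<le> ?t" by (intro sum_nonneg) auto
      have "\<psi> ?n x + ln (f k x) = - (\<Sum>j\<in>{..<?n} - {k}. ln (f j x))"
        unfolding \<psi>_def using k by (subst sum.remove[of _ k]) auto
      moreover have "(\<Sum>j\<in>{..<?n} - {k}. ln (f j x)) \<le> (\<Sum>j\<in>{..<?n} - {k}. max 0 (ln (f j x)))"
        by (intro sum_mono) auto
      moreover have "(\<Sum>j\<in>{..<?n} - {k}. max 0 (ln (f j x))) \<le> ?t" by (intro sum_mono2) auto
      ultimately have "- ln (f k x) \<le> \<psi> ?n x + ?t" by linarith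
      then have "\<bar>ln (f k x)\<bar> \<le> max 0 (\<psi> ?n x) + ?t" using t t0 by linarith
      then have "\<bar>ln (f k x)\<bar> * ?f x \<le> (max 0 (\<psi> ?n x) + ?t) * ?f x" by (intro mult_right_mono) auto
      also have "\<dots> = max 0 (\<psi> ?n x) * ?f x + ?s x" by (simp only: distrib_right sum_distrib_right)
      finally have "norm (?f x * ln (f k x)) \<le> max 0 (\<psi> ?n x) * ?f x + ?s x" by (simp add: abs_mult mult.commute)
      then show "norm (?f x * ln (f k x)) \<le> norm (max 0 (\<psi> ?n x) * ?f x + ?s x)"
        unfolding real_norm_def by (rule order_trans[OF _ abs_ge_self])
    qed
  qed measurable
  then show "k < Suc n \<Longrightarrow> integrable P (\<lambda>x. f (Suc n) x * ln (f k x))" by blast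
  have e\<psi>: "\<psi> ?n x * ?f x = - (\<Sum>k<?n. ?f x * ln (f k x))" for x
    unfolding \<psi>_def by (simp add: sum_distrib_left mult.commute[of _ "?f x"] del: sum.lessThan_Suc)
  show i\<psi>f: "integrable P (\<lambda>x. \<psi> ?n x * ?f x)"
    unfolding e\<psi> using il by (intro Bochner_Integration.integrable_minus Bochner_Integration.integrable_sum) auto
  let ?h = "\<lambda>x. \<Sum>k<?n. \<bar>sqrt (f k x) - 1\<bar> * \<bar>sqrt (?f x) - 1\<bar>"
  have ih: "integrable P ?h" by (intro Bochner_Integration.integrable_sum hell_bound(1)[of 1]) auto
  have "(\<integral>x. \<psi> ?n x * ?f x \<partial>P) - (\<integral>x. \<psi> ?n x \<partial>P) = (\<integral>x. \<psi> ?n x * ?f x - \<psi> ?n x \<partial>P)"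
    using i\<psi>f \<psi>_integrable by simp
  also have "\<dots> \<le> (\<integral>x. max 0 (\<psi> ?n x) * max 0 (?f x - 1) + 4 * ?h x \<partial>P)"
  proof (rule integral_mono)
    show "integrable P (\<lambda>x. \<psi> ?n x * ?f x - \<psi> ?n x)" using i\<psi>f \<psi>_integrable by auto
    show "integrable P (\<lambda>x. max 0 (\<psi> ?n x) * max 0 (?f x - 1) + 4 * ?h x)"
      using \<psi>_excess(1) ih by auto
    fix x
    have h0: "0 \<le> ?h x" by (intro sum_nonneg) auto
    show "\<psi> ?n x * ?f x - \<psi> ?n x \<le> max 0 (\<psi> ?n x) * max 0 (?f x - 1) + 4 * ?h x"
    proof (cases "?f x \<ge> 1")
      case True
      have "\<psi> ?n x * (?f x - 1) \<le> max 0 (\<psi> ?n x) * (?f x - 1)" using True by (intro mult_right_mono) auto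
      then show ?thesis using True h0 by (simp add: algebra_simps)
    next
      case False
      have "- \<psi> ?n x \<le> (\<Sum>k<?n. max 0 (ln (f k x)))" unfolding \<psi>_def by (simp, intro sum_mono add_mono) auto
      also have "\<dots> \<le> (\<Sum>k<?n. 2 * \<bar>sqrt (f k x) - 1\<bar>)" by (intro sum_mono ln_pos_le_sqrt) simp
      finally have 1: "- \<psi> ?n x \<le> (\<Sum>k<?n. 2 * \<bar>sqrt (f k x) - 1\<bar>)" .
      have 2: "1 - ?f x \<le> 2 * \<bar>sqrt (?f x) - 1\<bar>" using one_minus_le_sqrt[of "?f x"] by simp
      have "(- \<psi> ?n x) * (1 - ?f x) \<le> (\<Sum>k<?n. 2 * \<bar>sqrt (f k x) - 1\<bar>) * (1 - ?f x)"
        using 1 False by (intro mult_right_mono) auto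
      also have "\<dots> \<le> (\<Sum>k<?n. 2 * \<bar>sqrt (f k x) - 1\<bar>) * (2 * \<bar>sqrt (?f x) - 1\<bar>)"
        using 2 by (intro mult_left_mono sum_nonneg) auto
      also have "\<dots> = 4 * ?h x"
        unfolding sum_distrib_right sum_distrib_left by (intro sum.cong) auto
      finally have "\<psi> ?n x * ?f x - \<psi> ?n x \<le> 4 * ?h x" by (simp add: algebra_simps)
      then show ?thesis by (simp add: add_increasing)
    qed
  qed
  also have "\<dots> = (\<integral>x. max 0 (\<psi> ?n x) * max 0 (?f x - 1) \<partial>P) + 4 * (\<Sum>k<?n. hell k ?n)"
  proof -
    have "(\<integral>x. ?h x \<partial>P) = (\<Sum>k<?n. hell k ?n)"
      unfolding hell_def by (intro Bochner_Integration.integral_sum hell_bound(1)[of 1]) auto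
    then show ?thesis using \<psi>_excess(1) ih by simp
  qed
  also have "\<dots> \<le> \<eta> ?n + 4 * (\<Sum>k<?n. hell k ?n)" using \<psi>_excess(2) by simp
  finally show "(\<integral>x. \<psi> ?n x * ?f x \<partial>P) - (\<integral>x. \<psi> ?n x \<partial>P) \<le> \<eta> ?n + 4 * (\<Sum>k<?n. hell k ?n)" .
qed

text \<open>The telescoped identity tested with \<open>Rh n\<close> itself, whose second marginal
  has density \<open>f n\<close>. Replacing \<open>f n\<close> by 1 costs the error of
  \<open>\<psi>_f\<close>; after that the sum is the one that \<open>AB_bound\<close> compares with
  \<open>K\<close>.\<close>

lemma entropy_Rh:
  shows "kl_integrable P (Rh (Suc n)) (R 0)"
    "KL P (Rh (Suc n)) (R 0) \<le> K + \<eta> (Suc n) + 4 * (\<Sum>k<Suc n. hell k (Suc n))"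
proof -
  note sum.lessThan_Suc [simp del]
  let ?n = "Suc n"
  have lm: "(\<lambda>x. ln (f k x)) \<in> borel_measurable (F 0 N)" for k using f_meas by measurable
  have i: "integrable P (\<lambda>x. Rh ?n x * ln (f k x))" if "k < ?n" for k
    using marginalD(1)[OF marginal_Rh[of ?n] lm[of k]] \<psi>_f(1)[OF that] by (simp add: mult.commute)
  have eq: "(\<integral>x. Rh ?n x * ln (f k x) \<partial>P) = (\<integral>x. f ?n x * ln (f k x) \<partial>P)" for k
    using marginalD(2)[OF marginal_Rh[of ?n] lm[of k]] by (simp add: mult.commute)
  show "kl_integrable P (Rh (Suc n)) (R 0)"
    using causal_telescope(1)[OF Rh_causal i] A_integrable by simp
  have "KL P (Rh ?n) (R 0) = (\<Sum>k<?n. A k - (\<integral>x. f ?n x * ln (f k x) \<partial>P)) + A ?n"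
    using causal_telescope(2)[OF Rh_causal i A_integrable] by (simp add: eq A_def)
  also have "\<dots> = (\<Sum>k<?n. A k) + A ?n + (\<integral>x. \<psi> ?n x * f ?n x \<partial>P)"
  proof -
    have "(\<integral>x. \<psi> ?n x * f ?n x \<partial>P) = (\<integral>x. - (\<Sum>k<?n. f ?n x * ln (f k x)) \<partial>P)"
      unfolding \<psi>_def by (simp add: sum_distrib_left mult.commute[of _ "f ?n _"] del: sum.lessThan_Suc)
    also have "\<dots> = - (\<Sum>k<?n. (\<integral>x. f ?n x * ln (f k x) \<partial>P))"
      using \<psi>_f(1) by (simp only: integral_minus) (subst Bochner_Integration.integral_sum; simp)
    finally show ?thesis by (simp only: sum_subtractf)
  qed
  also have "\<dots> \<le> (\<Sum>k<?n. A k) + A ?n + (\<integral>x. \<psi> ?n x \<partial>P) + \<eta> ?n + 4 * (\<Sum>k<?n. hell k ?n)"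
    using \<psi>_f(3)[of n] by linarith
  also have "(\<integral>x. \<psi> ?n x \<partial>P) = (\<Sum>k<?n. B k)"
    unfolding \<psi>_def B_def using ln_f_integrable by (simp only: integral_minus sum_negf) (subst Bochner_Integration.integral_sum; simp)
  finally show "KL P (Rh (Suc n)) (R 0) \<le> K + \<eta> (Suc n) + 4 * (\<Sum>k<Suc n. hell k (Suc n))"
    using AB_bound[of ?n] by (simp only: sum.distrib)
qed

lemma entropy_Rh_limsup:
  assumes "\<epsilon> > 0"
  shows "\<forall>\<^sub>F n in sequentially. KL P (Rh (Suc n)) (R 0) \<le> K + \<epsilon>"
proof -
  have "(\<lambda>n. \<eta> (Suc n) + 4 * (\<Sum>k<Suc n. hell k (Suc n))) \<longlonglongrightarrow> 0 + 4 * 0"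
    by (intro tendsto_intros \<eta>_tendsto LIMSEQ_Suc[OF hell_sum_tendsto])
  then have "\<forall>\<^sub>F n in sequentially. \<eta> (Suc n) + 4 * (\<Sum>k<Suc n. hell k (Suc n)) < \<epsilon>"
    using assms by (intro order_tendstoD) auto
  then show ?thesis
  proof eventually_elim
    case (elim n)
    then show ?case using entropy_Rh(2)[of n] by linarith
  qed
qed

end

section \<open>Convergence of the densities\<close>

lemma (in prob_space) cond_exp_contraction:
  assumes G: "subalgebra M G" and k: "integrable M k"
  shows "(\<integral>x. \<bar>real_cond_exp M G k x\<bar> \<partial>M) \<le> (\<integral>x. \<bar>k x\<bar> \<partial>M)"
proof -
  interpret sigma_finite_subalgebra M G using sigma_finite_subalgebraI[OF G] .
  have ik: "integrable M (\<lambda>x. \<bar>k x\<bar>)" using k by auto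
  have "AE x in M. real_cond_exp M G k x \<le> real_cond_exp M G (\<lambda>x. \<bar>k x\<bar>) x"
    by (rule real_cond_exp_mono[OF _ k ik]) auto
  moreover have "AE x in M. real_cond_exp M G (\<lambda>x. - 1 * k x) x \<le> real_cond_exp M G (\<lambda>x. \<bar>k x\<bar>) x"
    by (rule real_cond_exp_mono[OF _ _ ik]) (use k in auto)
  moreover have "AE x in M. real_cond_exp M G (\<lambda>x. - 1 * k x) x = - 1 * real_cond_exp M G k x"
    by (rule real_cond_exp_cmult[OF k])
  ultimately have "AE x in M. \<bar>real_cond_exp M G k x\<bar> \<le> real_cond_exp M G (\<lambda>x. \<bar>k x\<bar>) x"
    by eventually_elim auto
  then have "(\<integral>x. \<bar>real_cond_exp M G k x\<bar> \<partial>M) \<le> (\<integral>x. real_cond_exp M G (\<lambda>x. \<bar>k x\<bar>) x \<partial>M)"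
    using k ik by (intro integral_mono_AE) auto
  then show ?thesis using real_cond_exp_int(2)[OF ik] by simp
qed

lemma (in prob_space) cond_exp_L1_diff:
  assumes G: "subalgebra M G" and u: "integrable M u" and h: "integrable M h"
  shows "(\<integral>x. \<bar>real_cond_exp M G u x - real_cond_exp M G h x\<bar> \<partial>M) \<le> (\<integral>x. \<bar>u x - h x\<bar> \<partial>M)"
proof -
  interpret sigma_finite_subalgebra M G using sigma_finite_subalgebraI[OF G] .
  have "(\<integral>x. \<bar>real_cond_exp M G u x - real_cond_exp M G h x\<bar> \<partial>M) = (\<integral>x. \<bar>real_cond_exp M G (\<lambda>x. u x - h x) x\<bar> \<partial>M)"
  proof (rule integral_cong_AE)
    show "AE x in M. \<bar>real_cond_exp M G u x - real_cond_exp M G h x\<bar> = \<bar>real_cond_exp M G (\<lambda>x. u x - h x) x\<bar>"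
      using real_cond_exp_diff[OF u h] by eventually_elim simp
  qed auto
  also have "\<dots> \<le> (\<integral>x. \<bar>u x - h x\<bar> \<partial>M)" by (rule cond_exp_contraction[OF G]) (use u h in auto)
  finally show ?thesis .
qed

lemma AE_eq_of_L1_approx:
  fixes a b :: "'a \<Rightarrow> real"
  assumes a: "integrable M a" and b: "integrable M b"
    and small: "\<And>\<epsilon>. \<epsilon> > 0 \<Longrightarrow> (\<integral>x. \<bar>a x - b x\<bar> \<partial>M) \<le> \<epsilon>"
  shows "AE x in M. a x = b x"
proof -
  have i: "integrable M (\<lambda>x. \<bar>a x - b x\<bar>)" using a b by auto
  have "(\<integral>x. \<bar>a x - b x\<bar> \<partial>M) \<le> 0" by (rule field_le_epsilon) (use small in auto)
  then have "(\<integral>x. \<bar>a x - b x\<bar> \<partial>M) = 0" by (intro antisym) auto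
  then have "AE x in M. \<bar>a x - b x\<bar> = 0" using integral_nonneg_eq_0_iff_AE[OF i] by simp
  then show ?thesis by eventually_elim simp
qed

text \<open>Completeness of L1 within the densities. The subsequence also converges almost
  everywhere, as \<open>kl_liminf\<close> requires.\<close>

lemma dens_L1_limit:
  fixes u :: "nat \<Rightarrow> 'a \<Rightarrow> real"
  assumes u: "\<And>n. dens M (u n)"
    and C: "\<And>\<epsilon>. \<epsilon> > 0 \<Longrightarrow> \<exists>n0. \<forall>i\<ge>n0. \<forall>j\<ge>n0. (\<integral>x. \<bar>u i x - u j x\<bar> \<partial>M) < \<epsilon>"
  obtains h \<sigma> where "strict_mono \<sigma>" "dens M h" "AE x in M. (\<lambda>i. u (\<sigma> i) x) \<longlonglongrightarrow> h x"
    "(\<lambda>i. \<integral>x. \<bar>u (\<sigma> i) x - h x\<bar> \<partial>M) \<longlonglongrightarrow> 0"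
proof -
  note iu = densD(2)[OF u] and [measurable] = densD(4)[OF u]
  obtain \<sigma> where \<sigma>: "strict_mono \<sigma>" "AE x in M. Cauchy (\<lambda>i. u (\<sigma> i) x)"
    by (rule cauchy_L1_AE_cauchy_subseq[where M=M and s=u]) (use iu C in auto)
  \<comment> \<open>\<open>lim\<close> is unspecified where the subsequence diverges; the maximum
    keeps \<open>h\<close> nonnegative everywhere.\<close>
  define h where "h x = max 0 (lim (\<lambda>i. u (\<sigma> i) x))" for x
  have hm[measurable]: "h \<in> borel_measurable M" unfolding h_def by measurable
  have h0: "0 \<le> h x" for x by (simp add: h_def)
  have lim: "AE x in M. (\<lambda>i. u (\<sigma> i) x) \<longlonglongrightarrow> h x"
    using \<sigma>(2)
  proof eventually_elim
    case (elim x)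
    then have "(\<lambda>i. u (\<sigma> i) x) \<longlonglongrightarrow> lim (\<lambda>i. u (\<sigma> i) x)"
      by (simp add: Cauchy_convergent_iff convergent_LIMSEQ_iff)
    moreover from this have "0 \<le> lim (\<lambda>i. u (\<sigma> i) x)"
      using densD(1)[OF u] by (intro LIMSEQ_le_const) auto
    ultimately show ?case by (simp add: h_def max_def)
  qed
  \<comment> \<open>Fatou's lemma in the second index turns the Cauchy estimate into an estimate for
    the limit.\<close>
  have fat: "\<exists>n0. \<forall>i\<ge>n0. integrable M (\<lambda>x. \<bar>u (\<sigma> i) x - h x\<bar>) \<and> (\<integral>x. \<bar>u (\<sigma> i) x - h x\<bar> \<partial>M) \<le> \<epsilon>" if \<epsilon>: "\<epsilon> > 0" for \<epsilon>
  proof -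
    obtain n0 where n0: "\<And>i j. i \<ge> n0 \<Longrightarrow> j \<ge> n0 \<Longrightarrow> (\<integral>x. \<bar>u i x - u j x\<bar> \<partial>M) < \<epsilon>" using C[OF \<epsilon>] by blast
    have "integrable M (\<lambda>x. \<bar>u (\<sigma> i) x - h x\<bar>) \<and> (\<integral>x. \<bar>u (\<sigma> i) x - h x\<bar> \<partial>M) \<le> \<epsilon>" if i: "i \<ge> n0" for i
    proof -
      have \<sigma>ge: "\<sigma> j \<ge> n0" if "j \<ge> n0" for j using seq_suble[OF \<sigma>(1), of j] that by simp
      have "(\<integral>\<^sup>+x. ennreal \<bar>u (\<sigma> i) x - h x\<bar> \<partial>M) = (\<integral>\<^sup>+x. liminf (\<lambda>j. ennreal \<bar>u (\<sigma> i) x - u (\<sigma> j) x\<bar>) \<partial>M)"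
      proof (rule nn_integral_cong_AE)
        show "AE x in M. ennreal \<bar>u (\<sigma> i) x - h x\<bar> = liminf (\<lambda>j. ennreal \<bar>u (\<sigma> i) x - u (\<sigma> j) x\<bar>)"
          using lim
        proof eventually_elim
          case (elim x)
          have "(\<lambda>j. ennreal \<bar>u (\<sigma> i) x - u (\<sigma> j) x\<bar>) \<longlonglongrightarrow> ennreal \<bar>u (\<sigma> i) x - h x\<bar>"
            by (intro tendsto_intros elim)
          then show ?case by (metis lim_imp_Liminf trivial_limit_sequentially)
        qed
      qed
      also have "\<dots> \<le> liminf (\<lambda>j. \<integral>\<^sup>+x. ennreal \<bar>u (\<sigma> i) x - u (\<sigma> j) x\<bar> \<partial>M)"
        by (intro nn_integral_liminf) auto
      also have "\<dots> \<le> ennreal \<epsilon>"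
      proof (rule Liminf_le)
        show "\<forall>\<^sub>F j in sequentially. (\<integral>\<^sup>+x. ennreal \<bar>u (\<sigma> i) x - u (\<sigma> j) x\<bar> \<partial>M) \<le> ennreal \<epsilon>"
          using eventually_ge_at_top[of n0]
        proof eventually_elim
          case (elim j)
          have "(\<integral>\<^sup>+x. ennreal \<bar>u (\<sigma> i) x - u (\<sigma> j) x\<bar> \<partial>M) = ennreal (\<integral>x. \<bar>u (\<sigma> i) x - u (\<sigma> j) x\<bar> \<partial>M)"
            using iu by (intro nn_integral_eq_integral) auto
          then show ?case using n0[OF \<sigma>ge[OF i] \<sigma>ge[OF elim]] by (simp add: ennreal_leI)
        qed
      qed simp
      finally have n: "(\<integral>\<^sup>+x. ennreal \<bar>u (\<sigma> i) x - h x\<bar> \<partial>M) \<le> ennreal \<epsilon>" .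
      then have "integrable M (\<lambda>x. \<bar>u (\<sigma> i) x - h x\<bar>)"
        by (intro integrableI_nonneg) (auto simp: le_less_trans)
      moreover from this have "(\<integral>x. \<bar>u (\<sigma> i) x - h x\<bar> \<partial>M) \<le> \<epsilon>"
        using n nn_integral_eq_integral[of M "\<lambda>x. \<bar>u (\<sigma> i) x - h x\<bar>"] \<epsilon> by simp
      ultimately show ?thesis by simp
    qed
    then show ?thesis by blast
  qed
  obtain i where i: "integrable M (\<lambda>x. \<bar>u (\<sigma> i) x - h x\<bar>)" using fat[of 1] by auto
  have ih: "integrable M h"
  proof (rule Bochner_Integration.integrable_bound)
    show "integrable M (\<lambda>x. \<bar>u (\<sigma> i) x - h x\<bar> + u (\<sigma> i) x)" using i iu by auto
    show "AE x in M. norm (h x) \<le> norm (\<bar>u (\<sigma> i) x - h x\<bar> + u (\<sigma> i) x)"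
    proof (intro AE_I2)
      fix x
      show "norm (h x) \<le> norm (\<bar>u (\<sigma> i) x - h x\<bar> + u (\<sigma> i) x)"
        using h0[of x] densD(1)[OF u, of "\<sigma> i" x] by (auto simp: abs_if)
    qed
  qed measurable
  have L1: "(\<lambda>i. \<integral>x. \<bar>u (\<sigma> i) x - h x\<bar> \<partial>M) \<longlonglongrightarrow> 0"
  proof (rule LIMSEQ_I)
    fix \<epsilon> :: real assume "\<epsilon> > 0"
    then obtain n0 where "\<forall>i\<ge>n0. integrable M (\<lambda>x. \<bar>u (\<sigma> i) x - h x\<bar>) \<and> (\<integral>x. \<bar>u (\<sigma> i) x - h x\<bar> \<partial>M) \<le> \<epsilon> / 2"
      using fat[of "\<epsilon> / 2"] by auto
    then have "\<forall>i\<ge>n0. norm ((\<integral>x. \<bar>u (\<sigma> i) x - h x\<bar> \<partial>M) - 0) < \<epsilon>"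
      using \<open>\<epsilon> > 0\<close> by fastforce
    then show "\<exists>n0. \<forall>i\<ge>n0. norm ((\<integral>x. \<bar>u (\<sigma> i) x - h x\<bar> \<partial>M) - 0) < \<epsilon>" by blast
  qed
  have b: "\<bar>1 - (\<integral>x. h x \<partial>M)\<bar> \<le> (\<integral>x. \<bar>u (\<sigma> i) x - h x\<bar> \<partial>M)" for i
  proof -
    have "1 - (\<integral>x. h x \<partial>M) = (\<integral>x. u (\<sigma> i) x - h x \<partial>M)" using iu ih densD(3)[OF u] by simp
    also have "\<bar>\<dots>\<bar> \<le> (\<integral>x. \<bar>u (\<sigma> i) x - h x\<bar> \<partial>M)" by (rule integral_abs_bound)
    finally show ?thesis .
  qed
  have "\<bar>1 - (\<integral>x. h x \<partial>M)\<bar> \<le> 0"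
    by (rule LIMSEQ_le_const[OF L1]) (use b in auto)
  then have "dens M h" unfolding dens_def using h0 ih by auto
  then show thesis using that[OF \<sigma>(1) _ lim L1] by blast
qed

text \<open>The law of \<open>w\<close> is the same for all \<open>n\<close>, so a single tail
  serves them all and a first moment is enough.\<close>

lemma unif_integrable_const_law:
  fixes w :: "'a \<Rightarrow> real"
  assumes w: "w \<in> borel_measurable M" "integrable M w"
    and law: "\<And>n (h :: real \<Rightarrow> real). h \<in> borel_measurable borel \<Longrightarrow> integrable M (\<lambda>x. h (w x)) \<Longrightarrow>
      integrable M (\<lambda>x. h (w x) * r n x) \<and> (\<integral>x. h (w x) * r n x \<partial>M) = (\<integral>x. h (w x) \<partial>M)"
    and w0: "\<And>x. 0 \<le> w x"
  shows "unif_integrable M w r"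
  unfolding unif_integrable_def
proof (intro allI impI)
  fix \<epsilon> :: real assume \<epsilon>: "\<epsilon> > 0"
  have [measurable]: "w \<in> borel_measurable M" by fact
  have "\<forall>\<^sub>F n in sequentially. (\<integral>x. indicator {x. real n < w x} x * w x \<partial>M) < \<epsilon>"
    using tail_integral_tendsto[OF w(2) w(1)] \<epsilon> by (intro order_tendstoD) auto
  then obtain n0 :: nat where n0: "(\<integral>x. indicator {x. real n0 < w x} x * w x \<partial>M) < \<epsilon>"
    by (auto simp: eventually_sequentially)
  have iK: "integrable M (\<lambda>x. indicator {x. K < w x} x * w x)" for K
    by (rule integrable_bounded_mult[OF w(2), of _ 1]) (auto simp: indicator_def)
  show "\<exists>K0. \<forall>K\<ge>K0. \<forall>\<^sub>F n in sequentially.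
     integrable M (\<lambda>x. w x * r n x) \<and> (\<integral>x. indicator {x. K < w x} x * (w x * r n x) \<partial>M) \<le> \<epsilon>"
  proof (intro exI allI impI always_eventually)
    fix K n assume K: "K \<ge> real n0"
    have "(\<integral>x. indicator {x. K < w x} x * w x \<partial>M) \<le> (\<integral>x. indicator {x. real n0 < w x} x * w x \<partial>M)"
      using iK K w0 by (intro integral_mono) (auto simp: indicator_def)
    then have TK: "(\<integral>x. indicator {x. K < w x} x * w x \<partial>M) \<le> \<epsilon>" using n0 by simp
    have e: "(\<lambda>x. indicator {x. K < w x} x * w x) = (\<lambda>x. (\<lambda>t. indicator {t. K < t} t * t) (w x))"
      by (auto simp: indicator_def)
    have "integrable M (\<lambda>x. (\<lambda>t. indicator {t. K < t} t * t) (w x))" using iK[of K] e by simp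
    from law[OF _ this, of n]
    have "(\<integral>x. (indicator {x. K < w x} x * w x) * r n x \<partial>M) = (\<integral>x. indicator {x. K < w x} x * w x \<partial>M)"
      by (auto simp: indicator_def)
    then show "integrable M (\<lambda>x. w x * r n x) \<and> (\<integral>x. indicator {x. K < w x} x * (w x * r n x) \<partial>M) \<le> \<epsilon>"
      using TK law[of "\<lambda>t. t" n] w(2) by (simp add: mult.assoc)
  qed
qed

text \<open>Uniform integrability is asked for from index 1 on, since no marginal of
  \<open>R 0\<close> is prescribed; the limits are insensitive to the shift.\<close>

lemma L1_weighted_sum_tendsto:
  assumes u: "u \<in> borel_measurable M" "\<And>x. 0 \<le> u x" and w: "w \<in> borel_measurable M" "\<And>x. 0 \<le> w x"
    and r: "\<And>n. dens M (r n)" and h: "dens M h" and i: "integrable M (\<lambda>x. u x * h x)" "integrable M (\<lambda>x. w x * h x)"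
    and L1: "(\<lambda>n. \<integral>x. \<bar>r n x - h x\<bar> \<partial>M) \<longlonglongrightarrow> 0"
    and ui: "unif_integrable M u (\<lambda>n. r (Suc n))" "unif_integrable M w (\<lambda>n. r (Suc n))"
  shows "\<forall>\<^sub>F n in sequentially. integrable M (\<lambda>x. (u x + w x) * \<bar>r n x - h x\<bar>)"
    "(\<lambda>n. \<integral>x. (u x + w x) * \<bar>r n x - h x\<bar> \<partial>M) \<longlonglongrightarrow> 0"
proof -
  note L = L1_weighted_tendsto[OF _ _ densD(2)[OF r] densD(1)[OF r] densD(2)[OF h] densD(1)[OF h] _ LIMSEQ_Suc[OF L1]]
  note Lu = L[OF u i(1) ui(1)] and Lw = L[OF w i(2) ui(2)]
  let ?s = "\<lambda>n. (\<integral>x. u x * \<bar>r (Suc n) x - h x\<bar> \<partial>M) + (\<integral>x. w x * \<bar>r (Suc n) x - h x\<bar> \<partial>M)"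
  have ev: "\<forall>\<^sub>F n in sequentially. integrable M (\<lambda>x. (u x + w x) * \<bar>r (Suc n) x - h x\<bar>) \<and>
     (\<integral>x. (u x + w x) * \<bar>r (Suc n) x - h x\<bar> \<partial>M) = ?s n"
    using Lu(1) Lw(1) by eventually_elim (simp add: distrib_right)
  from ev have "\<forall>\<^sub>F n in sequentially. integrable M (\<lambda>x. (u x + w x) * \<bar>r (Suc n) x - h x\<bar>)"
    by eventually_elim simp
  then show "\<forall>\<^sub>F n in sequentially. integrable M (\<lambda>x. (u x + w x) * \<bar>r n x - h x\<bar>)"
    by (subst (asm) eventually_sequentially_Suc)
  have "?s \<longlonglongrightarrow> 0 + 0" by (intro tendsto_add Lu(2) Lw(2))
  then have "(\<lambda>n. \<integral>x. (u x + w x) * \<bar>r (Suc n) x - h x\<bar> \<partial>M) \<longlonglongrightarrow> 0"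
    using ev by (subst tendsto_cong[where g="?s"]) (auto elim: eventually_mono)
  then show "(\<lambda>n. \<integral>x. (u x + w x) * \<bar>r n x - h x\<bar> \<partial>M) \<longlonglongrightarrow> 0" by (rule LIMSEQ_imp_Suc)
qed

context causal_filtration
begin

text \<open>Causality at \<open>t = 0\<close>, available because \<open>0 < N\<close>, identifies
  the projection to \<open>F N 0\<close> with that to the trivial \<open>F 0 0\<close>, which is the
  constant 1.\<close>

lemma causal_fst_law:
  assumes N: "0 < N" and r: "causal_dens r" and h: "h \<in> borel_measurable (F N 0)"
  shows "integrable P (\<lambda>x. h x * r x) \<longleftrightarrow> integrable P h" "(\<integral>x. h x * r x \<partial>P) = (\<integral>x. h x \<partial>P)"
proof -
  note dr = causal_dens_dens[OF r]
  interpret G: sigma_finite_subalgebra P "F 0 0" using sf by auto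
  have "AE x in P. real_cond_exp P (F 0 0) r x = 1"
  proof (rule G.real_cond_exp_charact)
    fix A assume "A \<in> sets (F 0 0)"
    then have "A = {} \<or> A = space P" by (rule F_trivial)
    then show "(\<integral>x\<in>A. r x \<partial>P) = (\<integral>x\<in>A. 1 \<partial>P)"
    proof
      assume A: "A = space P"
      have "(\<integral>x\<in>A. r x \<partial>P) = (\<integral>x. r x \<partial>P)" unfolding A using densD(2)[OF dr] by (rule set_integral_space)
      moreover have "(\<integral>x\<in>A. 1 \<partial>P) = (\<integral>x. (1::real) \<partial>P)" unfolding A by (rule set_integral_space) simp
      ultimately show ?thesis using densD(3)[OF dr] by (simp add: prob_space)
    qed (simp add: set_lebesgue_integral_def)
  qed (use densD(2)[OF dr] in auto)
  then have e: "AE x in P. real_cond_exp P (F N 0) r x = 1"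
    using causal_densD[OF r N] by eventually_elim simp
  show "integrable P (\<lambda>x. h x * r x) \<longleftrightarrow> integrable P h" "(\<integral>x. h x * r x \<partial>P) = (\<integral>x. h x \<partial>P)"
    using cond_density_integral[OF _ _ dr _ _ e h] by simp_all
qed

end

context causal_sinkhorn_dens
begin

text \<open>Causality is an equation between two conditional expectations, and both are contractions
  in L1.\<close>

lemma causal_L1_limit:
  assumes u: "\<And>n. causal_dens (u n)" and h: "dens P h" and L1: "(\<lambda>n. \<integral>x. \<bar>u n x - h x\<bar> \<partial>P) \<longlonglongrightarrow> 0"
  shows "causal_dens h"
  unfolding causal_dens_def
proof (intro conjI allI impI h)
  fix t assume t: "t < N"
  interpret A: sigma_finite_subalgebra P "F N t" using sf t by auto
  interpret B: sigma_finite_subalgebra P "F t t" using sf t by auto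
  note iu = densD(2)[OF causal_dens_dens[OF u]] and ih = densD(2)[OF h]
  show "AE x in P. real_cond_exp P (F N t) h x = real_cond_exp P (F t t) h x"
  proof (rule AE_eq_of_L1_approx)
    fix \<epsilon> :: real assume "\<epsilon> > 0"
    then have "\<forall>\<^sub>F n in sequentially. (\<integral>x. \<bar>u n x - h x\<bar> \<partial>P) < \<epsilon> / 2"
      using L1 by (intro order_tendstoD) auto
    then obtain n where n: "(\<integral>x. \<bar>u n x - h x\<bar> \<partial>P) < \<epsilon> / 2" by (auto simp: eventually_sequentially)
    let ?a = "real_cond_exp P (F N t)" and ?b = "real_cond_exp P (F t t)"
    note i = A.real_cond_exp_int(1)[OF iu, of n] A.real_cond_exp_int(1)[OF ih]
      B.real_cond_exp_int(1)[OF iu, of n] B.real_cond_exp_int(1)[OF ih]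
    have "(\<integral>x. \<bar>?a h x - ?b h x\<bar> \<partial>P) \<le> (\<integral>x. \<bar>?a (u n) x - ?a h x\<bar> + \<bar>?b (u n) x - ?b h x\<bar> \<partial>P)"
    proof (rule integral_mono_AE)
      show "AE x in P. \<bar>?a h x - ?b h x\<bar> \<le> \<bar>?a (u n) x - ?a h x\<bar> + \<bar>?b (u n) x - ?b h x\<bar>"
        using causal_densD[OF u t, of n] by eventually_elim auto
    qed (use i in auto)
    also have "\<dots> = (\<integral>x. \<bar>?a (u n) x - ?a h x\<bar> \<partial>P) + (\<integral>x. \<bar>?b (u n) x - ?b h x\<bar> \<partial>P)"
      using i by (intro Bochner_Integration.integral_add) auto
    also have "\<dots> \<le> (\<integral>x. \<bar>u n x - h x\<bar> \<partial>P) + (\<integral>x. \<bar>u n x - h x\<bar> \<partial>P)"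
      using F_subalg t iu ih by (intro add_mono cond_exp_L1_diff) auto
    also have "\<dots> \<le> \<epsilon>" using n by simp
    finally show "(\<integral>x. \<bar>?a h x - ?b h x\<bar> \<partial>P) \<le> \<epsilon>" .
  qed (use ih in auto)
qed

section \<open>The relaxed problem with approximate second marginal\<close>

definition defect :: "('a \<Rightarrow> real) \<Rightarrow> real" where
  "defect r = (\<integral>x. \<bar>real_cond_exp P (F 0 N) r x - 1\<bar> \<partial>P)"

text \<open>The iterates \<open>Rh n\<close> meet the constraint on the second marginal only in the
  limit, so they are compared with almost minimisers under a relaxed constraint.\<close>

definition near :: "real \<Rightarrow> ('a \<Rightarrow> real) set" where
  "near \<delta> = {r. causal_dens r \<and> defect r \<le> \<delta>}"

definition V :: "real \<Rightarrow> ennreal" where "V \<delta> = (INF r\<in>near \<delta>. kl P r (R 0))"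

text \<open>\<open>near\<close> grows with \<open>\<delta>\<close>, so \<open>V\<close> decreases in
  it and the supremum is the limit at 0.\<close>

definition v :: ennreal where "v = (SUP \<delta>\<in>{0<..}. V \<delta>)"

lemma Y_sub: "subalgebra P (F 0 N)" using F_subalg by simp

text \<open>The coefficient \<open>1 - 1/2\<close> is the form in which
  \<open>kl_compensation\<close> at \<open>s = 1/2\<close> produces the midpoint.\<close>

lemma near_mid:
  assumes "x \<in> near \<delta>" "y \<in> near \<delta>"
  shows "(\<lambda>z. (1 - 1/2) * x z + 1/2 * y z) \<in> near \<delta>"
proof -
  interpret Y: sigma_finite_subalgebra P "F 0 N" using sf by auto
  note ix = densD(2)[OF causal_dens_dens] 
  have c: "causal_dens x" "causal_dens y" and d: "defect x \<le> \<delta>" "defect y \<le> \<delta>" using assms by (auto simp: near_def)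
  let ?m = "\<lambda>z. (1 - 1/2) * x z + 1/2 * y z" and ?E = "real_cond_exp P (F 0 N)"
  have ixy: "integrable P x" "integrable P y" using ix c by auto
  have ih: "integrable P (\<lambda>z. (1 - 1/2) * x z)" "integrable P (\<lambda>z. 1/2 * y z)" using ixy by auto
  have cm: "causal_dens ?m" using c by (intro causal_dens_convex) auto
  have "defect ?m \<le> (\<integral>z. 1/2 * \<bar>?E x z - 1\<bar> + 1/2 * \<bar>?E y z - 1\<bar> \<partial>P)"
    unfolding defect_def
  proof (rule integral_mono_AE)
    show "AE z in P. \<bar>?E ?m z - 1\<bar> \<le> 1/2 * \<bar>?E x z - 1\<bar> + 1/2 * \<bar>?E y z - 1\<bar>"
      using Y.real_cond_exp_add[OF ih] Y.real_cond_exp_cmult[OF ixy(1), of "1 - 1/2"] Y.real_cond_exp_cmult[OF ixy(2), of "1/2"]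
    proof eventually_elim
      case (elim z)
      then have "?E ?m z = (1 - 1/2) * ?E x z + 1/2 * ?E y z" by simp
      then show ?case by (simp add: abs_if field_simps)
    qed
  qed (use Y.real_cond_exp_int(1)[OF ixy(1)] Y.real_cond_exp_int(1)[OF ixy(2)]
      Y.real_cond_exp_int(1)[OF densD(2)[OF causal_dens_dens[OF cm]]] in auto)
  also have "\<dots> = 1/2 * defect x + 1/2 * defect y"
    unfolding defect_def using Y.real_cond_exp_int(1)[OF ixy(1)] Y.real_cond_exp_int(1)[OF ixy(2)] by (subst Bochner_Integration.integral_add) auto
  also have "\<dots> \<le> \<delta>" using d by simp
  finally show ?thesis using cm by (simp add: near_def)
qed

text \<open>Uniform convexity of the relative entropy makes almost minimisers close in total variation.\<close>

lemma near_minimal_L1: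
  assumes xy: "x \<in> near \<delta>" "y \<in> near \<delta>" and a: "0 \<le> a" and \<epsilon>: "0 \<le> \<epsilon>"
    and kx: "kl P x (R 0) \<le> ennreal (a + \<epsilon>)" and ky: "kl P y (R 0) \<le> ennreal (a + \<epsilon>)"
    and V: "ennreal a \<le> V \<delta> + ennreal \<epsilon>"
  shows "(\<integral>z. \<bar>x z - y z\<bar> \<partial>P) \<le> 8 * sqrt \<epsilon>"
proof -
  let ?m = "\<lambda>z. (1 - 1/2) * x z + 1/2 * y z"
  have dx: "dens P x" and dy: "dens P y" using xy by (auto simp: near_def intro: causal_dens_dens)
  have dm: "dens P ?m" using dx dy by (intro dens_convex) auto
  have eq: "ennreal (1 - 1/2) * kl P x (R 0) + ennreal (1/2) * kl P y (R 0) =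
     kl P ?m (R 0) + ennreal (1 - 1/2) * kl P x ?m + ennreal (1/2) * kl P y ?m"
    by (rule kl_compensation[OF dx dy densD(4)[OF R_dens] R_pos]) auto
  have "kl P ?m (R 0) + ennreal (1/2) * kl P x ?m \<le> kl P ?m (R 0) + ennreal (1 - 1/2) * kl P x ?m + ennreal (1/2) * kl P y ?m"
    by simp
  also have "\<dots> \<le> ennreal (1 - 1/2) * ennreal (a + \<epsilon>) + ennreal (1/2) * ennreal (a + \<epsilon>)"
    unfolding eq[symmetric] using kx ky by (intro add_mono mult_left_mono) auto
  also have "\<dots> = ennreal (a + \<epsilon>)"
  proof -
    have "ennreal (1 - 1/2) * ennreal (a + \<epsilon>) = ennreal ((1 - 1/2) * (a + \<epsilon>))"
      "ennreal (1/2) * ennreal (a + \<epsilon>) = ennreal (1/2 * (a + \<epsilon>))"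
      by (rule ennreal_mult[symmetric]; use a \<epsilon> in simp)+
    moreover have "ennreal ((1 - 1/2) * (a + \<epsilon>)) + ennreal (1/2 * (a + \<epsilon>)) = ennreal ((1 - 1/2) * (a + \<epsilon>) + 1/2 * (a + \<epsilon>))"
      by (rule ennreal_plus[symmetric]) (use a \<epsilon> in simp_all)
    ultimately show ?thesis by (simp only:) (rule arg_cong[where f=ennreal], simp)
  qed
  finally have 1: "kl P ?m (R 0) + ennreal (1/2) * kl P x ?m \<le> ennreal (a + \<epsilon>)" .
  have "kl P ?m (R 0) \<le> kl P ?m (R 0) + ennreal (1/2) * kl P x ?m" by simp
  also note 1
  also have "ennreal (a + \<epsilon>) < \<infinity>" by simp
  finally obtain m where m: "kl P ?m (R 0) = ennreal m" "m \<ge> 0" by (cases "kl P ?m (R 0)") auto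
  have "ennreal (1/2) * kl P x ?m \<le> kl P ?m (R 0) + ennreal (1/2) * kl P x ?m" by simp
  also note 1
  also have "ennreal (a + \<epsilon>) < \<infinity>" by simp
  finally have "kl P x ?m < \<infinity>" by (auto simp: ennreal_mult_less_top)
  then obtain k where k: "kl P x ?m = ennreal k" "k \<ge> 0" by (cases "kl P x ?m") auto
  have "V \<delta> \<le> kl P ?m (R 0)" unfolding V_def by (rule INF_lower[OF near_mid[OF xy]])
  then have "ennreal a \<le> kl P ?m (R 0) + ennreal \<epsilon>" using V by (meson add_right_mono order_trans)
  then have 2: "a \<le> m + \<epsilon>" using m \<epsilon> a by (simp add: ennreal_plus[symmetric] del: ennreal_plus)
  have "ennreal (m + 1/2 * k) \<le> ennreal (a + \<epsilon>)"
  proof -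
    have "ennreal (m + 1/2 * k) = ennreal m + ennreal (1/2 * k)" by (rule ennreal_plus) (use m k in auto)
    also have "ennreal (1/2 * k) = ennreal (1/2) * ennreal k" by (rule ennreal_mult) (use k in auto)
    finally show ?thesis using 1 unfolding m(1) k(1) by simp
  qed
  then have "m + 1/2 * k \<le> a + \<epsilon>" using a \<epsilon> by (subst (asm) ennreal_le_iff) auto
  \<comment> \<open>\<open>m + k/2 \<le> a + \<epsilon>\<close> against
    \<open>a \<le> m + \<epsilon>\<close>. From this \<open>L1_le_kl\<close> gives
    \<open>4 * sqrt \<epsilon>\<close> for the distance to the midpoint, half the distance between
    \<open>x\<close> and \<open>y\<close>.\<close>
  then have "k \<le> 4 * \<epsilon>" using 2 by simp
  then have "kl P x ?m \<le> ennreal (4 * \<epsilon>)" unfolding k(1) by (rule ennreal_leI)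
  moreover have "?m z > 0 \<or> x z = 0" for z
    using densD(1)[OF dx, of z] densD(1)[OF dy, of z] by (cases "x z = 0") auto
  ultimately have "(\<integral>z. \<bar>x z - ?m z\<bar> \<partial>P) \<le> 2 * sqrt (4 * \<epsilon>)"
    using \<epsilon> by (intro L1_le_kl[OF dx dm]) auto
  also have "\<dots> = 4 * sqrt \<epsilon>" by (simp add: real_sqrt_mult)
  finally have "2 * (\<integral>z. \<bar>x z - ?m z\<bar> \<partial>P) \<le> 8 * sqrt \<epsilon>" by simp
  moreover have "2 * (\<integral>z. \<bar>x z - ?m z\<bar> \<partial>P) = (\<integral>z. \<bar>x z - y z\<bar> \<partial>P)"
    by (subst integral_mult_right_zero[symmetric], intro Bochner_Integration.integral_cong) (auto simp: abs_if field_simps)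
  ultimately show ?thesis by simp
qed

lemma rs_near: "\<delta> \<ge> 0 \<Longrightarrow> rs \<in> near \<delta>"
proof -
  have "defect rs = (\<integral>x. 0 \<partial>P)" unfolding defect_def by (rule integral_cong_AE) (use rs(2) in auto)
  then show "\<delta> \<ge> 0 \<Longrightarrow> rs \<in> near \<delta>" using rs(1) by (simp add: near_def)
qed

lemma kl_rs: "kl P rs (R 0) = ennreal K" "0 \<le> K"
  unfolding K_def using kl_fun_integral(3,4)[OF causal_dens_dens[OF rs(1)] R_dens R_pos rs(3)] by auto

lemma V_le_K: "\<delta> > 0 \<Longrightarrow> V \<delta> \<le> ennreal K"
  unfolding V_def kl_rs(1)[symmetric] by (rule INF_lower) (simp add: rs_near)

lemma v_approx:
  assumes "\<epsilon> > 0" shows "\<exists>\<delta>>0. v \<le> V \<delta> + ennreal \<epsilon>"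
proof (cases "v = 0")
  \<comment> \<open>\<open>v - \<epsilon> < v\<close> fails in \<open>ennreal\<close> at
    \<open>v = 0\<close>, where any \<open>\<delta>\<close> will do.\<close>
  case True then show ?thesis by (auto intro: exI[of _ 1])
next
  case False
  have "v \<le> ennreal K" unfolding v_def by (rule SUP_least) (auto intro: V_le_K)
  then have fin: "v \<noteq> \<infinity>" by (auto simp: top_unique)
  have "v - ennreal \<epsilon> < v" using fin False assms by (intro ennreal_between) (auto simp: less_top[symmetric] zero_less_iff_neq_zero)
  then obtain \<delta> where "\<delta> > 0" "v - ennreal \<epsilon> < V \<delta>" unfolding v_def less_SUP_iff by auto
  obtain a where a: "v = ennreal a" "0 \<le> a" using fin by (cases v) auto
  have "v \<le> (v - ennreal \<epsilon>) + ennreal \<epsilon>"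
  proof (cases "a \<le> \<epsilon>")
    case True
    then show ?thesis unfolding a(1) by (intro add_increasing ennreal_leI) auto
  next
    case False
    then have "ennreal a = ennreal (a - \<epsilon>) + ennreal \<epsilon>" using assms by (subst ennreal_plus[symmetric]) auto
    then show ?thesis unfolding a(1) using assms by (simp add: ennreal_minus)
  qed
  also have "\<dots> \<le> V \<delta> + ennreal \<epsilon>" using \<open>v - ennreal \<epsilon> < V \<delta>\<close> by (intro add_right_mono less_imp_le)
  finally show ?thesis using \<open>\<delta> > 0\<close> by blast
qed

text \<open>The relaxed values leave no gap below the optimal entropy. Almost minimisers for
  \<open>\<delta> = 1 / (j + 1)\<close> form a Cauchy sequence in L1 by
  \<open>near_minimal_L1\<close>; the limit is causal, has second marginal exactly \<nu>, and by
  Fatou's lemma its entropy is at most \<open>v\<close>, so it competes with \<open>rs\<close>.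
  Strong convergence takes the place of a compactness argument.\<close>

lemma v_eq_K: "v = ennreal K"
proof (rule antisym)
  show vK: "v \<le> ennreal K" unfolding v_def by (rule SUP_least) (auto intro: V_le_K)
  then have "v \<noteq> \<infinity>" by (auto simp: top_unique)
  then obtain a where a: "v = ennreal a" "0 \<le> a" by (cases v) auto
  define \<epsilon> where "\<epsilon> j = 1 / real (Suc j)" for j
  have \<epsilon>0: "0 < \<epsilon> j" for j by (simp add: \<epsilon>_def)
  have \<epsilon>lim: "\<epsilon> \<longlonglongrightarrow> 0" unfolding \<epsilon>_def using LIMSEQ_inverse_real_of_nat by (simp add: inverse_eq_divide)
  have Vv: "V (\<epsilon> j) \<le> v" for j unfolding v_def by (rule SUP_upper) (simp add: \<epsilon>0)
  have "\<exists>r\<in>near (\<epsilon> j). kl P r (R 0) < V (\<epsilon> j) + ennreal (\<epsilon> j)" for j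
  proof -
    have "V (\<epsilon> j) < V (\<epsilon> j) + ennreal (\<epsilon> j)"
      using V_le_K[OF \<epsilon>0, of j] \<epsilon>0[of j] by (cases "V (\<epsilon> j)") (auto simp: ennreal_plus[symmetric] ennreal_less_iff top_unique simp del: ennreal_plus)
    then show ?thesis unfolding V_def INF_less_iff by blast
  qed
  then obtain u where u: "\<And>j. u j \<in> near (\<epsilon> j)" "\<And>j. kl P (u j) (R 0) < V (\<epsilon> j) + ennreal (\<epsilon> j)" by metis
  have cu: "causal_dens (u j)" for j using u(1) by (simp add: near_def)
  have ku: "kl P (u j) (R 0) \<le> ennreal (a + \<epsilon> j)" for j
  proof -
    have "kl P (u j) (R 0) \<le> V (\<epsilon> j) + ennreal (\<epsilon> j)" using u(2) by (rule less_imp_le)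
    also have "\<dots> \<le> v + ennreal (\<epsilon> j)" using Vv by (rule add_right_mono)
    finally show ?thesis using a \<epsilon>0[of j] by simp
  qed
  have Cauchy: "\<exists>n0. \<forall>i\<ge>n0. \<forall>j\<ge>n0. (\<integral>x. \<bar>u i x - u j x\<bar> \<partial>P) < b" if b: "b > 0" for b
  proof -
    \<comment> \<open>Chosen so that the bound \<open>8 * sqrt c\<close> of
      \<open>near_minimal_L1\<close> becomes \<open>b / 2\<close>.\<close>
    define c where "c = (b / 16)\<^sup>2"
    have c: "c > 0" "8 * sqrt c = b / 2" using b by (auto simp: c_def real_sqrt_abs)
    obtain \<delta> where \<delta>: "\<delta> > 0" "v \<le> V \<delta> + ennreal c" using v_approx[OF c(1)] by blast
    have "\<forall>\<^sub>F j in sequentially. \<epsilon> j < min \<delta> c" using \<epsilon>lim \<delta> c by (intro order_tendstoD) auto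
    then obtain n0 where n0: "\<And>j. j \<ge> n0 \<Longrightarrow> \<epsilon> j < min \<delta> c" by (auto simp: eventually_sequentially)
    have "(\<integral>x. \<bar>u i x - u j x\<bar> \<partial>P) < b" if "i \<ge> n0" "j \<ge> n0" for i j
    proof -
      have n: "u k \<in> near \<delta>" "kl P (u k) (R 0) \<le> ennreal (a + c)" if "k \<ge> n0" for k
      proof -
        show "u k \<in> near \<delta>" using u(1)[of k] n0[OF that] by (auto simp: near_def)
        have "ennreal (a + \<epsilon> k) \<le> ennreal (a + c)" using n0[OF that] by (intro ennreal_leI) auto
        then show "kl P (u k) (R 0) \<le> ennreal (a + c)" using ku by (rule order_trans[rotated])
      qed
      have "(\<integral>x. \<bar>u i x - u j x\<bar> \<partial>P) \<le> 8 * sqrt c"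
        using n that a \<delta> c by (intro near_minimal_L1[of _ \<delta> _ a]) auto
      then show ?thesis using c b by simp
    qed
    then show ?thesis by blast
  qed
  obtain h \<sigma> where h: "strict_mono \<sigma>" "dens P h" "AE x in P. (\<lambda>i. u (\<sigma> i) x) \<longlonglongrightarrow> h x"
    "(\<lambda>i. \<integral>x. \<bar>u (\<sigma> i) x - h x\<bar> \<partial>P) \<longlonglongrightarrow> 0"
    by (rule dens_L1_limit[OF causal_dens_dens[OF cu] Cauchy])
  have ch: "causal_dens h" by (rule causal_L1_limit[OF cu h(2,4)])
  have \<epsilon>\<sigma>: "(\<lambda>i. \<epsilon> (\<sigma> i)) \<longlonglongrightarrow> 0" using LIMSEQ_subseq_LIMSEQ[OF \<epsilon>lim h(1)] by (simp add: o_def)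
  note iu = densD(2)[OF causal_dens_dens[OF cu]] and ih = densD(2)[OF h(2)]
  interpret Y: sigma_finite_subalgebra P "F 0 N" using sf by auto
  let ?E = "real_cond_exp P (F 0 N)"
  have h1: "AE x in P. ?E h x = 1"
  proof (rule AE_eq_of_L1_approx)
    fix b :: real assume "b > 0"
    then have "\<forall>\<^sub>F i in sequentially. (\<integral>x. \<bar>u (\<sigma> i) x - h x\<bar> \<partial>P) < b / 2 \<and> \<epsilon> (\<sigma> i) < b / 2"
      using h(4) \<epsilon>\<sigma> by (intro eventually_conj order_tendstoD) auto
    then obtain i where i: "(\<integral>x. \<bar>u (\<sigma> i) x - h x\<bar> \<partial>P) < b / 2" "\<epsilon> (\<sigma> i) < b / 2" by (auto simp: eventually_sequentially)
    note iE = Y.real_cond_exp_int(1)[OF iu, of "\<sigma> i"] Y.real_cond_exp_int(1)[OF ih]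
    have "(\<integral>x. \<bar>?E h x - 1\<bar> \<partial>P) \<le> (\<integral>x. \<bar>?E (u (\<sigma> i)) x - ?E h x\<bar> + \<bar>?E (u (\<sigma> i)) x - 1\<bar> \<partial>P)"
      using iE by (intro integral_mono) auto
    also have "\<dots> = (\<integral>x. \<bar>?E (u (\<sigma> i)) x - ?E h x\<bar> \<partial>P) + defect (u (\<sigma> i))"
      unfolding defect_def using iE by (intro Bochner_Integration.integral_add) auto
    also have "\<dots> \<le> (\<integral>x. \<bar>u (\<sigma> i) x - h x\<bar> \<partial>P) + \<epsilon> (\<sigma> i)"
      using u(1)[of "\<sigma> i"] Y_sub iu ih by (intro add_mono cond_exp_L1_diff) (auto simp: near_def)
    also have "\<dots> \<le> b" using i by simp
    finally show "(\<integral>x. \<bar>?E h x - 1\<bar> \<partial>P) \<le> b" .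
  qed (use ih in auto)
  have "kl P h (R 0) \<le> v"
  proof (rule ennreal_le_epsilon)
    fix b :: real assume b: "0 < b"
    have "\<forall>\<^sub>F i in sequentially. \<epsilon> (\<sigma> i) < b" using \<epsilon>\<sigma> b by (intro order_tendstoD) auto
    then obtain n0 where n0: "\<And>i. i \<ge> n0 \<Longrightarrow> \<epsilon> (\<sigma> i) < b" by (auto simp: eventually_sequentially)
    show "kl P h (R 0) \<le> v + ennreal b"
    proof (rule kl_liminf[where u="\<lambda>i. u (\<sigma> (i + n0))" and v="\<lambda>i. R 0"])
      show "AE x in P. (\<lambda>n. kl_fun (u (\<sigma> (n + n0)) x) (R 0 x)) \<longlonglongrightarrow> kl_fun (h x) (R 0 x)"
        using h(3)
      proof eventually_elim
        case (elim x)
        have l: "(\<lambda>n. u (\<sigma> (n + n0)) x) \<longlonglongrightarrow> h x" using elim by (rule LIMSEQ_ignore_initial_segment)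
        show ?case
        proof (cases "h x = 0")
          case False
          then show ?thesis unfolding kl_fun_def using l R_pos[of 0 x]
            by (intro tendsto_intros) auto
        next
          case True
          have u0: "0 \<le> u (\<sigma> (n + n0)) x" for n using densD(1)[OF causal_dens_dens[OF cu]] .
          \<comment> \<open>\<open>ln\<close> is not continuous at 0, so
            \<open>y * ln (y / c)\<close> is squeezed to 0 instead.\<close>
          have "(\<lambda>n. u (\<sigma> (n + n0)) x * ln (u (\<sigma> (n + n0)) x / R 0 x)) \<longlonglongrightarrow> 0"
          proof (rule tendsto_rabs_zero_cancel, rule tendsto_sandwich[OF _ _ tendsto_const])
            let ?s = "\<lambda>n. u (\<sigma> (n + n0)) x"
            have "\<bar>y * ln (y / c)\<bar> \<le> sqrt y + y * (\<bar>ln c\<bar> + y)" if "0 \<le> y" "0 < c" for y c :: real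
            proof (cases "y = 0")
              case False
              then have y: "0 < y" using that by simp
              have "ln y \<le> y" using ln_le_minus_one[OF y] by simp
              then have 1: "y * ln y \<le> y * y" using y by (intro mult_left_mono) auto
              have 2: "- (y * ln y) \<le> sqrt y" by (rule neg_xlnx_le_sqrt[OF that(1)])
              have "\<bar>y * ln y\<bar> \<le> sqrt y + y * y" using 1 2 y by (simp add: abs_if add_increasing add_increasing2)
              moreover have "\<bar>y * ln (y / c)\<bar> \<le> \<bar>y * ln y\<bar> + y * \<bar>ln c\<bar>"
                using y that(2) by (simp add: ln_div right_diff_distrib abs_mult) (metis abs_mult abs_of_pos abs_triangle_ineq4)
              ultimately show ?thesis by (simp add: distrib_left)
            qed simp
            then show "\<forall>\<^sub>F n in sequentially. \<bar>?s n * ln (?s n / R 0 x)\<bar> \<le> sqrt (?s n) + ?s n * (\<bar>ln (R 0 x)\<bar> + ?s n)"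
              using u0 R_pos by (intro always_eventually) auto
            have "(\<lambda>n. sqrt (?s n) + ?s n * (\<bar>ln (R 0 x)\<bar> + ?s n)) \<longlonglongrightarrow> sqrt 0 + 0 * (\<bar>ln (R 0 x)\<bar> + 0)"
              using l True by (intro tendsto_intros) auto
            then show "(\<lambda>n. sqrt (?s n) + ?s n * (\<bar>ln (R 0 x)\<bar> + ?s n)) \<longlonglongrightarrow> 0" by simp
          qed auto
          from tendsto_add[OF tendsto_diff[OF this l] tendsto_const[of "R 0 x"]] True
          show ?thesis unfolding kl_fun_def by simp
        qed
      qed
      show "kl P (u (\<sigma> (n + n0))) (R 0) \<le> v + ennreal b" for n
      proof -
        have "kl P (u (\<sigma> (n + n0))) (R 0) \<le> ennreal (a + \<epsilon> (\<sigma> (n + n0)))" by (rule ku)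
        also have "\<dots> \<le> ennreal (a + b)" using n0[of "n + n0"] by (intro ennreal_leI) simp
        finally show ?thesis using a b by simp
      qed
    qed (use iu ih in auto)
  qed
  moreover have "ennreal K \<le> kl P h (R 0)" using rs_min[OF ch h1] kl_rs by simp
  ultimately show "ennreal K \<le> v" by (rule order_trans[rotated])
qed

lemma defect_Rh: "(\<lambda>n. defect (Rh (Suc n))) \<longlonglongrightarrow> 0"
proof -
  have "defect (Rh n) = (\<integral>x. \<bar>f n x - 1\<bar> \<partial>P)" for n
    unfolding defect_def by (rule integral_cong_AE) (use f_cond[of n] in auto)
  then show ?thesis using f_one_L1_tendsto by simp
qed

text \<open>For large \<open>n\<close> both \<open>Rh (Suc n)\<close> and \<open>rs\<close> lie in
  \<open>near \<delta>\<close> with entropy at most \<open>K + c\<close>, and \<open>K = v\<close>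
  exceeds \<open>V \<delta>\<close> by at most \<open>c\<close>; uniform convexity brings them
  together.\<close>

theorem Rh_L1: "(\<lambda>n. \<integral>x. \<bar>Rh n x - rs x\<bar> \<partial>P) \<longlonglongrightarrow> 0"
proof (rule LIMSEQ_imp_Suc, rule tendstoI)
  fix b :: real assume b: "b > 0"
  define c where "c = (b / 16)\<^sup>2"
  have c: "c > 0" "8 * sqrt c = b / 2" using b by (auto simp: c_def real_sqrt_abs)
  obtain \<delta> where \<delta>: "\<delta> > 0" "v \<le> V \<delta> + ennreal c" using v_approx[OF c(1)] by blast
  have "\<forall>\<^sub>F n in sequentially. defect (Rh (Suc n)) < \<delta>" using defect_Rh \<delta> by (intro order_tendstoD) auto
  with entropy_Rh_limsup[OF c(1)] show "\<forall>\<^sub>F n in sequentially. dist (\<integral>x. \<bar>Rh (Suc n) x - rs x\<bar> \<partial>P) 0 < b"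
  proof eventually_elim
    case (elim n)
    have "(\<integral>x. \<bar>Rh (Suc n) x - rs x\<bar> \<partial>P) \<le> 8 * sqrt c"
    proof (rule near_minimal_L1[of _ \<delta> _ K])
      show "Rh (Suc n) \<in> near \<delta>" using elim Rh_causal by (simp add: near_def)
      show "rs \<in> near \<delta>" using \<delta> by (simp add: rs_near)
      show "kl P (Rh (Suc n)) (R 0) \<le> ennreal (K + c)"
        using kl_fun_integral(3)[OF Rh_dens R_dens R_pos entropy_Rh(1)] elim(1) by (simp only: ennreal_leI)
      show "kl P rs (R 0) \<le> ennreal (K + c)" unfolding kl_rs(1) using c by (intro ennreal_leI) simp
    qed (use kl_rs c \<delta> v_eq_K in auto)
    then show ?case using c b by simp
  qed
qed

lemma KL_R_Rh: "kl_integrable P (R (Suc n)) (Rh n)" "KL P (R (Suc n)) (Rh n) = B n"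
proof -
  have lm: "(\<lambda>x. - ln (f n x)) \<in> borel_measurable (F 0 N)" using f_meas by measurable
  have e: "AE x in P. R (Suc n) x * ln (R (Suc n) x / Rh n x) = - ln (f n x) * R (Suc n) x"
    using R_Suc[of n]
  proof eventually_elim
    case (elim x)
    have "R (Suc n) x / Rh n x = 1 / f n x" using Rh_pos[of n x] unfolding elim by simp
    then show ?case by (simp add: ln_div)
  qed
  note m = marginalD[OF marginal_R lm, of n]
  have "kl_integrable P (R (Suc n)) (Rh n) \<longleftrightarrow> integrable P (\<lambda>x. - ln (f n x) * R (Suc n) x)"
    unfolding kl_integrable_def using e by (intro integrable_cong_AE) auto
  then show "kl_integrable P (R (Suc n)) (Rh n)" using m(1) ln_f_integrable[of n] by simp
  have "KL P (R (Suc n)) (Rh n) = (\<integral>x. - ln (f n x) * R (Suc n) x \<partial>P)"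
    unfolding KL_def using e by (intro integral_cong_AE) auto
  then show "KL P (R (Suc n)) (Rh n) = B n" using m(2) by (simp add: B_def)
qed

text \<open>The entropy of \<open>R (Suc n)\<close> relative to \<open>Rh n\<close> is
  \<open>B n\<close>, and \<open>B\<close> is summable.\<close>

theorem R_L1: "(\<lambda>n. \<integral>x. \<bar>R n x - rs x\<bar> \<partial>P) \<longlonglongrightarrow> 0"
proof (rule LIMSEQ_imp_Suc, rule tendsto_sandwich[OF _ _ tendsto_const])
  have "B \<longlonglongrightarrow> 0" by (rule summable_LIMSEQ_zero[OF summable_B])
  then have "(\<lambda>n. 2 * sqrt (B n) + (\<integral>x. \<bar>Rh n x - rs x\<bar> \<partial>P)) \<longlonglongrightarrow> 2 * sqrt 0 + 0"
    by (intro tendsto_intros Rh_L1)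
  then show "(\<lambda>n. 2 * sqrt (B n) + (\<integral>x. \<bar>Rh n x - rs x\<bar> \<partial>P)) \<longlonglongrightarrow> 0" by simp
  show "\<forall>\<^sub>F n in sequentially. (\<integral>x. \<bar>R (Suc n) x - rs x\<bar> \<partial>P) \<le> 2 * sqrt (B n) + (\<integral>x. \<bar>Rh n x - rs x\<bar> \<partial>P)"
  proof (intro always_eventually allI)
    fix n
    note i = densD(2)[OF R_dens, of "Suc n"] densD(2)[OF Rh_dens, of n] densD(2)[OF causal_dens_dens[OF rs(1)]]
    have "(\<integral>x. \<bar>R (Suc n) x - rs x\<bar> \<partial>P) \<le> (\<integral>x. \<bar>R (Suc n) x - Rh n x\<bar> + \<bar>Rh n x - rs x\<bar> \<partial>P)"
      using i by (intro integral_mono) auto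
    also have "\<dots> = (\<integral>x. \<bar>R (Suc n) x - Rh n x\<bar> \<partial>P) + (\<integral>x. \<bar>Rh n x - rs x\<bar> \<partial>P)"
      using i by (intro Bochner_Integration.integral_add) auto
    also have "(\<integral>x. \<bar>R (Suc n) x - Rh n x\<bar> \<partial>P) \<le> 2 * sqrt (B n)"
    proof (rule L1_le_kl[OF R_dens Rh_dens])
      show "kl P (R (Suc n)) (Rh n) \<le> ennreal (B n)"
        using kl_fun_integral(3)[OF R_dens Rh_dens Rh_pos KL_R_Rh(1)] KL_R_Rh(2) by simp
    qed (use Rh_pos B_nonneg in auto)
    finally show "(\<integral>x. \<bar>R (Suc n) x - rs x\<bar> \<partial>P) \<le> 2 * sqrt (B n) + (\<integral>x. \<bar>Rh n x - rs x\<bar> \<partial>P)" by simp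
  qed
qed auto

text \<open>The first marginal of \<open>Rh n\<close> is \<mu> for all \<open>n\<close>, so
  integrability of \<open>u\<close> suffices. The second marginal need not be \<nu>, but for
  \<open>n > 0\<close> that of \<open>R n\<close> is, and the entropy of \<open>Rh n\<close>
  relative to \<open>R n\<close> tends to 0; here the exponential moment of \<open>w\<close> is
  spent.\<close>

theorem Rh_weighted:
  assumes N: "0 < N" and u: "u \<in> borel_measurable (F N 0)" "\<And>x. 0 \<le> u x" "integrable P u"
    and w: "w \<in> borel_measurable (F 0 N)" "\<And>x. 0 \<le> w x" "integrable P w"
    and \<beta>: "0 < \<beta>" "integrable P (\<lambda>x. exp (\<beta> * w x))"
  shows "\<forall>\<^sub>F n in sequentially. integrable P (\<lambda>x. (u x + w x) * \<bar>Rh n x - rs x\<bar>)"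
    "(\<lambda>n. \<integral>x. (u x + w x) * \<bar>Rh n x - rs x\<bar> \<partial>P) \<longlonglongrightarrow> 0"
proof -
  have uP: "u \<in> borel_measurable P" and wP: "w \<in> borel_measurable P" using u w meas_F[of N 0] meas_F[of 0 N] by auto
  have uiu: "unif_integrable P u (\<lambda>n. Rh (Suc n))"
  proof (rule unif_integrable_const_law[OF uP u(3) _ u(2)])
    fix n and h :: "real \<Rightarrow> real" assume h: "h \<in> borel_measurable borel" "integrable P (\<lambda>x. h (u x))"
    have "(\<lambda>x. h (u x)) \<in> borel_measurable (F N 0)" using measurable_compose[OF u(1) h(1)] .
    from causal_fst_law[OF N Rh_causal this] h(2)
    show "integrable P (\<lambda>x. h (u x) * Rh (Suc n) x) \<and> (\<integral>x. h (u x) * Rh (Suc n) x \<partial>P) = (\<integral>x. h (u x) \<partial>P)" by simp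
  qed
  have uiw: "unif_integrable P w (\<lambda>n. Rh (Suc n))"
  proof (rule unif_integrable_exp_moment[OF wP w(2) \<beta>, where q="\<lambda>n. R (Suc n)"])
    have "A \<longlonglongrightarrow> 0" by (rule summable_LIMSEQ_zero[OF summable_A])
    then show "(\<lambda>n. KL P (Rh (Suc n)) (R (Suc n))) \<longlonglongrightarrow> 0" unfolding A_def by (rule LIMSEQ_Suc)
    fix n and h :: "real \<Rightarrow> real" assume h: "h \<in> borel_measurable borel" "integrable P (\<lambda>x. h (w x))"
    have "(\<lambda>x. h (w x)) \<in> borel_measurable (F 0 N)" using measurable_compose[OF w(1) h(1)] .
    from marginalD[OF marginal_R this, of n] h(2)
    show "integrable P (\<lambda>x. h (w x) * R (Suc n) x) \<and> (\<integral>x. h (w x) * R (Suc n) x \<partial>P) = (\<integral>x. h (w x) \<partial>P)" by simp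
  qed (use Rh_dens R_dens R_pos A_integrable in auto)
  note drs = causal_dens_dens[OF rs(1)]
  have iur: "integrable P (\<lambda>x. u x * rs x)" using causal_fst_law(1)[OF N rs(1) u(1)] u(3) by simp
  have iwr: "integrable P (\<lambda>x. w x * rs x)" using marginalD(1)[OF marginal_rs w(1)] w(3) by simp
  note lim = L1_weighted_sum_tendsto[OF uP u(2) wP w(2) Rh_dens drs iur iwr Rh_L1 uiu uiw]
  show "\<forall>\<^sub>F n in sequentially. integrable P (\<lambda>x. (u x + w x) * \<bar>Rh n x - rs x\<bar>)"
    "(\<lambda>n. \<integral>x. (u x + w x) * \<bar>Rh n x - rs x\<bar> \<partial>P) \<longlonglongrightarrow> 0" by (rule lim)+
qed

text \<open>The roles are exchanged: \<open>R (Suc n)\<close> has second marginal \<nu> and is close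
  in entropy to \<open>Rh n\<close>, whose first marginal is \<mu>; so now \<open>u\<close> needs
  the exponential moment.\<close>

theorem R_weighted:
  assumes N: "0 < N" and u: "u \<in> borel_measurable (F N 0)" "\<And>x. 0 \<le> u x" "integrable P u"
    and w: "w \<in> borel_measurable (F 0 N)" "\<And>x. 0 \<le> w x" "integrable P w"
    and \<beta>: "0 < \<beta>" "integrable P (\<lambda>x. exp (\<beta> * u x))"
  shows "\<forall>\<^sub>F n in sequentially. integrable P (\<lambda>x. (u x + w x) * \<bar>R n x - rs x\<bar>)"
    "(\<lambda>n. \<integral>x. (u x + w x) * \<bar>R n x - rs x\<bar> \<partial>P) \<longlonglongrightarrow> 0"
proof -
  have uP: "u \<in> borel_measurable P" and wP: "w \<in> borel_measurable P" using u w meas_F[of N 0] meas_F[of 0 N] by auto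
  have uiw: "unif_integrable P w (\<lambda>n. R (Suc n))"
  proof (rule unif_integrable_const_law[OF wP w(3) _ w(2)])
    fix n and h :: "real \<Rightarrow> real" assume h: "h \<in> borel_measurable borel" "integrable P (\<lambda>x. h (w x))"
    have "(\<lambda>x. h (w x)) \<in> borel_measurable (F 0 N)" using measurable_compose[OF w(1) h(1)] .
    from marginalD[OF marginal_R this, of n] h(2)
    show "integrable P (\<lambda>x. h (w x) * R (Suc n) x) \<and> (\<integral>x. h (w x) * R (Suc n) x \<partial>P) = (\<integral>x. h (w x) \<partial>P)" by simp
  qed
  have uiu: "unif_integrable P u (\<lambda>n. R (Suc n))"
  proof (rule unif_integrable_exp_moment[OF uP u(2) \<beta>, where q="\<lambda>n. Rh n"])
    have "B \<longlonglongrightarrow> 0" by (rule summable_LIMSEQ_zero[OF summable_B])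
    then show "(\<lambda>n. KL P (R (Suc n)) (Rh n)) \<longlonglongrightarrow> 0" unfolding KL_R_Rh(2) .
    fix n and h :: "real \<Rightarrow> real" assume h: "h \<in> borel_measurable borel" "integrable P (\<lambda>x. h (u x))"
    have "(\<lambda>x. h (u x)) \<in> borel_measurable (F N 0)" using measurable_compose[OF u(1) h(1)] .
    from causal_fst_law[OF N Rh_causal this] h(2)
    show "integrable P (\<lambda>x. h (u x) * Rh n x) \<and> (\<integral>x. h (u x) * Rh n x \<partial>P) = (\<integral>x. h (u x) \<partial>P)" by simp
  qed (use Rh_dens R_dens Rh_pos KL_R_Rh in auto)
  note drs = causal_dens_dens[OF rs(1)]
  have iur: "integrable P (\<lambda>x. u x * rs x)" using causal_fst_law(1)[OF N rs(1) u(1)] u(3) by simp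
  have iwr: "integrable P (\<lambda>x. w x * rs x)" using marginalD(1)[OF marginal_rs w(1)] w(3) by simp
  note lim = L1_weighted_sum_tendsto[OF uP u(2) wP w(2) R_dens drs iur iwr R_L1 uiu uiw]
  show "\<forall>\<^sub>F n in sequentially. integrable P (\<lambda>x. (u x + w x) * \<bar>R n x - rs x\<bar>)"
    "(\<lambda>n. \<integral>x. (u x + w x) * \<bar>R n x - rs x\<bar> \<partial>P) \<longlonglongrightarrow> 0" by (rule lim)+
qed

end

section \<open>Causality in terms of densities\<close>

text \<open>Dynkin's argument. \<open>total\<close> serves the complements, since the whole space
  need not belong to \<open>G\<close>.\<close>

lemma integral_eq_on_generator:
  fixes f g :: "'a \<Rightarrow> real"
  assumes f: "integrable M f" and g: "integrable M g"
    and G: "Int_stable G" "G \<subseteq> Pow (space M)" "sigma_sets (space M) G \<subseteq> sets M"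
    and eq: "\<And>A. A \<in> G \<Longrightarrow> (\<integral>x\<in>A. f x \<partial>M) = (\<integral>x\<in>A. g x \<partial>M)"
    and total: "(\<integral>x. f x \<partial>M) = (\<integral>x. g x \<partial>M)"
    and A: "A \<in> sigma_sets (space M) G"
  shows "(\<integral>x\<in>A. f x \<partial>M) = (\<integral>x\<in>A. g x \<partial>M)"
  using G(1,2) A
proof (induction rule: sigma_sets_induct_disjoint)
  case (basic A)
  then show ?case by (rule eq)
next
  case empty
  then show ?case by (simp add: set_lebesgue_integral_def)
next
  case (compl A)
  then have A: "A \<in> sets M" using G(3) by auto
  have c: "(\<integral>x\<in>space M - A. h x \<partial>M) = (\<integral>x. h x \<partial>M) - (\<integral>x\<in>A. h x \<partial>M)" if h: "integrable M h" for h :: "'a \<Rightarrow> real"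
  proof -
    have "(\<integral>x\<in>space M - A. h x \<partial>M) = (\<integral>x. h x - indicator A x * h x \<partial>M)"
      unfolding set_lebesgue_integral_def by (intro Bochner_Integration.integral_cong) (auto simp: indicator_def)
    also have "\<dots> = (\<integral>x. h x \<partial>M) - (\<integral>x. indicator A x * h x \<partial>M)"
      using h A by (intro Bochner_Integration.integral_diff integrable_mult_indicator[where 'b=real, simplified])
    finally show ?thesis by (simp add: set_lebesgue_integral_def)
  qed
  show ?case unfolding c[OF f] c[OF g] using compl total by simp
next
  case (union A)
  then have A: "\<And>i. A i \<in> sets M" using G(3) by auto
  have s: "(\<integral>x\<in>(\<Union>i. A i). h x \<partial>M) = (\<Sum>i. \<integral>x\<in>A i. h x \<partial>M)" if h: "integrable M h" for h :: "'a \<Rightarrow> real"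
  proof (rule lebesgue_integral_countable_add[OF A])
    show "A i \<inter> A j = {}" if "i \<noteq> j" for i j using union(1) that by (auto simp: disjoint_family_on_def)
    show "set_integrable M (\<Union> (range A)) h"
      unfolding set_integrable_def using h A by (intro integrable_mult_indicator) auto
  qed
  show ?case unfolding s[OF f] s[OF g] using union by simp
qed

lemma real_cond_exp_cong_sets:
  assumes "sets F = sets F'" "space F = space F'"
  shows "real_cond_exp M F f = real_cond_exp M F' f"
proof -
  have "restr_to_subalg K F = restr_to_subalg K F'" for K :: "'a measure"
    unfolding restr_to_subalg_def using assms by simp
  moreover have "subalgebra M F \<longleftrightarrow> subalgebra M F'" unfolding subalgebra_def using assms by simp
  ultimately show ?thesis unfolding real_cond_exp_def nn_cond_exp_def by simp
qed

lemma cond_indep_cong: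
  assumes "sets F = sets F'" "space F = space F'" "sets G = sets G'" "sets H = sets H'"
  shows "cond_indep M F G H \<longleftrightarrow> cond_indep M F' G' H'"
  unfolding cond_indep_def real_cond_exp_cong_sets[OF assms(1,2)] assms(3,4) ..

lemma dens_prob_space:
  assumes r: "dens M r"
  shows "prob_space (density M (\<lambda>x. ennreal (r x)))"
proof (rule prob_spaceI)
  note [measurable] = densD(4)[OF r]
  have "emeasure (density M (\<lambda>x. ennreal (r x))) (space M) = (\<integral>\<^sup>+x. ennreal (r x) \<partial>M)"
    by (subst emeasure_density) (auto intro!: nn_integral_cong simp: indicator_def)
  also have "\<dots> = ennreal (\<integral>x. r x \<partial>M)"
    using densD[OF r] by (intro nn_integral_eq_integral) auto
  finally show "emeasure (density M (\<lambda>x. ennreal (r x))) (space (density M (\<lambda>x. ennreal (r x)))) = 1"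
    using densD(3)[OF r] by simp
qed

lemma dens_density_integral:
  fixes f :: "'a \<Rightarrow> real"
  assumes r: "dens M r" and f: "f \<in> borel_measurable M"
  shows "integrable (density M (\<lambda>x. ennreal (r x))) f \<longleftrightarrow> integrable M (\<lambda>x. r x * f x)"
    "(\<integral>x. f x \<partial>density M (\<lambda>x. ennreal (r x))) = (\<integral>x. r x * f x \<partial>M)"
  using densD[OF r] f by (auto simp: integrable_density integral_density)

context causal_filtration
begin

text \<open>\<open>m\<close>, the conditional probability of \<open>A\<close> under
  \<open>P\<close>, remains one under the density \<open>r\<close>: project \<open>r\<close> to
  \<open>F N t\<close>, where causality turns it into a function of \<open>F t t\<close>; then
  project \<open>A\<close> to \<open>F t t\<close>, which by \<open>commute\<close> gives
  \<open>m\<close>; finally put \<open>r\<close> back.\<close>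

lemma causal_imp_cond_indep:
  assumes r: "causal_dens r" and t: "t < N"
    and G: "sets G \<subseteq> sets (F N 0)" and H: "sets H \<subseteq> sets (F 0 t)"
  shows "cond_indep (density P (\<lambda>x. ennreal (r x))) (F t 0) G H"
  unfolding cond_indep_def
proof (intro ballI)
  note dr = causal_dens_dens[OF r] and ir = densD(2)[OF causal_dens_dens[OF r]]
  define M where "M = density P (\<lambda>x. ennreal (r x))"
  interpret M: prob_space M unfolding M_def by (rule dens_prob_space[OF dr])
  have [simp]: "sets M = sets P" "space M = space P" by (auto simp: M_def)
  have [measurable]: "r \<in> borel_measurable P" using ir by auto
  have sub: "subalgebra M (F t 0)" using F_subalg[of t 0] t by (auto simp: subalgebra_def)
  interpret E: sigma_finite_subalgebra M "F t 0" by (rule M.sigma_finite_subalgebraI[OF sub])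
  interpret Nt: sigma_finite_subalgebra P "F N t" using sf t by auto
  interpret tt: sigma_finite_subalgebra P "F t t" using sf t by auto
  interpret t0: sigma_finite_subalgebra P "F t 0" using sf t by auto
  note Mint = dens_density_integral[OF dr, folded M_def]
  fix A B assume "A \<in> sets G" "B \<in> sets H"
  then have A: "A \<in> sets (F N 0)" and B: "B \<in> sets (F 0 t)" using G H by auto
  have AP[measurable]: "A \<in> sets P" using A sets_F[of N 0] by auto
  define m where "m = real_cond_exp P (F t 0) (indicator A)"
  have mm: "m \<in> borel_measurable (F t 0)" unfolding m_def by auto
  have mP[measurable]: "m \<in> borel_measurable P" unfolding m_def by auto
  have mb: "AE x in P. \<bar>m x\<bar> \<le> 1" unfolding m_def using cond_exp_indicator_bounds(3)[OF _ AP] F_subalg t by simp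
  let ?rt = "real_cond_exp P (F t t) r"
  have main: "AE x in M. real_cond_exp M (F t 0) (indicator (A \<inter> B)) x = m x * real_cond_exp M (F t 0) (indicator B) x"
    if B: "B \<in> sets (F 0 t)" for B
  proof -
    have BP[measurable]: "B \<in> sets P" using B sets_F[of 0 t] t by auto
    have BM: "B \<in> sets M" by simp
    have iAB: "integrable M (indicator (A \<inter> B) :: _ \<Rightarrow> real)" by (simp add: integrable_real_indicator M.emeasure_eq_measure)
    have iB: "integrable M (indicator B :: _ \<Rightarrow> real)" by (simp add: integrable_real_indicator M.emeasure_eq_measure)
    have mMb: "AE x in M. \<bar>m x\<bar> \<le> 1" unfolding M_def using mb by (subst AE_density) auto
    have imB: "integrable M (\<lambda>x. m x * indicator B x)"
      by (rule integrable_bounded_mult[OF iB _ mMb]) (simp add: M_def)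
    have key: "(\<integral>x\<in>D. indicator (A \<inter> B) x \<partial>M) = (\<integral>x\<in>D. m x * indicator B x \<partial>M)" if D: "D \<in> sets (F t 0)" for D
    proof -
      have DP[measurable]: "D \<in> sets P" using D sets_F[of t 0] t by auto
      have DN: "D \<in> sets (F N t)" "D \<in> sets (F t t)" using D t by (auto intro: sets_F_mono[of t _ 0 t])
      have AN: "A \<in> sets (F N t)" using A t by (auto intro: sets_F_mono[of N N 0 t])
      have BN: "B \<in> sets (F N t)" "B \<in> sets (F t t)" using B t by (auto intro: sets_F_mono[of 0 _ t t])
      have mtt: "m \<in> borel_measurable (F t t)" using mm t by (auto intro: meas_F_mono[of t t 0 t])
      let ?i = "\<lambda>x. indicator D x * indicator A x * indicator B x :: real"
      let ?j = "\<lambda>x. indicator D x * indicator B x :: real"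
      have irt: "integrable P ?rt" using ir by auto
      have "(\<integral>x\<in>D. indicator (A \<inter> B) x \<partial>M) = (\<integral>x. ?i x \<partial>M)"
        unfolding set_lebesgue_integral_def by (intro Bochner_Integration.integral_cong) (auto simp: indicator_def)
      also have "\<dots> = (\<integral>x. ?i x * r x \<partial>P)" by (subst Mint(2)) (auto simp: mult_ac)
      also have "\<dots> = (\<integral>x. ?i x * real_cond_exp P (F N t) r x \<partial>P)"
        using DN AN BN ir by (intro Nt.real_cond_exp_intg(2)[symmetric] integrable_bounded_mult[where c=1]) (auto simp: indicator_def)
      also have "\<dots> = (\<integral>x. (?j x * ?rt x) * indicator A x \<partial>P)"
        using causal_densD[OF r t] by (intro integral_cong_AE) (auto simp: mult_ac)
      also have "\<dots> = (\<integral>x. (?j x * ?rt x) * real_cond_exp P (F t t) (indicator A) x \<partial>P)"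
      proof (rule tt.real_cond_exp_intg(2)[symmetric])
        have "integrable P (\<lambda>x. (?j x * indicator A x) * ?rt x)"
          by (rule integrable_bounded_mult[OF irt, where c=1]) (auto simp: indicator_def)
        then show "integrable P (\<lambda>x. (?j x * ?rt x) * indicator A x)" by (simp add: mult_ac)
      qed (use DN BN in auto)
      also have "\<dots> = (\<integral>x. (?j x * m x) * ?rt x \<partial>P)"
      proof (rule integral_cong_AE)
        have "AE x in P. real_cond_exp P (F t t) (indicator A) x = m x"
          unfolding m_def by (rule commute[of t N 0 t]) (use t A in auto)
        then show "AE x in P. (?j x * ?rt x) * real_cond_exp P (F t t) (indicator A) x = (?j x * m x) * ?rt x"
          by eventually_elim (simp add: mult_ac)
      qed auto
      also have "\<dots> = (\<integral>x. (?j x * m x) * r x \<partial>P)"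
      proof (rule tt.real_cond_exp_intg(2))
        show "integrable P (\<lambda>x. (?j x * m x) * r x)"
        proof (rule integrable_bounded_mult[OF ir])
          show "AE x in P. \<bar>?j x * m x\<bar> \<le> 1" using mb by eventually_elim (auto simp: indicator_def)
        qed measurable
      qed (use DN BN mtt in auto)
      also have "\<dots> = (\<integral>x. ?j x * m x \<partial>M)" by (subst Mint(2)) (auto simp: mult_ac)
      also have "\<dots> = (\<integral>x\<in>D. m x * indicator B x \<partial>M)"
        unfolding set_lebesgue_integral_def by (intro Bochner_Integration.integral_cong) (auto simp: mult_ac)
      finally show ?thesis .
    qed
    have 1: "AE x in M. real_cond_exp M (F t 0) (indicator (A \<inter> B)) x = real_cond_exp M (F t 0) (\<lambda>x. m x * indicator B x) x"
    proof (rule E.real_cond_exp_charact)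
      fix D assume D: "D \<in> sets (F t 0)"
      show "(\<integral>x\<in>D. indicator (A \<inter> B) x \<partial>M) = (\<integral>x\<in>D. real_cond_exp M (F t 0) (\<lambda>x. m x * indicator B x) x \<partial>M)"
        using key[OF D] E.real_cond_exp_intA[OF imB D] by simp
    qed (use iAB imB in auto)
    have 2: "AE x in M. real_cond_exp M (F t 0) (\<lambda>x. m x * indicator B x) x = m x * real_cond_exp M (F t 0) (indicator B) x"
      by (rule E.real_cond_exp_mult[OF mm borel_measurable_integrable[OF iB] imB])
    show ?thesis using 1 2 by eventually_elim simp
  qed
  \<comment> \<open>Taking the whole space for \<open>B\<close> in \<open>main\<close> shows that
    \<open>m\<close> is the conditional probability of \<open>A\<close> under \<open>M\<close>;
    \<open>main\<close> for the given \<open>B\<close> is then the product formula.\<close>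
  have sp: "space P \<in> sets (F 0 t)" using F_subalg[of 0 t] t by (metis le0 less_imp_le subalgebra_def sets.top)
  have As: "real_cond_exp M (F t 0) (indicator (A \<inter> space P)) = real_cond_exp M (F t 0) (indicator A)"
    using sets.sets_into_space[OF AP] by (simp add: Int_absorb2)
  have "AE x in M. real_cond_exp M (F t 0) (indicator (space P)) x = 1"
  proof -
    have "AE x in M. real_cond_exp M (F t 0) (\<lambda>_. 1) x = 1" by (rule E.real_cond_exp_F_meas) auto
    moreover have "AE x in M. real_cond_exp M (F t 0) (indicator (space P)) x = real_cond_exp M (F t 0) (\<lambda>_. 1) x"
      using borel_measurable_indicator[OF sets.top[of M]] by (intro E.real_cond_exp_cong) (auto intro: AE_I2)
    ultimately show ?thesis by eventually_elim simp
  qed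
  then have mA: "AE x in M. real_cond_exp M (F t 0) (indicator A) x = m x"
    using main[OF sp] unfolding As by eventually_elim simp
  show "AE x in density P (\<lambda>x. ennreal (r x)). real_cond_exp (density P (\<lambda>x. ennreal (r x))) (F t 0) (indicator (A \<inter> B)) x =
     real_cond_exp (density P (\<lambda>x. ennreal (r x))) (F t 0) (indicator A) x * real_cond_exp (density P (\<lambda>x. ennreal (r x))) (F t 0) (indicator B) x"
    unfolding M_def[symmetric] using mA main[OF B] by eventually_elim simp
qed

text \<open>Conditional independence speaks of the next coordinate of \<open>X\<close> only,
  \<open>causal_dens\<close> of the whole path. Induction from \<open>t\<close> to \<open>N\<close>
  adds one coordinate at a time, using at time \<open>s\<close> that \<open>Y\<close> up to
  \<open>t\<close> is part of \<open>Y\<close> up to \<open>s\<close>.\<close>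

lemma cond_indep_imp_causal:
  assumes dr: "dens P r" and fst: "AE x in P. real_cond_exp P (F N 0) r x = 1"
    and ci: "\<And>t. 1 \<le> t \<Longrightarrow> t < N \<Longrightarrow> cond_indep (density P (\<lambda>x. ennreal (r x))) (F t 0) (W t) (F 0 t)"
    and W: "\<And>t. 1 \<le> t \<Longrightarrow> t < N \<Longrightarrow> sets (W t) \<subseteq> sets (F (Suc t) 0)"
    and gen: "\<And>s t. 1 \<le> t \<Longrightarrow> t \<le> s \<Longrightarrow> s < N \<Longrightarrow> sets (F (Suc s) t) =
      sigma_sets (space P) {D \<inter> E \<inter> B | D E B. D \<in> sets (F s 0) \<and> E \<in> sets (W s) \<and> B \<in> sets (F 0 t)}"
  shows "causal_dens r"
  unfolding causal_dens_def
proof (intro conjI allI impI dr)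
  fix t assume t: "t < N"
  note ir = densD(2)[OF dr]
  have [measurable]: "r \<in> borel_measurable P" using ir by auto
  define M where "M = density P (\<lambda>x. ennreal (r x))"
  interpret M: prob_space M unfolding M_def by (rule dens_prob_space[OF dr])
  have [simp]: "sets M = sets P" "space M = space P" by (auto simp: M_def)
  note Mint = dens_density_integral[OF dr, folded M_def]
  show "AE x in P. real_cond_exp P (F N t) r x = real_cond_exp P (F t t) r x"
  proof (cases "t = 0")
    case True
    interpret G: sigma_finite_subalgebra P "F 0 0" using sf by auto
    have 1: "AE x in P. real_cond_exp P (F 0 0) (real_cond_exp P (F N 0) r) x = real_cond_exp P (F 0 0) r x"
      by (rule G.real_cond_exp_nested_subalg) (use F_subalg F_mono ir in auto)
    have 2: "AE x in P. real_cond_exp P (F 0 0) (real_cond_exp P (F N 0) r) x = real_cond_exp P (F 0 0) (\<lambda>_. 1) x"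
      by (rule G.real_cond_exp_cong[OF fst]) auto
    have 3: "AE x in P. real_cond_exp P (F 0 0) (\<lambda>_. 1) x = 1" by (rule G.real_cond_exp_F_meas) auto
    show ?thesis unfolding True using fst 1 2 3 by eventually_elim simp
  next
    case False
    then have t1: "1 \<le> t" by simp
    have fstI: "(\<integral>x. h x * r x \<partial>P) = (\<integral>x. h x \<partial>P)" if h: "h \<in> borel_measurable (F N 0)" for h :: "'a \<Rightarrow> real"
      using cond_density_integral(2)[OF _ _ dr _ _ fst h] by simp
    have "t + k \<le> N \<Longrightarrow> AE x in P. real_cond_exp P (F (t + k) t) r x = real_cond_exp P (F t t) r x" for k
    proof (induction k)
      case (Suc k)
      define s where "s = t + k"
      have s: "t \<le> s" "s < N" "Suc s \<le> N" "1 \<le> s" using Suc t1 by (auto simp: s_def)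
      define rs where "rs = real_cond_exp P (F s t) r"
      interpret S: sigma_finite_subalgebra P "F (Suc s) t" using sf s t by auto
      interpret st: sigma_finite_subalgebra P "F s t" using sf s t by auto
      interpret s0: sigma_finite_subalgebra P "F s 0" using sf s by auto
      have subM: "subalgebra M (F s 0)" using F_subalg[of s 0] s by (auto simp: subalgebra_def)
      interpret E: sigma_finite_subalgebra M "F s 0" by (rule M.sigma_finite_subalgebraI[OF subM])
      have rsm: "rs \<in> borel_measurable (F s t)" and irs: "integrable P rs" unfolding rs_def using ir by auto
      have rsP[measurable]: "rs \<in> borel_measurable P" using irs by auto
      let ?G = "{D \<inter> E \<inter> B | D E B. D \<in> sets (F s 0) \<and> E \<in> sets (W s) \<and> B \<in> sets (F 0 t)}"
      \<comment> \<open>Under \<open>M\<close>, conditional independence replaces \<open>A\<close>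
        by \<open>m\<close>; then all factors are known to \<open>F s t\<close> and \<open>r\<close>
        may be projected to \<open>rs\<close>; under \<open>P\<close>, \<open>commute\<close> turns
        \<open>m\<close> back into \<open>A\<close>.\<close>
      have basic: "(\<integral>x\<in>D \<inter> A \<inter> B. r x \<partial>P) = (\<integral>x\<in>D \<inter> A \<inter> B. rs x \<partial>P)"
        if D: "D \<in> sets (F s 0)" and AW: "A \<in> sets (W s)" and B: "B \<in> sets (F 0 t)" for D A B
      proof -
        have A: "A \<in> sets (F (Suc s) 0)" using AW W[OF s(4,2)] by auto
        have AN: "A \<in> sets (F N 0)" using A s by (auto intro: sets_F_mono[of "Suc s" N 0 0])
        have DN: "D \<in> sets (F N 0)" using D s by (auto intro: sets_F_mono[of s N 0 0])
        have [measurable]: "A \<in> sets P" "D \<in> sets P" "B \<in> sets P"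
          using AN DN B sets_F[of N 0] sets_F[of 0 t] t by auto
        have Bs: "B \<in> sets (F 0 s)" using B s by (auto intro: sets_F_mono[of 0 0 t s])
        have Dst: "D \<in> sets (F s t)" using D s t by (auto intro: sets_F_mono[of s s 0 t])
        have Bst: "B \<in> sets (F s t)" using B s t by (auto intro: sets_F_mono[of 0 s t t])
        define m where "m = real_cond_exp P (F s 0) (indicator A)"
        have mm: "m \<in> borel_measurable (F s 0)" unfolding m_def by auto
        have mP[measurable]: "m \<in> borel_measurable P" unfolding m_def by auto
        have mN: "m \<in> borel_measurable (F N 0)" using mm s by (auto intro: meas_F_mono[of s N 0 0])
        have mst: "m \<in> borel_measurable (F s t)" using mm s t by (auto intro: meas_F_mono[of s s 0 t])
        have mb: "AE x in P. \<bar>m x\<bar> \<le> 1" unfolding m_def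
          by (rule cond_exp_indicator_bounds(3)) (use F_subalg s in auto)
        have mMb: "AE x in M. \<bar>m x\<bar> \<le> 1" unfolding m_def M_def using mb[unfolded m_def] by (subst AE_density) auto
        have im: "integrable M m" using M.integrable_const_bound[of m 1] mMb by (simp add: M_def)
        have iA: "integrable M (indicator A :: _ \<Rightarrow> real)" "integrable M (indicator B :: _ \<Rightarrow> real)"
          "integrable M (indicator (A \<inter> B) :: _ \<Rightarrow> real)" "integrable P (indicator A :: _ \<Rightarrow> real)"
          by (simp_all add: integrable_real_indicator M.emeasure_eq_measure emeasure_eq_measure)
        \<comment> \<open>Integrals of functions of \<open>X\<close> agree under \<open>M\<close>
          and \<open>P\<close> by the condition on the first marginal, so \<open>m\<close> is a
          version of the conditional probability under both.\<close>
        have mA: "AE x in M. real_cond_exp M (F s 0) (indicator A) x = m x"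
        proof (rule E.real_cond_exp_charact)
          fix C assume C: "C \<in> sets (F s 0)"
          then have CN: "C \<in> sets (F N 0)" using s by (auto intro: sets_F_mono[of s N 0 0])
          have [measurable]: "C \<in> sets P" using CN sets_F[of N 0] by auto
          have "(\<integral>x\<in>C. indicator A x \<partial>M) = (\<integral>x. (indicator C x * indicator A x) * r x \<partial>P)"
            unfolding set_lebesgue_integral_def by (subst Mint(2)) (auto simp: mult_ac)
          also have "\<dots> = (\<integral>x\<in>C. indicator A x \<partial>P)"
            using CN AN by (subst fstI) (auto simp: set_lebesgue_integral_def)
          also have "\<dots> = (\<integral>x\<in>C. m x \<partial>P)" unfolding m_def by (rule s0.real_cond_exp_intA[OF iA(4) C])
          also have "\<dots> = (\<integral>x. (indicator C x * m x) * r x \<partial>P)"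
            using CN mN by (subst fstI) (auto simp: set_lebesgue_integral_def)
          also have "\<dots> = (\<integral>x\<in>C. m x \<partial>M)"
            unfolding set_lebesgue_integral_def by (subst Mint(2)) (auto simp: mult_ac)
          finally show "(\<integral>x\<in>C. indicator A x \<partial>M) = (\<integral>x\<in>C. m x \<partial>M)" .
        qed (use iA im mm in auto)
        let ?eB = "real_cond_exp M (F s 0) (indicator B)"
        have eAB: "AE x in M. real_cond_exp M (F s 0) (indicator (A \<inter> B)) x = m x * ?eB x"
          using ci[OF s(4,2), folded M_def, unfolded cond_indep_def, rule_format, OF AW Bs] mA
          by eventually_elim simp
        have idm: "integrable M (\<lambda>x. (indicator D x * m x) * indicator B x)"
        proof (rule integrable_bounded_mult[OF iA(2)])
          show "AE x in M. \<bar>indicator D x * m x\<bar> \<le> 1" using mMb by eventually_elim (auto simp: indicator_def)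
        qed (simp add: M_def)
        have "(\<integral>x\<in>D \<inter> A \<inter> B. r x \<partial>P) = (\<integral>x. indicator D x * indicator (A \<inter> B) x \<partial>M)"
          unfolding set_lebesgue_integral_def by (subst Mint(2)) (auto simp: indicator_def intro!: Bochner_Integration.integral_cong)
        also have "\<dots> = (\<integral>x. indicator D x * real_cond_exp M (F s 0) (indicator (A \<inter> B)) x \<partial>M)"
          using E.real_cond_exp_intA[OF iA(3) D] by (simp add: set_lebesgue_integral_def)
        also have "\<dots> = (\<integral>x. (indicator D x * m x) * ?eB x \<partial>M)"
        proof (rule integral_cong_AE)
          show "AE x in M. indicator D x * real_cond_exp M (F s 0) (indicator (A \<inter> B)) x = (indicator D x * m x) * ?eB x"
            using eAB by eventually_elim simp
        qed (auto simp: M_def)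
        also have "\<dots> = (\<integral>x. (indicator D x * m x) * indicator B x \<partial>M)"
          by (rule E.real_cond_exp_intg(2)[OF idm]) (use D mm in \<open>auto simp: M_def\<close>)
        also have "\<dots> = (\<integral>x. (indicator D x * m x * indicator B x) * r x \<partial>P)"
          by (subst Mint(2)) (auto simp: mult_ac)
        also have "\<dots> = (\<integral>x. (indicator D x * m x * indicator B x) * rs x \<partial>P)"
          unfolding rs_def
        proof (rule st.real_cond_exp_intg(2)[symmetric])
          show "integrable P (\<lambda>x. (indicator D x * m x * indicator B x) * r x)"
          proof (rule integrable_bounded_mult[OF ir])
            show "AE x in P. \<bar>indicator D x * m x * indicator B x\<bar> \<le> 1" using mb by eventually_elim (auto simp: indicator_def)
          qed measurable
        qed (use Dst Bst mst in auto)
        also have "\<dots> = (\<integral>x. (indicator D x * indicator B x * rs x) * real_cond_exp P (F s t) (indicator A) x \<partial>P)"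
        proof (rule integral_cong_AE)
          have "AE x in P. real_cond_exp P (F s t) (indicator A) x = m x"
            unfolding m_def by (rule commute[of s N 0 t]) (use s t AN in auto)
          then show "AE x in P. (indicator D x * m x * indicator B x) * rs x = (indicator D x * indicator B x * rs x) * real_cond_exp P (F s t) (indicator A) x"
            by eventually_elim (simp add: mult_ac)
        qed auto
        also have "\<dots> = (\<integral>x. (indicator D x * indicator B x * rs x) * indicator A x \<partial>P)"
        proof (rule st.real_cond_exp_intg(2))
          have "integrable P (\<lambda>x. (indicator D x * indicator B x * indicator A x) * rs x)"
            by (rule integrable_bounded_mult[OF irs, where c=1]) (auto simp: indicator_def)
          then show "integrable P (\<lambda>x. (indicator D x * indicator B x * rs x) * indicator A x)" by (simp add: mult_ac)
        qed (use Dst Bst rsm in auto)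
        also have "\<dots> = (\<integral>x\<in>D \<inter> A \<inter> B. rs x \<partial>P)"
          unfolding set_lebesgue_integral_def by (intro Bochner_Integration.integral_cong) (auto simp: indicator_def)
        finally show ?thesis .
      qed
      have "AE x in P. real_cond_exp P (F (Suc s) t) r x = rs x"
      proof (rule S.real_cond_exp_charact)
        fix C assume C: "C \<in> sets (F (Suc s) t)"
        note g = gen[OF t1 s(1,2)]
        show "(\<integral>x\<in>C. r x \<partial>P) = (\<integral>x\<in>C. rs x \<partial>P)"
        proof (rule integral_eq_on_generator[OF ir irs])
          show "Int_stable ?G"
          proof (rule Int_stableI)
            fix a b assume "a \<in> ?G" "b \<in> ?G"
            then obtain D E B D' E' B' where *: "a = D \<inter> E \<inter> B" "b = D' \<inter> E' \<inter> B'"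
              "D \<in> sets (F s 0)" "D' \<in> sets (F s 0)" "E \<in> sets (W s)" "E' \<in> sets (W s)" "B \<in> sets (F 0 t)" "B' \<in> sets (F 0 t)"
              by blast
            have "a \<inter> b = (D \<inter> D') \<inter> (E \<inter> E') \<inter> (B \<inter> B')" using *(1,2) by blast
            then show "a \<inter> b \<in> ?G" using *(3-8) by blast
          qed
          have sF: "sets (F (Suc s) t) \<subseteq> sets P" using sets_F[of "Suc s" t] s t by auto
          have "?G \<subseteq> sigma_sets (space P) ?G" by auto
          then show "?G \<subseteq> Pow (space P)" using sF sets.sets_into_space unfolding g[symmetric] by blast
          show "sigma_sets (space P) ?G \<subseteq> sets P" unfolding g[symmetric] by (rule sF)
          show "C \<in> sigma_sets (space P) ?G" using C unfolding g .
          show "(\<integral>x. r x \<partial>P) = (\<integral>x. rs x \<partial>P)" unfolding rs_def using st.real_cond_exp_int(2)[OF ir] by simp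
          show "(\<integral>x\<in>A. r x \<partial>P) = (\<integral>x\<in>A. rs x \<partial>P)" if "A \<in> ?G" for A using that basic by blast
        qed
      qed (use ir irs rsm s t in \<open>auto intro: meas_F_mono[of s "Suc s" t t]\<close>)
      then show ?case using Suc unfolding rs_def s_def by (auto elim: eventually_elim2)
    qed simp
    from this[of "N - t"] show ?thesis using t by simp
  qed
qed

end

section \<open>The filtration of a product of path spaces\<close>

lemma subalgebra_pair:
  assumes "subalgebra M1 A1" "subalgebra M2 A2"
  shows "subalgebra (M1 \<Otimes>\<^sub>M M2) (A1 \<Otimes>\<^sub>M A2)"
  unfolding subalgebra_def
proof
  show sp: "space (A1 \<Otimes>\<^sub>M A2) = space (M1 \<Otimes>\<^sub>M M2)" using assms by (simp add: space_pair_measure subalgebra_def)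
  have "fst \<in> M1 \<Otimes>\<^sub>M M2 \<rightarrow>\<^sub>M A1" "snd \<in> M1 \<Otimes>\<^sub>M M2 \<rightarrow>\<^sub>M A2"
    using assms by (auto simp: measurable_def subalgebra_def space_pair_measure dest: measurable_sets[OF measurable_fst] measurable_sets[OF measurable_snd])
  then have "(\<lambda>z. (fst z, snd z)) \<in> M1 \<Otimes>\<^sub>M M2 \<rightarrow>\<^sub>M A1 \<Otimes>\<^sub>M A2" by (rule measurable_Pair)
  then have m: "(\<lambda>z. z) \<in> M1 \<Otimes>\<^sub>M M2 \<rightarrow>\<^sub>M A1 \<Otimes>\<^sub>M A2" by simp
  show "sets (A1 \<Otimes>\<^sub>M A2) \<subseteq> sets (M1 \<Otimes>\<^sub>M M2)"
  proof
    fix S assume S: "S \<in> sets (A1 \<Otimes>\<^sub>M A2)"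
    have "(\<lambda>z. z) -` S \<inter> space (M1 \<Otimes>\<^sub>M M2) = S" using sets.sets_into_space[OF S] sp by auto
    then show "S \<in> sets (M1 \<Otimes>\<^sub>M M2)" using measurable_sets[OF m S] by simp
  qed
qed

text \<open>Fubini: for a fixed second component \<open>f\<close> is measurable for
  \<open>A1\<close> in the first one, so the indicator may be projected in that variable
  alone.\<close>

lemma pair_cond_exp_fst:
  assumes M1: "prob_space M1" and M2: "prob_space M2" and A: "subalgebra M1 A1" and B: "space A2 = space M2"
    and D: "D \<in> sets M1" and f: "f \<in> borel_measurable (A1 \<Otimes>\<^sub>M A2)" "integrable (M1 \<Otimes>\<^sub>M M2) f"
  shows "(\<integral>z. indicator D (fst z) * f z \<partial>(M1 \<Otimes>\<^sub>M M2)) = (\<integral>z. real_cond_exp M1 A1 (indicator D) (fst z) * f z \<partial>(M1 \<Otimes>\<^sub>M M2))"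
    "AE z in M1 \<Otimes>\<^sub>M M2. \<bar>real_cond_exp M1 A1 (indicator D) (fst z)\<bar> \<le> 1"
proof -
  interpret M1: prob_space M1 by fact
  interpret M2: prob_space M2 by fact
  interpret pair_prob_space M1 M2 ..
  interpret E: sigma_finite_subalgebra M1 A1 by (rule M1.sigma_finite_subalgebraI[OF A])
  have [measurable]: "f \<in> borel_measurable (M1 \<Otimes>\<^sub>M M2)" using f(2) by auto
  let ?m = "real_cond_exp M1 A1 (indicator D)"
  have "AE z in distr (M1 \<Otimes>\<^sub>M M2) M1 fst. \<bar>?m z\<bar> \<le> 1"
    unfolding M2.distr_pair_fst by (rule M1.cond_exp_indicator_bounds(3)[OF A D])
  from AE_distrD[OF measurable_fst this]
  show mb: "AE z in M1 \<Otimes>\<^sub>M M2. \<bar>?m (fst z)\<bar> \<le> 1" .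
  have i1: "integrable (M1 \<Otimes>\<^sub>M M2) (\<lambda>(x, y). indicator D x * f (x, y))"
    using integrable_bounded_mult[OF f(2), of "\<lambda>z. indicator D (fst z)" 1] D
    by (simp add: case_prod_beta' indicator_def)
  have i2: "integrable (M1 \<Otimes>\<^sub>M M2) (\<lambda>(x, y). ?m x * f (x, y))"
    using integrable_bounded_mult[OF f(2) _ mb] by (simp add: case_prod_beta')
  have "(\<integral>z. indicator D (fst z) * f z \<partial>(M1 \<Otimes>\<^sub>M M2)) = (\<integral>y. (\<integral>x. indicator D x * f (x, y) \<partial>M1) \<partial>M2)"
    using integral_snd[OF i1] by (simp add: case_prod_beta')
  also have "\<dots> = (\<integral>y. (\<integral>x. ?m x * f (x, y) \<partial>M1) \<partial>M2)"
  proof (rule integral_cong_AE)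
    show "AE y in M2. (\<integral>x. indicator D x * f (x, y) \<partial>M1) = (\<integral>x. ?m x * f (x, y) \<partial>M1)"
      using AE_integrable_snd[OF i1] AE_integrable_snd[OF i2] AE_space
    proof eventually_elim
      case (elim y)
      have "(\<lambda>x. (x, y)) \<in> A1 \<rightarrow>\<^sub>M A1 \<Otimes>\<^sub>M A2" using elim(3) B by simp
      from measurable_compose[OF this f(1)] have fy: "(\<lambda>x. f (x, y)) \<in> borel_measurable A1" .
      have "(\<integral>x. indicator D x * f (x, y) \<partial>M1) = (\<integral>x. f (x, y) * indicator D x \<partial>M1)" by (simp add: mult.commute)
      also have "\<dots> = (\<integral>x. f (x, y) * ?m x \<partial>M1)"
        using elim(1) D by (intro E.real_cond_exp_intg(2)[symmetric] fy) (auto simp: mult.commute)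
      finally show ?case by (simp add: mult.commute)
    qed
  qed (use D in measurable)
  also have "\<dots> = (\<integral>z. ?m (fst z) * f z \<partial>(M1 \<Otimes>\<^sub>M M2))"
    using integral_snd[OF i2] by (simp add: case_prod_beta')
  finally show "(\<integral>z. indicator D (fst z) * f z \<partial>(M1 \<Otimes>\<^sub>M M2)) = (\<integral>z. ?m (fst z) * f z \<partial>(M1 \<Otimes>\<^sub>M M2))" .
qed

text \<open>The defining equation of the projection, tested on sets \<open>T\<close>, becomes by
  self-adjointness an equation of integrals over \<open>S\<close>; for this it suffices to treat
  rectangles \<open>S\<close>.\<close>

lemma pair_cond_exp_commute:
  assumes M1: "prob_space M1" and M2: "prob_space M2"
    and A: "subalgebra M1 A'" "subalgebra A' A" and B: "subalgebra M2 B" "subalgebra B B'"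
    and S: "S \<in> sets (A' \<Otimes>\<^sub>M B')"
  shows "AE z in M1 \<Otimes>\<^sub>M M2. real_cond_exp (M1 \<Otimes>\<^sub>M M2) (A \<Otimes>\<^sub>M B) (indicator S) z =
    real_cond_exp (M1 \<Otimes>\<^sub>M M2) (A \<Otimes>\<^sub>M B') (indicator S) z"
proof -
  interpret M1: prob_space M1 by fact
  interpret M2: prob_space M2 by fact
  interpret pair_prob_space M1 M2 ..
  have A1: "subalgebra M1 A" and B1: "subalgebra M2 B'" using A B by (auto simp: subalgebra_def)
  let ?P = "M1 \<Otimes>\<^sub>M M2"
  have AA: "subalgebra A A" by (simp add: subalgebra_def)
  note sAB = subalgebra_pair[OF A1 B(1)] subalgebra_pair[OF A1 B1] subalgebra_pair[OF A(1) B1] subalgebra_pair[OF AA B(2)]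
  interpret AB: sigma_finite_subalgebra ?P "A \<Otimes>\<^sub>M B" by (rule sigma_finite_subalgebraI[OF sAB(1)])
  interpret AB': sigma_finite_subalgebra ?P "A \<Otimes>\<^sub>M B'" by (rule sigma_finite_subalgebraI[OF sAB(2)])
  have SP: "S \<in> sets ?P" using S sAB(3) by (auto simp: subalgebra_def)
  have iS: "integrable ?P (indicator S :: _ \<Rightarrow> real)" using SP by (simp add: integrable_real_indicator emeasure_eq_measure)
  show ?thesis
  proof (rule AB.real_cond_exp_charact[OF _ iS])
    show "real_cond_exp ?P (A \<Otimes>\<^sub>M B') (indicator S) \<in> borel_measurable (A \<Otimes>\<^sub>M B)"
      by (rule measurable_from_subalg[OF sAB(4)]) auto
    show "integrable ?P (real_cond_exp ?P (A \<Otimes>\<^sub>M B') (indicator S))" using iS by auto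
    fix T assume T: "T \<in> sets (A \<Otimes>\<^sub>M B)"
    then have TP: "T \<in> sets ?P" using sAB(1) by (auto simp: subalgebra_def)
    have iT: "integrable ?P (indicator T :: _ \<Rightarrow> real)" using TP by (simp add: integrable_real_indicator emeasure_eq_measure)
    define g where "g = real_cond_exp ?P (A \<Otimes>\<^sub>M B') (indicator T)"
    have ig: "integrable ?P g" unfolding g_def using iT by auto
    have gm: "g \<in> borel_measurable (A \<Otimes>\<^sub>M B')" unfolding g_def by auto
    have gm': "g \<in> borel_measurable (A \<Otimes>\<^sub>M B)" by (rule measurable_from_subalg[OF sAB(4) gm])
    \<comment> \<open>\<open>D\<close> is replaced by its projection to \<open>A\<close>, once for
      the indicator of \<open>T\<close> and once for \<open>g\<close>; in between the weight is
      measurable for the product of \<open>A\<close> and \<open>B'\<close>, so that \<open>T\<close>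
      may be projected to \<open>g\<close>.\<close>
    have rect: "(\<integral>z\<in>D \<times> C. indicator T z \<partial>?P) = (\<integral>z\<in>D \<times> C. g z \<partial>?P)" if D: "D \<in> sets A'" and C: "C \<in> sets B'" for D C
    proof -
      have DM: "D \<in> sets M1" using D A by (auto simp: subalgebra_def)
      have CM: "C \<in> sets M2" using C B1 by (auto simp: subalgebra_def)
      have CB: "C \<in> sets B" using C B by (auto simp: subalgebra_def)
      have CP: "space M1 \<times> C \<in> sets ?P" using CM by auto
      have spA: "space A = space M1" "space B = space M2" "space B' = space M2" using A1 B B1 by (auto simp: subalgebra_def)
      let ?c = "\<lambda>z. indicator (space M1 \<times> C) z :: real" and ?m = "real_cond_exp M1 A (indicator D)"
      have cAB: "?c \<in> borel_measurable (A \<Otimes>\<^sub>M B')" "?c \<in> borel_measurable (A \<Otimes>\<^sub>M B)"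
        using pair_measureI[OF sets.top[of A] C] pair_measureI[OF sets.top[of A] CB] unfolding spA(1)
        by (simp_all add: borel_measurable_indicator)
      have icT: "integrable ?P (\<lambda>z. ?c z * indicator T z)" "integrable ?P (\<lambda>z. ?c z * g z)"
        by (rule integrable_bounded_mult[OF iT, where c=1] integrable_bounded_mult[OF ig, where c=1]; use CP in \<open>auto simp: indicator_def\<close>)+
      have r: "(\<integral>z\<in>D \<times> C. h z \<partial>?P) = (\<integral>z. indicator D (fst z) * (?c z * h z) \<partial>?P)" for h :: "_ \<Rightarrow> real"
        unfolding set_lebesgue_integral_def using sets.sets_into_space[OF DM]
        by (intro Bochner_Integration.integral_cong) (auto simp: indicator_def)
      have cT: "(\<lambda>z. ?c z * indicator T z) \<in> borel_measurable (A \<Otimes>\<^sub>M B)" "(\<lambda>z. ?c z * g z) \<in> borel_measurable (A \<Otimes>\<^sub>M B)"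
        using cAB(2) T gm' by auto
      note p1 = pair_cond_exp_fst[OF M1 M2 A1 spA(2) DM cT(1) icT(1)]
      note p2 = pair_cond_exp_fst[OF M1 M2 A1 spA(2) DM cT(2) icT(2)]
      have mf: "(\<lambda>z. ?m (fst z) * ?c z) \<in> borel_measurable (A \<Otimes>\<^sub>M B')"
        using cAB(1) measurable_compose[OF measurable_fst borel_measurable_cond_exp] by (intro borel_measurable_times) auto
      have imT: "integrable ?P (\<lambda>z. (?m (fst z) * ?c z) * indicator T z)"
      proof (rule integrable_bounded_mult[OF iT])
        show "AE z in ?P. \<bar>?m (fst z) * ?c z\<bar> \<le> 1" using p1(2) by eventually_elim (auto simp: indicator_def)
        show "(\<lambda>z. ?m (fst z) * ?c z) \<in> borel_measurable ?P" by (rule measurable_from_subalg[OF sAB(2) mf])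
      qed
      have "(\<integral>z\<in>D \<times> C. indicator T z \<partial>?P) = (\<integral>z. (?m (fst z) * ?c z) * indicator T z \<partial>?P)"
        unfolding r p1(1) by (simp add: mult.assoc)
      also have "\<dots> = (\<integral>z. (?m (fst z) * ?c z) * g z \<partial>?P)"
        unfolding g_def by (rule AB'.real_cond_exp_intg(2)[symmetric, OF imT mf]) (use TP in auto)
      also have "\<dots> = (\<integral>z\<in>D \<times> C. g z \<partial>?P)"
        unfolding r p2(1) by (simp add: mult.assoc)
      finally show ?thesis .
    qed
    have sp: "space A' \<times> space B' = space ?P" using A B1 by (simp add: subalgebra_def space_pair_measure)
    have gen: "sets (A' \<Otimes>\<^sub>M B') = sigma_sets (space ?P) {a \<times> b |a b. a \<in> sets A' \<and> b \<in> sets B'}"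
      unfolding sets_pair_measure sp ..
    have "(\<integral>z\<in>S. indicator T z \<partial>?P) = (\<integral>z\<in>S. g z \<partial>?P)"
    proof (rule integral_eq_on_generator[OF iT ig Int_stable_pair_measure_generator])
      show "{a \<times> b |a b. a \<in> sets A' \<and> b \<in> sets B'} \<subseteq> Pow (space ?P)"
        using sets.sets_into_space[of _ A'] sets.sets_into_space[of _ B'] unfolding sp[symmetric] by blast
      show "sigma_sets (space ?P) {a \<times> b |a b. a \<in> sets A' \<and> b \<in> sets B'} \<subseteq> sets ?P"
        unfolding gen[symmetric] using sAB(3) by (simp add: subalgebra_def)
      show "S \<in> sigma_sets (space ?P) {a \<times> b |a b. a \<in> sets A' \<and> b \<in> sets B'}" using S unfolding gen .
      show "(\<integral>z. indicator T z \<partial>?P) = (\<integral>z. g z \<partial>?P)" unfolding g_def using AB'.real_cond_exp_int(2)[OF iT] by simp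
    qed (use rect in auto)
    then have "(\<integral>z\<in>T. indicator S z \<partial>?P) = (\<integral>z. g z * indicator S z \<partial>?P)"
      by (simp add: set_lebesgue_integral_def mult.commute)
    also have "\<dots> = (\<integral>z\<in>T. real_cond_exp ?P (A \<Otimes>\<^sub>M B') (indicator S) z \<partial>?P)"
      unfolding g_def set_lebesgue_integral_def using cond_exp_swap(1)[OF sAB(2) TP iS] by simp
    finally show "(\<integral>z\<in>T. indicator S z \<partial>?P) = (\<integral>z\<in>T. real_cond_exp ?P (A \<Otimes>\<^sub>M B') (indicator S) z \<partial>?P)" .
  qed
qed

text \<open>\<open>sG\<close> says that \<open>G\<close> is generated by \<open>\<phi>\<close>, so
  both sides state that \<open>r\<close> and 1 have the same integral over every preimage under
  \<open>\<phi>\<close>.\<close>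

lemma (in prob_space) distr_density_eq_iff:
  assumes r: "dens M r" and G: "subalgebra M G" and \<phi>: "\<phi> \<in> M \<rightarrow>\<^sub>M K"
    and sG: "sets G = {\<phi> -` D \<inter> space M | D. D \<in> sets K}"
  shows "distr (density M (\<lambda>z. ennreal (r z))) K \<phi> = distr M K \<phi> \<longleftrightarrow> (AE z in M. real_cond_exp M G r z = 1)"
proof -
  let ?d = "density M (\<lambda>z. ennreal (r z))"
  note ir = densD(2)[OF r]
  interpret G: sigma_finite_subalgebra M G by (rule sigma_finite_subalgebraI[OF G])
  interpret R: prob_space ?d by (rule dens_prob_space[OF r])
  have \<phi>': "\<phi> \<in> ?d \<rightarrow>\<^sub>M K" using \<phi> by simp
  interpret D: prob_space "distr ?d K \<phi>" by (rule R.prob_space_distr[OF \<phi>'])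
  interpret E: prob_space "distr M K \<phi>" by (rule prob_space_distr[OF \<phi>])
  have m1: "measure (distr ?d K \<phi>) D = (\<integral>z\<in>\<phi> -` D \<inter> space M. r z \<partial>M)" if D: "D \<in> sets K" for D
  proof -
    note S = measurable_sets[OF \<phi> D]
    have "measure (distr ?d K \<phi>) D = measure ?d (\<phi> -` D \<inter> space M)" using measure_distr[OF \<phi>' D] by simp
    also have "\<dots> = (\<integral>z. indicator (\<phi> -` D \<inter> space M) z \<partial>?d)" using S by simp
    also have "\<dots> = (\<integral>z\<in>\<phi> -` D \<inter> space M. r z \<partial>M)"
      by (subst dens_density_integral(2)[OF r borel_measurable_indicator[OF S]])
        (simp add: set_lebesgue_integral_def mult.commute)
    finally show ?thesis .
  qed
  have m2: "measure (distr M K \<phi>) D = (\<integral>z\<in>\<phi> -` D \<inter> space M. 1 \<partial>M)" if D: "D \<in> sets K" for D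
    using measure_distr[OF \<phi> D] measurable_sets[OF \<phi> D] by (simp add: set_lebesgue_integral_def)
  show ?thesis
  proof
    assume L: "distr ?d K \<phi> = distr M K \<phi>"
    show "AE z in M. real_cond_exp M G r z = 1"
    proof (rule G.real_cond_exp_charact)
      fix S assume "S \<in> sets G"
      then obtain D where D: "D \<in> sets K" "S = \<phi> -` D \<inter> space M" using sG by auto
      show "(\<integral>z\<in>S. r z \<partial>M) = (\<integral>z\<in>S. 1 \<partial>M)" using m1[OF D(1)] m2[OF D(1)] L by (simp add: D(2))
    qed (use ir in auto)
  next
    assume R: "AE z in M. real_cond_exp M G r z = 1"
    show "distr ?d K \<phi> = distr M K \<phi>"
    proof (rule measure_eqI)
      fix D assume "D \<in> sets (distr ?d K \<phi>)"
      then have D: "D \<in> sets K" by simp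
      let ?S = "\<phi> -` D \<inter> space M"
      have "?S \<in> sets G" using D sG by auto
      then have "(\<integral>z\<in>?S. r z \<partial>M) = (\<integral>z\<in>?S. real_cond_exp M G r z \<partial>M)" by (rule G.real_cond_exp_intA[OF ir])
      also have "\<dots> = (\<integral>z\<in>?S. 1 \<partial>M)"
        unfolding set_lebesgue_integral_def
        using R borel_measurable_indicator[OF measurable_sets[OF \<phi> D]] by (intro integral_cong_AE) auto
      finally have "measure (distr ?d K \<phi>) D = measure (distr M K \<phi>) D" unfolding m1[OF D] m2[OF D] .
      then show "emeasure (distr ?d K \<phi>) D = emeasure (distr M K \<phi>) D"
        unfolding D.emeasure_eq_measure E.emeasure_eq_measure by simp
    qed simp
  qed
qed

text \<open>Kept on the full path space rather than on the first \<open>t\<close> factors, so that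
  the sigma-algebras for different \<open>t\<close> live on one space and can be compared.\<close>

definition past :: "nat \<Rightarrow> (nat \<Rightarrow> 'a topology) \<Rightarrow> nat \<Rightarrow> (nat \<Rightarrow> 'a) measure" where
  "past N X t = vimage_algebra (topspace (path_space N X)) (\<lambda>x. restrict x {1..t}) (borel_of (path_space t X))"

definition hist :: "nat \<Rightarrow> (nat \<Rightarrow> 'a topology) \<Rightarrow> (nat \<Rightarrow> 'b topology) \<Rightarrow> nat \<Rightarrow> nat
    \<Rightarrow> ((nat \<Rightarrow> 'a) \<times> (nat \<Rightarrow> 'b)) measure" where
  "hist N X Y s t = past N X s \<Otimes>\<^sub>M past N Y t"

lemma space_past [simp]: "space (past N X t) = topspace (path_space N X)"
  by (simp add: past_def)

lemma continuous_restrict_path: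
  assumes "t \<le> s"
  shows "continuous_map (path_space s X) (path_space t X) (\<lambda>x. restrict x {1..t})"
  unfolding path_space_def continuous_map_componentwise
  using assms by (auto intro!: continuous_map_product_projection)

lemma measurable_restrict_path:
  assumes "t \<le> s" "s \<le> N"
  shows "(\<lambda>x. restrict x {1..t}) \<in> past N X s \<rightarrow>\<^sub>M borel_of (path_space t X)"
proof -
  have 1: "(\<lambda>x. restrict x {1..s}) \<in> past N X s \<rightarrow>\<^sub>M borel_of (path_space s X)"
    unfolding past_def
    by (rule measurable_vimage_algebra1)
      (use continuous_map_image_subset_topspace[OF continuous_restrict_path[OF assms(2), of X]] in \<open>auto simp: image_subset_iff\<close>)
  from measurable_compose[OF 1 continuous_map_measurable_borel_of[OF continuous_restrict_path[OF assms(1)]]]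
  have "(\<lambda>x. restrict (restrict x {1..s}) {1..t}) \<in> past N X s \<rightarrow>\<^sub>M borel_of (path_space t X)" .
  moreover have "restrict (restrict x {1..s}) {1..t} = restrict x {1..t}" for x :: "nat \<Rightarrow> 'a"
    using assms by (auto simp: restrict_def)
  ultimately show ?thesis by simp
qed

lemma subalgebra_past:
  assumes "t \<le> s" "s \<le> N"
  shows "subalgebra (past N X s) (past N X t)"
  unfolding subalgebra_def using sets_image_in_sets[OF _ measurable_restrict_path[OF assms]]
  by (simp add: past_def)

lemma sets_past_full: "sets (past N X N) = sets (borel_of (path_space N X))"
proof -
  have r: "restrict x {1..N} = x" if "x \<in> topspace (path_space N X)" for x
    using that by (auto simp: path_space_def PiE_iff extensional_restrict)
  have "sets (past N X N) = sets (vimage_algebra (topspace (path_space N X)) (\<lambda>x. x) (borel_of (path_space N X)))"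
    unfolding past_def by (intro arg_cong[where f=sets] vimage_algebra_cong refl r)
  also have "\<dots> = sets (borel_of (path_space N X))"
  proof -
    have e: "(\<lambda>x. x) -` A \<inter> topspace (path_space N X) = A" if "A \<in> sets (borel_of (path_space N X))" for A
      using sets.sets_into_space[OF that] by auto
    show ?thesis
    proof (subst sets_vimage_algebra2)
      show "{(\<lambda>x. x) -` A \<inter> topspace (path_space N X) | A. A \<in> sets (borel_of (path_space N X))} = sets (borel_of (path_space N X))"
      proof (intro equalityI subsetI)
        fix B assume "B \<in> {(\<lambda>x. x) -` A \<inter> topspace (path_space N X) | A. A \<in> sets (borel_of (path_space N X))}"
        then obtain A where "B = (\<lambda>x. x) -` A \<inter> topspace (path_space N X)" "A \<in> sets (borel_of (path_space N X))" by blast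
        then show "B \<in> sets (borel_of (path_space N X))" by (simp only: e)
      next
        fix B assume B: "B \<in> sets (borel_of (path_space N X))"
        show "B \<in> {(\<lambda>x. x) -` A \<inter> topspace (path_space N X) | A. A \<in> sets (borel_of (path_space N X))}"
          by (rule CollectI, rule exI[of _ B]) (simp only: e[OF B] B simp_thms)
      qed
    qed simp
  qed
  finally show ?thesis .
qed

lemma sets_past_0: "A \<in> sets (past N X 0) \<Longrightarrow> A = {} \<or> A = topspace (path_space N X)"
proof -
  have f: "(\<lambda>x. restrict x {1..0}) \<in> topspace (path_space N X) \<rightarrow> space (borel_of (path_space 0 X))"
    by (auto simp: path_space_def)
  assume "A \<in> sets (past N X 0)"
  then show ?thesis unfolding past_def sets_vimage_algebra2[OF f] by (auto simp: restrict_def split: if_splits)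
qed

text \<open>The initial segment and the next coordinate are glued by a continuous map; second
  countability makes the Borel sets of its domain those of the product sigma-algebra.\<close>

lemma measurable_past_Suc:
  assumes X: "second_countable (path_space s X)" "second_countable (X (Suc s))" and s: "Suc s \<le> N"
    and g: "(\<lambda>z. restrict (g z) {1..s}) \<in> M \<rightarrow>\<^sub>M borel_of (path_space s X)"
      "(\<lambda>z. g z (Suc s)) \<in> M \<rightarrow>\<^sub>M borel_of (X (Suc s))"
      "g \<in> space M \<rightarrow> topspace (path_space N X)"
  shows "g \<in> M \<rightarrow>\<^sub>M past N X (Suc s)"
  unfolding past_def
proof (rule measurable_vimage_algebra2[OF g(3)])
  let ?k = "\<lambda>(a, b). a(Suc s := b) :: nat \<Rightarrow> 'a"
  have k: "continuous_map (prod_topology (path_space s X) (X (Suc s))) (path_space (Suc s) X) ?k"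
    unfolding path_space_def continuous_map_componentwise
  proof (intro conjI ballI)
    show "?k ` topspace (prod_topology (product_topology X {1..s}) (X (Suc s))) \<subseteq> extensional {1..Suc s}"
      by (auto simp: PiE_iff extensional_def)
    fix i assume i: "i \<in> {1..Suc s}"
    show "continuous_map (prod_topology (product_topology X {1..s}) (X (Suc s))) (X i) (\<lambda>x. ?k x i)"
    proof (cases "i = Suc s")
      case True
      have e: "(\<lambda>x. ?k x i) = snd" using True by (auto simp: fun_eq_iff)
      show ?thesis unfolding e using True continuous_map_snd by metis
    next
      case False
      then have i': "i \<in> {1..s}" using i by auto
      have e: "(\<lambda>x. ?k x i) = (\<lambda>a. a i) \<circ> fst" using False by (auto simp: fun_eq_iff)
      show ?thesis unfolding e
        by (rule continuous_map_compose[OF continuous_map_fst continuous_map_product_projection[OF i']])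
    qed
  qed
  have p: "(\<lambda>z. (restrict (g z) {1..s}, g z (Suc s))) \<in> M \<rightarrow>\<^sub>M borel_of (prod_topology (path_space s X) (X (Suc s)))"
    unfolding measurable_cong_sets[OF refl sets_borel_of_prod_topology[OF X]] using g(1,2) by (rule measurable_Pair)
  have "?k (restrict h {1..s}, h (Suc s)) = restrict h {1..Suc s}" for h :: "nat \<Rightarrow> 'a"
    by (auto simp: restrict_def fun_eq_iff)
  then show "(\<lambda>x. restrict (g x) {1..Suc s}) \<in> M \<rightarrow>\<^sub>M borel_of (path_space (Suc s) X)"
    using measurable_compose[OF p continuous_map_measurable_borel_of[OF k]] by simp
qed

locale path_setting =
  fixes N :: nat and X :: "nat \<Rightarrow> 'a topology" and Y :: "nat \<Rightarrow> 'b topology"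
    and \<mu> :: "(nat \<Rightarrow> 'a) measure" and \<nu> :: "(nat \<Rightarrow> 'b) measure"
  assumes polX: "\<And>t. t \<in> {1..N} \<Longrightarrow> polish_topology (X t)"
    and polY: "\<And>t. t \<in> {1..N} \<Longrightarrow> polish_topology (Y t)"
    and \<mu>: "\<mu> \<in> borel_probs (path_space N X)" and \<nu>: "\<nu> \<in> borel_probs (path_space N Y)"
begin

abbreviation "XN \<equiv> path_space N X"
abbreviation "YN \<equiv> path_space N Y"
abbreviation "P \<equiv> \<mu> \<Otimes>\<^sub>M \<nu>"

lemma prob_\<mu>: "prob_space \<mu>" and prob_\<nu>: "prob_space \<nu>"
  and sets_\<mu>[simp]: "sets \<mu> = sets (borel_of XN)" and sets_\<nu>[simp]: "sets \<nu> = sets (borel_of YN)"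
  using \<mu> \<nu> by (auto simp: borel_probs_def)

lemma space_\<mu>[simp]: "space \<mu> = topspace XN" and space_\<nu>[simp]: "space \<nu> = topspace YN"
  using sets_eq_imp_space_eq[OF sets_\<mu>] sets_eq_imp_space_eq[OF sets_\<nu>] by auto

lemma sc: "t \<le> N \<Longrightarrow> second_countable (path_space t X)" "t \<le> N \<Longrightarrow> second_countable (path_space t Y)"
  using polX polY unfolding polish_topology_def by (auto intro!: second_countable_path_space)

lemma space_P: "space P = topspace XN \<times> topspace YN"
  by (simp add: space_pair_measure)

lemma sets_P: "sets P = sets (borel_of (prod_topology XN YN))"
  using sets_borel_of_prod_topology[OF sc(1)[of N] sc(2)[of N]] by (simp cong: sets_pair_measure_cong)

lemma subalgebra_\<mu>: "t \<le> N \<Longrightarrow> subalgebra \<mu> (past N X t)"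
  using subalgebra_past[of t N N X] sets_past_full[of N X] by (simp add: subalgebra_def)

lemma subalgebra_\<nu>: "t \<le> N \<Longrightarrow> subalgebra \<nu> (past N Y t)"
  using subalgebra_past[of t N N Y] sets_past_full[of N Y] by (simp add: subalgebra_def)

sublocale prob_space P
proof -
  interpret \<mu>: prob_space \<mu> by (rule prob_\<mu>)
  interpret \<nu>: prob_space \<nu> by (rule prob_\<nu>)
  interpret pair_prob_space \<mu> \<nu> ..
  show "prob_space P" by unfold_locales
qed

sublocale causal_filtration P N "hist N X Y"
proof
  show "subalgebra P (hist N X Y s t)" if "s \<le> N" "t \<le> N" for s t
    unfolding hist_def using that by (intro subalgebra_pair subalgebra_\<mu> subalgebra_\<nu>)
  show "subalgebra (hist N X Y s' t') (hist N X Y s t)" if "s \<le> s'" "s' \<le> N" "t \<le> t'" "t' \<le> N" for s s' t t'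
    unfolding hist_def using that by (intro subalgebra_pair subalgebra_past)
  show "sets (hist N X Y N N) = sets P"
    unfolding hist_def by (rule sets_pair_measure_cong) (simp_all add: sets_past_full)
  show "A = {} \<or> A = space P" if A: "A \<in> sets (hist N X Y 0 0)" for A
  proof -
    have "sigma_sets (space P) {a \<times> b |a b. a \<in> sets (past N X 0) \<and> b \<in> sets (past N Y 0)} \<subseteq> {{}, space P}"
      by (rule sigma_algebra.sigma_sets_subset[OF sigma_algebra_trivial])
        (auto simp: space_P dest!: sets_past_0)
    then show ?thesis using A unfolding hist_def sets_pair_measure by (auto simp: space_P)
  qed
  show "AE x in P. real_cond_exp P (hist N X Y s t) (indicator A) x = real_cond_exp P (hist N X Y s t') (indicator A) x"
    if "s \<le> s'" "s' \<le> N" "t' \<le> t" "t \<le> N" "A \<in> sets (hist N X Y s' t')" for s s' t t' A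
  proof -
    have "t' \<le> N" using that(3,4) by simp
    show ?thesis
      using pair_cond_exp_commute[OF prob_\<mu> prob_\<nu> subalgebra_\<mu>[OF that(2)] subalgebra_past[OF that(1,2)]
          subalgebra_\<nu>[OF that(4)] subalgebra_past[OF that(3,4)] that(5)[unfolded hist_def]]
      unfolding hist_def .
  qed
qed

section \<open>The sigma-algebras of the causality condition\<close>

abbreviation "sigX t \<equiv> vimage_algebra (space P) (\<lambda>z. restrict (fst z) {1..t}) (borel_of (path_space t X))"
abbreviation "sigY t \<equiv> vimage_algebra (space P) (\<lambda>z. restrict (snd z) {1..t}) (borel_of (path_space t Y))"
abbreviation "nextX t \<equiv> vimage_algebra (space P) (\<lambda>z. fst z (t + 1)) (borel_of (X (t + 1)))"

lemma restrict_path_topspace: "t \<le> N \<Longrightarrow> x \<in> topspace (path_space N Z) \<Longrightarrow> restrict x {1..t} \<in> topspace (path_space t Z)"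
  by (auto simp: path_space_def PiE_iff)

lemma space_hist: "space (hist N X Y s t) = space P"
  by (simp add: hist_def space_pair_measure)

lemma sets_eqI_measurable:
  assumes "space M = space M'" "(\<lambda>z. z) \<in> M \<rightarrow>\<^sub>M M'"
  shows "sets M' \<subseteq> sets M"
proof
  fix S assume S: "S \<in> sets M'"
  have "(\<lambda>z. z) -` S \<inter> space M = S" using sets.sets_into_space[OF S] assms(1) by auto
  then show "S \<in> sets M" using measurable_sets[OF assms(2) S] by simp
qed

lemma sets_hist_subset:
  assumes "space M = space P" "fst \<in> M \<rightarrow>\<^sub>M past N X s" "snd \<in> M \<rightarrow>\<^sub>M past N Y t"
  shows "sets (hist N X Y s t) \<subseteq> sets M"
proof (rule sets_eqI_measurable)
  show "space M = space (hist N X Y s t)" using assms(1) by (simp add: space_hist)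
  have "(\<lambda>z. (fst z, snd z)) \<in> M \<rightarrow>\<^sub>M hist N X Y s t" unfolding hist_def using assms(2,3) by (rule measurable_Pair)
  then show "(\<lambda>z. z) \<in> M \<rightarrow>\<^sub>M hist N X Y s t" by simp
qed

lemma measurable_fst_hist: "t \<le> s \<Longrightarrow> s \<le> N \<Longrightarrow> (\<lambda>z. restrict (fst z) {1..t}) \<in> hist N X Y s u \<rightarrow>\<^sub>M borel_of (path_space t X)"
  unfolding hist_def by (rule measurable_compose[OF measurable_fst measurable_restrict_path])

lemma measurable_snd_hist: "t \<le> s \<Longrightarrow> s \<le> N \<Longrightarrow> (\<lambda>z. restrict (snd z) {1..t}) \<in> hist N X Y u s \<rightarrow>\<^sub>M borel_of (path_space t Y)"
  unfolding hist_def by (rule measurable_compose[OF measurable_snd measurable_restrict_path])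

lemma measurable_past_0:
  assumes "g \<in> space M \<rightarrow> topspace (path_space N Z)"
  shows "g \<in> M \<rightarrow>\<^sub>M past N Z 0"
proof (rule measurableI)
  show "g x \<in> space (past N Z 0)" if "x \<in> space M" for x using that assms by auto
  fix A assume "A \<in> sets (past N Z 0)"
  then have "A = {} \<or> A = topspace (path_space N Z)" by (rule sets_past_0)
  then show "g -` A \<inter> space M \<in> sets M"
  proof
    assume A: "A = topspace (path_space N Z)"
    have "g -` A \<inter> space M = space M" using assms A by auto
    then show ?thesis by simp
  qed simp
qed

lemma sets_sigX: "t \<le> N \<Longrightarrow> sets (sigX t) = sets (hist N X Y t 0)"
proof
  assume t: "t \<le> N"
  show "sets (sigX t) \<subseteq> sets (hist N X Y t 0)"
    by (rule sets_image_in_sets[OF _ measurable_fst_hist]) (use t in \<open>auto simp: space_hist\<close>)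
  show "sets (hist N X Y t 0) \<subseteq> sets (sigX t)"
  proof (rule sets_hist_subset)
    show "fst \<in> sigX t \<rightarrow>\<^sub>M past N X t"
      unfolding past_def
    proof (rule measurable_vimage_algebra2)
      show "fst \<in> space (sigX t) \<rightarrow> topspace XN" by (auto simp: space_P)
      show "(\<lambda>z. restrict (fst z) {1..t}) \<in> sigX t \<rightarrow>\<^sub>M borel_of (path_space t X)"
        by (rule measurable_vimage_algebra1) (auto simp: space_P simp del: One_nat_def intro!: restrict_path_topspace t)
    qed
    show "snd \<in> sigX t \<rightarrow>\<^sub>M past N Y 0" by (rule measurable_past_0) (auto simp: space_P)
  qed simp
qed

lemma sets_sigY: "t \<le> N \<Longrightarrow> sets (sigY t) = sets (hist N X Y 0 t)"
proof
  assume t: "t \<le> N"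
  show "sets (sigY t) \<subseteq> sets (hist N X Y 0 t)"
    by (rule sets_image_in_sets[OF _ measurable_snd_hist]) (use t in \<open>auto simp: space_hist\<close>)
  show "sets (hist N X Y 0 t) \<subseteq> sets (sigY t)"
  proof (rule sets_hist_subset)
    show "snd \<in> sigY t \<rightarrow>\<^sub>M past N Y t"
      unfolding past_def
    proof (rule measurable_vimage_algebra2)
      show "snd \<in> space (sigY t) \<rightarrow> topspace YN" by (auto simp: space_P)
      show "(\<lambda>z. restrict (snd z) {1..t}) \<in> sigY t \<rightarrow>\<^sub>M borel_of (path_space t Y)"
        by (rule measurable_vimage_algebra1) (auto simp: space_P simp del: One_nat_def intro!: restrict_path_topspace t)
    qed
    show "fst \<in> sigY t \<rightarrow>\<^sub>M past N X 0" by (rule measurable_past_0) (auto simp: space_P)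
  qed simp
qed

lemma measurable_coord_hist:
  assumes "s < N"
  shows "(\<lambda>z. fst z (s + 1)) \<in> hist N X Y (Suc s) u \<rightarrow>\<^sub>M borel_of (X (s + 1))"
proof -
  have "continuous_map (path_space (Suc s) X) (X (s + 1)) (\<lambda>x. x (s + 1))"
    unfolding path_space_def by (rule continuous_map_product_projection) simp
  from measurable_compose[OF measurable_fst_hist continuous_map_measurable_borel_of[OF this]]
  have "(\<lambda>z. restrict (fst z) {1..Suc s} (s + 1)) \<in> hist N X Y (Suc s) u \<rightarrow>\<^sub>M borel_of (X (s + 1))" using assms by simp
  then show ?thesis by simp
qed

lemma sets_nextX: "s < N \<Longrightarrow> sets (nextX s) \<subseteq> sets (hist N X Y (Suc s) u)"
  by (rule sets_image_in_sets[OF _ measurable_coord_hist]) (auto simp: space_hist)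

text \<open>Each of the three families arises from the generator by taking the whole space for the
  other two; together they make both components measurable, by \<open>measurable_past_Suc\<close>
  for the first.\<close>

lemma hist_Suc_generator:
  assumes t: "t \<le> s" and s: "s < N"
  shows "sets (hist N X Y (Suc s) t) =
      sigma_sets (space P) {D \<inter> E \<inter> B | D E B. D \<in> sets (hist N X Y s 0) \<and> E \<in> sets (nextX s) \<and> B \<in> sets (hist N X Y 0 t)}"
    (is "_ = sigma_sets _ ?G")
proof
  have incl: "sets (hist N X Y s 0) \<subseteq> sets (hist N X Y (Suc s) t)" "sets (hist N X Y 0 t) \<subseteq> sets (hist N X Y (Suc s) t)"
    "sets (nextX s) \<subseteq> sets (hist N X Y (Suc s) t)"
    using sets_F_mono[of s "Suc s" 0 t] sets_F_mono[of 0 "Suc s" t t] sets_nextX s t by auto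
  have G: "?G \<subseteq> sets (hist N X Y (Suc s) t)" using incl by blast
  then show "sigma_sets (space P) ?G \<subseteq> sets (hist N X Y (Suc s) t)"
    unfolding space_hist[of "Suc s" t, symmetric] by (rule sets.sigma_sets_subset)
  have GP: "?G \<subseteq> Pow (space P)" using G sets.sets_into_space[of _ "hist N X Y (Suc s) t"] by (auto simp: space_hist)
  let ?M = "sigma (space P) ?G"
  have sM: "space ?M = space P" "sets ?M = sigma_sets (space P) ?G" using GP by (simp_all add: space_measure_of_conv)
  have top: "space P \<in> sets (hist N X Y s 0)" "space P \<in> sets (nextX s)" "space P \<in> sets (hist N X Y 0 t)"
    using sets.top[of "hist N X Y s 0"] sets.top[of "hist N X Y 0 t"] sets.top[of "nextX s"] by (simp_all add: space_hist)
  have base: "D \<in> sets ?M" if "D \<in> sets (hist N X Y s 0)" for D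
  proof -
    have "D = D \<inter> space P \<inter> space P" using sets.sets_into_space[OF that] by (auto simp: space_hist)
    then have "D \<in> ?G" using that top by blast
    then show ?thesis unfolding sM by (rule sigma_sets.Basic)
  qed
  have nxt: "D \<in> sets ?M" if "D \<in> sets (nextX s)" for D
  proof -
    have "D = space P \<inter> D \<inter> space P" using sets.sets_into_space[OF that] by auto
    then have "D \<in> ?G" using that top by blast
    then show ?thesis unfolding sM by (rule sigma_sets.Basic)
  qed
  have snd: "D \<in> sets ?M" if "D \<in> sets (hist N X Y 0 t)" for D
  proof -
    have "D = space P \<inter> space P \<inter> D" using sets.sets_into_space[OF that] by (auto simp: space_hist)
    then have "D \<in> ?G" using that top by blast
    then show ?thesis unfolding sM by (rule sigma_sets.Basic)
  qed
  have sub: "subalgebra ?M (hist N X Y s 0)" "subalgebra ?M (nextX s)" "subalgebra ?M (hist N X Y 0 t)"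
    using base nxt snd unfolding subalgebra_def by (simp_all only: space_hist sM(1) space_vimage_algebra subset_iff) blast+
  have "sets (hist N X Y (Suc s) t) \<subseteq> sets ?M"
  proof (rule sets_hist_subset[OF sM(1)])
    show "fst \<in> ?M \<rightarrow>\<^sub>M past N X (Suc s)"
    proof (rule measurable_past_Suc)
      show "second_countable (path_space s X)" "second_countable (X (Suc s))" "Suc s \<le> N"
        using sc(1)[of s] polX[of "Suc s"] s by (auto simp: polish_topology_def)
      show "(\<lambda>z. restrict (fst z) {1..s}) \<in> ?M \<rightarrow>\<^sub>M borel_of (path_space s X)"
        by (rule measurable_from_subalg[OF sub(1) measurable_fst_hist]) (use s in auto)
      have "(\<lambda>z. fst z (s + 1)) \<in> nextX s \<rightarrow>\<^sub>M borel_of (X (s + 1))"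
        by (rule measurable_vimage_algebra1) (use s in \<open>auto simp: space_P path_space_def PiE_iff\<close>)
      from measurable_from_subalg[OF sub(2) this] show "(\<lambda>z. fst z (Suc s)) \<in> ?M \<rightarrow>\<^sub>M borel_of (X (Suc s))" by simp
      show "fst \<in> space ?M \<rightarrow> topspace (path_space N X)" unfolding sM(1) by (auto simp: space_P)
    qed
    have "snd \<in> hist N X Y 0 t \<rightarrow>\<^sub>M past N Y t" unfolding hist_def by simp
    from measurable_from_subalg[OF sub(3) this] show "snd \<in> ?M \<rightarrow>\<^sub>M past N Y t" .
  qed
  then show "sets (hist N X Y (Suc s) t) \<subseteq> sigma_sets (space P) ?G" unfolding sM(2) .
qed

section \<open>Couplings and causality as conditions on densities\<close>

abbreviation "dm r \<equiv> density P (\<lambda>z. ennreal (r z))"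

lemma measurable_proj: "fst \<in> P \<rightarrow>\<^sub>M borel_of XN" "snd \<in> P \<rightarrow>\<^sub>M borel_of YN"
  using measurable_fst[of \<mu> \<nu>] measurable_snd[of \<mu> \<nu>] by (simp_all cong: measurable_cong_sets)

lemma sets_sigma_full:
  "sets (hist N X Y N 0) = {fst -` D \<inter> space P | D. D \<in> sets (borel_of XN)}"
  "sets (hist N X Y 0 N) = {snd -` D \<inter> space P | D. D \<in> sets (borel_of YN)}"
proof -
  have r: "restrict x {1..N} = x" if "x \<in> topspace (path_space N Z)" for x :: "nat \<Rightarrow> 'c" and Z
    using that by (auto simp: path_space_def PiE_iff extensional_restrict)
  have "(\<lambda>z. restrict (fst z) {1..N}) -` D \<inter> space P = fst -` D \<inter> space P"
    "(\<lambda>z. restrict (snd z) {1..N}) -` E \<inter> space P = snd -` E \<inter> space P" for D E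
    by (auto simp: space_P r simp del: One_nat_def)
  then show "sets (hist N X Y N 0) = {fst -` D \<inter> space P | D. D \<in> sets (borel_of XN)}"
    "sets (hist N X Y 0 N) = {snd -` D \<inter> space P | D. D \<in> sets (borel_of YN)}"
    unfolding sets_sigX[OF order_refl, symmetric] sets_sigY[OF order_refl, symmetric]
    by (subst sets_vimage_algebra2; auto simp: space_P simp del: One_nat_def intro!: restrict_path_topspace)+
qed

lemma distr_P: "distr P (borel_of XN) fst = \<mu>" "distr P (borel_of YN) snd = \<nu>"
proof -
  interpret \<mu>: prob_space \<mu> by (rule prob_\<mu>)
  interpret \<nu>: prob_space \<nu> by (rule prob_\<nu>)
  have "distr P (borel_of XN) fst = distr P \<mu> fst" by (intro distr_cong) auto
  then show "distr P (borel_of XN) fst = \<mu>" by (simp add: \<nu>.distr_pair_fst)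
  show "distr P (borel_of YN) snd = \<nu>"
  proof (rule measure_eqI)
    fix D assume "D \<in> sets (distr P (borel_of YN) snd)"
    then have D: "D \<in> sets \<nu>" by simp
    have "snd -` D \<inter> space P = space \<mu> \<times> D" using sets.sets_into_space[OF D] by (auto simp: space_P)
    then show "emeasure (distr P (borel_of YN) snd) D = emeasure \<nu> D"
      using \<nu>.emeasure_pair_measure_Times[OF sets.top[of \<mu>] D] emeasure_distr[OF measurable_proj(2), of D] D \<mu>.emeasure_space_1 by simp
  qed simp
qed

lemma marginal_iff_X:
  assumes r: "dens P r"
  shows "distr (dm r) (borel_of XN) fst = \<mu> \<longleftrightarrow> (AE z in P. real_cond_exp P (hist N X Y N 0) r z = 1)"
  using distr_density_eq_iff[OF r F_subalg[of N 0] measurable_proj(1) sets_sigma_full(1)] by (simp add: distr_P)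

lemma marginal_iff_Y:
  assumes r: "dens P r"
  shows "distr (dm r) (borel_of YN) snd = \<nu> \<longleftrightarrow> (AE z in P. real_cond_exp P (hist N X Y 0 N) r z = 1)"
  using distr_density_eq_iff[OF r F_subalg[of 0 N] measurable_proj(2) sets_sigma_full(2)] by (simp add: distr_P)

lemma dm_borel_prob:
  assumes r: "dens P r"
  shows "dm r \<in> borel_probs (prod_topology XN YN)" "distr (dm r) (borel_of XN) fst \<in> borel_probs XN"
    "distr (dm r) (borel_of YN) snd \<in> borel_probs YN"
proof -
  interpret R: prob_space "dm r" by (rule dens_prob_space[OF r])
  have fm: "fst \<in> dm r \<rightarrow>\<^sub>M borel_of XN" "snd \<in> dm r \<rightarrow>\<^sub>M borel_of YN"
    using measurable_fst[of \<mu> \<nu>] measurable_snd[of \<mu> \<nu>] by (simp_all cong: measurable_cong_sets)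
  show "dm r \<in> borel_probs (prod_topology XN YN)"
    unfolding borel_probs_def using R.prob_space_axioms sets_P by simp
  show "distr (dm r) (borel_of XN) fst \<in> borel_probs XN" "distr (dm r) (borel_of YN) snd \<in> borel_probs YN"
    unfolding borel_probs_def using R.prob_space_distr[OF fm(1)] R.prob_space_distr[OF fm(2)] by auto
qed

lemma couplings_snd_iff:
  assumes r: "dens P r"
  shows "dm r \<in> couplings_snd XN YN \<nu> \<longleftrightarrow> (AE z in P. real_cond_exp P (hist N X Y 0 N) r z = 1)"
  unfolding couplings_snd_def couplings_def marginal_iff_Y[OF r, symmetric] using dm_borel_prob[OF r] by auto

text \<open>\<open>0 < N\<close> is used in passing from densities to couplings: there the condition
  at \<open>t = 0\<close> carries the first marginal.\<close>

lemma causal_iff: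
  assumes r: "dens P r" and N: "0 < N"
  shows "dm r \<in> causal_couplings_fst N X Y \<mu> \<longleftrightarrow> causal_dens r"
proof -
  have c: "causal N X Y (dm r) \<longleftrightarrow> (\<forall>t\<in>{1..<N}. cond_indep (dm r) (hist N X Y t 0) (nextX t) (hist N X Y 0 t))"
    unfolding causal_def
  proof (rule ball_cong[OF refl])
    fix t assume t: "t \<in> {1..<N}"
    show "cond_indep (dm r) (vimage_algebra (space (dm r)) (\<lambda>z. restrict (fst z) {1..t}) (borel_of (path_space t X)))
        (vimage_algebra (space (dm r)) (\<lambda>z. fst z (t + 1)) (borel_of (X (t + 1))))
        (vimage_algebra (space (dm r)) (\<lambda>z. restrict (snd z) {1..t}) (borel_of (path_space t Y))) =
      cond_indep (dm r) (hist N X Y t 0) (nextX t) (hist N X Y 0 t)"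
      using t by (intro cond_indep_cong) (simp_all add: sets_sigX sets_sigY space_hist del: One_nat_def)
  qed
  have m: "dm r \<in> causal_couplings_fst N X Y \<mu> \<longleftrightarrow> distr (dm r) (borel_of XN) fst = \<mu> \<and> causal N X Y (dm r)"
    unfolding causal_couplings_fst_def causal_couplings_def couplings_def using dm_borel_prob[OF r] by auto
  show ?thesis
  proof
    assume "dm r \<in> causal_couplings_fst N X Y \<mu>"
    then have *: "AE z in P. real_cond_exp P (hist N X Y N 0) r z = 1"
      "\<forall>t\<in>{1..<N}. cond_indep (dm r) (hist N X Y t 0) (nextX t) (hist N X Y 0 t)"
      unfolding m c marginal_iff_X[OF r] by auto
    show "causal_dens r"
    proof (rule cond_indep_imp_causal[OF r *(1), where W=nextX])
      fix s t :: nat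
      show "cond_indep (dm r) (hist N X Y t 0) (nextX t) (hist N X Y 0 t)" if "1 \<le> t" "t < N"
        using *(2) that by (simp del: One_nat_def)
      show "sets (nextX t) \<subseteq> sets (hist N X Y (Suc t) 0)" if "t < N" using that by (rule sets_nextX)
      show "sets (hist N X Y (Suc s) t) = sigma_sets (space P)
          {D \<inter> E \<inter> B | D E B. D \<in> sets (hist N X Y s 0) \<and> E \<in> sets (nextX s) \<and> B \<in> sets (hist N X Y 0 t)}"
        if "t \<le> s" "s < N" using that by (rule hist_Suc_generator)
    qed
  next
    assume cr: "causal_dens r"
    interpret G: sigma_finite_subalgebra P "hist N X Y 0 0" using sf by auto
    have "AE x in P. real_cond_exp P (hist N X Y 0 0) r x = 1"
    proof (rule G.real_cond_exp_charact)
      fix A assume "A \<in> sets (hist N X Y 0 0)"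
      then have "A = {} \<or> A = space P" by (rule F_trivial)
      then show "(\<integral>x\<in>A. r x \<partial>P) = (\<integral>x\<in>A. 1 \<partial>P)"
      proof
        assume A: "A = space P"
        have "(\<integral>x\<in>A. r x \<partial>P) = (\<integral>x. r x \<partial>P)" unfolding A using densD(2)[OF r] by (rule set_integral_space)
        moreover have "(\<integral>x\<in>A. 1 \<partial>P) = (\<integral>x. (1::real) \<partial>P)" unfolding A by (rule set_integral_space) simp
        ultimately show ?thesis using densD(3)[OF r] by (simp add: prob_space)
      qed (simp add: set_lebesgue_integral_def)
    qed (use densD(2)[OF r] in auto)
    then have 1: "AE z in P. real_cond_exp P (hist N X Y N 0) r z = 1"
      using causal_densD[OF cr N] by eventually_elim simp
    have 2: "cond_indep (dm r) (hist N X Y t 0) (nextX t) (hist N X Y 0 t)" if t: "t \<in> {1..<N}" for t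
    proof (rule causal_imp_cond_indep[OF cr])
      show "sets (nextX t) \<subseteq> sets (hist N X Y N 0)"
        using sets_nextX[of t 0] sets_F_mono[of "Suc t" N 0 0] t by auto
    qed (use t in auto)
    show "dm r \<in> causal_couplings_fst N X Y \<mu>" unfolding m c marginal_iff_X[OF r] using 1 2 by auto
  qed
qed

end

section \<open>Relative entropy of measures and densities\<close>

lemma density_pos_ac:
  assumes q: "dens M q" "\<And>x. 0 < q x" and r: "dens M r"
  shows "absolutely_continuous (density M (\<lambda>x. ennreal (q x))) (density M (\<lambda>x. ennreal (r x)))"
proof -
  note [measurable] = densD(4)[OF q(1)] densD(4)[OF r]
  have q0: "ennreal (q x) \<noteq> 0" for x using q(2)[of x] by (simp add: ennreal_eq_0_iff)
  show ?thesis
    unfolding absolutely_continuous_def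
    by (auto simp: null_sets_density_iff q0 elim!: eventually_mono)
qed

lemma enn_diff_eq:
  fixes p n k :: ennreal
  assumes "k + n = p" "n < \<infinity>"
  shows "enn2ereal p - enn2ereal n = enn2ereal k"
proof -
  obtain b where b: "n = ennreal b" "b \<ge> 0" using assms(2) by (cases n) auto
  show ?thesis
  proof (cases k)
    case (real a)
    then have p: "p = ennreal (a + b)" using assms(1) b by simp
    show ?thesis unfolding p real(1) b(1) using real b by (simp add: enn2ereal_ennreal del: ennreal_plus)
  next
    case top
    then have "p = \<infinity>" using assms(1) b by simp
    then show ?thesis using top b by simp
  qed
qed

text \<open>\<open>ext_integral\<close> is a difference of two integrals, the negative one being at
  most the integral of \<open>q\<close>. So it is enough to show that \<open>kl\<close> plus the
  negative part is the positive part, which involves no subtraction.\<close>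

lemma D_KL_density:
  assumes M: "prob_space M" and r: "dens M r" and q: "dens M q" "\<And>x. 0 < q x"
  shows "D_KL (density M (\<lambda>x. ennreal (r x))) (density M (\<lambda>x. ennreal (q x))) = enn2ereal (kl M r q)"
proof -
  interpret M: prob_space M by fact
  note [measurable] = densD(4)[OF q(1)] densD(4)[OF r]
  note r0 = densD(1)[OF r]
  let ?r = "density M (\<lambda>x. ennreal (r x))" and ?q = "density M (\<lambda>x. ennreal (q x))"
  interpret q: prob_space ?q by (rule dens_prob_space[OF q(1)])
  have dd: "density ?q (\<lambda>x. ennreal (r x / q x)) = ?r"
  proof -
    have "density ?q (\<lambda>x. ennreal (r x / q x)) = density M (\<lambda>x. ennreal (q x) * ennreal (r x / q x))"
      by (rule density_density_eq) auto
    also have "\<dots> = ?r"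
    proof (rule density_cong)
      show "AE x in M. ennreal (q x) * ennreal (r x / q x) = ennreal (r x)"
      proof (rule AE_I2)
        fix x
        have "ennreal (q x) * ennreal (r x / q x) = ennreal (q x * (r x / q x))"
          using q(2)[of x] r0[of x] by (intro ennreal_mult[symmetric]) auto
        then show "ennreal (q x) * ennreal (r x / q x) = ennreal (r x)" using q(2)[of x] by simp
      qed
    qed auto
    finally show ?thesis .
  qed
  have "AE x in ?q. ennreal (r x / q x) = RN_deriv ?q ?r x"
    by (rule q.RN_deriv_unique) (use dd in auto)
  then have rn: "AE x in M. RN_deriv ?q ?r x = ennreal (r x / q x)"
    by (subst (asm) AE_density) (auto simp: q(2) elim!: eventually_mono)
  have D: "D_KL ?r ?q = ext_integral ?r (\<lambda>x. ln (enn2real (RN_deriv ?q ?r x)))"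
    unfolding D_KL_def using density_pos_ac[OF q r] by simp
  let ?a = "\<lambda>x. r x * ln (r x / q x)"
  have e: "(\<integral>\<^sup>+x. ennreal (s * ln (enn2real (RN_deriv ?q ?r x))) \<partial>?r) = (\<integral>\<^sup>+x. ennreal (s * ?a x) \<partial>M)" for s
  proof -
    have "(\<integral>\<^sup>+x. ennreal (s * ln (enn2real (RN_deriv ?q ?r x))) \<partial>?r) = (\<integral>\<^sup>+x. ennreal (r x) * ennreal (s * ln (enn2real (RN_deriv ?q ?r x))) \<partial>M)"
      by (rule nn_integral_density) auto
    also have "\<dots> = (\<integral>\<^sup>+x. ennreal (s * ?a x) \<partial>M)"
    proof (rule nn_integral_cong_AE)
      show "AE x in M. ennreal (r x) * ennreal (s * ln (enn2real (RN_deriv ?q ?r x))) = ennreal (s * ?a x)"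
        using rn
      proof eventually_elim
        case (elim x)
        then have "enn2real (RN_deriv ?q ?r x) = r x / q x" using r0[of x] q(2)[of x] by simp
        then show ?case using r0[of x] by (simp add: ennreal_mult'[symmetric] mult_ac)
      qed
    qed
    finally show ?thesis .
  qed
  have ni: "(\<integral>\<^sup>+x. ennreal (- 1 * ?a x) \<partial>M) < \<infinity>"
  proof -
    have "(\<integral>\<^sup>+x. ennreal (- 1 * ?a x) \<partial>M) \<le> (\<integral>\<^sup>+x. ennreal (q x) \<partial>M)"
    proof (intro nn_integral_mono ennreal_leI)
      fix x
      have "0 \<le> kl_fun (r x) (q x)" by (rule kl_fun_nonneg) (use r0 q in auto)
      then show "- 1 * ?a x \<le> q x" using r0[of x] by (simp add: kl_fun_def)
    qed
    also have "\<dots> < \<infinity>" using densD[OF q(1)] by (subst nn_integral_eq_integral) auto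
    finally show ?thesis .
  qed
  have one: "(\<integral>\<^sup>+x. ennreal (r x) \<partial>M) = 1" "(\<integral>\<^sup>+x. ennreal (q x) \<partial>M) = 1"
    using densD[OF r] densD[OF q(1)] by (auto simp: nn_integral_eq_integral)
  \<comment> \<open>Pointwise, \<open>kl_fun\<close> plus negative part plus \<open>r\<close> equals
    positive part plus \<open>q\<close>; both densities have integral 1 and cancel at the
    end.\<close>
  have "kl M r q + (\<integral>\<^sup>+x. ennreal (- 1 * ?a x) \<partial>M) + (\<integral>\<^sup>+x. ennreal (r x) \<partial>M)
      = (\<integral>\<^sup>+x. ennreal (kl_fun (r x) (q x)) + ennreal (- 1 * ?a x) + ennreal (r x) \<partial>M)"
    unfolding kl_def by (simp add: nn_integral_add)
  also have "\<dots> = (\<integral>\<^sup>+x. ennreal (1 * ?a x) + ennreal (q x) \<partial>M)"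
  proof (rule nn_integral_cong)
    fix x
    have k: "0 \<le> kl_fun (r x) (q x)" by (rule kl_fun_nonneg) (use r0 q in auto)
    show "ennreal (kl_fun (r x) (q x)) + ennreal (- 1 * ?a x) + ennreal (r x) = ennreal (1 * ?a x) + ennreal (q x)"
    proof (cases "?a x \<ge> 0")
      case True
      then have "ennreal (- 1 * ?a x) = 0" by (simp add: ennreal_neg)
      moreover have "ennreal (kl_fun (r x) (q x)) + ennreal (r x) = ennreal (kl_fun (r x) (q x) + r x)"
        by (rule ennreal_plus[symmetric, OF k r0])
      moreover have "ennreal (?a x) + ennreal (q x) = ennreal (?a x + q x)"
        by (rule ennreal_plus[symmetric, OF True less_imp_le[OF q(2)]])
      ultimately show ?thesis by (simp add: kl_fun_def)
    next
      case False
      then have "ennreal (1 * ?a x) = 0" by (simp add: ennreal_neg)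
      moreover have "ennreal (kl_fun (r x) (q x)) + ennreal (- 1 * ?a x) = ennreal (kl_fun (r x) (q x) + - 1 * ?a x)"
        by (rule ennreal_plus[symmetric]) (use k False in auto)
      moreover have "ennreal (kl_fun (r x) (q x) + - 1 * ?a x) + ennreal (r x) = ennreal (kl_fun (r x) (q x) + - 1 * ?a x + r x)"
        by (rule ennreal_plus[symmetric]) (use k False r0 in auto)
      moreover have "kl_fun (r x) (q x) + - 1 * ?a x + r x = q x" by (simp add: kl_fun_def)
      ultimately show ?thesis by (simp only: add_0)
    qed
  qed
  also have "\<dots> = (\<integral>\<^sup>+x. ennreal (1 * ?a x) \<partial>M) + (\<integral>\<^sup>+x. ennreal (q x) \<partial>M)"
    by (rule nn_integral_add) auto
  finally have "kl M r q + (\<integral>\<^sup>+x. ennreal (- 1 * ?a x) \<partial>M) = (\<integral>\<^sup>+x. ennreal (1 * ?a x) \<partial>M)"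
    unfolding one by (simp add: add.commute[of _ 1] ennreal_add_left_cancel)
  from enn_diff_eq[OF this ni]
  show ?thesis
    unfolding D ext_integral_def using e[of 1] e[of "- 1"] by simp
qed

lemma D_KL_imp_density:
  assumes M: "prob_space M" and q: "dens M q" "\<And>x. 0 < q x"
    and \<pi>: "prob_space \<pi>" "sets \<pi> = sets M" and fin: "D_KL \<pi> (density M (\<lambda>x. ennreal (q x))) < \<infinity>"
  shows "\<exists>r. dens M r \<and> \<pi> = density M (\<lambda>x. ennreal (r x))"
proof -
  interpret M: prob_space M by fact
  interpret \<pi>: prob_space \<pi> by fact
  note [measurable] = densD(4)[OF q(1)]
  have "absolutely_continuous (density M (\<lambda>x. ennreal (q x))) \<pi>" using fin unfolding D_KL_def by (auto split: if_splits)
  moreover have "null_sets M \<subseteq> null_sets (density M (\<lambda>x. ennreal (q x)))"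
  proof
    fix S assume S: "S \<in> null_sets M"
    have "AE x in M. x \<in> S \<longrightarrow> ennreal (q x) = 0" using AE_not_in[OF S] by eventually_elim simp
    then show "S \<in> null_sets (density M (\<lambda>x. ennreal (q x)))"
      using null_setsD2[OF S] by (simp add: null_sets_density_iff)
  qed
  ultimately have ac: "absolutely_continuous M \<pi>" unfolding absolutely_continuous_def by blast
  define r where "r x = enn2real (RN_deriv M \<pi> x)" for x
  have rm[measurable]: "r \<in> borel_measurable M" unfolding r_def by measurable
  have "AE x in M. RN_deriv M \<pi> x \<noteq> \<infinity>"
    by (rule M.RN_deriv_finite[OF \<pi>.sigma_finite_measure_axioms ac \<pi>(2)])
  then have e: "AE x in M. RN_deriv M \<pi> x = ennreal (r x)"
    by eventually_elim (simp add: r_def less_top)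
  have "\<pi> = density M (RN_deriv M \<pi>)" using M.density_RN_deriv[OF ac \<pi>(2)] by simp
  also have "\<dots> = density M (\<lambda>x. ennreal (r x))" by (rule density_cong) (use e in auto)
  finally have d: "\<pi> = density M (\<lambda>x. ennreal (r x))" .
  have "(\<integral>\<^sup>+x. ennreal (r x) \<partial>M) = emeasure \<pi> (space M)"
    unfolding d by (subst emeasure_density) (auto intro!: nn_integral_cong simp: indicator_def)
  also have "\<dots> = 1" using \<pi>.emeasure_space_1 sets_eq_imp_space_eq[OF \<pi>(2)] by simp
  finally have n: "(\<integral>\<^sup>+x. ennreal (r x) \<partial>M) = 1" .
  then have i: "integrable M r" by (intro integrableI_nonneg) (auto simp: r_def)
  have r0: "0 \<le> r x" for x by (simp add: r_def)
  have "ennreal (\<integral>x. r x \<partial>M) = 1"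
    using n nn_integral_eq_integral[OF i] r0 by simp
  then have "(\<integral>x. r x \<partial>M) = 1" by simp
  then have "dens M r" using i r0 by (simp add: dens_def)
  then show ?thesis using d by blast
qed

lemma kl_cong_AE:
  assumes "AE x in M. r x = r' x" "AE x in M. q x = q' x"
  shows "kl M r q = kl M r' q'"
  unfolding kl_def by (rule nn_integral_cong_AE) (use assms in auto)

lemma dens_cong_AE:
  assumes r: "dens M r" and e: "AE x in M. r x = r' x" and m: "r' \<in> borel_measurable M" and n: "\<And>x. 0 \<le> r' x"
  shows "dens M r'" "density M (\<lambda>x. ennreal (r x)) = density M (\<lambda>x. ennreal (r' x))"
proof -
  note [measurable] = densD(4)[OF r] m
  have "integrable M r'"
    using densD(2)[OF r] by (rule Bochner_Integration.integrable_cong_AE_imp) (use e in auto)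
  moreover have "(\<integral>x. r' x \<partial>M) = (\<integral>x. r x \<partial>M)" by (rule integral_cong_AE) (use e in auto)
  ultimately show "dens M r'" using densD(3)[OF r] n by (simp add: dens_def)
  show "density M (\<lambda>x. ennreal (r x)) = density M (\<lambda>x. ennreal (r' x))"
    by (rule density_cong) (use e in auto)
qed

lemma is_arg_minD:
  fixes f :: "'a \<Rightarrow> 'b::linorder"
  assumes "is_arg_min f Q x"
  shows "Q x" "\<And>y. Q y \<Longrightarrow> f x \<le> f y"
  using assms unfolding is_arg_min_def by (auto simp: not_less)

section \<open>The half steps of the algorithm\<close>

context path_setting
begin

lemma dm_one: "dm (\<lambda>_. 1) = P"
  using density_1[of P] by simp

lemma dens_one: "dens P (\<lambda>_. 1)"
  by (rule causal_dens_dens[OF causal_dens_one])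

text \<open>The density 1 is a competitor of finite entropy. It makes the minimum finite, so that
  the minimiser has a density; by \<open>kl_minimal_pos\<close> it makes this density positive; and
  by the Pythagorean inequality its own entropy relative to the minimiser is finite, as the next
  half step requires.\<close>

lemma causal_half_step:
  assumes N: "0 < N" and q: "dens P q" "\<And>z. 0 < q z" "kl_integrable P (\<lambda>_. 1) q"
    and am: "is_arg_min (\<lambda>\<rho>. D_KL \<rho> (dm q)) (\<lambda>\<rho>. \<rho> \<in> causal_couplings_fst N X Y \<mu>) \<pi>"
  shows "\<exists>a. causal_dens a \<and> (\<forall>z. 0 < a z) \<and> \<pi> = dm a \<and> (\<forall>r. causal_dens r \<longrightarrow> kl P a q \<le> kl P r q) \<and>
    kl_integrable P (\<lambda>_. 1) a"
proof -
  note qm = densD(4)[OF q(1)]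
  have \<pi>: "\<pi> \<in> causal_couplings_fst N X Y \<mu>" and min: "\<And>\<rho>. \<rho> \<in> causal_couplings_fst N X Y \<mu> \<Longrightarrow> D_KL \<pi> (dm q) \<le> D_KL \<rho> (dm q)"
    using is_arg_minD[OF am] by auto
  have k1: "kl P (\<lambda>_. 1) q < \<infinity>" using q kl_less_top_iff[OF dens_one] by simp
  have D: "D_KL (dm r) (dm q) = enn2ereal (kl P r q)" if "dens P r" for r
    by (rule D_KL_density[OF prob_space_axioms that q(1,2)])
  have "D_KL \<pi> (dm q) \<le> D_KL (dm (\<lambda>_. 1)) (dm q)"
    using causal_iff[OF dens_one N] causal_dens_one by (intro min) blast
  also have "\<dots> = enn2ereal (kl P (\<lambda>_. 1) q)" by (rule D[OF dens_one])
  also have "\<dots> < \<infinity>" using k1 by (cases "kl P (\<lambda>_. 1) q") auto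
  finally have fin: "D_KL \<pi> (dm q) < \<infinity>" .
  have "\<pi> \<in> borel_probs (prod_topology XN YN)"
    using \<pi> unfolding causal_couplings_fst_def causal_couplings_def couplings_def by auto
  then have p: "prob_space \<pi>" "sets \<pi> = sets P" unfolding borel_probs_def using sets_P by auto
  obtain b where b: "dens P b" "\<pi> = dm b" using D_KL_imp_density[OF prob_space_axioms q(1,2) p fin] by blast
  have cb: "causal_dens b" using \<pi> unfolding b(2) causal_iff[OF b(1) N] .
  have minb: "kl P b q \<le> kl P r q" if "causal_dens r" for r
  proof -
    have "D_KL \<pi> (dm q) \<le> D_KL (dm r) (dm q)"
      using that by (intro min) (simp add: causal_iff[OF causal_dens_dens N])
    then show ?thesis unfolding b(2) D[OF b(1)] D[OF causal_dens_dens[OF that]] by (simp add: less_eq_ennreal.rep_eq)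
  qed
  have kb: "kl P b q < \<infinity>" using minb[OF causal_dens_one] k1 by (rule le_less_trans)
  have pos: "AE z in P. 0 < b z"
    using kl_minimal_pos[OF b(1) dens_one qm q(2) kb k1 minb[OF causal_dens_convex[OF cb causal_dens_one]]] by simp
  \<comment> \<open>A version positive at every point; the change on a null set preserves the
    measure, causality and entropy.\<close>
  define a where "a z = (if 0 < b z then b z else 1)" for z
  have am[measurable]: "a \<in> borel_measurable P" unfolding a_def using densD(4)[OF b(1)] by measurable
  have a0: "0 < a z" for z by (simp add: a_def)
  have e: "AE z in P. b z = a z" using pos by eventually_elim (simp add: a_def)
  have ca: "causal_dens a" by (rule causal_dens_cong[OF cb e less_imp_le[OF a0] am])
  have ea: "kl P a q = kl P b q" by (rule kl_cong_AE) (use e in auto)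
  have \<pi>a: "\<pi> = dm a" unfolding b(2) by (rule dens_cong_AE(2)[OF b(1) e am less_imp_le[OF a0]])
  have mina: "kl P a q \<le> kl P r q" if "causal_dens r" for r unfolding ea by (rule minb[OF that])
  have "kl P (\<lambda>_. 1) a \<le> kl P (\<lambda>_. 1) a + kl P a q" by simp
  also have "\<dots> \<le> kl P (\<lambda>_. 1) q"
    by (rule kl_pythagoras[OF causal_dens_dens[OF ca] a0 dens_one qm q(2)])
      (use kb ea mina[OF causal_dens_convex[OF ca causal_dens_one]] in auto)
  also note k1
  finally have "kl P (\<lambda>_. 1) a < \<infinity>" .
  then have "kl_integrable P (\<lambda>_. 1) a" using kl_less_top_iff[OF dens_one causal_dens_dens[OF ca] a0] by simp
  then show ?thesis using ca a0 \<pi>a mina by blast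
qed

text \<open>For every density \<open>r\<close> with second marginal \<nu> the integral of
  \<open>r * ln f\<close> has the same value \<open>b\<close>, so at finite entropy relative to
  \<open>a\<close> the entropy relative to \<open>?q\<close> is larger by \<open>b\<close>. The
  candidate \<open>?q\<close> attains \<open>- b\<close>; a minimiser therefore has entropy 0
  relative to \<open>?q\<close> and equals it.\<close>

lemma marginal_half_step:
  assumes a: "dens P a" "\<And>z. 0 < a z" "kl_integrable P (\<lambda>_. 1) a"
    and f: "f \<in> borel_measurable (hist N X Y 0 N)" "\<And>z. 0 < f z" "AE z in P. real_cond_exp P (hist N X Y 0 N) a z = f z"
    and am: "is_arg_min (\<lambda>\<rho>. D_KL \<rho> (dm a)) (\<lambda>\<rho>. \<rho> \<in> couplings_snd XN YN \<nu>) \<pi>"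
  shows "dens P (\<lambda>z. a z / f z)" "kl_integrable P (\<lambda>_. 1) (\<lambda>z. a z / f z)" "\<pi> = dm (\<lambda>z. a z / f z)"
proof -
  let ?E = "real_cond_exp P (hist N X Y 0 N)"
  interpret E: sigma_finite_subalgebra P "hist N X Y 0 N" using sf by auto
  have am'[measurable]: "a \<in> borel_measurable P" by (rule densD(4)[OF a(1)])
  have fP[measurable]: "f \<in> borel_measurable P" using f(1) meas_F[of 0 N] by auto
  have f0: "f z \<noteq> 0" "0 \<le> f z" for z using f(2)[of z] by auto
  have "marginal a f" by (rule marginalI[OF a(1) f(1) _ f(3)]) (use f0 in auto)
  note ma = marginalD[OF this]
  let ?q = "\<lambda>z. a z / f z"
  have q0: "0 < ?q z" for z using a(2) f(2) by simp
  have inv: "(\<lambda>z. 1 / f z) \<in> borel_measurable (hist N X Y 0 N)" using f(1) by measurable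
  have iq: "integrable P (\<lambda>z. 1 / f z * a z)" and q1: "(\<integral>z. 1 / f z * a z \<partial>P) = 1"
    using ma[OF inv] by (auto simp: f0 prob_space)
  show dq: "dens P ?q" unfolding dens_def using iq q1 q0 by (auto intro: less_imp_le)
  note qm = densD(4)[OF dq]
  have Eq: "AE z in P. ?E ?q z = 1"
  proof -
    have "AE z in P. ?E (\<lambda>z. 1 / f z * a z) z = 1 / f z * ?E a z"
      by (rule E.real_cond_exp_mult[OF inv am' iq])
    then show ?thesis using f(3) by eventually_elim (simp add: f0)
  qed
  have ifn: "integrable P f" using ma(1)[of "\<lambda>_. 1"] densD(2)[OF a(1)] by simp
  have ila: "integrable P (\<lambda>z. ln (a z))"
  proof -
    have "ln (1 / a z) = - ln (a z)" for z using a(2)[of z] by (simp add: ln_div)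
    then show ?thesis using a(3) unfolding kl_integrable_def by simp
  qed
  have ilf: "integrable P (\<lambda>z. ln (f z))"
  proof (rule Bochner_Integration.integrable_bound)
    show "integrable P (\<lambda>z. \<bar>ln (a z)\<bar> + 1 + ?q z + f z)" using ila densD(2)[OF dq] ifn by auto
    show "AE z in P. norm (ln (f z)) \<le> norm (\<bar>ln (a z)\<bar> + 1 + ?q z + f z)"
    proof (rule AE_I2)
      fix z
      have "ln (f z) \<le> f z - 1" by (rule ln_le_minus_one[OF f(2)])
      moreover have "ln (?q z) \<le> ?q z - 1" by (rule ln_le_minus_one[OF q0])
      moreover have "ln (?q z) = ln (a z) - ln (f z)" using a(2)[of z] f(2)[of z] by (simp add: ln_div)
      moreover note q0[of z] f(2)[of z]
      ultimately have "\<bar>ln (f z)\<bar> \<le> \<bar>ln (a z)\<bar> + 1 + ?q z + f z" by linarith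
      also have "\<dots> \<le> \<bar>\<bar>ln (a z)\<bar> + 1 + ?q z + f z\<bar>" by (rule abs_ge_self)
      finally show "norm (ln (f z)) \<le> norm (\<bar>ln (a z)\<bar> + 1 + ?q z + f z)" by simp
    qed
  qed measurable
  have lf: "(\<lambda>z. ln (f z)) \<in> borel_measurable (hist N X Y 0 N)" using f(1) by measurable
  define b where "b = (\<integral>z. ln (f z) \<partial>P)"
  have rlf: "integrable P (\<lambda>z. r z * ln (f z))" "(\<integral>z. r z * ln (f z) \<partial>P) = b"
    if r: "dens P r" "AE z in P. ?E r z = 1" for r
  proof -
    have "marginal r (\<lambda>_. 1)" by (rule marginalI[OF r(1) _ _ r(2)]) auto
    from marginalD[OF this lf] ilf show "integrable P (\<lambda>z. r z * ln (f z))" "(\<integral>z. r z * ln (f z) \<partial>P) = b"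
      by (simp_all add: mult.commute b_def)
  qed
  have split: "y * ln (y / ?q z) = y * ln (y / a z) + y * ln (f z)" if "0 \<le> y" for y z
    using that a(2)[of z] f(2)[of z] by (cases "y = 0") (auto simp: ln_div ln_mult algebra_simps)
  have step: "kl_integrable P r ?q" "KL P r ?q = KL P r a + b" if r: "dens P r" "AE z in P. ?E r z = 1" "kl_integrable P r a" for r
  proof -
    have s: "(\<lambda>z. r z * ln (r z / ?q z)) = (\<lambda>z. r z * ln (r z / a z) + r z * ln (f z))"
      using split[OF densD(1)[OF r(1)]] by blast
    show "kl_integrable P r ?q" "KL P r ?q = KL P r a + b"
      using r(3) rlf[OF r(1,2)] unfolding kl_integrable_def KL_def s by auto
  qed
  have E1: "AE z in P. ?E (\<lambda>_. 1) z = 1" by (rule E.real_cond_exp_F_meas) auto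
  show "kl_integrable P (\<lambda>_. 1) ?q" by (rule step(1)[OF dens_one E1 a(3)])
  have kq: "kl_integrable P ?q a" "KL P ?q a = - b"
  proof -
    have e: "?q z * ln (?q z / a z) = - (?q z * ln (f z))" for z
      using a(2)[of z] f(2)[of z] by (simp add: ln_div)
    show "kl_integrable P ?q a" "KL P ?q a = - b"
      unfolding kl_integrable_def KL_def e using rlf[OF dq Eq] by auto
  qed
  have \<pi>: "\<pi> \<in> couplings_snd XN YN \<nu>" and min: "\<And>\<rho>. \<rho> \<in> couplings_snd XN YN \<nu> \<Longrightarrow> D_KL \<pi> (dm a) \<le> D_KL \<rho> (dm a)"
    using is_arg_minD[OF am] by auto
  have D: "D_KL (dm r) (dm a) = enn2ereal (kl P r a)" if "dens P r" for r
    by (rule D_KL_density[OF prob_space_axioms that a(1,2)])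
  have le: "D_KL \<pi> (dm a) \<le> D_KL (dm ?q) (dm a)"
    by (rule min) (simp add: couplings_snd_iff[OF dq] Eq)
  also have "\<dots> = enn2ereal (kl P ?q a)" by (rule D[OF dq])
  also have "\<dots> < \<infinity>" unfolding kl_fun_integral(3)[OF dq a(1,2) kq(1)] by simp
  finally have fin: "D_KL \<pi> (dm a) < \<infinity>" .
  have "\<pi> \<in> borel_probs (prod_topology XN YN)" using \<pi> unfolding couplings_snd_def couplings_def by auto
  then have p: "prob_space \<pi>" "sets \<pi> = sets P" unfolding borel_probs_def using sets_P by auto
  obtain r where r: "dens P r" "\<pi> = dm r" using D_KL_imp_density[OF prob_space_axioms a(1,2) p fin] by blast
  have Er: "AE z in P. ?E r z = 1" using \<pi> unfolding r(2) couplings_snd_iff[OF r(1)] .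
  have kle: "kl P r a \<le> kl P ?q a"
    using le unfolding r(2) D[OF r(1)] D[OF dq] by (simp add: less_eq_ennreal.rep_eq)
  then have "kl P r a < \<infinity>" unfolding kl_fun_integral(3)[OF dq a(1,2) kq(1)] by (rule le_less_trans) simp
  then have kr: "kl_integrable P r a" using kl_less_top_iff[OF r(1) a(1,2)] by simp
  have "KL P r a \<le> - b"
    using kle unfolding kl_fun_integral(3)[OF dq a(1,2) kq(1)] kl_fun_integral(3)[OF r(1) a(1,2) kr] kq(2)
    using kl_fun_integral(4)[OF dq a(1,2) kq(1)] kq(2) by (subst (asm) ennreal_le_iff) auto
  then have "KL P r ?q \<le> 0" using step(2)[OF r(1) Er kr] by simp
  then have "kl P r ?q \<le> ennreal 0"
    unfolding kl_fun_integral(3)[OF r(1) dq q0 step(1)[OF r(1) Er kr]] by (rule ennreal_leI)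
  then have "(\<integral>z. \<bar>r z - ?q z\<bar> \<partial>P) \<le> 2 * sqrt 0"
    by (intro L1_le_kl[OF r(1) dq]) (use q0 in auto)
  then have "AE z in P. r z = ?q z"
    by (intro AE_eq_of_L1_approx densD(2)[OF r(1)] densD(2)[OF dq]) simp
  then show "\<pi> = dm ?q" unfolding r(2)
    by (intro dens_cong_AE(2)[OF r(1) _ qm] less_imp_le[OF q0])
qed

lemma dm_eq_AE:
  assumes "dens P r" "dens P r'" "dm r = dm r'"
  shows "AE z in P. r z = r' z"
proof -
  have "AE z in P. ennreal (r z) = ennreal (r' z)"
    using assms(3) densD(4)[OF assms(1)] densD(4)[OF assms(2)] by (subst (asm) density_unique_iff) auto
  then show ?thesis
    by eventually_elim (use densD(1)[OF assms(1)] densD(1)[OF assms(2)] in simp)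
qed

lemma pos_cond_exp_version:
  assumes a: "dens P a" "\<And>z. 0 < a z"
  obtains f where "f \<in> borel_measurable (hist N X Y 0 N)" "\<And>z. 0 < f z" "AE z in P. real_cond_exp P (hist N X Y 0 N) a z = f z"
proof -
  let ?E = "real_cond_exp P (hist N X Y 0 N) a"
  interpret E: sigma_finite_subalgebra P "hist N X Y 0 N" using sf by auto
  have pos: "AE z in P. ?E z > 0" by (rule E.real_cond_exp_gr_c[OF densD(2)[OF a(1)]]) (use a(2) in auto)
  let ?f = "\<lambda>z. if 0 < ?E z then ?E z else 1"
  have "?f \<in> borel_measurable (hist N X Y 0 N)" by measurable
  moreover have "AE z in P. ?E z = ?f z" using pos by eventually_elim simp
  ultimately show thesis by (intro that[of ?f]) auto
qed

text \<open>The densities of the given measures are chosen one by one, so \<open>R (Suc n)\<close>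
  and \<open>Rh n / f n\<close> agree only almost everywhere.\<close>

lemma sinkhorn_densities:
  assumes N: "0 < N" and R0: "dens P R0" "\<And>z. 0 < R0 z" "kl_integrable P (\<lambda>_. 1) R0"
    and \<pi>0: "\<pi> 0 = dm R0"
    and h: "\<And>k. is_arg_min (\<lambda>\<rho>. D_KL \<rho> (\<pi> k)) (\<lambda>\<rho>. \<rho> \<in> causal_couplings_fst N X Y \<mu>) (\<pi>h k)"
    and i: "\<And>k. is_arg_min (\<lambda>\<rho>. D_KL \<rho> (\<pi>h k)) (\<lambda>\<rho>. \<rho> \<in> couplings_snd XN YN \<nu>) (\<pi> (Suc k))"
  obtains R Rh f where "R 0 = R0" "\<And>n. dens P (R n)" "\<And>n z. 0 < R n z" "\<And>n. \<pi> n = dm (R n)"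
    "\<And>n. causal_dens (Rh n)" "\<And>n z. 0 < Rh n z" "\<And>n. \<pi>h n = dm (Rh n)"
    "\<And>n r. causal_dens r \<Longrightarrow> kl P (Rh n) (R n) \<le> kl P r (R n)"
    "\<And>n. f n \<in> borel_measurable (hist N X Y 0 N)" "\<And>n z. 0 < f n z"
    "\<And>n. AE z in P. real_cond_exp P (hist N X Y 0 N) (Rh n) z = f n z"
    "\<And>n. AE z in P. R (Suc n) z = Rh n z / f n z"
proof -
  \<comment> \<open>The last conjunct pins the choice at \<open>n = 0\<close> to the explicit
    density \<open>R0\<close>.\<close>
  define Q where "Q n q \<longleftrightarrow> dens P q \<and> (\<forall>z. 0 < q z) \<and> kl_integrable P (\<lambda>_. 1) q \<and> \<pi> n = dm q \<and> (n = 0 \<longrightarrow> q = R0)" for n q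
  define H where "H n q a \<longleftrightarrow> causal_dens a \<and> (\<forall>z. 0 < a z) \<and> \<pi>h n = dm a \<and> (\<forall>r. causal_dens r \<longrightarrow> kl P a q \<le> kl P r q) \<and>
    kl_integrable P (\<lambda>_. 1) a" for n q a
  have QH: "\<exists>a. H n q a" if "Q n q" for n q
    unfolding H_def using that h[of n] unfolding Q_def by (intro causal_half_step[OF N]) auto
  have HQ: "dens P (\<lambda>z. a z / f z)" "kl_integrable P (\<lambda>_. 1) (\<lambda>z. a z / f z)" "\<pi> (Suc n) = dm (\<lambda>z. a z / f z)"
    if "H n q a" and f: "f \<in> borel_measurable (hist N X Y 0 N)" "\<And>z. 0 < f z" "AE z in P. real_cond_exp P (hist N X Y 0 N) a z = f z"
    for n q a f
    using marginal_half_step[OF _ _ _ f, of "\<pi> (Suc n)"] that(1) i[of n] unfolding H_def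
    by (auto intro: causal_dens_dens)
  have "\<exists>q. Q n q" for n
  proof (induction n)
    case 0
    then show ?case unfolding Q_def using R0 \<pi>0 by blast
  next
    case (Suc n)
    then obtain q a where a: "H n q a" using QH by blast
    then have a': "dens P a" "\<And>z. 0 < a z" unfolding H_def by (auto intro: causal_dens_dens)
    obtain f where f: "f \<in> borel_measurable (hist N X Y 0 N)" "\<And>z. 0 < f z" "AE z in P. real_cond_exp P (hist N X Y 0 N) a z = f z"
      using pos_cond_exp_version[OF a'] by blast
    have "Q (Suc n) (\<lambda>z. a z / f z)" unfolding Q_def using HQ[OF a f] a'(2) f(2) by simp
    then show ?case by blast
  qed
  then have "\<forall>n. \<exists>q. Q n q" by blast
  then obtain R where "\<forall>n. Q n (R n)" by (rule choice[THEN exE])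
  then have R: "Q n (R n)" for n by blast
  have "\<forall>n. \<exists>a. H n (R n) a" using QH[OF R] by blast
  then obtain Rh where "\<forall>n. H n (R n) (Rh n)" by (rule choice[THEN exE])
  then have Rh: "H n (R n) (Rh n)" for n by blast
  have Rh1: "dens P (Rh n)" for n using Rh[of n] unfolding H_def by (elim conjE) (rule causal_dens_dens)
  have Rh2: "0 < Rh n z" for n z using Rh[of n] unfolding H_def by (elim conjE) (erule spec)
  have "\<forall>n. \<exists>f. f \<in> borel_measurable (hist N X Y 0 N) \<and> (\<forall>z. 0 < f z) \<and> (AE z in P. real_cond_exp P (hist N X Y 0 N) (Rh n) z = f z)"
  proof
    fix n
    show "\<exists>f. f \<in> borel_measurable (hist N X Y 0 N) \<and> (\<forall>z. 0 < f z) \<and> (AE z in P. real_cond_exp P (hist N X Y 0 N) (Rh n) z = f z)"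
      by (rule pos_cond_exp_version[OF Rh1[of n] Rh2[of n]], rule exI, intro conjI allI)
  qed
  then obtain f where F: "\<forall>n. f n \<in> borel_measurable (hist N X Y 0 N) \<and> (\<forall>z. 0 < f n z) \<and> (AE z in P. real_cond_exp P (hist N X Y 0 N) (Rh n) z = f n z)"
    by (rule choice[THEN exE])
  have f1: "f n \<in> borel_measurable (hist N X Y 0 N)" for n by (rule F[THEN spec, THEN conjunct1])
  have f2: "0 < f n z" for n z by (rule F[THEN spec, THEN conjunct2, THEN conjunct1, THEN spec])
  have f3: "AE z in P. real_cond_exp P (hist N X Y 0 N) (Rh n) z = f n z" for n
    by (rule F[THEN spec, THEN conjunct2, THEN conjunct2])
  note f = f1 f2 f3
  show thesis
  proof (rule that[of R Rh f])
    show "AE z in P. R (Suc n) z = Rh n z / f n z" for n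
    proof (rule dm_eq_AE)
      show "dens P (R (Suc n))" using R[of "Suc n"] by (simp add: Q_def)
      show "dens P (\<lambda>z. Rh n z / f n z)" by (rule HQ(1)[OF Rh f])
      have "\<pi> (Suc n) = dm (R (Suc n))" using R[of "Suc n"] by (simp add: Q_def)
      then show "dm (R (Suc n)) = dm (\<lambda>z. Rh n z / f n z)" using HQ(3)[OF Rh f] by simp
    qed
    show "R 0 = R0" using R[of 0] unfolding Q_def by blast
    show "dens P (R n)" "\<pi> n = dm (R n)" for n using R[of n] unfolding Q_def by blast+
    show "0 < R n z" for n z using R[of n] unfolding Q_def by (elim conjE) (erule spec)
    show "causal_dens (Rh n)" "\<pi>h n = dm (Rh n)"
      "causal_dens r \<Longrightarrow> kl P (Rh n) (R n) \<le> kl P r (R n)" for n r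
      using Rh[of n] unfolding H_def by (elim conjE; simp only:)+
  qed (rule Rh2 f)+
qed

end

section \<open>Couplings and the Wasserstein distance\<close>

text \<open>The mass common to both measures stays on the diagonal and the remainders are coupled
  independently; the boolean component selects between the two parts.\<close>

lemma maximal_coupling:
  assumes M: "prob_space M" and r1: "dens M r1" and r2: "dens M r2"
  obtains \<theta> where "prob_space \<theta>" "sets \<theta> = sets (M \<Otimes>\<^sub>M M)"
    "distr \<theta> M fst = density M (\<lambda>z. ennreal (r1 z))" "distr \<theta> M snd = density M (\<lambda>z. ennreal (r2 z))"
    "\<And>F a. F \<in> borel_measurable (M \<Otimes>\<^sub>M M) \<Longrightarrow> a \<in> borel_measurable M \<Longrightarrow> (\<And>z. z \<in> space M \<Longrightarrow> F (z, z) = 0) \<Longrightarrow>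
      (\<And>z z'. z \<in> space M \<Longrightarrow> z' \<in> space M \<Longrightarrow> F (z, z') \<le> a z + a z') \<Longrightarrow>
      (\<integral>\<^sup>+w. F w \<partial>\<theta>) \<le> (\<integral>\<^sup>+z. a z * ennreal \<bar>r1 z - r2 z\<bar> \<partial>M)"
proof -
  interpret M: prob_space M by fact
  interpret MM: pair_prob_space M M ..
  have [measurable]: "r1 \<in> borel_measurable M" "r2 \<in> borel_measurable M" using densD(4)[OF r1] densD(4)[OF r2] by auto
  define m where "m z = min (r1 z) (r2 z)" for z
  define p1 where "p1 z = r1 z - m z" for z
  define p2 where "p2 z = r2 z - m z" for z
  have [measurable]: "m \<in> borel_measurable M" "p1 \<in> borel_measurable M" "p2 \<in> borel_measurable M"
    unfolding m_def p1_def p2_def by measurable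
  have nn: "0 \<le> m z" "0 \<le> p1 z" "0 \<le> p2 z" for z
    using densD(1)[OF r1, of z] densD(1)[OF r2, of z] by (auto simp: m_def p1_def p2_def)
  have im: "integrable M m" unfolding m_def using densD(2)[OF r1] densD(2)[OF r2] by auto
  have ip: "integrable M p1" "integrable M p2" unfolding p1_def p2_def using im densD(2)[OF r1] densD(2)[OF r2] by auto
  define \<epsilon> where "\<epsilon> = 1 - (\<integral>z. m z \<partial>M)"
  have pe: "(\<integral>z. p1 z \<partial>M) = \<epsilon>" "(\<integral>z. p2 z \<partial>M) = \<epsilon>"
    unfolding p1_def p2_def \<epsilon>_def using im densD[OF r1] densD[OF r2] by auto
  have \<epsilon>0: "0 \<le> \<epsilon>" unfolding pe(1)[symmetric] using nn by simp
  \<comment> \<open>Product coupling of the remainders, each of mass \<epsilon>. For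
    \<open>\<epsilon> = 0\<close> the quotient is 0, as it should be, because both remainders vanish
    almost everywhere.\<close>
  define k where "k z z' = ennreal (p1 z * p2 z' / \<epsilon>)" for z z'
  have km[measurable]: "(\<lambda>(z, z'). k z z') \<in> borel_measurable (M \<Otimes>\<^sub>M M)" unfolding k_def by measurable
  have zero: "AE z in M. p1 z = 0" "AE z in M. p2 z = 0" if "\<epsilon> = 0"
    using integral_nonneg_eq_0_iff_AE[OF ip(1)] integral_nonneg_eq_0_iff_AE[OF ip(2)] nn pe that by auto
  have I: "(\<integral>\<^sup>+z. ennreal (c * p z) \<partial>M) = ennreal (c * \<epsilon>)" if "0 \<le> c" "p = p1 \<or> p = p2" for c p
  proof -
    have "integrable M p" "(\<integral>z. p z \<partial>M) = \<epsilon>" "\<And>z. 0 \<le> p z" using that ip pe nn by auto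
    then show ?thesis using that(1) by (subst nn_integral_eq_integral) auto
  qed
  have K1: "AE z in M. (\<integral>\<^sup>+z'. k z z' \<partial>M) = ennreal (p1 z)"
  proof (cases "\<epsilon> = 0")
    case True
    then show ?thesis using zero(1) by (auto simp: k_def)
  next
    case False
    have "(\<integral>\<^sup>+z'. k z z' \<partial>M) = ennreal (p1 z)" for z
      using I[of "p1 z / \<epsilon>" p2] nn \<epsilon>0 False by (simp add: k_def)
    then show ?thesis by simp
  qed
  have K2: "AE z' in M. (\<integral>\<^sup>+z. k z z' \<partial>M) = ennreal (p2 z')"
  proof (cases "\<epsilon> = 0")
    case True
    then show ?thesis using zero(2) by (auto simp: k_def)
  next
    case False
    have "(\<integral>\<^sup>+z. k z z' \<partial>M) = ennreal (p2 z')" for z'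
      using I[of "p2 z' / \<epsilon>" p1] nn \<epsilon>0 False by (simp add: k_def mult.commute)
    then show ?thesis by simp
  qed
  let ?B = "count_space (UNIV :: bool set)"
  interpret B: sigma_finite_measure ?B by (rule sigma_finite_measure_count_space_countable) simp
  define g where "g = (\<lambda>(w, b). if b then ennreal (m (fst w)) else k (fst w) (snd w))"
  define T where "T = (\<lambda>(w :: 'a \<times> 'a, b). if b then (fst w, fst w) else w)"
  have gm[measurable]: "g \<in> borel_measurable ((M \<Otimes>\<^sub>M M) \<Otimes>\<^sub>M ?B)" unfolding g_def by measurable
  have Tm[measurable]: "T \<in> (M \<Otimes>\<^sub>M M) \<Otimes>\<^sub>M ?B \<rightarrow>\<^sub>M M \<Otimes>\<^sub>M M" unfolding T_def by measurable
  define \<theta> where "\<theta> = distr (density ((M \<Otimes>\<^sub>M M) \<Otimes>\<^sub>M ?B) g) (M \<Otimes>\<^sub>M M) T"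
  have s\<theta>: "sets \<theta> = sets (M \<Otimes>\<^sub>M M)" by (simp add: \<theta>_def)
  have master: "(\<integral>\<^sup>+w. F w \<partial>\<theta>) = (\<integral>\<^sup>+z. ennreal (m z) * F (z, z) \<partial>M) + (\<integral>\<^sup>+z. (\<integral>\<^sup>+z'. k z z' * F (z, z') \<partial>M) \<partial>M)"
    if F[measurable]: "F \<in> borel_measurable (M \<Otimes>\<^sub>M M)" for F
  proof -
    have "(\<integral>\<^sup>+w. F w \<partial>\<theta>) = (\<integral>\<^sup>+v. g v * F (T v) \<partial>((M \<Otimes>\<^sub>M M) \<Otimes>\<^sub>M ?B))"
      unfolding \<theta>_def by (subst nn_integral_distr) (auto simp: nn_integral_density)
    also have "\<dots> = (\<integral>\<^sup>+w. (\<integral>\<^sup>+b. g (w, b) * F (T (w, b)) \<partial>?B) \<partial>(M \<Otimes>\<^sub>M M))"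
      by (rule B.nn_integral_fst[symmetric]) measurable
    also have "\<dots> = (\<integral>\<^sup>+w. ennreal (m (fst w)) * F (fst w, fst w) + k (fst w) (snd w) * F w \<partial>(M \<Otimes>\<^sub>M M))"
      by (simp add: nn_integral_count_space_finite UNIV_bool g_def T_def add.commute)
    also have "\<dots> = (\<integral>\<^sup>+w. ennreal (m (fst w)) * F (fst w, fst w) \<partial>(M \<Otimes>\<^sub>M M)) + (\<integral>\<^sup>+w. k (fst w) (snd w) * F w \<partial>(M \<Otimes>\<^sub>M M))"
      by (rule nn_integral_add) measurable
    also have "(\<integral>\<^sup>+w. ennreal (m (fst w)) * F (fst w, fst w) \<partial>(M \<Otimes>\<^sub>M M)) = (\<integral>\<^sup>+z. ennreal (m z) * F (z, z) \<partial>M)"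
      by (subst M.nn_integral_fst[symmetric]) (auto simp: M.emeasure_space_1)
    also have "(\<integral>\<^sup>+w. k (fst w) (snd w) * F w \<partial>(M \<Otimes>\<^sub>M M)) = (\<integral>\<^sup>+z. (\<integral>\<^sup>+z'. k z z' * F (z, z') \<partial>M) \<partial>M)"
      by (subst M.nn_integral_fst[symmetric]) auto
    finally show ?thesis .
  qed
  have swap: "(\<integral>\<^sup>+z. (\<integral>\<^sup>+z'. k z z' * h z' \<partial>M) \<partial>M) = (\<integral>\<^sup>+z'. ennreal (p2 z') * h z' \<partial>M)" if [measurable]: "h \<in> borel_measurable M" for h
  proof -
    have "(\<integral>\<^sup>+z. (\<integral>\<^sup>+z'. k z z' * h z' \<partial>M) \<partial>M) = (\<integral>\<^sup>+z'. (\<integral>\<^sup>+z. k z z' * h z' \<partial>M) \<partial>M)"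
      by (rule MM.Fubini'[symmetric]) measurable
    also have "\<dots> = (\<integral>\<^sup>+z'. ennreal (p2 z') * h z' \<partial>M)"
    proof (rule nn_integral_cong_AE)
      show "AE z' in M. (\<integral>\<^sup>+z. k z z' * h z' \<partial>M) = ennreal (p2 z') * h z'"
        using K2 AE_space
      proof eventually_elim
        case (elim z')
        have "(\<integral>\<^sup>+z. k z z' * h z' \<partial>M) = (\<integral>\<^sup>+z. k z z' \<partial>M) * h z'"
          using elim(2) by (intro nn_integral_multc) measurable
        then show ?case using elim(1) by simp
      qed
    qed
    finally show ?thesis .
  qed
  have noswap: "(\<integral>\<^sup>+z. (\<integral>\<^sup>+z'. k z z' * h z \<partial>M) \<partial>M) = (\<integral>\<^sup>+z. ennreal (p1 z) * h z \<partial>M)" if [measurable]: "h \<in> borel_measurable M" for h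
  proof (rule nn_integral_cong_AE)
    show "AE z in M. (\<integral>\<^sup>+z'. k z z' * h z \<partial>M) = ennreal (p1 z) * h z"
      using K1 AE_space
    proof eventually_elim
      case (elim z)
      have "(\<integral>\<^sup>+z'. k z z' * h z \<partial>M) = (\<integral>\<^sup>+z'. k z z' \<partial>M) * h z"
        using elim(2) by (intro nn_integral_multc) measurable
      then show ?case using elim(1) by simp
    qed
  qed
  have mp: "ennreal (m z) + ennreal (p1 z) = ennreal (r1 z)" "ennreal (m z) + ennreal (p2 z) = ennreal (r2 z)" for z
    using nn by (simp_all flip: ennreal_plus add: p1_def p2_def)
  have d1: "distr \<theta> M fst = density M (\<lambda>z. ennreal (r1 z))"
  proof (rule measure_eqI)
    fix A assume "A \<in> sets (distr \<theta> M fst)"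
    then have A[measurable]: "A \<in> sets M" by simp
    have f: "fst \<in> \<theta> \<rightarrow>\<^sub>M M" unfolding measurable_cong_sets[OF s\<theta> refl] by simp
    have "emeasure (distr \<theta> M fst) A = (\<integral>\<^sup>+w. indicator A w \<partial>distr \<theta> M fst)" by simp
    also have "\<dots> = (\<integral>\<^sup>+w. indicator A (fst w) \<partial>\<theta>)" by (rule nn_integral_distr[OF f]) measurable
    also have "\<dots> = (\<integral>\<^sup>+z. ennreal (m z) * indicator A z \<partial>M) + (\<integral>\<^sup>+z. ennreal (p1 z) * indicator A z \<partial>M)"
      by (subst master) (auto simp: noswap)
    also have "\<dots> = (\<integral>\<^sup>+z. ennreal (m z) * indicator A z + ennreal (p1 z) * indicator A z \<partial>M)"
      by (rule nn_integral_add[symmetric]) auto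
    also have "\<dots> = (\<integral>\<^sup>+z. ennreal (r1 z) * indicator A z \<partial>M)" by (simp add: distrib_right[symmetric] mp)
    also have "\<dots> = emeasure (density M (\<lambda>z. ennreal (r1 z))) A" by (rule emeasure_density[symmetric]) auto
    finally show "emeasure (distr \<theta> M fst) A = emeasure (density M (\<lambda>z. ennreal (r1 z))) A" .
  qed simp
  have d2: "distr \<theta> M snd = density M (\<lambda>z. ennreal (r2 z))"
  proof (rule measure_eqI)
    fix A assume "A \<in> sets (distr \<theta> M snd)"
    then have A[measurable]: "A \<in> sets M" by simp
    have f: "snd \<in> \<theta> \<rightarrow>\<^sub>M M" unfolding measurable_cong_sets[OF s\<theta> refl] by simp
    have "emeasure (distr \<theta> M snd) A = (\<integral>\<^sup>+w. indicator A w \<partial>distr \<theta> M snd)" by simp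
    also have "\<dots> = (\<integral>\<^sup>+w. indicator A (snd w) \<partial>\<theta>)" by (rule nn_integral_distr[OF f]) measurable
    also have "\<dots> = (\<integral>\<^sup>+z. ennreal (m z) * indicator A z \<partial>M) + (\<integral>\<^sup>+z. ennreal (p2 z) * indicator A z \<partial>M)"
      by (subst master) (auto simp: swap)
    also have "\<dots> = (\<integral>\<^sup>+z. ennreal (m z) * indicator A z + ennreal (p2 z) * indicator A z \<partial>M)"
      by (rule nn_integral_add[symmetric]) auto
    also have "\<dots> = (\<integral>\<^sup>+z. ennreal (r2 z) * indicator A z \<partial>M)" by (simp add: distrib_right[symmetric] mp)
    also have "\<dots> = emeasure (density M (\<lambda>z. ennreal (r2 z))) A" by (rule emeasure_density[symmetric]) auto
    finally show "emeasure (distr \<theta> M snd) A = emeasure (density M (\<lambda>z. ennreal (r2 z))) A" .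
  qed simp
  have pr: "prob_space \<theta>"
  proof (rule prob_spaceI)
    have f: "fst \<in> \<theta> \<rightarrow>\<^sub>M M" unfolding measurable_cong_sets[OF s\<theta> refl] by simp
    have "emeasure \<theta> (space \<theta>) = emeasure (distr \<theta> M fst) (space M)"
      using f by (subst emeasure_distr) (auto dest: measurable_space intro!: arg_cong[where f="emeasure \<theta>"])
    also have "\<dots> = 1" unfolding d1 using prob_space.emeasure_space_1[OF dens_prob_space[OF r1]] by simp
    finally show "emeasure \<theta> (space \<theta>) = 1" .
  qed
  show thesis
  proof (rule that[OF pr s\<theta> d1 d2])
    fix F :: "'a \<times> 'a \<Rightarrow> ennreal" and a :: "'a \<Rightarrow> ennreal" assume F[measurable]: "F \<in> borel_measurable (M \<Otimes>\<^sub>M M)" and a[measurable]: "a \<in> borel_measurable M"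
      and F0: "\<And>z. z \<in> space M \<Longrightarrow> F (z, z) = 0" and Fa: "\<And>z z'. z \<in> space M \<Longrightarrow> z' \<in> space M \<Longrightarrow> F (z, z') \<le> a z + a z'"
    \<comment> \<open>The diagonal part contributes nothing because \<open>F\<close> vanishes there;
      the marginals of the rest are \<open>p1\<close> and \<open>p2\<close>, and
      \<open>p1 + p2 = \<bar>r1 - r2\<bar>\<close>.\<close>
    have "(\<integral>\<^sup>+w. F w \<partial>\<theta>) = (\<integral>\<^sup>+z. (\<integral>\<^sup>+z'. k z z' * F (z, z') \<partial>M) \<partial>M)"
    proof -
      have "(\<integral>\<^sup>+z. ennreal (m z) * F (z, z) \<partial>M) = (\<integral>\<^sup>+z. 0 \<partial>M)" by (rule nn_integral_cong) (simp add: F0)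
      then show ?thesis using master[OF F] by simp
    qed
    also have "\<dots> \<le> (\<integral>\<^sup>+z. (\<integral>\<^sup>+z'. k z z' * a z + k z z' * a z' \<partial>M) \<partial>M)"
    proof (intro nn_integral_mono)
      fix z z' assume "z \<in> space M" "z' \<in> space M"
      then have "k z z' * F (z, z') \<le> k z z' * (a z + a z')" by (intro mult_left_mono Fa) auto
      then show "k z z' * F (z, z') \<le> k z z' * a z + k z z' * a z'" by (simp add: distrib_left)
    qed
    also have "\<dots> = (\<integral>\<^sup>+z. (\<integral>\<^sup>+z'. k z z' * a z \<partial>M) + (\<integral>\<^sup>+z'. k z z' * a z' \<partial>M) \<partial>M)"
      by (intro nn_integral_cong nn_integral_add) measurable
    also have "\<dots> = (\<integral>\<^sup>+z. (\<integral>\<^sup>+z'. k z z' * a z \<partial>M) \<partial>M) + (\<integral>\<^sup>+z. (\<integral>\<^sup>+z'. k z z' * a z' \<partial>M) \<partial>M)"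
      by (rule nn_integral_add) measurable
    also have "\<dots> = (\<integral>\<^sup>+z. ennreal (p1 z) * a z \<partial>M) + (\<integral>\<^sup>+z. ennreal (p2 z) * a z \<partial>M)"
      by (simp add: noswap swap)
    also have "\<dots> = (\<integral>\<^sup>+z. ennreal (p1 z) * a z + ennreal (p2 z) * a z \<partial>M)"
      by (rule nn_integral_add[symmetric]) auto
    also have "\<dots> = (\<integral>\<^sup>+z. a z * ennreal \<bar>r1 z - r2 z\<bar> \<partial>M)"
    proof (rule nn_integral_cong)
      fix z
      have "ennreal (p1 z) + ennreal (p2 z) = ennreal (p1 z + p2 z)" by (rule ennreal_plus[symmetric, OF nn(2,3)])
      also have "p1 z + p2 z = \<bar>r1 z - r2 z\<bar>" by (auto simp: p1_def p2_def m_def)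
      finally show "ennreal (p1 z) * a z + ennreal (p2 z) * a z = a z * ennreal \<bar>r1 z - r2 z\<bar>"
        by (metis distrib_right mult.commute)
    qed
    finally show "(\<integral>\<^sup>+w. F w \<partial>\<theta>) \<le> (\<integral>\<^sup>+z. a z * ennreal \<bar>r1 z - r2 z\<bar> \<partial>M)" .
  qed
qed

section \<open>Metrics, Borel sets and the transport cost\<close>

lemma second_countable_prod_topology:
  assumes "second_countable X" "second_countable Y"
  shows "second_countable (prod_topology X Y)"
proof -
  obtain A where A: "countable A" "\<And>V. V \<in> A \<Longrightarrow> openin X V"
    "\<And>U x. openin X U \<Longrightarrow> x \<in> U \<Longrightarrow> \<exists>V\<in>A. x \<in> V \<and> V \<subseteq> U"
    using assms(1) unfolding second_countable_def by auto
  obtain B where B: "countable B" "\<And>V. V \<in> B \<Longrightarrow> openin Y V"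
    "\<And>U x. openin Y U \<Longrightarrow> x \<in> U \<Longrightarrow> \<exists>V\<in>B. x \<in> V \<and> V \<subseteq> U"
    using assms(2) unfolding second_countable_def by auto
  show ?thesis
    unfolding second_countable_def
  proof (intro exI[of _ "(\<lambda>(V, W). V \<times> W) ` (A \<times> B)"] conjI ballI allI impI)
    show "countable ((\<lambda>(V, W). V \<times> W) ` (A \<times> B))" using A(1) B(1) by auto
    fix V assume "V \<in> (\<lambda>(V, W). V \<times> W) ` (A \<times> B)"
    then show "openin (prod_topology X Y) V" using A(2) B(2) by (auto simp: openin_prod_Times_iff)
  next
    fix U z assume U: "openin (prod_topology X Y) U \<and> z \<in> U"
    obtain x y where z: "z = (x, y)" by force
    obtain V W where VW: "openin X V" "openin Y W" "x \<in> V" "y \<in> W" "V \<times> W \<subseteq> U"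
      using U[THEN conjunct1, unfolded openin_prod_topology_alt, rule_format, of x y] U z by auto
    obtain V' W' where "V' \<in> A" "x \<in> V'" "V' \<subseteq> V" "W' \<in> B" "y \<in> W'" "W' \<subseteq> W"
      using A(3)[OF VW(1,3)] B(3)[OF VW(2,4)] by blast
    then show "\<exists>V\<in>(\<lambda>(V, W). V \<times> W) ` (A \<times> B). z \<in> V \<and> V \<subseteq> U"
      using VW(5) z by (intro bexI[of _ "V' \<times> W'"]) auto
  qed
qed

lemma sets_borel_of_euclideanreal: "sets (borel_of euclideanreal) = sets borel"
  unfolding sets_borel_of borel_def by (simp add: sets_measure_of_conv)

lemma borel_measurable_continuous_map:
  assumes "continuous_map T euclideanreal f"
  shows "f \<in> borel_measurable (borel_of T)"
  using continuous_map_measurable_borel_of[OF assms] measurable_cong_sets[OF refl sets_borel_of_euclideanreal] by blast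

lemma metric_forD:
  assumes "metric_for T d"
  shows "continuous_map (prod_topology T T) euclideanreal (\<lambda>(x, y). d x y)"
    "x \<in> topspace T \<Longrightarrow> y \<in> topspace T \<Longrightarrow> 0 \<le> d x y" "x \<in> topspace T \<Longrightarrow> d x x = 0"
    "x \<in> topspace T \<Longrightarrow> y \<in> topspace T \<Longrightarrow> d x y = d y x"
    "x \<in> topspace T \<Longrightarrow> y \<in> topspace T \<Longrightarrow> z \<in> topspace T \<Longrightarrow> d x z \<le> d x y + d y z"
    "x \<in> topspace T \<Longrightarrow> continuous_map T euclideanreal (d x)"
proof -
  interpret Metric_space "topspace T" d using assms by (simp add: metric_for_def)
  have T: "mtopology = T" using assms by (simp add: metric_for_def)
  show c: "continuous_map (prod_topology T T) euclideanreal (\<lambda>(x, y). d x y)"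
    using continuous_map_metric[of "metric (topspace T, d)"] by (simp add: T)
  show "x \<in> topspace T \<Longrightarrow> y \<in> topspace T \<Longrightarrow> 0 \<le> d x y" "x \<in> topspace T \<Longrightarrow> d x x = 0"
    "x \<in> topspace T \<Longrightarrow> y \<in> topspace T \<Longrightarrow> d x y = d y x"
    "x \<in> topspace T \<Longrightarrow> y \<in> topspace T \<Longrightarrow> z \<in> topspace T \<Longrightarrow> d x z \<le> d x y + d y z"
    using triangle commute by auto
  show "continuous_map T euclideanreal (d x)" if "x \<in> topspace T"
  proof -
    have "continuous_map T (prod_topology T T) (\<lambda>y. (x, y))"
      using that by (intro continuous_map_pairedI continuous_map_id[unfolded id_def]) auto
    from continuous_map_compose[OF this c] show ?thesis by (simp add: o_def)
  qed
qed

text \<open>Through the maximum instead of convexity, so that \<open>p \<ge> 0\<close> is enough;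
  hence \<open>2 powr p\<close> rather than \<open>2 powr (p - 1)\<close>.\<close>

lemma metric_powr_triangle:
  assumes d: "metric_for T d" and x: "x \<in> topspace T" "y \<in> topspace T" "z \<in> topspace T" and p: "0 \<le> p"
  shows "d x z powr p \<le> 2 powr p * (d y x powr p + d y z powr p)"
proof -
  note m = metric_forD[OF d]
  have 0: "0 \<le> d y x" "0 \<le> d y z" "0 \<le> d x z" using m(2) x by auto
  have "d x z \<le> d y x + d y z" using m(5)[OF x] m(4)[OF x(1,2)] by simp
  also have "\<dots> \<le> 2 * max (d y x) (d y z)" by simp
  finally have "d x z powr p \<le> (2 * max (d y x) (d y z)) powr p" using 0 p by (intro powr_mono2) auto
  also have "\<dots> = 2 powr p * (max (d y x) (d y z)) powr p" by (rule powr_mult)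
  also have "\<dots> \<le> 2 powr p * (d y x powr p + d y z powr p)" by (intro mult_left_mono) (auto simp: max_def)
  finally show ?thesis .
qed

lemma wasserstein_tendsto_zero:
  assumes p: "0 < p" and b: "b \<longlonglongrightarrow> 0" "\<And>n. 0 \<le> b n"
    and le: "\<forall>\<^sub>F n in sequentially. wasserstein_pow p X dX Y dY (\<pi> n) \<rho> \<le> ennreal (b n)"
  shows "(\<lambda>n. wasserstein p X dX Y dY (\<pi> n) \<rho>) \<longlonglongrightarrow> 0"
proof (rule tendsto_sandwich[OF _ _ tendsto_const])
  show "\<forall>\<^sub>F n in sequentially. wasserstein p X dX Y dY (\<pi> n) \<rho> \<le> ennreal (b n powr (1 / p))"
    using le
  proof eventually_elim
    case (elim n)
    let ?w = "wasserstein_pow p X dX Y dY (\<pi> n) \<rho>"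
    have "?w \<noteq> \<infinity>" using elim by (auto simp: top_unique)
    moreover have "enn2real ?w \<le> b n" using elim b(2) by (simp add: enn2real_leI)
    then have "enn2real ?w powr (1 / p) \<le> b n powr (1 / p)" using p by (intro powr_mono2) auto
    ultimately show ?case by (simp add: wasserstein_def Let_def ennreal_leI)
  qed
  have "(\<lambda>n. b n powr (1 / p)) \<longlonglongrightarrow> 0"
    using b p by (intro tendsto_zero_powrI[OF b(1) tendsto_const]) auto
  then have "(\<lambda>n. ennreal (b n powr (1 / p))) \<longlonglongrightarrow> ennreal 0" by (rule tendsto_ennrealI)
  then show "(\<lambda>n. ennreal (b n powr (1 / p))) \<longlonglongrightarrow> 0" by simp
qed auto

context path_setting
begin

text \<open>The transport cost vanishes on the diagonal, and the triangle inequality splits it into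
  weights of the two points, which is the form that \<open>maximal_coupling\<close> asks
  for.\<close>

lemma wasserstein_pow_le:
  assumes dX: "metric_for XN dX" and dY: "metric_for YN dY" and xy: "x0 \<in> topspace XN" "y0 \<in> topspace YN"
    and p: "0 < p" and r: "dens P r1" "dens P r2"
    and int: "integrable P (\<lambda>z. (dX x0 (fst z) powr p + dY y0 (snd z) powr p) * \<bar>r1 z - r2 z\<bar>)"
  shows "wasserstein_pow p XN dX YN dY (dm r1) (dm r2) \<le>
    ennreal (2 powr p * (\<integral>z. (dX x0 (fst z) powr p + dY y0 (snd z) powr p) * \<bar>r1 z - r2 z\<bar> \<partial>P))"
proof -
  let ?XY = "prod_topology XN YN"
  let ?w = "\<lambda>z. dX x0 (fst z) powr p + dY y0 (snd z) powr p"
  obtain \<theta> where \<theta>: "prob_space \<theta>" "sets \<theta> = sets (P \<Otimes>\<^sub>M P)"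
    "distr \<theta> P fst = dm r1" "distr \<theta> P snd = dm r2"
    and bound: "\<And>F a. F \<in> borel_measurable (P \<Otimes>\<^sub>M P) \<Longrightarrow> a \<in> borel_measurable P \<Longrightarrow> (\<And>z. z \<in> space P \<Longrightarrow> F (z, z) = 0) \<Longrightarrow>
      (\<And>z z'. z \<in> space P \<Longrightarrow> z' \<in> space P \<Longrightarrow> F (z, z') \<le> a z + a z') \<Longrightarrow>
      (\<integral>\<^sup>+w. F w \<partial>\<theta>) \<le> (\<integral>\<^sup>+z. a z * ennreal \<bar>r1 z - r2 z\<bar> \<partial>P)"
    using maximal_coupling[OF prob_space_axioms r] by blast
  have sc2: "second_countable ?XY" by (intro second_countable_prod_topology sc) auto
  have sPP: "sets (P \<Otimes>\<^sub>M P) = sets (borel_of (prod_topology ?XY ?XY))"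
    unfolding sets_borel_of_prod_topology[OF sc2 sc2] by (intro sets_pair_measure_cong sets_P)
  have "distr \<theta> (borel_of ?XY) fst = distr \<theta> P fst" "distr \<theta> (borel_of ?XY) snd = distr \<theta> P snd"
    by (intro distr_cong refl sets_P[symmetric])+
  then have c: "\<theta> \<in> couplings ?XY ?XY (dm r1) (dm r2)"
    unfolding couplings_def borel_probs_def using \<theta> sPP by simp
  let ?F = "\<lambda>((x, y), (x', y')). ennreal (dX x x' powr p + dY y y' powr p)"
  have cm: "(\<lambda>w. dX (fst (fst w)) (fst (snd w))) \<in> borel_measurable (borel_of (prod_topology ?XY ?XY))"
    "(\<lambda>w. dY (snd (fst w)) (snd (snd w))) \<in> borel_measurable (borel_of (prod_topology ?XY ?XY))"
  proof -
    have "continuous_map (prod_topology ?XY ?XY) (prod_topology XN XN) (\<lambda>w. (fst (fst w), fst (snd w)))"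
      "continuous_map (prod_topology ?XY ?XY) (prod_topology YN YN) (\<lambda>w. (snd (fst w), snd (snd w)))"
      by (intro continuous_map_pairedI continuous_map_compose[OF continuous_map_fst continuous_map_fst, unfolded o_def]
        continuous_map_compose[OF continuous_map_snd continuous_map_fst, unfolded o_def]
        continuous_map_compose[OF continuous_map_fst continuous_map_snd, unfolded o_def]
        continuous_map_compose[OF continuous_map_snd continuous_map_snd, unfolded o_def])+
    from continuous_map_compose[OF this(1) metric_forD(1)[OF dX]] continuous_map_compose[OF this(2) metric_forD(1)[OF dY]]
    show "(\<lambda>w. dX (fst (fst w)) (fst (snd w))) \<in> borel_measurable (borel_of (prod_topology ?XY ?XY))"
      "(\<lambda>w. dY (snd (fst w)) (snd (snd w))) \<in> borel_measurable (borel_of (prod_topology ?XY ?XY))"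
      by (auto intro!: borel_measurable_continuous_map simp: o_def)
  qed
  have Fm: "?F \<in> borel_measurable (P \<Otimes>\<^sub>M P)"
  proof -
    have [measurable]: "(\<lambda>w. dX (fst (fst w)) (fst (snd w))) \<in> borel_measurable (P \<Otimes>\<^sub>M P)"
      "(\<lambda>w. dY (snd (fst w)) (snd (snd w))) \<in> borel_measurable (P \<Otimes>\<^sub>M P)"
      using cm unfolding measurable_cong_sets[OF sPP refl] .
    have "(\<lambda>w. ennreal (dX (fst (fst w)) (fst (snd w)) powr p + dY (snd (fst w)) (snd (snd w)) powr p)) \<in> borel_measurable (P \<Otimes>\<^sub>M P)"
      by measurable
    then show ?thesis by (simp add: case_prod_beta')
  qed
  have wm[measurable]: "?w \<in> borel_measurable P"
  proof -
    have "dX x0 \<in> borel_measurable \<mu>" "dY y0 \<in> borel_measurable \<nu>"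
      using borel_measurable_continuous_map[OF metric_forD(6)[OF dX xy(1)]] borel_measurable_continuous_map[OF metric_forD(6)[OF dY xy(2)]]
      unfolding measurable_cong_sets[OF sets_\<mu> refl] measurable_cong_sets[OF sets_\<nu> refl] by auto
    then show ?thesis by measurable
  qed
  have [measurable]: "r1 \<in> borel_measurable P" "r2 \<in> borel_measurable P" using densD(4)[OF r(1)] densD(4)[OF r(2)] .
  have "wasserstein_pow p XN dX YN dY (dm r1) (dm r2) \<le> (\<integral>\<^sup>+w. ?F w \<partial>\<theta>)"
    unfolding wasserstein_pow_def by (rule INF_lower[OF c])
  also have "\<dots> \<le> (\<integral>\<^sup>+z. ennreal (2 powr p * ?w z) * ennreal \<bar>r1 z - r2 z\<bar> \<partial>P)"
  proof (rule bound[OF Fm])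
    show "(\<lambda>z. ennreal (2 powr p * ?w z)) \<in> borel_measurable P" by measurable
    show "?F (z, z) = 0" if "z \<in> space P" for z
      using that metric_forD(3)[OF dX] metric_forD(3)[OF dY] p by (auto simp: space_P)
    fix z z' assume z: "z \<in> space P" "z' \<in> space P"
    obtain x y x' y' where e: "z = (x, y)" "z' = (x', y')" by force
    have s: "x \<in> topspace XN" "x' \<in> topspace XN" "y \<in> topspace YN" "y' \<in> topspace YN" using z e by (auto simp: space_P)
    have "dX x x' powr p + dY y y' powr p \<le> 2 powr p * (dX x0 x powr p + dX x0 x' powr p) + 2 powr p * (dY y0 y powr p + dY y0 y' powr p)"
      using s xy p by (intro add_mono metric_powr_triangle[OF dX] metric_powr_triangle[OF dY]) auto
    also have "\<dots> = 2 powr p * ?w z + 2 powr p * ?w z'" by (simp add: e algebra_simps)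
    finally have "?F (z, z') \<le> ennreal (2 powr p * ?w z + 2 powr p * ?w z')" unfolding e by (simp only: prod.case fst_conv snd_conv ennreal_leI)
    also have "\<dots> = ennreal (2 powr p * ?w z) + ennreal (2 powr p * ?w z')" by (intro ennreal_plus) auto
    finally show "?F (z, z') \<le> ennreal (2 powr p * ?w z) + ennreal (2 powr p * ?w z')" .
  qed
  also have "\<dots> = (\<integral>\<^sup>+z. ennreal (2 powr p * (?w z * \<bar>r1 z - r2 z\<bar>)) \<partial>P)"
    by (intro nn_integral_cong) (simp add: ennreal_mult'[symmetric] mult.assoc)
  also have "\<dots> = ennreal (\<integral>z. 2 powr p * (?w z * \<bar>r1 z - r2 z\<bar>) \<partial>P)"
    using int by (intro nn_integral_eq_integral) auto
  finally show ?thesis by simp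
qed

end

section \<open>Entropic cost of densities\<close>

lemma ext_integral_integrable:
  assumes "integrable M f"
  shows "ext_integral M f = ereal (\<integral>x. f x \<partial>M)"
proof -
  have "(\<integral>\<^sup>+x. ennreal (f x) \<partial>M) \<noteq> \<infinity>" "(\<integral>\<^sup>+x. ennreal (- f x) \<partial>M) \<noteq> \<infinity>"
    using assms by (auto simp: real_integrable_def)
  moreover have "enn2ereal a = ereal (enn2real a)" if "a \<noteq> \<infinity>" for a :: ennreal
    using that by (cases a) (simp_all add: enn2ereal_ennreal)
  ultimately show ?thesis
    unfolding ext_integral_def real_lebesgue_integral_def[OF assms] by simp
qed

context path_setting
begin

lemma causal_couplings_iff:
  assumes N: "0 < N" and r: "dens P r"
  shows "dm r \<in> causal_couplings N X Y \<mu> \<nu> \<longleftrightarrow> causal_dens r \<and> (AE z in P. real_cond_exp P (hist N X Y 0 N) r z = 1)"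
proof -
  have "dm r \<in> causal_couplings N X Y \<mu> \<nu> \<longleftrightarrow> dm r \<in> causal_couplings_fst N X Y \<mu> \<and> distr (dm r) (borel_of YN) snd = \<nu>"
    using \<nu> unfolding causal_couplings_fst_def causal_couplings_def couplings_def by blast
  then show ?thesis unfolding causal_iff[OF r N] marginal_iff_Y[OF r] .
qed

lemma integrable_proj_P:
  fixes h :: "_ \<Rightarrow> real" and k :: "_ \<Rightarrow> real"
  shows "integrable \<mu> h \<Longrightarrow> integrable P (\<lambda>z. h (fst z))" "integrable \<nu> k \<Longrightarrow> integrable P (\<lambda>z. k (snd z))"
  using integrable_distr[OF measurable_proj(1), of h] integrable_distr[OF measurable_proj(2), of k] by (simp_all add: distr_P)

end

text \<open>The metrics enter only as weights: \<open>u\<close> depends on \<open>x\<close> alone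
  and \<open>w\<close> on \<open>y\<close> alone, as their measurability expresses.\<close>

locale entropic_setting = path_setting N X Y \<mu> \<nu>
  for N :: nat and X :: "nat \<Rightarrow> 'a topology" and Y :: "nat \<Rightarrow> 'b topology" and \<mu> \<nu> +
  fixes c u w :: "(nat \<Rightarrow> 'a) \<times> (nat \<Rightarrow> 'b) \<Rightarrow> real" and C :: real
  assumes N0: "0 < N"
    and c_meas [measurable]: "c \<in> borel_measurable P"
    and u: "u \<in> borel_measurable (hist N X Y N 0)" "\<And>z. 0 \<le> u z" "integrable P u"
    and w: "w \<in> borel_measurable (hist N X Y 0 N)" "\<And>z. 0 \<le> w z" "integrable P w"
    and C0: "0 \<le> C" and growth: "\<And>z. z \<in> space P \<Longrightarrow> \<bar>c z\<bar> \<le> C * (1 + u z + w z)"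
    and exp_c: "integrable P (\<lambda>z. exp (- c z))"
begin

lemma u_meas [measurable]: "u \<in> borel_measurable P" and w_meas [measurable]: "w \<in> borel_measurable P"
  using u(3) w(3) by auto

definition Z :: real where "Z = (\<integral>z. exp (- c z) \<partial>P)"

definition R0 :: "(nat \<Rightarrow> 'a) \<times> (nat \<Rightarrow> 'b) \<Rightarrow> real" where "R0 z = exp (- c z) / Z"

lemma Z_pos: "0 < Z"
proof -
  have "Z \<noteq> 0"
  proof
    assume "Z = 0"
    then have "AE z in P. exp (- c z) = 0"
      using integral_nonneg_eq_0_iff_AE[OF exp_c] by (simp add: Z_def)
    then have "AE z in P. False" by simp
    then show False using AE_False by simp
  qed
  moreover have "0 \<le> Z" unfolding Z_def by (intro integral_nonneg_AE) auto
  ultimately show ?thesis by simp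
qed

lemma R0_pos: "0 < R0 z" using Z_pos by (simp add: R0_def)

lemma dens_R0: "dens P R0"
  unfolding dens_def R0_def[abs_def] using exp_c Z_pos by (auto simp: Z_def less_imp_le)

lemma gibbs_eq: "gibbs P c = dm R0" by (simp add: gibbs_def R0_def Z_def)

lemma ln_R0: "ln (R0 z) = - c z - ln Z" using Z_pos by (simp add: R0_def ln_div)

lemma c_integrable_mult:
  assumes r: "r \<in> borel_measurable P" "\<And>z. 0 \<le> r z" "integrable P r" "integrable P (\<lambda>z. u z * r z)" "integrable P (\<lambda>z. w z * r z)"
  shows "integrable P (\<lambda>z. r z * c z)"
proof (rule Bochner_Integration.integrable_bound)
  show "integrable P (\<lambda>z. C * (r z + u z * r z + w z * r z))" using r by auto
  show "(\<lambda>z. r z * c z) \<in> borel_measurable P" using r(1) by simp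
  show "AE z in P. norm (r z * c z) \<le> norm (C * (r z + u z * r z + w z * r z))"
  proof (rule AE_I2)
    fix z assume "z \<in> space P"
    then have "r z * \<bar>c z\<bar> \<le> r z * (C * (1 + u z + w z))" using r(2) growth by (intro mult_left_mono) auto
    also have "\<dots> = C * (r z + u z * r z + w z * r z)" by (simp add: algebra_simps)
    finally have "\<bar>r z * c z\<bar> \<le> C * (r z + u z * r z + w z * r z)" using r(2)[of z] by (simp add: abs_mult)
    then show "norm (r z * c z) \<le> norm (C * (r z + u z * r z + w z * r z))" by simp
  qed
qed

lemma c_integrable: "integrable P c"
  using c_integrable_mult[of "\<lambda>_. 1"] u(3) w(3) by simp

lemma c_integrable_causal:
  assumes r: "causal_dens r" "AE z in P. real_cond_exp P (hist N X Y 0 N) r z = 1"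
  shows "integrable P (\<lambda>z. r z * c z)"
proof (rule c_integrable_mult)
  note d = causal_dens_dens[OF r(1)]
  show "r \<in> borel_measurable P" "\<And>z. 0 \<le> r z" "integrable P r" using densD[OF d] by auto
  show "integrable P (\<lambda>z. u z * r z)" using causal_fst_law(1)[OF N0 r(1) u(1)] u(3) by simp
  have "marginal r (\<lambda>_. 1)" using d r(2) by (intro marginalI) auto
  then show "integrable P (\<lambda>z. w z * r z)" using marginalD(1)[OF _ w(1)] w(3) by simp
qed

lemma kl_integrable_one_R0: "kl_integrable P (\<lambda>_. 1) R0"
proof -
  have "1 * ln (1 / R0 z) = c z + ln Z" for z using R0_pos[of z] ln_R0[of z] by (simp add: ln_div)
  then show ?thesis unfolding kl_integrable_def using c_integrable by simp
qed

text \<open>\<open>R0\<close> is proportional to \<open>exp (- c)\<close>, so entropy relative to it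
  is the entropic cost plus the constant \<open>ln Z\<close>, and minimisers agree. Integrability of
  the cost excludes differences of infinities.\<close>

lemma entropy_R0:
  assumes r: "dens P r" and i: "integrable P (\<lambda>z. r z * c z)"
  shows "kl_integrable P r R0 \<longleftrightarrow> kl_integrable P r (\<lambda>_. 1)"
    "kl_integrable P r (\<lambda>_. 1) \<Longrightarrow> KL P r R0 = KL P r (\<lambda>_. 1) + (\<integral>z. r z * c z \<partial>P) + ln Z"
proof -
  have e: "r z * ln (r z / R0 z) = r z * ln (r z / 1) + (r z * c z + ln Z * r z)" for z
  proof (cases "r z = 0")
    case False
    then have "0 < r z" using densD(1)[OF r, of z] by simp
    then have "ln (r z / R0 z) = ln (r z) - (- c z - ln Z)" using R0_pos[of z] by (simp add: ln_div flip: ln_R0)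
    then show ?thesis by (simp add: algebra_simps)
  qed simp
  have i2: "integrable P (\<lambda>z. r z * c z + ln Z * r z)" using i densD(2)[OF r] by auto
  show "kl_integrable P r R0 \<longleftrightarrow> kl_integrable P r (\<lambda>_. 1)"
  proof
    assume "kl_integrable P r R0"
    then have "integrable P (\<lambda>z. r z * ln (r z / R0 z) - (r z * c z + ln Z * r z))"
      unfolding kl_integrable_def using i2 by (rule Bochner_Integration.integrable_diff)
    then show "kl_integrable P r (\<lambda>_. 1)" unfolding kl_integrable_def e by simp
  next
    assume "kl_integrable P r (\<lambda>_. 1)"
    then show "kl_integrable P r R0"
      unfolding kl_integrable_def e using i2 by (rule Bochner_Integration.integrable_add)
  qed
  assume "kl_integrable P r (\<lambda>_. 1)"
  then show "KL P r R0 = KL P r (\<lambda>_. 1) + (\<integral>z. r z * c z \<partial>P) + ln Z"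
    unfolding kl_integrable_def KL_def e using i densD(2,3)[OF r] by simp
qed

lemma entropic_cost_dm:
  assumes r: "dens P r" and i: "integrable P (\<lambda>z. r z * c z)"
  shows "entropic_cost \<mu> \<nu> c (dm r) = ereal (\<integral>z. r z * c z \<partial>P) + enn2ereal (kl P r (\<lambda>_. 1))"
proof -
  have rm: "r \<in> borel_measurable P" and nn: "AE z in P. 0 \<le> r z" using densD[OF r] by auto
  have "integrable (dm r) c" using integrable_real_density[OF rm nn c_meas] i by simp
  then have "ext_integral (dm r) c = ereal (\<integral>z. c z \<partial>dm r)" by (rule ext_integral_integrable)
  also have "(\<integral>z. c z \<partial>dm r) = (\<integral>z. r z * c z \<partial>P)" using integral_real_density[OF rm nn c_meas] by simp
  moreover have "D_KL (dm r) P = enn2ereal (kl P r (\<lambda>_. 1))"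
    using D_KL_density[OF prob_space_axioms r dens_one] dm_one by simp
  ultimately show ?thesis unfolding entropic_cost_def by simp
qed

lemma optimizer_density:
  assumes opt: "E_c_optimizer N X Y \<mu> \<nu> c \<pi>"
  obtains rs where "\<pi> = dm rs" "causal_dens rs" "AE z in P. real_cond_exp P (hist N X Y 0 N) rs z = 1"
    "kl_integrable P rs R0"
    "\<And>r. causal_dens r \<Longrightarrow> AE z in P. real_cond_exp P (hist N X Y 0 N) r z = 1 \<Longrightarrow> kl P rs R0 \<le> kl P r R0"
proof -
  have \<pi>: "\<pi> \<in> causal_couplings N X Y \<mu> \<nu>" and min: "\<And>\<rho>. \<rho> \<in> causal_couplings N X Y \<mu> \<nu> \<Longrightarrow> entropic_cost \<mu> \<nu> c \<pi> \<le> entropic_cost \<mu> \<nu> c \<rho>"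
    using opt unfolding E_c_optimizer_def E_c_def by (auto intro: INF_lower)
  have cost: "entropic_cost \<mu> \<nu> c \<pi> \<le> ereal (\<integral>z. r z * c z \<partial>P) + enn2ereal (kl P r (\<lambda>_. 1))"
    if r: "causal_dens r" "AE z in P. real_cond_exp P (hist N X Y 0 N) r z = 1" for r
  proof -
    note d = causal_dens_dens[OF r(1)]
    have "dm r \<in> causal_couplings N X Y \<mu> \<nu>" using causal_couplings_iff[OF N0 d] r by simp
    from min[OF this] show ?thesis unfolding entropic_cost_dm[OF d c_integrable_causal[OF r]] .
  qed
  \<comment> \<open>The product coupling has finite cost, so the optimizer has finite entropy and
    therefore a density.\<close>
  have one: "AE z in P. real_cond_exp P (hist N X Y 0 N) (\<lambda>_. 1) z = 1"
    using sigma_finite_subalgebra.real_cond_exp_F_meas[OF sf[of 0 N], of "\<lambda>_. 1"] by simp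
  have "kl P (\<lambda>_. 1) (\<lambda>_. 1) = 0" by (simp add: kl_def kl_fun_def)
  then have "entropic_cost \<mu> \<nu> c \<pi> \<le> ereal (\<integral>z. c z \<partial>P)" using cost[OF causal_dens_one one] by (simp add: zero_ennreal.rep_eq)
  then have fin: "D_KL \<pi> P < \<infinity>" unfolding entropic_cost_def by (cases "D_KL \<pi> P") auto
  have "prob_space \<pi>" "sets \<pi> = sets P" using \<pi> unfolding causal_couplings_def couplings_def borel_probs_def sets_P by auto
  then obtain rs where rs: "dens P rs" "\<pi> = dm rs"
    using D_KL_imp_density[OF prob_space_axioms dens_one, of \<pi>] fin unfolding dm_one by auto
  have rc: "causal_dens rs" "AE z in P. real_cond_exp P (hist N X Y 0 N) rs z = 1"
    using \<pi> unfolding rs(2) causal_couplings_iff[OF N0 rs(1)] by auto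
  note ic = c_integrable_causal[OF rc]
  have "kl P rs (\<lambda>_. 1) < \<infinity>"
    using fin D_KL_density[OF prob_space_axioms rs(1) dens_one] unfolding dm_one rs(2)
    by (auto simp: less_top)
  then have k1: "kl_integrable P rs (\<lambda>_. 1)" using kl_less_top_iff[OF rs(1) dens_one] by simp
  then have kR: "kl_integrable P rs R0" using entropy_R0(1)[OF rs(1) ic] by simp
  show thesis
  proof (rule that[OF rs(2) rc kR])
    fix r assume r: "causal_dens r" "AE z in P. real_cond_exp P (hist N X Y 0 N) r z = 1"
    note d = causal_dens_dens[OF r(1)] and ir = c_integrable_causal[OF r]
    show "kl P rs R0 \<le> kl P r R0"
    proof (cases "kl_integrable P r R0")
      case False
      then have "kl P r R0 = \<infinity>" using kl_less_top_iff[OF d dens_R0 R0_pos] by (simp add: less_top[symmetric])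
      then show ?thesis by simp
    next
      case True
      then have kr: "kl_integrable P r (\<lambda>_. 1)" using entropy_R0(1)[OF d ir] by simp
      have e: "enn2ereal (kl P q (\<lambda>_. 1)) = ereal (KL P q (\<lambda>_. 1))" if "dens P q" "kl_integrable P q (\<lambda>_. 1)" for q
        using kl_fun_integral(3,4)[OF that(1) dens_one _ that(2)] by (simp add: enn2ereal_ennreal)
      have "ereal (\<integral>z. rs z * c z \<partial>P) + ereal (KL P rs (\<lambda>_. 1)) \<le> ereal (\<integral>z. r z * c z \<partial>P) + ereal (KL P r (\<lambda>_. 1))"
        using cost[OF r] unfolding rs(2) entropic_cost_dm[OF rs(1) ic] e[OF d kr] e[OF rs(1) k1] .
      then have "KL P rs R0 \<le> KL P r R0"
        unfolding entropy_R0(2)[OF rs(1) ic k1] entropy_R0(2)[OF d ir kr] by simp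
      then show ?thesis
        unfolding kl_fun_integral(3)[OF rs(1) dens_R0 R0_pos kR] kl_fun_integral(3)[OF d dens_R0 R0_pos True]
        by (rule ennreal_leI)
    qed
  qed
qed

text \<open>Growth bound for \<open>- ln R0 = c + ln Z\<close> with \<open>u\<close> replaced by its
  mean. \<open>U_bound\<close> uses it only after integration against functions of \<open>y\<close>,
  which do not see the difference.\<close>

definition U :: "(nat \<Rightarrow> 'a) \<times> (nat \<Rightarrow> 'b) \<Rightarrow> real" where
  "U z = C * (1 + (\<integral>z. u z \<partial>P) + w z) + \<bar>ln Z\<bar>"

lemma U_meas: "U \<in> borel_measurable (hist N X Y 0 N)" unfolding U_def using w(1) by simp

lemma U_nonneg: "0 \<le> U z"
  unfolding U_def using C0 w(2)[of z] u(2) by (intro add_nonneg_nonneg mult_nonneg_nonneg integral_nonneg_AE) auto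

text \<open>Dividing by \<open>C + 1\<close> reduces the coefficient of \<open>w\<close> to at most
  \<beta>, also for \<open>C = 0\<close>.\<close>

lemma U_exp:
  assumes \<beta>: "0 < \<beta>" "integrable P (\<lambda>z. exp (\<beta> * w z))"
  shows "integrable P (\<lambda>z. exp (\<beta> / (C + 1) * U z))"
proof (rule Bochner_Integration.integrable_bound)
  let ?K = "exp (\<beta> / (C + 1) * (C * (1 + (\<integral>z. u z \<partial>P)) + \<bar>ln Z\<bar>))"
  show "integrable P (\<lambda>z. ?K * exp (\<beta> * w z))" using \<beta> by simp
  show "(\<lambda>z. exp (\<beta> / (C + 1) * U z)) \<in> borel_measurable P"
    unfolding U_def by measurable
  show "AE z in P. norm (exp (\<beta> / (C + 1) * U z)) \<le> norm (?K * exp (\<beta> * w z))"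
  proof (rule AE_I2)
    fix z
    have "\<beta> * w z * (C / (C + 1)) \<le> \<beta> * w z * 1" using C0 \<beta>(1) w(2)[of z] by (intro mult_left_mono) auto
    then have "\<beta> / (C + 1) * U z \<le> \<beta> / (C + 1) * (C * (1 + (\<integral>z. u z \<partial>P)) + \<bar>ln Z\<bar>) + \<beta> * w z"
      using C0 by (simp add: U_def field_simps)
    then show "norm (exp (\<beta> / (C + 1) * U z)) \<le> norm (?K * exp (\<beta> * w z))" by (simp flip: exp_add)
  qed
qed

lemma U_bound:
  assumes g: "g \<in> borel_measurable (hist N X Y 0 N)" "\<And>z. 0 \<le> g z" "\<And>z. g z \<le> K"
  shows "integrable P (\<lambda>z. g z * ln (R0 z))" "- (\<integral>z. g z * ln (R0 z) \<partial>P) \<le> (\<integral>z. U z * g z \<partial>P)"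
proof -
  have gm[measurable]: "g \<in> borel_measurable P" using g(1) meas_F[of 0 N] by auto
  have bd: "integrable P (\<lambda>z. h z * g z)" if "integrable P h" for h
    using integrable_bounded_mult[OF that gm, of K] g(2,3) by (auto simp: mult.commute)
  note ig = bd[of "\<lambda>_. 1", simplified] and iu = bd[OF u(3)] and iw = bd[OF w(3)]
  have ic: "integrable P (\<lambda>z. g z * c z)" using gm g(2) ig iu iw by (rule c_integrable_mult)
  have e: "g z * ln (R0 z) = - (g z * c z + ln Z * g z)" for z by (simp add: ln_R0 algebra_simps)
  show "integrable P (\<lambda>z. g z * ln (R0 z))" unfolding e using ic ig by auto
  \<comment> \<open>Independence of \<open>u\<close> and \<open>g\<close>, read off from
    \<open>causal_fst_law\<close> for the normalised \<open>g\<close>.\<close>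
  have gu: "(\<integral>z. u z * g z \<partial>P) = (\<integral>z. u z \<partial>P) * (\<integral>z. g z \<partial>P)"
  proof (cases "(\<integral>z. g z \<partial>P) = 0")
    case True
    then have "AE z in P. g z = 0" using integral_nonneg_eq_0_iff_AE[OF ig] g(2) by simp
    then have "(\<integral>z. u z * g z \<partial>P) = (\<integral>z. 0 \<partial>P)" by (intro integral_cong_AE) auto
    then show ?thesis using True by simp
  next
    case False
    let ?m = "\<integral>z. g z \<partial>P"
    have m: "0 < ?m" using False g(2) by (simp add: less_le)
    have "dens P (\<lambda>z. g z / ?m)" unfolding dens_def using g(2) ig m by auto
    then have "causal_dens (\<lambda>z. g z / ?m)" by (rule causal_dens_snd) (use g(1) in simp)
    from causal_fst_law(2)[OF N0 this u(1)] have "(\<integral>z. u z * g z / ?m \<partial>P) = (\<integral>z. u z \<partial>P)" by simp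
    then show ?thesis using m by (simp add: field_simps)
  qed
  have "- (\<integral>z. g z * ln (R0 z) \<partial>P) = (\<integral>z. g z * c z + ln Z * g z \<partial>P)" unfolding e by (simp only: Bochner_Integration.integral_minus minus_minus)
  also have "\<dots> \<le> (\<integral>z. C * g z + C * (u z * g z) + C * (w z * g z) + \<bar>ln Z\<bar> * g z \<partial>P)"
  proof (rule integral_mono)
    show "integrable P (\<lambda>z. g z * c z + ln Z * g z)" "integrable P (\<lambda>z. C * g z + C * (u z * g z) + C * (w z * g z) + \<bar>ln Z\<bar> * g z)"
      using ic ig iu iw by auto
    fix z assume "z \<in> space P"
    then have "c z \<le> C * (1 + u z + w z)" using growth[of z] by simp
    then have "g z * c z \<le> g z * (C * (1 + u z + w z))" using g(2) by (intro mult_left_mono)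
    moreover have "ln Z * g z \<le> \<bar>ln Z\<bar> * g z" using g(2) by (intro mult_right_mono) auto
    ultimately show "g z * c z + ln Z * g z \<le> C * g z + C * (u z * g z) + C * (w z * g z) + \<bar>ln Z\<bar> * g z"
      by (simp add: algebra_simps)
  qed
  also have "\<dots> = C * (\<integral>z. g z \<partial>P) + C * ((\<integral>z. u z \<partial>P) * (\<integral>z. g z \<partial>P)) + C * (\<integral>z. w z * g z \<partial>P) + \<bar>ln Z\<bar> * (\<integral>z. g z \<partial>P)"
    using ig iu iw by (simp add: gu)
  also have "\<dots> = (\<integral>z. (C * (1 + (\<integral>z. u z \<partial>P)) + \<bar>ln Z\<bar>) * g z + C * (w z * g z) \<partial>P)"
    using ig iw by (simp add: algebra_simps)
  also have "\<dots> = (\<integral>z. U z * g z \<partial>P)"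
    by (intro Bochner_Integration.integral_cong) (auto simp: U_def algebra_simps)
  finally show "- (\<integral>z. g z * ln (R0 z) \<partial>P) \<le> (\<integral>z. U z * g z \<partial>P)" .
qed

lemma sinkhorn_convergence:
  assumes opt: "E_c_optimizer N X Y \<mu> \<nu> c \<pi>opt" and sk: "causal_sinkhorn N X Y \<mu> \<nu> c \<pi> \<pi>h"
    and \<beta>: "0 < \<beta>" "integrable P (\<lambda>z. exp (\<beta> * w z))"
  obtains R Rh rs where "\<pi>opt = dm rs" "dens P rs" "\<And>n. \<pi> n = dm (R n)" "\<And>n. dens P (R n)"
    "\<And>n. \<pi>h n = dm (Rh n)" "\<And>n. dens P (Rh n)"
    "\<forall>\<^sub>F n in sequentially. integrable P (\<lambda>x. (u x + w x) * \<bar>Rh n x - rs x\<bar>)"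
    "(\<lambda>n. \<integral>x. (u x + w x) * \<bar>Rh n x - rs x\<bar> \<partial>P) \<longlonglongrightarrow> 0"
    "\<And>\<gamma>. 0 < \<gamma> \<Longrightarrow> integrable P (\<lambda>z. exp (\<gamma> * u z)) \<Longrightarrow>
      (\<forall>\<^sub>F n in sequentially. integrable P (\<lambda>x. (u x + w x) * \<bar>R n x - rs x\<bar>)) \<and>
      (\<lambda>n. \<integral>x. (u x + w x) * \<bar>R n x - rs x\<bar> \<partial>P) \<longlonglongrightarrow> 0"
proof -
  obtain rs where rs: "\<pi>opt = dm rs" "causal_dens rs" "AE z in P. real_cond_exp P (hist N X Y 0 N) rs z = 1"
    "kl_integrable P rs R0"
    "\<And>r. causal_dens r \<Longrightarrow> AE z in P. real_cond_exp P (hist N X Y 0 N) r z = 1 \<Longrightarrow> kl P rs R0 \<le> kl P r R0"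
    by (rule optimizer_density[OF opt]) (erule (3) that, simp)
  have sk': "\<pi> 0 = dm R0" "\<And>k. is_arg_min (\<lambda>\<rho>. D_KL \<rho> (\<pi> k)) (\<lambda>\<rho>. \<rho> \<in> causal_couplings_fst N X Y \<mu>) (\<pi>h k)"
    "\<And>k. is_arg_min (\<lambda>\<rho>. D_KL \<rho> (\<pi>h k)) (\<lambda>\<rho>. \<rho> \<in> couplings_snd XN YN \<nu>) (\<pi> (Suc k))"
    using sk unfolding causal_sinkhorn_def gibbs_eq by auto
  obtain R Rh f where R: "R 0 = R0" "\<And>n. dens P (R n)" "\<And>n z. 0 < R n z" "\<And>n. \<pi> n = dm (R n)"
    "\<And>n. causal_dens (Rh n)" "\<And>n z. 0 < Rh n z" "\<And>n. \<pi>h n = dm (Rh n)"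
    "\<And>n r. causal_dens r \<Longrightarrow> kl P (Rh n) (R n) \<le> kl P r (R n)"
    "\<And>n. f n \<in> borel_measurable (hist N X Y 0 N)" "\<And>n z. 0 < f n z"
    "\<And>n. AE z in P. real_cond_exp P (hist N X Y 0 N) (Rh n) z = f n z"
    "\<And>n. AE z in P. R (Suc n) z = Rh n z / f n z"
    by (rule sinkhorn_densities[OF N0 dens_R0 R0_pos kl_integrable_one_R0 sk']) (rule that; simp)
  interpret S: causal_sinkhorn_dens P N "hist N X Y" R Rh f rs U "\<beta> / (C + 1)"
  proof unfold_locales
    show "0 < \<beta> / (C + 1)" using \<beta>(1) C0 by simp
    show "integrable P (\<lambda>x. exp (\<beta> / (C + 1) * U x))" by (rule U_exp[OF \<beta>])
    show "integrable P (\<lambda>x. g x * ln (R 0 x))" "- (\<integral>x. g x * ln (R 0 x) \<partial>P) \<le> (\<integral>x. U x * g x \<partial>P)"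
      if "g \<in> borel_measurable (hist N X Y 0 N)" "\<And>x. 0 \<le> g x" "\<And>x. g x \<le> K" for g K
      unfolding R(1) by (rule U_bound[OF that])+
  qed (use R rs U_meas U_nonneg kl_integrable_one_R0 in \<open>simp_all add: R(1)\<close>)
  show thesis
  proof (rule that[OF rs(1) causal_dens_dens[OF rs(2)] R(4,2,7) causal_dens_dens[OF R(5)]
      S.Rh_weighted[OF N0 u w \<beta>]])
    fix \<gamma> :: real assume "0 < \<gamma>" "integrable P (\<lambda>z. exp (\<gamma> * u z))"
    from S.R_weighted[OF N0 u w this] show "(\<forall>\<^sub>F n in sequentially. integrable P (\<lambda>x. (u x + w x) * \<bar>R n x - rs x\<bar>)) \<and>
      (\<lambda>n. \<integral>x. (u x + w x) * \<bar>R n x - rs x\<bar> \<partial>P) \<longlonglongrightarrow> 0" by blast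
  qed
qed

end

section \<open>Change of base point in moments\<close>

lemma metric_powr_measurable:
  assumes "metric_for T d" "x \<in> topspace T" "sets M = sets (borel_of T)"
  shows "(\<lambda>z. d x z powr p) \<in> borel_measurable M"
proof -
  have [measurable]: "d x \<in> borel_measurable M"
    using borel_measurable_continuous_map[OF metric_forD(6)[OF assms(1,2)]] measurable_cong_sets[OF assms(3) refl] by blast
  show ?thesis by measurable
qed

text \<open>The base points of the moments and of the growth condition may differ; the change costs
  the factor \<open>2 powr p\<close> and a constant.\<close>

lemma moment_change_base:
  assumes d: "metric_for T d" and M: "M \<in> borel_probs_p p T d" and x: "x \<in> topspace T" and p: "0 \<le> p"
  shows "integrable M (\<lambda>z. d x z powr p)"
proof -
  obtain y where y: "y \<in> topspace T" and fin: "(\<integral>\<^sup>+z. ennreal (d y z powr p) \<partial>M) < \<infinity>"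
    using M unfolding borel_probs_p_def by auto
  interpret prob_space M using M by (simp add: borel_probs_p_def borel_probs_def)
  have s: "sets M = sets (borel_of T)" using M by (simp add: borel_probs_p_def borel_probs_def)
  note m = metric_powr_measurable[OF d _ s]
  have "integrable M (\<lambda>z. d y z powr p)" using fin m[OF y] by (intro integrableI_nonneg) auto
  then have "integrable M (\<lambda>z. 2 powr p * (d y x powr p + d y z powr p))" by auto
  then show ?thesis
  proof (rule Bochner_Integration.integrable_bound[OF _ m[OF x]])
    show "AE z in M. norm (d x z powr p) \<le> norm (2 powr p * (d y x powr p + d y z powr p))"
      using metric_powr_triangle[OF d x y _ p] sets_eq_imp_space_eq[OF s] by (intro AE_I2) auto
  qed
qed

lemma exp_moment_change_base:
  assumes d: "metric_for T d" and M: "M \<in> borel_probs T" and e: "finite_exp_moments p T d M"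
    and x: "x \<in> topspace T" and p: "0 \<le> p"
  obtains \<beta> where "0 < \<beta>" "integrable M (\<lambda>z. exp (\<beta> * d x z powr p))"
proof -
  obtain \<alpha> y where \<alpha>: "0 < \<alpha>" and y: "y \<in> topspace T" and fin: "(\<integral>\<^sup>+z. ennreal (exp (\<alpha> * d y z powr p)) \<partial>M) < \<infinity>"
    using e unfolding finite_exp_moments_def by auto
  have s: "sets M = sets (borel_of T)" using M by (simp add: borel_probs_def)
  note m = metric_powr_measurable[OF d _ s, where p=p]
  have [measurable]: "(\<lambda>z. d x z powr p) \<in> borel_measurable M" "(\<lambda>z. d y z powr p) \<in> borel_measurable M"
    using m[OF x] m[OF y] .
  \<comment> \<open>The factor \<open>2 powr p\<close> of the triangle inequality is taken out of
    the exponent.\<close>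
  define \<beta> where "\<beta> = \<alpha> / 2 powr p"
  have "integrable M (\<lambda>z. exp (\<alpha> * d y z powr p))" using fin by (intro integrableI_nonneg) auto
  then have i: "integrable M (\<lambda>z. exp (\<alpha> * d y x powr p) * exp (\<alpha> * d y z powr p))" by auto
  have "integrable M (\<lambda>z. exp (\<beta> * d x z powr p))"
  proof (rule Bochner_Integration.integrable_bound[OF i])
    show "AE z in M. norm (exp (\<beta> * d x z powr p)) \<le> norm (exp (\<alpha> * d y x powr p) * exp (\<alpha> * d y z powr p))"
    proof (rule AE_I2)
      fix z assume "z \<in> space M"
      then have z: "z \<in> topspace T" using sets_eq_imp_space_eq[OF s] by simp
      have "\<beta> * d x z powr p \<le> \<beta> * (2 powr p * (d y x powr p + d y z powr p))"
        using \<alpha> by (intro mult_left_mono metric_powr_triangle[OF d x y z p]) (simp add: \<beta>_def)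
      also have "\<dots> = \<alpha> * d y x powr p + \<alpha> * d y z powr p" by (simp add: \<beta>_def distrib_left)
      finally show "norm (exp (\<beta> * d x z powr p)) \<le> norm (exp (\<alpha> * d y x powr p) * exp (\<alpha> * d y z powr p))"
        by (simp flip: exp_add)
    qed
  qed measurable
  moreover have "0 < \<beta>" using \<alpha> by (simp add: \<beta>_def)
  ultimately show thesis using that by blast
qed

lemma growth_at_mostE:
  assumes g: "growth_at_most p S dX T dY c"
  obtains x0 y0 C where "x0 \<in> topspace S" "y0 \<in> topspace T" "0 \<le> C"
    "\<And>x y. x \<in> topspace S \<Longrightarrow> y \<in> topspace T \<Longrightarrow> \<bar>c (x, y)\<bar> \<le> C * (1 + dX x0 x powr p + dY y0 y powr p)"
proof -
  obtain x0 y0 C where xy: "x0 \<in> topspace S" "y0 \<in> topspace T"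
    and C: "\<And>x y. x \<in> topspace S \<Longrightarrow> y \<in> topspace T \<Longrightarrow> \<bar>c (x, y) / (1 + dX x0 x powr p + dY y0 y powr p)\<bar> \<le> C"
    using g unfolding growth_at_most_def by blast
  have "0 \<le> C" using C[OF xy] by linarith
  moreover have "\<bar>c (x, y)\<bar> \<le> C * (1 + dX x0 x powr p + dY y0 y powr p)" if "x \<in> topspace S" "y \<in> topspace T" for x y
  proof -
    have "0 < 1 + dX x0 x powr p + dY y0 y powr p" by (intro add_pos_nonneg) auto
    then show ?thesis using C[OF that] by (simp add: abs_divide pos_divide_le_eq)
  qed
  ultimately show thesis using that xy by blast
qed

theorem proposition6p5:
  fixes N :: nat and p :: real
    and X :: "nat \<Rightarrow> 'a topology" and Y :: "nat \<Rightarrow> 'b topology"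
    and dX :: "(nat \<Rightarrow> 'a) \<Rightarrow> (nat \<Rightarrow> 'a) \<Rightarrow> real"
    and dY :: "(nat \<Rightarrow> 'b) \<Rightarrow> (nat \<Rightarrow> 'b) \<Rightarrow> real"
    and \<mu> :: "(nat \<Rightarrow> 'a) measure" and \<nu> :: "(nat \<Rightarrow> 'b) measure"
    and c :: "(nat \<Rightarrow> 'a) \<times> (nat \<Rightarrow> 'b) \<Rightarrow> real"
    and \<pi>opt :: "((nat \<Rightarrow> 'a) \<times> (nat \<Rightarrow> 'b)) measure"
    and \<pi> \<pi>h :: "nat \<Rightarrow> ((nat \<Rightarrow> 'a) \<times> (nat \<Rightarrow> 'b)) measure"
  assumes "N \<ge> 1"
    and "\<And>t. t \<in> {1..N} \<Longrightarrow> polish_topology (X t)"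
    and "\<And>t. t \<in> {1..N} \<Longrightarrow> polish_topology (Y t)"
    and "metric_for (path_space N X) dX"
    and "metric_for (path_space N Y) dY"
    and "p \<ge> 1"
    and "\<mu> \<in> borel_probs_p p (path_space N X) dX"
    and "\<nu> \<in> borel_probs_p p (path_space N Y) dY"
    and "continuous_map (prod_topology (path_space N X) (path_space N Y)) euclideanreal c"
    and "growth_at_most p (path_space N X) dX (path_space N Y) dY c"
    and "integrable (\<mu> \<Otimes>\<^sub>M \<nu>) (\<lambda>z. exp (- c z))"
    and "E_c_optimizer N X Y \<mu> \<nu> c \<pi>opt"
    and "causal_sinkhorn N X Y \<mu> \<nu> c \<pi> \<pi>h"
  shows "(finite_exp_moments p (path_space N Y) dY \<nu> \<longrightarrow>
            (\<lambda>k. wasserstein p (path_space N X) dX (path_space N Y) dY (\<pi>h k) \<pi>opt) \<longlonglongrightarrow> 0) \<and>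
         (finite_exp_moments p (path_space N Y) dY \<nu> \<and>
          finite_exp_moments p (path_space N X) dX \<mu> \<longrightarrow>
            (\<lambda>k. wasserstein p (path_space N X) dX (path_space N Y) dY (\<pi> k) \<pi>opt) \<longlonglongrightarrow> 0)"
proof -
  note dX = assms(4) and dY = assms(5)
  have p: "0 < p" "0 \<le> p" using assms(6) by auto
  interpret path_setting N X Y \<mu> \<nu>
    using assms(2,3,7,8) by unfold_locales (auto simp: borel_probs_p_def)
  obtain x0 y0 C where x0: "x0 \<in> topspace XN" and y0: "y0 \<in> topspace YN" and C: "0 \<le> C"
    and bd: "\<And>x y. x \<in> topspace XN \<Longrightarrow> y \<in> topspace YN \<Longrightarrow> \<bar>c (x, y)\<bar> \<le> C * (1 + dX x0 x powr p + dY y0 y powr p)"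
    by (rule growth_at_mostE[OF assms(10)]) blast
  \<comment> \<open>Both weights are centred at the base points of the growth condition; the moments
    are moved there.\<close>
  define u where "u = (\<lambda>z :: (nat \<Rightarrow> 'a) \<times> (nat \<Rightarrow> 'b). dX x0 (fst z) powr p)"
  define w where "w = (\<lambda>z :: (nat \<Rightarrow> 'a) \<times> (nat \<Rightarrow> 'b). dY y0 (snd z) powr p)"
  have mX: "(\<lambda>x. dX x0 x powr p) \<in> borel_measurable M" if "sets M = sets (borel_of XN)" for M
    using metric_powr_measurable[OF dX x0 that] .
  have mY: "(\<lambda>y. dY y0 y powr p) \<in> borel_measurable M" if "sets M = sets (borel_of YN)" for M
    using metric_powr_measurable[OF dY y0 that] .
  interpret entropic_setting N X Y \<mu> \<nu> c u w C
  proof unfold_locales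
    show "0 < N" using assms(1) by simp
    show "c \<in> borel_measurable P"
      using borel_measurable_continuous_map[OF assms(9)] measurable_cong_sets[OF sets_P refl] by blast
    show "u \<in> borel_measurable (hist N X Y N 0)"
      unfolding u_def hist_def using mX[OF sets_past_full] by measurable
    show "w \<in> borel_measurable (hist N X Y 0 N)"
      unfolding w_def hist_def using mY[OF sets_past_full] by measurable
    show "0 \<le> u z" "0 \<le> w z" for z by (auto simp: u_def w_def)
    show "integrable P u" unfolding u_def
      by (rule integrable_proj_P(1)[OF moment_change_base[OF dX assms(7) x0 p(2)]])
    show "integrable P w" unfolding w_def
      by (rule integrable_proj_P(2)[OF moment_change_base[OF dY assms(8) y0 p(2)]])
    show "0 \<le> C" by (rule C)
    show "\<bar>c z\<bar> \<le> C * (1 + u z + w z)" if "z \<in> space P" for z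
      using that bd[of "fst z" "snd z"] by (auto simp: space_P u_def w_def)
    show "integrable P (\<lambda>z. exp (- c z))" by (rule assms(11))
  qed
  have conv: "(\<lambda>n. wasserstein p XN dX YN dY (\<rho> n) \<pi>opt) \<longlonglongrightarrow> 0"
    if r: "\<pi>opt = dm rs" "dens P rs" "\<And>n. \<rho> n = dm (r n)" "\<And>n. dens P (r n)"
      and i: "\<forall>\<^sub>F n in sequentially. integrable P (\<lambda>x. (u x + w x) * \<bar>r n x - rs x\<bar>)"
      and l: "(\<lambda>n. \<integral>x. (u x + w x) * \<bar>r n x - rs x\<bar> \<partial>P) \<longlonglongrightarrow> 0" for \<rho> r rs
  proof (rule wasserstein_tendsto_zero[OF p(1)])
    show "(\<lambda>n. 2 powr p * (\<integral>x. (u x + w x) * \<bar>r n x - rs x\<bar> \<partial>P)) \<longlonglongrightarrow> 0"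
      using tendsto_mult_left[OF l, of "2 powr p"] by simp
    show "0 \<le> 2 powr p * (\<integral>x. (u x + w x) * \<bar>r n x - rs x\<bar> \<partial>P)" for n
      by (intro mult_nonneg_nonneg integral_nonneg_AE) (auto simp: u_def w_def)
    show "\<forall>\<^sub>F n in sequentially. wasserstein_pow p XN dX YN dY (\<rho> n) \<pi>opt \<le>
        ennreal (2 powr p * (\<integral>x. (u x + w x) * \<bar>r n x - rs x\<bar> \<partial>P))"
      using i
    proof eventually_elim
      case (elim n)
      then show ?case
        unfolding r(1,3) u_def w_def by (intro wasserstein_pow_le[OF dX dY x0 y0 p(1) r(4,2)])
    qed
  qed
  have main: "(\<lambda>k. wasserstein p XN dX YN dY (\<pi>h k) \<pi>opt) \<longlonglongrightarrow> 0 \<and>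
      (finite_exp_moments p XN dX \<mu> \<longrightarrow> (\<lambda>k. wasserstein p XN dX YN dY (\<pi> k) \<pi>opt) \<longlonglongrightarrow> 0)"
    if e\<nu>: "finite_exp_moments p YN dY \<nu>"
  proof -
    obtain \<beta> where "0 < \<beta>" and \<beta>: "integrable \<nu> (\<lambda>y. exp (\<beta> * dY y0 y powr p))"
      by (rule exp_moment_change_base[OF dY \<nu> e\<nu> y0 p(2)])
    have w\<beta>: "integrable P (\<lambda>z. exp (\<beta> * w z))"
      unfolding w_def using integrable_proj_P(2)[OF \<beta>] .
    show ?thesis
    proof (rule sinkhorn_convergence[OF assms(12,13) \<open>0 < \<beta>\<close> w\<beta>])
      fix R Rh :: "nat \<Rightarrow> (nat \<Rightarrow> 'a) \<times> (nat \<Rightarrow> 'b) \<Rightarrow> real" and rs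
      assume r: "\<pi>opt = dm rs" "dens P rs" "\<And>n. \<pi> n = dm (R n)" "\<And>n. dens P (R n)"
        "\<And>n. \<pi>h n = dm (Rh n)" "\<And>n. dens P (Rh n)"
        "\<forall>\<^sub>F n in sequentially. integrable P (\<lambda>x. (u x + w x) * \<bar>Rh n x - rs x\<bar>)"
        "(\<lambda>n. \<integral>x. (u x + w x) * \<bar>Rh n x - rs x\<bar> \<partial>P) \<longlonglongrightarrow> 0"
        and R: "\<And>\<gamma>. 0 < \<gamma> \<Longrightarrow> integrable P (\<lambda>z. exp (\<gamma> * u z)) \<Longrightarrow>
          (\<forall>\<^sub>F n in sequentially. integrable P (\<lambda>x. (u x + w x) * \<bar>R n x - rs x\<bar>)) \<and>
          (\<lambda>n. \<integral>x. (u x + w x) * \<bar>R n x - rs x\<bar> \<partial>P) \<longlonglongrightarrow> 0"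
      have "(\<lambda>k. wasserstein p XN dX YN dY (\<pi> k) \<pi>opt) \<longlonglongrightarrow> 0" if e\<mu>: "finite_exp_moments p XN dX \<mu>"
      proof -
        obtain \<gamma> where "0 < \<gamma>" and \<gamma>: "integrable \<mu> (\<lambda>x. exp (\<gamma> * dX x0 x powr p))"
          by (rule exp_moment_change_base[OF dX \<mu> e\<mu> x0 p(2)])
        have "integrable P (\<lambda>z. exp (\<gamma> * u z))"
          unfolding u_def using integrable_proj_P(1)[OF \<gamma>] .
        from R[OF \<open>0 < \<gamma>\<close> this] show ?thesis using conv[of rs \<pi> R, OF r(1-4)] by blast
      qed
      then show ?thesis using conv[of rs \<pi>h Rh, OF r(1,2,5-8)] by blast
    qed
  qed
  then show ?thesis by blast
qed

end
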